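(* Let $f\in\mathcal{T}^n(\mathbb{Q})$. If $f_\sharp(K)$ is a boundary for every combinatorial manifold $K$, then $f$ is a coboundary in $\mathcal{T}^*(\mathbb{Q})$.
   Context: A $k$-dimensional PL sphere is a simplicial complex PL homeomorphic to the boundary of a $(k+1)$-simplex; an $m$-dimensional combinatorial manifold is a finite simplicial complex in which the link of every $k$-simplex is an $(m-k-1)$-dimensional PL sphere (so manifolds are closed, not necessarily orientable). Isomorphisms of oriented complexes preserve orientation. For $n\ge 1$ let $\mathcal{T}_n$ be the set of isomorphism classes of oriented $(n-1)$-dimensional PL spheres; $-L$ denotes $L$ with the opposite orientation. For an abelian group $G$ and $n\ge1$, $\mathcal{T}^n(G)$ is the group of all functions $f:\mathcal{T}_n\to G$ with $f(-L)=-f(L)$ for all $L$; $\mathcal{T}^0(G)=G$ (the value on the positively oriented empty sphere) and $\mathcal{T}^{n}(G)=0$ for $n<0$. The differential $\delta:\mathcal{T}^n(G)\to\mathcal{T}^{n+1}(G)$ is $(\delta f)(L)=\sum_{v} f(\mathrm{Lk}\,v)$, the sum over all vertices $v$ of $L$, where $\mathrm{Lk}\,v$ has the orientation induced from $L$ (for $n=0$, $\delta=0$). Let $K$ be an $m$-dimensional combinatorial manifold. A coorientation of a simplex $\Delta$ is an orientation of $\mathrm{Lk}\,\Delta$; $m$-simplices are positively cooriented. $\widehat{C}_*(K;G)$ is the complex of cooriented simplicial chains with boundary operator $\widehat\partial$, in which the incidence coefficient of $\tau^{k-1}\subset\sigma^k$ is $+1$ iff the orientation of $\mathrm{Lk}\,\sigma^k$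 is induced by that of $\mathrm{Lk}\,\tau^{k-1}$ (and $-1$ otherwise). For $f\in\mathcal{T}^n(G)$ put $f_\sharp(K)=\sum_{\Delta^{m-n}\in K}f(\mathrm{Lk}\,\Delta^{m-n})\,\Delta^{m-n}\in\widehat{C}_{m-n}(K;G)$, each summand being independent of the coorientation chosen. "Boundary" means an element of the image of $\widehat\partial$. *)

theory Defs
  imports "HOL-Analysis.Analysis" "HOL-Analysis.Finite_Function_Topology"
begin

section \<open>Simplicial complexes\<close>

text \<open>
  Complexes are finite abstract simplicial complexes whose vertices are natural numbers; every
  finite complex is isomorphic to one of these. The empty simplex, of dimension \<open>-1\<close>, belongs to
  every complex, so the empty sphere of dimension \<open>-1\<close> is the complex \<open>{{}}\<close>. Dimensions and
  degrees are integers throughout.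
\<close>

definition simplicial_cpx :: "nat set set \<Rightarrow> bool" where
  "simplicial_cpx K \<longleftrightarrow> finite K \<and> {} \<in> K \<and> (\<forall>s\<in>K. finite s \<and> (\<forall>t. t \<subseteq> s \<longrightarrow> t \<in> K))"

definition sdim :: "nat set \<Rightarrow> int" where
  "sdim s = int (card s) - 1"

definition verts :: "nat set set \<Rightarrow> nat set" where
  "verts K = {v. {v} \<in> K}"

definition link :: "nat set set \<Rightarrow> nat set \<Rightarrow> nat set set" where
  "link K s = {t \<in> K. t \<inter> s = {} \<and> t \<union> s \<in> K}"


section \<open>PL homeomorphism, PL spheres, combinatorial manifolds\<close>

text \<open>
  The library's \<^const>\<open>simplicial_complex\<close> lives in a Euclidean space of fixed dimension. The
  following is the same definition in an arbitrary real vector space, so that all complexes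
  can be realised in the space of finitely supported functions on the natural numbers, with the
  vertex \<open>v\<close> placed at the basis vector \<open>Poly_Mapping.single v 1\<close>.
\<close>

definition geom_simplex :: "'a::real_vector set \<Rightarrow> bool" where
  "geom_simplex S \<longleftrightarrow> (\<exists>C. finite C \<and> \<not> affine_dependent C \<and> S = convex hull C)"

definition geom_complex :: "'a::real_vector set set \<Rightarrow> bool" where
  "geom_complex \<C> \<longleftrightarrow>
     finite \<C> \<and>
     (\<forall>S\<in>\<C>. geom_simplex S) \<and>
     (\<forall>F S. S \<in> \<C> \<and> F face_of S \<longrightarrow> F \<in> \<C>) \<and>
     (\<forall>S S'. S \<in> \<C> \<and> S' \<in> \<C> \<longrightarrow> (S \<inter> S') face_of S)"

definition geom_subdivision :: "'a::real_vector set set \<Rightarrow> 'a set set \<Rightarrow> bool" where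
  "geom_subdivision \<D> \<C> \<longleftrightarrow>
     geom_complex \<D> \<and> \<Union>\<D> = \<Union>\<C> \<and> (\<forall>D\<in>\<D>. \<exists>C\<in>\<C>. D \<subseteq> C)"

definition affine_map_on :: "'a::real_vector set \<Rightarrow> ('a \<Rightarrow> 'b::real_vector) \<Rightarrow> bool" where
  "affine_map_on S h \<longleftrightarrow>
     (\<forall>x\<in>S. \<forall>y\<in>S. \<forall>u\<in>{0..1}. h ((1 - u) *\<^sub>R x + u *\<^sub>R y) = (1 - u) *\<^sub>R h x + u *\<^sub>R h y)"

definition realisation :: "nat set set \<Rightarrow> (nat \<Rightarrow>\<^sub>0 real) set set" where
  "realisation K = (\<lambda>s. convex hull ((\<lambda>v. Poly_Mapping.single v 1) ` s)) ` K"

definition pl_map_on :: "nat set set \<Rightarrow> ((nat \<Rightarrow>\<^sub>0 real) \<Rightarrow> (nat \<Rightarrow>\<^sub>0 real)) \<Rightarrow> bool" where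
  "pl_map_on K h \<longleftrightarrow> (\<exists>\<D>. geom_subdivision \<D> (realisation K) \<and> (\<forall>D\<in>\<D>. affine_map_on D h))"

definition pl_homeomorphic :: "nat set set \<Rightarrow> nat set set \<Rightarrow> bool" where
  "pl_homeomorphic K L \<longleftrightarrow>
     (\<exists>h k. homeomorphism (\<Union>(realisation K)) (\<Union>(realisation L)) h k \<and>
            pl_map_on K h \<and> pl_map_on L k)"

definition simplex_boundary :: "nat \<Rightarrow> nat set set" where
  "simplex_boundary k = {s. s \<subset> {..k}}"

definition pl_sphere :: "int \<Rightarrow> nat set set \<Rightarrow> bool" where
  "pl_sphere k L \<longleftrightarrow>
     k \<ge> -1 \<and> simplicial_cpx L \<and> pl_homeomorphic L (simplex_boundary (nat (k + 1)))"

definition combinatorial_manifold :: "int \<Rightarrow> nat set set \<Rightarrow> bool" where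
  "combinatorial_manifold m K \<longleftrightarrow>
     simplicial_cpx K \<and> (\<forall>s\<in>K. s \<noteq> {} \<longrightarrow> pl_sphere (m - sdim s - 1) (link K s))"


section \<open>Orientations\<close>

text \<open>
  An orientation of a \<open>d\<close>-dimensional complex assigns a sign to every ordering of the vertices of
  every \<open>d\<close>-simplex, alternating in the ordering, such that adjacent \<open>d\<close>-simplices induce opposite
  orientations on their common face. It is extended by \<open>0\<close> to all other lists, so that equality
  of orientations is equality of functions. The two orientations of the empty sphere are
  \<open>[] \<mapsto> 1\<close> (the positive one) and \<open>[] \<mapsto> -1\<close>.
\<close>

definition ordered_simplex :: "int \<Rightarrow> nat set set \<Rightarrow> nat list \<Rightarrow> bool" where
  "ordered_simplex d L vs \<longleftrightarrow> distinct vs \<and> set vs \<in> L \<and> sdim (set vs) = d"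

definition is_orientation :: "int \<Rightarrow> nat set set \<Rightarrow> (nat list \<Rightarrow> int) \<Rightarrow> bool" where
  "is_orientation d L \<omega> \<longleftrightarrow>
     (\<forall>vs. if ordered_simplex d L vs then \<omega> vs \<in> {1, -1} else \<omega> vs = 0) \<and>
     (\<forall>us a b vs. \<omega> (us @ b # a # vs) = - \<omega> (us @ a # b # vs)) \<and>
     (\<forall>a b vs. a \<noteq> b \<and> ordered_simplex d L (a # vs) \<and> ordered_simplex d L (b # vs)
        \<longrightarrow> \<omega> (b # vs) = - \<omega> (a # vs))"

definition opposite :: "(nat list \<Rightarrow> int) \<Rightarrow> nat list \<Rightarrow> int" where
  "opposite \<omega> = (\<lambda>vs. - \<omega> vs)"

text \<open>
  The orientation induced on \<open>Lk v\<close>: an ordered simplex of \<open>Lk v\<close> is positive iff it becomes a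
  positive ordered simplex when \<open>v\<close> is put in front. The same rule is used for the differential
  of \<open>\<T>\<^sup>*\<close> and for coorientations.
\<close>

definition induced :: "nat \<Rightarrow> (nat list \<Rightarrow> int) \<Rightarrow> nat list \<Rightarrow> int" where
  "induced v \<omega> = (\<lambda>vs. \<omega> (v # vs))"

type_synonym oriented_cpx = "nat set set \<times> (nat list \<Rightarrow> int)"

definition oriented_cpxs :: "int \<Rightarrow> oriented_cpx set" where
  "oriented_cpxs d = {(L, \<omega>). simplicial_cpx L \<and> is_orientation d L \<omega>}"

definition oriented_spheres :: "int \<Rightarrow> oriented_cpx set" where
  "oriented_spheres d = {(L, \<omega>). pl_sphere d L \<and> is_orientation d L \<omega>}"

definition oriented_iso :: "int \<Rightarrow> (oriented_cpx \<times> oriented_cpx) set" where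
  "oriented_iso d = {((L, \<omega>), (L', \<omega>')).
     (L, \<omega>) \<in> oriented_cpxs d \<and> (L', \<omega>') \<in> oriented_cpxs d \<and>
     (\<exists>\<phi>. inj_on \<phi> (verts L) \<and> (\<lambda>s. \<phi> ` s) ` L = L' \<and>
          (\<forall>vs. set vs \<in> L \<longrightarrow> \<omega>' (map \<phi> vs) = \<omega> vs))}"

definition iso_class :: "int \<Rightarrow> oriented_cpx \<Rightarrow> oriented_cpx set" where
  "iso_class d X = oriented_iso d `` {X}"


section \<open>The complex of functions on oriented PL spheres\<close>

definition sphere_classes :: "int \<Rightarrow> oriented_cpx set set" where
  "sphere_classes n = iso_class (n - 1) ` oriented_spheres (n - 1)"

text \<open>
  Elements of \<open>\<T>\<^sup>n(G)\<close> are extended by \<open>0\<close> outside \<open>\<T>\<^sub>n\<close>. There are no PL spheres of dimension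
  below \<open>-1\<close>, so \<open>\<T>\<^sup>n(G) = 0\<close> for \<open>n < 0\<close>; and \<open>\<T>\<^sub>0\<close> consists of the two oriented empty spheres,
  so an element of \<open>\<T>\<^sup>0(G)\<close> is given by its value on the positive one.
\<close>

definition sphere_cochains :: "int \<Rightarrow> (oriented_cpx set \<Rightarrow> 'g::ab_group_add) set" where
  "sphere_cochains n = {f.
     (\<forall>C. C \<notin> sphere_classes n \<longrightarrow> f C = 0) \<and>
     (\<forall>L \<omega>. (L, \<omega>) \<in> oriented_spheres (n - 1) \<longrightarrow>
        f (iso_class (n - 1) (L, opposite \<omega>)) = - f (iso_class (n - 1) (L, \<omega>)))}"

definition coboundary ::
    "int \<Rightarrow> (oriented_cpx set \<Rightarrow> 'g::ab_group_add) \<Rightarrow> oriented_cpx set \<Rightarrow> 'g" where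
  "coboundary n f C =
     (if n \<ge> 1 \<and> C \<in> sphere_classes (n + 1)
      then (let (L, \<omega>) = (SOME X. X \<in> C)
            in \<Sum>v\<in>verts L. f (iso_class (n - 1) (link L {v}, induced v \<omega>)))
      else 0)"


section \<open>Cooriented chains\<close>

definition coorientation :: "int \<Rightarrow> nat set set \<Rightarrow> nat set \<Rightarrow> (nat list \<Rightarrow> int) \<Rightarrow> bool" where
  "coorientation m K s \<omega> \<longleftrightarrow> is_orientation (m - sdim s - 1) (link K s) \<omega>"

definition cooriented_simplex ::
    "int \<Rightarrow> nat set set \<Rightarrow> int \<Rightarrow> nat set \<Rightarrow> (nat list \<Rightarrow> int) \<Rightarrow> bool" where
  "cooriented_simplex m K k s \<omega> \<longleftrightarrow> s \<in> K \<and> s \<noteq> {} \<and> sdim s = k \<and> coorientation m K s \<omega>"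

text \<open>
  In the chain group a simplex with the opposite coorientation is minus the simplex. A
  chain \<open>c\<close> is therefore represented by the function taking a simplex \<open>s\<close> with a coorientation \<open>\<omega>\<close> to
  the coefficient \<open>c s \<omega>\<close> of \<open>(s, \<omega>)\<close> in \<open>c\<close>, which is odd in \<open>\<omega>\<close>. For an \<open>m\<close>-simplex the
  link is the empty sphere and \<open>c s \<omega>\<close> at the positive \<open>\<omega>\<close> is the usual coefficient.
\<close>

definition cooriented_chains ::
    "int \<Rightarrow> nat set set \<Rightarrow> int \<Rightarrow> (nat set \<Rightarrow> (nat list \<Rightarrow> int) \<Rightarrow> 'g::ab_group_add) set" where
  "cooriented_chains m K k = {c.
     (\<forall>s \<omega>. \<not> cooriented_simplex m K k s \<omega> \<longrightarrow> c s \<omega> = 0) \<and>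
     (\<forall>s \<omega>. cooriented_simplex m K k s \<omega> \<longrightarrow> c s (opposite \<omega>) = - c s \<omega>)}"

text \<open>
  If \<open>s = insert v t\<close>, then \<open>Lk s\<close> is the link of \<open>v\<close> in \<open>Lk t\<close>, and the incidence coefficient of
  \<open>(t, \<omega>)\<close> and \<open>(s, \<omega>')\<close> is \<open>1\<close> iff \<open>\<omega>' = induced v \<omega>\<close>. Choosing \<open>\<omega>' = induced v \<omega>\<close> for each \<open>s\<close>, the
  coefficient of \<open>(t, \<omega>)\<close> in the boundary of \<open>c\<close> becomes the following sum; the lemma
  \<open>cooriented_boundary_incidence\<close> below gives the formula for arbitrary choices.
\<close>

definition cooriented_boundary ::
    "int \<Rightarrow> nat set set \<Rightarrow> int \<Rightarrow> (nat set \<Rightarrow> (nat list \<Rightarrow> int) \<Rightarrow> 'g::ab_group_add)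
      \<Rightarrow> nat set \<Rightarrow> (nat list \<Rightarrow> int) \<Rightarrow> 'g" where
  "cooriented_boundary m K k c t \<omega> =
     (if cooriented_simplex m K (k - 1) t \<omega>
      then \<Sum>v\<in>verts (link K t). c (insert v t) (induced v \<omega>)
      else 0)"

definition sharp ::
    "int \<Rightarrow> (oriented_cpx set \<Rightarrow> 'g::ab_group_add) \<Rightarrow> int \<Rightarrow> nat set set
      \<Rightarrow> nat set \<Rightarrow> (nat list \<Rightarrow> int) \<Rightarrow> 'g" where
  "sharp n f m K s \<omega> =
     (if cooriented_simplex m K (m - n) s \<omega> then f (iso_class (n - 1) (link K s, \<omega>)) else 0)"


section \<open>Well-definedness\<close>

lemma simplicial_cpxD:
  assumes "simplicial_cpx K"
  shows "finite K" "{} \<in> K" "\<And>s. s \<in> K \<Longrightarrow> finite s" "\<And>s t. s \<in> K \<Longrightarrow> t \<subseteq> s \<Longrightarrow> t \<in> K"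
  using assms by (auto simp: simplicial_cpx_def)

lemma simplex_subset_verts:
  assumes "simplicial_cpx K" "s \<in> K"
  shows "s \<subseteq> verts K"
  using simplicial_cpxD(4)[OF assms] by (auto simp: verts_def)

lemma simplicial_cpx_link:
  assumes K: "simplicial_cpx K" and s: "s \<in> K"
  shows "simplicial_cpx (link K s)"
  unfolding simplicial_cpx_def
proof (intro conjI ballI allI impI)
  show "finite (link K s)"
    using simplicial_cpxD(1)[OF K] by (simp add: link_def)
  show "{} \<in> link K s"
    using simplicial_cpxD(2)[OF K] s by (simp add: link_def)
next
  fix u assume "u \<in> link K s"
  then show "finite u"
    using simplicial_cpxD(3)[OF K] by (auto simp: link_def)
next
  fix u t assume "u \<in> link K s" "t \<subseteq> u"
  moreover have "t \<union> s \<subseteq> u \<union> s" using \<open>t \<subseteq> u\<close> by blast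
  ultimately show "t \<in> link K s"
    using simplicial_cpxD(4)[OF K] by (fastforce simp: link_def)
qed

lemma ordered_simplex_link:
  assumes K: "simplicial_cpx K"
  shows "ordered_simplex (d - 1) (link K {v}) vs \<longleftrightarrow> ordered_simplex d K (v # vs)"
proof -
  have "set vs \<in> K" if "insert v (set vs) \<in> K"
    using simplicial_cpxD(4)[OF K that] by blast
  then show ?thesis
    by (auto simp: ordered_simplex_def link_def sdim_def)
qed

lemma is_orientation_induced:
  assumes K: "simplicial_cpx K" and ori: "is_orientation d K \<omega>"
  shows "is_orientation (d - 1) (link K {v}) (induced v \<omega>)"
proof -
  have sw: "\<omega> (us @ b # a # vs) = - \<omega> (us @ a # b # vs)" for us a b vs
    using ori unfolding is_orientation_def by blast
  have co: "\<omega> (b # vs) = - \<omega> (a # vs)"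
    if "a \<noteq> b" "ordered_simplex d K (a # vs)" "ordered_simplex d K (b # vs)" for a b vs
    using ori that unfolding is_orientation_def by blast
  have osw: "ordered_simplex d K (v # a # vs) \<longleftrightarrow> ordered_simplex d K (a # v # vs)" for a vs
    by (auto simp: ordered_simplex_def insert_commute)
  have 1: "if ordered_simplex (d - 1) (link K {v}) vs then induced v \<omega> vs \<in> {1, -1}
           else induced v \<omega> vs = 0" for vs
    unfolding ordered_simplex_link[OF K] induced_def
    using ori unfolding is_orientation_def by blast
  have 2: "induced v \<omega> (us @ b # a # vs) = - induced v \<omega> (us @ a # b # vs)" for us a b vs
    using sw[of "v # us" b a vs] by (simp add: induced_def)
  have 3: "induced v \<omega> (b # vs) = - induced v \<omega> (a # vs)"
    if "a \<noteq> b" "ordered_simplex (d - 1) (link K {v}) (a # vs)"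
       "ordered_simplex (d - 1) (link K {v}) (b # vs)" for a b vs
  proof -
    have "\<omega> (b # v # vs) = - \<omega> (a # v # vs)"
      using co[of a b "v # vs"] that osw by (simp add: ordered_simplex_link[OF K])
    moreover have "\<omega> (v # x # vs) = - \<omega> (x # v # vs)" for x
      using sw[of "[]" v x vs] by simp
    ultimately show ?thesis by (simp add: induced_def)
  qed
  show ?thesis
    unfolding is_orientation_def using 1 2 3 by blast
qed

lemma oriented_isoI:
  assumes "simplicial_cpx L" "is_orientation d L \<omega>" "simplicial_cpx L'" "is_orientation d L' \<omega>'"
    and "inj_on \<phi> (verts L)" "(\<lambda>s. \<phi> ` s) ` L = L'"
    and "\<And>vs. set vs \<in> L \<Longrightarrow> \<omega>' (map \<phi> vs) = \<omega> vs"
  shows "((L, \<omega>), (L', \<omega>')) \<in> oriented_iso d"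
  using assms by (auto simp: oriented_iso_def oriented_cpxs_def)

lemma oriented_isoE:
  assumes "((L, \<omega>), (L', \<omega>')) \<in> oriented_iso d"
  obtains \<phi> where "simplicial_cpx L" "is_orientation d L \<omega>"
    "simplicial_cpx L'" "is_orientation d L' \<omega>'"
    "inj_on \<phi> (verts L)" "(\<lambda>s. \<phi> ` s) ` L = L'"
    "\<And>vs. set vs \<in> L \<Longrightarrow> \<omega>' (map \<phi> vs) = \<omega> vs"
  using assms unfolding oriented_iso_def oriented_cpxs_def by blast

lemma iso_verts:
  assumes L: "simplicial_cpx L" and inj: "inj_on \<phi> (verts L)" and L': "(\<lambda>s. \<phi> ` s) ` L = L'"
  shows "bij_betw \<phi> (verts L) (verts L')"
proof -
  have "\<phi> ` verts L = verts L'"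
  proof
    show "\<phi> ` verts L \<subseteq> verts L'"
    proof
      fix w assume "w \<in> \<phi> ` verts L"
      then obtain v where "{v} \<in> L" "w = \<phi> v" by (auto simp: verts_def)
      then have "{w} = \<phi> ` {v}" by simp
      with \<open>{v} \<in> L\<close> show "w \<in> verts L'" using L' unfolding verts_def by blast
    qed
    show "verts L' \<subseteq> \<phi> ` verts L"
    proof
      fix w assume "w \<in> verts L'"
      then obtain s where s: "s \<in> L" "{w} = \<phi> ` s" using L' by (auto simp: verts_def)
      then show "w \<in> \<phi> ` verts L" using simplex_subset_verts[OF L s(1)] by blast
    qed
  qed
  with inj show ?thesis by (simp add: bij_betw_def)
qed

lemma oriented_iso_sym:
  assumes "(X, Y) \<in> oriented_iso d"
  shows "(Y, X) \<in> oriented_iso d"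
proof -
  obtain L \<omega> L' \<omega>' where XY: "X = (L, \<omega>)" "Y = (L', \<omega>')" by (metis surj_pair)
  from assms[unfolded XY] obtain \<phi> where
    L: "simplicial_cpx L" "is_orientation d L \<omega>" and
    L': "simplicial_cpx L'" "is_orientation d L' \<omega>'" and
    inj: "inj_on \<phi> (verts L)" and im: "(\<lambda>s. \<phi> ` s) ` L = L'" and
    ori: "\<And>vs. set vs \<in> L \<Longrightarrow> \<omega>' (map \<phi> vs) = \<omega> vs"
    by (rule oriented_isoE) blast
  define \<psi> where "\<psi> = inv_into (verts L) \<phi>"
  have recov: "\<psi> ` (\<phi> ` s) = s" if "s \<in> L" for s
    using inj simplex_subset_verts[OF L(1) that]
    by (simp add: \<psi>_def inv_into_image_cancel)
  have bij: "bij_betw \<phi> (verts L) (verts L')"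
    by (rule iso_verts[OF L(1) inj im])
  have "inj_on \<psi> (verts L')"
    using bij_betw_inv_into[OF bij] by (simp add: \<psi>_def bij_betw_def)
  moreover have "(\<lambda>s. \<psi> ` s) ` L' = L"
    using recov unfolding im[symmetric] image_image by simp
  moreover have "\<omega> (map \<psi> vs) = \<omega>' vs" if "set vs \<in> L'" for vs
  proof -
    obtain s where s: "s \<in> L" "set vs = \<phi> ` s" using \<open>set vs \<in> L'\<close> im by auto
    have "set (map \<psi> vs) \<in> L" using s recov by simp
    moreover have "map \<phi> (map \<psi> vs) = vs"
    proof -
      have "\<phi> (\<psi> w) = w" if "w \<in> set vs" for w
        using that s simplex_subset_verts[OF L(1) s(1)] unfolding \<psi>_def
        by (intro f_inv_into_f) blast
      then show ?thesis by (simp add: map_idI)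
    qed
    ultimately show ?thesis using ori by metis
  qed
  ultimately show ?thesis
    unfolding XY using L L' by (intro oriented_isoI[where \<phi> = \<psi>])
qed

lemma oriented_iso_trans:
  assumes "(X, Y) \<in> oriented_iso d" "(Y, Z) \<in> oriented_iso d"
  shows "(X, Z) \<in> oriented_iso d"
proof -
  obtain L \<omega> L' \<omega>' M \<mu> where XYZ: "X = (L, \<omega>)" "Y = (L', \<omega>')" "Z = (M, \<mu>)"
    by (metis surj_pair)
  from assms(1)[unfolded XYZ] obtain \<phi> where
    L: "simplicial_cpx L" "is_orientation d L \<omega>" and
    inj: "inj_on \<phi> (verts L)" and im: "(\<lambda>s. \<phi> ` s) ` L = L'" and
    ori: "\<And>vs. set vs \<in> L \<Longrightarrow> \<omega>' (map \<phi> vs) = \<omega> vs"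
    by (rule oriented_isoE) blast
  from assms(2)[unfolded XYZ] obtain \<psi> where
    M: "simplicial_cpx M" "is_orientation d M \<mu>" and
    inj': "inj_on \<psi> (verts L')" and im': "(\<lambda>s. \<psi> ` s) ` L' = M" and
    ori': "\<And>vs. set vs \<in> L' \<Longrightarrow> \<mu> (map \<psi> vs) = \<omega>' vs"
    by (rule oriented_isoE) blast
  have "inj_on (\<psi> \<circ> \<phi>) (verts L)"
    using inj inj' iso_verts[OF L(1) inj im] by (auto intro: comp_inj_on simp: bij_betw_def)
  moreover have "(\<lambda>s. (\<psi> \<circ> \<phi>) ` s) ` L = M"
    unfolding im'[symmetric] im[symmetric] by (simp add: image_image image_comp)
  moreover have "\<mu> (map (\<psi> \<circ> \<phi>) vs) = \<omega> vs" if "set vs \<in> L" for vs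
  proof -
    have "set (map \<phi> vs) \<in> L'" using that im by auto
    then show ?thesis using ori'[of "map \<phi> vs"] ori[OF that] by simp
  qed
  ultimately show ?thesis
    unfolding XYZ using L M by (intro oriented_isoI[where \<phi> = "\<psi> \<circ> \<phi>"])
qed

lemma equiv_oriented_iso: "equiv (oriented_cpxs d) (oriented_iso d)"
proof (rule equivI)
  show "oriented_iso d \<subseteq> oriented_cpxs d \<times> oriented_cpxs d"
    by (auto simp: oriented_iso_def)
  show "refl_on (oriented_cpxs d) (oriented_iso d)"
  proof (rule refl_onI)
    fix X assume "X \<in> oriented_cpxs d"
    then show "(X, X) \<in> oriented_iso d"
      by (cases X) (auto simp: oriented_cpxs_def intro!: oriented_isoI[where \<phi> = id])
  qed
  show "sym (oriented_iso d)"
    by (rule symI) (rule oriented_iso_sym)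
  show "trans (oriented_iso d)"
    by (rule transI) (rule oriented_iso_trans)
qed

lemma image_link:
  assumes L: "simplicial_cpx L" and inj: "inj_on \<phi> (verts L)" and im: "(\<lambda>s. \<phi> ` s) ` L = L'"
    and v: "v \<in> verts L"
  shows "(\<lambda>s. \<phi> ` s) ` link L {v} = link L' {\<phi> v}"
proof
  show "(\<lambda>s. \<phi> ` s) ` link L {v} \<subseteq> link L' {\<phi> v}"
  proof
    fix t assume "t \<in> (\<lambda>s. \<phi> ` s) ` link L {v}"
    then obtain s where s: "s \<in> L" "v \<notin> s" "insert v s \<in> L" "t = \<phi> ` s"
      by (auto simp: link_def)
    have "\<phi> v \<notin> \<phi> ` s"
      using inj_on_image_mem_iff[OF inj v simplex_subset_verts[OF L s(1)]] s(2) by simp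
    moreover have "\<phi> ` s \<in> L'" using s(1) im by blast
    moreover have "\<phi> ` insert v s \<in> L'" using s(3) im by blast
    ultimately show "t \<in> link L' {\<phi> v}" using s(4) by (simp add: link_def)
  qed
  show "link L' {\<phi> v} \<subseteq> (\<lambda>s. \<phi> ` s) ` link L {v}"
  proof
    fix t assume "t \<in> link L' {\<phi> v}"
    then have t: "t \<in> L'" "\<phi> v \<notin> t" "insert (\<phi> v) t \<in> L'" by (auto simp: link_def)
    then obtain s u where s: "s \<in> L" "t = \<phi> ` s" and u: "u \<in> L" "insert (\<phi> v) t = \<phi> ` u"
      using im by blast
    have "\<phi> ` u = \<phi> ` insert v s" using u s by simp
    moreover have "u \<subseteq> verts L" "insert v s \<subseteq> verts L"
      using simplex_subset_verts[OF L] u s v by auto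
    ultimately have "u = insert v s"
      using inj_on_image_eq_iff[OF inj] by metis
    then have "s \<in> link L {v}" using s u t by (auto simp: link_def)
    then show "t \<in> (\<lambda>s. \<phi> ` s) ` link L {v}" using s by blast
  qed
qed

lemma iso_class_link:
  assumes L: "simplicial_cpx L" "is_orientation d L \<omega>"
    and L': "simplicial_cpx L'" "is_orientation d L' \<omega>'"
    and inj: "inj_on \<phi> (verts L)" and im: "(\<lambda>s. \<phi> ` s) ` L = L'"
    and ori: "\<And>vs. set vs \<in> L \<Longrightarrow> \<omega>' (map \<phi> vs) = \<omega> vs"
    and v: "v \<in> verts L"
  shows "iso_class (d - 1) (link L {v}, induced v \<omega>)
       = iso_class (d - 1) (link L' {\<phi> v}, induced (\<phi> v) \<omega>')"
proof -
  have v': "{v} \<in> L" "{\<phi> v} \<in> L'"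
    using v iso_verts[OF L(1) inj im] by (auto simp: verts_def bij_betw_def)
  have "((link L {v}, induced v \<omega>), (link L' {\<phi> v}, induced (\<phi> v) \<omega>')) \<in> oriented_iso (d - 1)"
  proof (rule oriented_isoI[where \<phi> = \<phi>])
    show "inj_on \<phi> (verts (link L {v}))"
      by (rule inj_on_subset[OF inj]) (auto simp: verts_def link_def)
    show "induced (\<phi> v) \<omega>' (map \<phi> vs) = induced v \<omega> vs" if "set vs \<in> link L {v}" for vs
      using ori[of "v # vs"] that by (simp add: induced_def link_def)
  qed (use L L' v' in \<open>auto simp: simplicial_cpx_link is_orientation_induced
         image_link[OF L(1) inj im v]\<close>)
  then show ?thesis
    unfolding iso_class_def by (rule equiv_class_eq[OF equiv_oriented_iso])
qed

lemma coboundary_iso_class: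
  assumes n: "n \<ge> 1" and X: "(L, \<omega>) \<in> oriented_spheres n"
  shows "coboundary n f (iso_class n (L, \<omega>)) =
           (\<Sum>v\<in>verts L. f (iso_class (n - 1) (link L {v}, induced v \<omega>)))"
proof -
  let ?C = "iso_class n (L, \<omega>)"
  have "(L, \<omega>) \<in> oriented_cpxs n"
    using X by (auto simp: oriented_spheres_def oriented_cpxs_def pl_sphere_def)
  then have "(L, \<omega>) \<in> ?C"
    unfolding iso_class_def by (rule equiv_class_self[OF equiv_oriented_iso])
  then have "(SOME X. X \<in> ?C) \<in> ?C" by (rule someI)
  moreover obtain L' \<omega>' where Y: "(SOME X. X \<in> ?C) = (L', \<omega>')" by (metis surj_pair)
  ultimately have "((L, \<omega>), (L', \<omega>')) \<in> oriented_iso n" by (simp add: iso_class_def)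
  then obtain \<phi> where iso: "simplicial_cpx L" "is_orientation n L \<omega>"
    "simplicial_cpx L'" "is_orientation n L' \<omega>'"
    "inj_on \<phi> (verts L)" "(\<lambda>s. \<phi> ` s) ` L = L'"
    "\<And>vs. set vs \<in> L \<Longrightarrow> \<omega>' (map \<phi> vs) = \<omega> vs"
    by (rule oriented_isoE) blast
  have "?C \<in> sphere_classes (n + 1)"
    using X by (auto simp: sphere_classes_def)
  then have "coboundary n f ?C =
      (\<Sum>w\<in>verts L'. f (iso_class (n - 1) (link L' {w}, induced w \<omega>')))"
    using n by (simp add: coboundary_def Y)
  also have "\<dots> = (\<Sum>v\<in>verts L. f (iso_class (n - 1) (link L' {\<phi> v}, induced (\<phi> v) \<omega>')))"
    by (rule sum.reindex_bij_betw[symmetric]) (rule iso_verts[OF iso(1,5,6)])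
  also have "\<dots> = (\<Sum>v\<in>verts L. f (iso_class (n - 1) (link L {v}, induced v \<omega>)))"
    by (rule sum.cong) (simp_all add: iso_class_link[OF iso, symmetric])
  finally show ?thesis .
qed

text \<open>
  The boundary computed with an arbitrary choice \<open>\<kappa> s\<close> of coorientations of the \<open>k\<close>-simplices \<open>s\<close>
  containing \<open>t\<close>; the factor is the incidence coefficient of \<open>(t, \<omega>)\<close> and \<open>(s, \<kappa> s)\<close>.
\<close>

lemma cooriented_boundary_incidence:
  assumes K: "simplicial_cpx K" and c: "c \<in> cooriented_chains m K k"
    and t: "cooriented_simplex m K (k - 1) t \<omega>"
    and \<kappa>: "\<And>v. v \<in> verts (link K t) \<Longrightarrow>
              \<kappa> (insert v t) = induced v \<omega> \<or> \<kappa> (insert v t) = opposite (induced v \<omega>)"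
  shows "cooriented_boundary m K k c t \<omega> =
    (\<Sum>v\<in>verts (link K t). if \<kappa> (insert v t) = induced v \<omega> then c (insert v t) (\<kappa> (insert v t))
                           else - c (insert v t) (\<kappa> (insert v t)))"
proof -
  have tK: "t \<in> K" and tk: "sdim t = k - 1" and ori: "is_orientation (m - k) (link K t) \<omega>"
    using t by (auto simp: cooriented_simplex_def coorientation_def)
  have "c (insert v t) (opposite (induced v \<omega>)) = - c (insert v t) (induced v \<omega>)"
    if v: "v \<in> verts (link K t)" for v
  proof -
    have v': "v \<notin> t" "insert v t \<in> K" using v by (auto simp: verts_def link_def)
    have "link (link K t) {v} = link K (insert v t)"
    proof (rule set_eqI)
      fix x
      have "x \<in> K" "x \<union> t \<in> K" "insert v x \<in> K" if "insert v (x \<union> t) \<in> K"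
        by (rule simplicial_cpxD(4)[OF K that]; blast)+
      then show "x \<in> link (link K t) {v} \<longleftrightarrow> x \<in> link K (insert v t)"
        using v' by (auto simp: link_def)
    qed
    then have "is_orientation (m - k - 1) (link K (insert v t)) (induced v \<omega>)"
      using is_orientation_induced[OF simplicial_cpx_link[OF K tK] ori, of v] by simp
    moreover have "sdim (insert v t) = k"
      using v' tk simplicial_cpxD(3)[OF K tK] by (simp add: sdim_def)
    ultimately have "cooriented_simplex m K k (insert v t) (induced v \<omega>)"
      using v' by (simp add: cooriented_simplex_def coorientation_def)
    then show ?thesis using c by (simp add: cooriented_chains_def)
  qed
  then have "c (insert v t) (induced v \<omega>) =
      (if \<kappa> (insert v t) = induced v \<omega> then c (insert v t) (\<kappa> (insert v t))
       else - c (insert v t) (\<kappa> (insert v t)))" if "v \<in> verts (link K t)" for v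
    using \<kappa>[OF that] that by auto
  then show ?thesis
    using t by (simp add: cooriented_boundary_def)
qed

end

theory Submission
  imports Defs "HOL-Library.Function_Algebras" "HOL-Library.Multiset"
begin

text \<open>
  Let \<open>n \<ge> 1\<close>. For a manifold \<open>K\<close> of dimension \<open>m = n\<close>, the chain \<open>f\<^sub>\<sharp>(K)\<close> has the coefficient
  \<open>f (Lk v)\<close> at the vertex \<open>v\<close>. If \<open>K\<close> is oriented, each edge contributes to the boundary of a \<open>1\<close>-chain
  with opposite signs at its two ends, so the hypothesis implies \<open>\<Sum>v. f (Lk v) = 0\<close> for every closed
  oriented \<open>n\<close>-manifold (\<open>kills_manifolds_of_boundaries\<close>). This property alone makes \<open>f\<close> a coboundary,
  as the following three facts show. For \<open>n = 0\<close> it suffices to let \<open>K\<close> be a point (\<open>degree_zero\<close>).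

  Barycentric subdivision changes \<open>f\<close> by a coboundary. Triangulate \<open>L \<times> [0, 1]\<close> with \<open>L\<close> at one end and its
  barycentric subdivision \<open>sd L\<close> at the other, and cone off the ends. The vertex links of this sphere \<open>cyl L\<close>
  are \<open>- L\<close>, \<open>sd L\<close>, the spheres \<open>- cyl (Lk v)\<close> for the vertices \<open>v\<close> of \<open>L\<close>, and spheres with an
  orientation-reversing symmetry, on which \<open>f\<close> vanishes. Hence \<open>f (L) = f (sd L) - (\<Sum>v. f (cyl (Lk v)))\<close>
  (\<open>cyl_formula\<close>), and \<open>f\<close> may be replaced by \<open>L \<mapsto> f (sd (sd (sd L)))\<close>.

  The new function vanishes on balanced families. Suppose that the vertex links of a family of oriented
  spheres \<open>B j\<close> cancel in pairs of opposite orientation. Then a closed oriented \<open>n\<close>-manifold can be glued from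
  cells such that the links of the centres of the cells are triply subdivided copies of the \<open>B j\<close>, each \<open>B j\<close>
  occurring equally often, and the links of all other vertices have orientation-reversing symmetries. So
  \<open>\<Sum>j. f (sd (sd (sd (B j)))) = 0\<close> (\<open>gluing.sum_cells\<close>, \<open>mirrors.sum_zero\<close>, \<open>paired_sum_zero\<close>).

  Over \<open>\<rat>\<close>, a function that vanishes on balanced families is a coboundary: it depends linearly on the sum of
  the classes of the vertex links, and an extension of this dependence to all combinations of classes is a
  cochain whose coboundary is the function (\<open>cobounds_if_vanishes_on_balanced\<close>).

  PL homeomorphisms enter only through \<open>pl_sphere_iff_sph\<close>, which characterises PL spheres by common
  subdivisions of abstract complexes, given by linear maps between fans, the cones over the realisations.
\<close>

section \<open>Fans and linear subdivisions\<close>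

text \<open>
 The vertices of the complexes below are natural numbers, simplices, equivalence classes or
 flags; hence the arbitrary vertex type.
\<close>

definition cpx :: "'a set set => bool" where
 "cpx K \<longleftrightarrow> finite K \<and> {} \<in> K \<and> (\<forall>s\<in>K. finite s \<and> (\<forall>t. t \<subseteq> s --> t \<in> K))"

lemma cpxD:
 assumes "cpx K"
 shows "finite K" "{} \<in> K" "\<And>s. s \<in> K ==> finite s" "\<And>s t. s \<in> K ==> t \<subseteq> s ==> t \<in> K"
  "finite (\<Union>K)" "\<And>v. v \<in> \<Union>K ==> {v} \<in> K"
proof -
 show fK: "finite K" and "{} \<in> K" and fs: "\<And>s. s \<in> K ==> finite s"
  and sub: "\<And>s t. s \<in> K ==> t \<subseteq> s ==> t \<in> K"
  using assms by (auto simp: cpx_def)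
 show "finite (\<Union>K)" using fK fs by blast
 show "{v} \<in> K" if "v \<in> \<Union>K" for v using that sub by blast
qed

abbreviation pt :: "'a => 'a \<Rightarrow>\<^sub>0 real" where
 "pt v \<equiv> Poly_Mapping.single v 1"

abbreviation "coord \<equiv> Poly_Mapping.lookup"
abbreviation "supp \<equiv> Poly_Mapping.keys"

text \<open>
 The cone over the geometric realisation. On cones, piecewise linear maps given by their
 values at the vertices become restrictions of linear maps of the whole space of finitely
 supported functions.
\<close>

definition fan :: "'a set set => ('a \<Rightarrow>\<^sub>0 real) set" where
 "fan K = {x. supp x \<in> K \<and> (\<forall>v. 0 \<le> coord x v)}"

definition lin_ext :: "('a => 'b::real_vector) => ('a \<Rightarrow>\<^sub>0 real) => 'b" where
 "lin_ext p x = (\<Sum>v\<in>supp x. coord x v *\<^sub>R p v)"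

text \<open>
 The combinatorial form of "\<open>D\<close> is a subdivision of \<open>K\<close>":
 \<open>T\<close> sends each vertex of \<open>D\<close> to its position in the fan of
 \<open>K\<close>. A single linear map describes all simplices, because the vertices of
 \<open>D\<close> are a basis, and a simplex of \<open>D\<close> lands in a simplex of
 \<open>K\<close> automatically: nonnegative vectors do not cancel, so the support of an
 interior point contains those of the vertices.
\<close>

definition subdiv ::
  "(('a \<Rightarrow>\<^sub>0 real) => ('b \<Rightarrow>\<^sub>0 real)) => 'a set set => 'b set set => bool" where
 "subdiv T D K \<longleftrightarrow> cpx D \<and> cpx K \<and> linear T \<and> bij_betw T (fan D) (fan K)"

lemma coord_scaleR [simp]: "coord (r *\<^sub>R x) v = r * coord x v" for x :: "'a \<Rightarrow>\<^sub>0 real"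
proof -
 have "finite {i. r * coord x i \<noteq> 0}"
  by (rule finite_subset[OF _ finite_lookup[of x]]) auto
 then show ?thesis by (simp add: scaleR_poly_mapping_def)
qed

lemma lin_ext_superset:
 assumes "finite A" "supp x \<subseteq> A"
 shows "lin_ext p x = (\<Sum>v\<in>A. coord x v *\<^sub>R p v)"
 unfolding lin_ext_def
 by (rule sum.mono_neutral_left) (use assms in \<open>auto simp: in_keys_iff\<close>)

lemma linear_lin_ext: "linear (lin_ext p)"
proof (rule linearI)
 fix x y :: "'a \<Rightarrow>\<^sub>0 real" and r :: real
 have "supp (x + y) \<subseteq> supp x \<union> supp y" by (rule Poly_Mapping.keys_add)
 then show "lin_ext p (x + y) = lin_ext p x + lin_ext p y"
  using lin_ext_superset[of "supp x \<union> supp y" x p] lin_ext_superset[of "supp x \<union> supp y" y p]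
   lin_ext_superset[of "supp x \<union> supp y" "x + y" p]
  by (simp add: sum.distrib scaleR_add_left lookup_add)
 have "supp (r *\<^sub>R x) \<subseteq> supp x" by (auto simp: in_keys_iff)
 then show "lin_ext p (r *\<^sub>R x) = r *\<^sub>R lin_ext p x"
  using lin_ext_superset[of "supp x" "r *\<^sub>R x" p] lin_ext_superset[of "supp x" x p]
  by (simp add: scaleR_sum_right)
qed

lemma lin_ext_unit [simp]: "lin_ext p (pt v) = p v"
 by (simp add: lin_ext_def)

lemma unit_expansion: "x = (\<Sum>v\<in>supp x. coord x v *\<^sub>R pt v)" for x :: "'a \<Rightarrow>\<^sub>0 real"
 by (rule poly_mapping_eqI)
   (auto simp: lookup_sum lookup_single when_def sum.If_cases in_keys_iff if_distrib cong: if_cong)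

lemma linear_expansion:
 fixes x :: "'a \<Rightarrow>\<^sub>0 real"
 assumes "linear T"
 shows "T x = (\<Sum>v\<in>supp x. coord x v *\<^sub>R T (pt v))"
proof -
 have "T x = T (\<Sum>v\<in>supp x. coord x v *\<^sub>R pt v)" using unit_expansion[of x] by simp
 also have "\<dots> = (\<Sum>v\<in>supp x. coord x v *\<^sub>R T (pt v))"
  by (simp only: linear_sum[OF assms] linear_scale[OF assms])
 finally show ?thesis .
qed

lemma linear_eq_lin_ext: "linear T ==> T = lin_ext (\<lambda>v. T (pt v))"
 by (rule ext) (simp add: lin_ext_def linear_expansion[symmetric])

lemma supp_add_nonneg:
 fixes x y :: "'a \<Rightarrow>\<^sub>0 real"
 assumes "\<forall>v. 0 \<le> coord x v" "\<forall>v. 0 \<le> coord y v"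
 shows "supp (x + y) = supp x \<union> supp y"
 using assms by (auto simp: in_keys_iff lookup_add add_nonneg_eq_0_iff)

lemma supp_scaleR [simp]: "r \<noteq> 0 ==> supp (r *\<^sub>R x) = supp x" for x :: "'a \<Rightarrow>\<^sub>0 real"
 by (auto simp: in_keys_iff)

lemma pt_fan: "{v} \<in> K ==> pt v \<in> fan K"
 by (auto simp: fan_def lookup_single when_def)

lemma fan_scaleR: "cpx K ==> 0 \<le> r ==> x \<in> fan K ==> r *\<^sub>R x \<in> fan K"
 by (cases "r = 0") (use cpxD(2)[of K] in \<open>auto simp: fan_def\<close>)

lemma fan_add: "x \<in> fan K ==> y \<in> fan K ==> supp x \<union> supp y \<in> K ==> x + y \<in> fan K"
 by (auto simp: fan_def supp_add_nonneg lookup_add)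

lemma fan_sum_units:
 assumes "cpx K" "s \<in> K"
 shows "(\<Sum>v\<in>s. pt v) \<in> fan K" "supp (\<Sum>v\<in>s. pt v) = s"
  "\<And>v. coord (\<Sum>v\<in>s. pt v) v = (if v \<in> s then 1 else 0)"
proof -
 have f: "finite s" using cpxD[OF assms(1)] assms(2) by auto
 show *: "coord (\<Sum>v\<in>s. pt v) v = (if v \<in> s then 1 else 0)" for v
  using f by (simp add: lookup_sum lookup_single when_def)
 show **: "supp (\<Sum>v\<in>s. pt v) = s"
  by (auto simp: in_keys_iff * split: if_splits)
 show "(\<Sum>v\<in>s. pt v) \<in> fan K"
  unfolding fan_def mem_Collect_eq ** * using assms by simp
qed

lemma supp_sum_nonneg:
 fixes q :: "'b => 'a \<Rightarrow>\<^sub>0 real"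
 assumes "finite A" "\<And>v. v \<in> A ==> 0 < c v" "\<And>v w. v \<in> A ==> 0 \<le> coord (q v) w"
 shows "supp (\<Sum>v\<in>A. c v *\<^sub>R q v) = (\<Union>v\<in>A. supp (q v))"
  and "0 \<le> coord (\<Sum>v\<in>A. c v *\<^sub>R q v) w"
proof -
 have nn: "0 \<le> c v * coord (q v) w" if "v \<in> A" for v w
  using assms(2,3)[OF that] by (simp add: less_imp_le)
 show "0 \<le> coord (\<Sum>v\<in>A. c v *\<^sub>R q v) w" by (simp add: lookup_sum sum_nonneg nn)
 have "w \<in> supp (\<Sum>v\<in>A. c v *\<^sub>R q v) \<longleftrightarrow> (\<exists>v\<in>A. c v * coord (q v) w \<noteq> 0)" for w
  using sum_nonneg_eq_0_iff[OF assms(1), of "\<lambda>v. c v * coord (q v) w"] nn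
  by (simp add: in_keys_iff lookup_sum)
 then show "supp (\<Sum>v\<in>A. c v *\<^sub>R q v) = (\<Union>v\<in>A. supp (q v))"
  using assms(2) by (intro set_eqI) (auto simp: in_keys_iff, (metis less_irrefl)+)
qed

lemma subdivD:
 assumes "subdiv T D K"
 shows "cpx D" "cpx K" "linear T" "bij_betw T (fan D) (fan K)"
  "\<And>x. x \<in> fan D ==> T x \<in> fan K" "inj_on T (fan D)" "T ` fan D = fan K"
 using assms by (auto simp: subdiv_def bij_betw_def)

lemma subdiv_unit:
 assumes T: "subdiv T D K" and v: "v \<in> \<Union>D"
 shows "T (pt v) \<in> fan K" "T (pt v) \<noteq> 0" "0 \<le> coord (T (pt v)) w"
proof -
 note t = subdivD[OF T]
 have 1: "pt v \<in> fan D" using v cpxD(6)[OF t(1)] by (simp add: pt_fan)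
 show "T (pt v) \<in> fan K" by (rule t(5)[OF 1])
 then show "0 \<le> coord (T (pt v)) w" by (simp add: fan_def)
 have "(0::_ \<Rightarrow>\<^sub>0 real) \<in> fan D" using cpxD[OF t(1)] by (simp add: fan_def)
 then show "T (pt v) \<noteq> 0"
  using inj_onD[OF t(6), of 0 "pt v"] 1 linear_0[OF t(3)]
  by (metis keys_zero keys_single insert_not_empty zero_neq_one)
qed

lemma subdiv_supp:
 assumes T: "subdiv T D K" and x: "x \<in> fan D"
 shows "supp (T x) = (\<Union>v\<in>supp x. supp (T (pt v)))"
proof -
 note t = subdivD[OF T]
 have "0 < coord x v" if "v \<in> supp x" for v
  using x that by (simp add: fan_def in_keys_iff order_less_le)
 moreover have "v \<in> \<Union>D" if "v \<in> supp x" for v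
  using x that by (auto simp: fan_def)
 ultimately have "supp (\<Sum>v\<in>supp x. coord x v *\<^sub>R T (pt v)) = (\<Union>v\<in>supp x. supp (T (pt v)))"
  by (intro supp_sum_nonneg(1)) (auto intro: subdiv_unit(3)[OF T])
 then show ?thesis using linear_expansion[OF t(3), of x] by simp
qed

lemma subdiv_simplex:
 assumes T: "subdiv T D K" and s: "s \<in> D"
 shows "(\<Union>v\<in>s. supp (T (pt v))) \<in> K"
 using subdiv_supp[OF T fan_sum_units(1)[OF subdivD(1)[OF T] s]]
  subdivD(5)[OF T fan_sum_units(1)[OF subdivD(1)[OF T] s]]
  fan_sum_units(2)[OF subdivD(1)[OF T] s]
 by (simp add: fan_def)

lemma subdiv_comp:
 assumes "subdiv T D K" "subdiv S E D"
 shows "subdiv (T \<circ> S) E K"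
 using assms unfolding subdiv_def by (auto intro: linear_compose bij_betw_trans)

lemma subdiv_cong:
 assumes "subdiv T D K" "linear S" "\<And>v. v \<in> \<Union>D ==> S (pt v) = T (pt v)"
 shows "subdiv S D K" "\<And>x. x \<in> fan D ==> S x = T x"
proof -
 note t = subdivD[OF assms(1)]
 show *: "S x = T x" if "x \<in> fan D" for x
  unfolding linear_expansion[OF assms(2), of x] linear_expansion[OF t(3), of x]
  using that assms(3) by (intro sum.cong) (auto simp: fan_def)
 show "subdiv S D K"
  using assms(1,2) * bij_betw_cong[of "fan D" S T "fan K"] by (simp add: subdiv_def)
qed

lemma cpx_image:
 assumes K: "cpx K"
 shows "cpx ((`) \<phi> ` K)"
 unfolding cpx_def
proof (intro conjI ballI allI impI)
 show "finite ((`) \<phi> ` K)" "{} \<in> (`) \<phi> ` K" using cpxD(1,2)[OF K] by auto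
next
 fix s assume "s \<in> (`) \<phi> ` K" then show "finite s" using cpxD(3)[OF K] by auto
next
 fix s t assume "s \<in> (`) \<phi> ` K" "t \<subseteq> s"
 then obtain r where r: "r \<in> K" "t \<subseteq> \<phi> ` r" by auto
 then have "t = \<phi> ` {v \<in> r. \<phi> v \<in> t}" by auto
 moreover have "{v \<in> r. \<phi> v \<in> t} \<in> K" by (rule cpxD(4)[OF K r(1)]) auto
 ultimately show "t \<in> (`) \<phi> ` K" by blast
qed

lemma rename_fan:
 assumes "x \<in> fan K"
 shows "lin_ext (\<lambda>v. pt (\<phi> v)) x \<in> fan ((`) \<phi> ` K)"
proof -
 have c: "0 < coord x v" if "v \<in> supp x" for v
  using assms that by (simp add: fan_def in_keys_iff order_less_le)
 have "supp (lin_ext (\<lambda>v. pt (\<phi> v)) x) = (\<Union>v\<in>supp x. supp (pt (\<phi> v)))"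
  "\<And>w. 0 \<le> coord (lin_ext (\<lambda>v. pt (\<phi> v)) x) w"
  unfolding lin_ext_def by (rule supp_sum_nonneg; use c in \<open>auto simp: lookup_single when_def\<close>)+
 then show ?thesis using assms by (auto simp: fan_def)
qed

lemma rename_inverse:
 assumes "\<And>v. v \<in> supp x ==> \<psi> (\<phi> v) = v"
 shows "lin_ext (\<lambda>v. pt (\<psi> v)) (lin_ext (\<lambda>v. pt (\<phi> v)) x) = x"
proof -
 have "lin_ext (\<lambda>v. pt (\<psi> v)) (lin_ext (\<lambda>v. pt (\<phi> v)) x) =
   (\<Sum>v\<in>supp x. coord x v *\<^sub>R pt (\<psi> (\<phi> v)))"
  unfolding lin_ext_def[of "\<lambda>v. pt (\<phi> v)"]
  by (simp only: linear_sum[OF linear_lin_ext] linear_scale[OF linear_lin_ext] lin_ext_unit)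
 also have "\<dots> = x" using assms unit_expansion[of x] by simp
 finally show ?thesis .
qed

lemma subdiv_iso:
 assumes K: "cpx K" and inj: "inj_on \<phi> (\<Union>K)"
 shows "subdiv (lin_ext (\<lambda>v. pt (\<phi> v))) K ((`) \<phi> ` K)"
proof -
 define \<psi> where "\<psi> = inv_into (\<Union>K) \<phi>"
 have inv: "\<psi> (\<phi> v) = v" if "v \<in> \<Union>K" for v using that inj by (simp add: \<psi>_def)
 have "\<psi> ` \<phi> ` s = s" if "s \<in> K" for s
  using inv that by (force simp: image_image)
 then have inv_image: "(`) \<psi> ` (`) \<phi> ` K = K" by (force simp: image_image)
 have "bij_betw (lin_ext (\<lambda>v. pt (\<phi> v))) (fan K) (fan ((`) \<phi> ` K))"
 proof (rule bij_betw_byWitness[where f' = "lin_ext (\<lambda>v. pt (\<psi> v))"])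
  show "\<forall>x\<in>fan K. lin_ext (\<lambda>v. pt (\<psi> v)) (lin_ext (\<lambda>v. pt (\<phi> v)) x) = x"
   using inv by (intro ballI rename_inverse) (auto simp: fan_def)
  show "\<forall>y\<in>fan ((`) \<phi> ` K). lin_ext (\<lambda>v. pt (\<phi> v)) (lin_ext (\<lambda>v. pt (\<psi> v)) y) = y"
   using inv by (intro ballI rename_inverse) (force simp: fan_def)
  show "lin_ext (\<lambda>v. pt (\<psi> v)) ` fan ((`) \<phi> ` K) \<subseteq> fan K"
   using rename_fan[of _ "(`) \<phi> ` K" \<psi>] unfolding inv_image by blast
 qed (use rename_fan in blast)
 then show ?thesis using K cpx_image[OF K] by (simp add: subdiv_def linear_lin_ext)
qed

text \<open>
 The simplex \<open>\<sigma>\<close> is starred at an interior point, the new vertex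
 \<open>w\<close>.
\<close>

definition stellar :: "'a set set => 'a set => 'a => 'a set set" where
 "stellar D \<sigma> w = {s \<in> D. \<not> \<sigma> \<subseteq> s} \<union> {insert w s |s. s \<in> D \<and> \<not> \<sigma> \<subseteq> s \<and> s \<union> \<sigma> \<in> D}"

lemma mem_stellar_iff:
 assumes "w \<notin> \<Union>D"
 shows "s \<in> stellar D \<sigma> w \<longleftrightarrow> s - {w} \<in> D \<and> \<not> \<sigma> \<subseteq> s - {w} \<and> (w \<in> s --> s - {w} \<union> \<sigma> \<in> D)"
proof (cases "w \<in> s")
 case True
 have "s = insert w r \<and> r \<in> D \<longleftrightarrow> r = s - {w} \<and> r \<in> D" for r using True assms by auto
 then have "(\<exists>r. s = insert w r \<and> r \<in> D \<and> \<not> \<sigma> \<subseteq> r \<and> r \<union> \<sigma> \<in> D) \<longleftrightarrow>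
   s - {w} \<in> D \<and> \<not> \<sigma> \<subseteq> s - {w} \<and> s - {w} \<union> \<sigma> \<in> D" by metis
 moreover have "s \<notin> D" using True assms by auto
 ultimately show ?thesis using True by (simp add: stellar_def)
qed (auto simp: stellar_def)

lemma cpx_stellar:
 assumes D: "cpx D" and "\<sigma> \<in> D" "\<sigma> \<noteq> {}" and w: "w \<notin> \<Union>D"
 shows "cpx (stellar D \<sigma> w)"
 unfolding cpx_def
proof (intro conjI ballI allI impI)
 have "stellar D \<sigma> w \<subseteq> D \<union> insert w ` D" by (auto simp: stellar_def)
 then show "finite (stellar D \<sigma> w)" using cpxD(1)[OF D] by (meson finite_UnI finite_imageI finite_subset)
 show "{} \<in> stellar D \<sigma> w" using cpxD(2)[OF D] assms(3) by (auto simp: stellar_def)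
 show "finite s" if "s \<in> stellar D \<sigma> w" for s using that cpxD(3)[OF D] by (auto simp: stellar_def)
 fix s t assume "s \<in> stellar D \<sigma> w" and t: "t \<subseteq> s"
 then have s: "s - {w} \<in> D" "\<not> \<sigma> \<subseteq> s - {w}" "w \<in> t ==> s - {w} \<union> \<sigma> \<in> D"
  unfolding mem_stellar_iff[OF w] by blast+
 have "t - {w} \<in> D" by (rule cpxD(4)[OF D s(1)]) (use t in blast)
 moreover have "t - {w} \<union> \<sigma> \<in> D" if "w \<in> t" by (rule cpxD(4)[OF D s(3)[OF that]]) (use t in blast)
 ultimately show "t \<in> stellar D \<sigma> w" unfolding mem_stellar_iff[OF w] using s(2) t by blast
qed

lemma fan_subset_supp:
 "cpx K ==> x \<in> fan K ==> supp y \<subseteq> supp x ==> (\<And>v. 0 \<le> coord y v) ==> y \<in> fan K"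
 using cpxD(4)[of K] by (auto simp: fan_def)

lemma fan_outside: "x \<in> fan K ==> v \<notin> \<Union>K ==> coord x v = 0"
 by (auto simp: fan_def simp flip: not_in_keys_iff_lookup_eq_zero)

text \<open>
 A point \<open>u\<close> of the fan of \<open>D\<close> is \<open>l z + y\<close> with
 \<open>l \<ge> 0\<close> and \<open>y\<close> in the fan, not supported on all of
 \<open>\<sigma>\<close>, in exactly one way: \<open>l\<close> is the largest number for
 which \<open>u - l z\<close> is nonnegative.
\<close>

lemma subdiv_stellar:
 assumes D: "cpx D" and \<sigma>: "\<sigma> \<in> D" "\<sigma> \<noteq> {}" and w: "w \<notin> \<Union>D"
  and z: "supp z = \<sigma>" "\<And>v. 0 \<le> coord z v"
 shows "subdiv (lin_ext (\<lambda>v. if v = w then z else pt v)) (stellar D \<sigma> w) D"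
  (is "subdiv ?T ?S D")
proof -
 have lin: "linear ?T" by (rule linear_lin_ext)
 have Tu: "?T y = y" if "coord y w = 0" for y
 proof -
  have "?T y = (\<Sum>v\<in>supp y. coord y v *\<^sub>R pt v)"
   unfolding lin_ext_def using that by (intro sum.cong) (auto simp: in_keys_iff)
  then show ?thesis using unit_expansion[of y] by simp
 qed
 have T: "?T (l *\<^sub>R pt w + y) = l *\<^sub>R z + y" if "coord y w = 0" for l y
  using Tu[OF that] by (simp only: linear_add[OF lin] linear_scale[OF lin] lin_ext_unit) simp
 have split: "\<exists>l y. x = l *\<^sub>R pt w + y \<and> 0 \<le> l \<and> coord y w = 0 \<and> y \<in> fan D \<and>
   \<not> \<sigma> \<subseteq> supp y \<and> (l \<noteq> 0 --> supp y \<union> \<sigma> \<in> D)" if x: "x \<in> fan ?S" for x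
 proof (intro exI conjI)
  define y where "y = x - coord x w *\<^sub>R pt w"
  show "x = coord x w *\<^sub>R pt w + y" by (simp add: y_def)
  show "0 \<le> coord x w" using x by (simp add: fan_def)
  show "coord y w = 0" by (simp add: y_def lookup_minus)
  have cy: "coord y v = (if v = w then 0 else coord x v)" for v
   by (auto simp: y_def lookup_minus lookup_single when_def)
  then have sy: "supp y = supp x - {w}" by (auto simp: in_keys_iff split: if_splits)
  have "supp y \<in> D \<and> \<not> \<sigma> \<subseteq> supp y \<and> (w \<in> supp x --> supp y \<union> \<sigma> \<in> D)"
   using x unfolding sy fan_def mem_Collect_eq mem_stellar_iff[OF w] by blast
  then show "y \<in> fan D" "\<not> \<sigma> \<subseteq> supp y" "coord x w \<noteq> 0 --> supp y \<union> \<sigma> \<in> D"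
   using x cy by (auto simp: fan_def in_keys_iff)
 qed
 have zD: "z \<in> fan D" using z \<sigma> by (simp add: fan_def)
 have w0: "coord y w = 0" if "y \<in> fan D" for y using fan_outside[OF that w] .
 have mem: "?T x \<in> fan D" if "x \<in> fan ?S" for x
 proof -
  from split[OF that] obtain l y where ly: "x = l *\<^sub>R pt w + y" "0 \<le> l" "coord y w = 0"
   "y \<in> fan D" "\<not> \<sigma> \<subseteq> supp y" "l \<noteq> 0 --> supp y \<union> \<sigma> \<in> D" by blast
  then have "supp (l *\<^sub>R z) \<union> supp y \<in> D"
   by (cases "l = 0") (auto simp: z Un_commute fan_def)
  then show ?thesis unfolding ly(1) T[OF ly(3)]
   using fan_scaleR[OF D ly(2) zD] ly(4) by (intro fan_add) auto
 qed
 have "inj_on ?T (fan ?S)"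
 proof (rule inj_onI)
  fix x x' assume x: "x \<in> fan ?S" and x': "x' \<in> fan ?S" and eq: "?T x = ?T x'"
  from split[OF x] obtain l y where ly: "x = l *\<^sub>R pt w + y" "0 \<le> l" "coord y w = 0"
   "y \<in> fan D" "\<not> \<sigma> \<subseteq> supp y" by blast
  from split[OF x'] obtain l' y' where ly': "x' = l' *\<^sub>R pt w + y'" "0 \<le> l'" "coord y' w = 0"
   "y' \<in> fan D" "\<not> \<sigma> \<subseteq> supp y'" by blast
  have e: "l *\<^sub>R z + y = l' *\<^sub>R z + y'" using eq ly ly' T by simp
  have no: False if "l < l'" "l *\<^sub>R z + y = l' *\<^sub>R z + y'" "y' \<in> fan D" "\<not> \<sigma> \<subseteq> supp y" for l l' y y'
  proof -
   have "y = (l' - l) *\<^sub>R z + y'" using that(2) by (simp add: algebra_simps)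
   moreover have "(\<forall>v. 0 \<le> coord ((l' - l) *\<^sub>R z) v) \<and> (\<forall>v. 0 \<le> coord y' v)"
    using that z by (auto simp: fan_def)
   ultimately have "supp y = supp ((l' - l) *\<^sub>R z) \<union> supp y'" using supp_add_nonneg by blast
   then show False using that z by auto
  qed
  have "l = l'" using no[OF _ e ly'(4) ly(5)] no[OF _ e[symmetric] ly(4) ly'(5)] by force
  then show "x = x'" using e ly ly' by simp
 qed
 moreover have "fan D \<subseteq> ?T ` fan ?S"
 proof
  fix u assume u: "u \<in> fan D"
  have fs: "finite \<sigma>" using cpxD(3)[OF D \<sigma>(1)] .
  define l where "l = Min ((\<lambda>v. coord u v / coord z v) ` \<sigma>)"
  define y where "y = u - l *\<^sub>R z"
  have zp: "0 < coord z v" if "v \<in> \<sigma>" for v using z that by (metis in_keys_iff order_less_le)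
  have up: "0 \<le> coord u v" for v using u by (simp add: fan_def)
  have "l \<in> (\<lambda>v. coord u v / coord z v) ` \<sigma>" unfolding l_def using fs \<sigma>(2) by (intro Min_in) auto
  then obtain v0 where v0: "v0 \<in> \<sigma>" "l = coord u v0 / coord z v0" by auto
  have l0: "0 \<le> l" using v0 zp[OF v0(1)] up by simp
  have lle: "l \<le> coord u v / coord z v" if "v \<in> \<sigma>" for v unfolding l_def using fs that by simp
  have yp: "0 \<le> coord y v" for v
  proof (cases "v \<in> \<sigma>")
   case True then show ?thesis using lle[OF True] zp[OF True] by (simp add: y_def lookup_minus field_simps)
  next
   case False then show ?thesis using up z by (simp add: y_def lookup_minus not_in_keys_iff_lookup_eq_zero[symmetric])
     (metis in_keys_iff mult_zero_right up z(1))
  qed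
  have "coord y v0 = 0" using v0 zp[OF v0(1)] by (simp add: y_def lookup_minus)
  then have ny: "\<not> \<sigma> \<subseteq> supp y" using v0 by (auto simp: in_keys_iff)
  have su: "\<sigma> \<subseteq> supp u" if "l \<noteq> 0"
  proof
   fix v assume "v \<in> \<sigma>"
   then have "0 < coord u v / coord z v" using lle l0 that by fastforce
   then show "v \<in> supp u" by (auto simp: in_keys_iff)
  qed
  have sy: "supp y \<subseteq> supp u"
  proof
   fix v assume "v \<in> supp y"
   then have "0 < coord y v" using yp by (simp add: in_keys_iff order_less_le)
   moreover have "0 \<le> l * coord z v" using l0 z by simp
   ultimately show "v \<in> supp u" by (auto simp: in_keys_iff y_def lookup_minus)
  qed
  have yD: "y \<in> fan D" by (rule fan_subset_supp[OF D u sy yp])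
  have uD: "supp u \<in> D" using u by (simp add: fan_def)
  have yu: "supp y \<union> \<sigma> \<in> D" if "l \<noteq> 0"
   using su[OF that] sy by (intro cpxD(4)[OF D uD]) auto
  have nn: "(\<forall>v. 0 \<le> coord (l *\<^sub>R pt w) v) \<and> (\<forall>v. 0 \<le> coord y v)"
   using l0 yp by (auto simp: lookup_single when_def)
  have "supp (l *\<^sub>R pt w + y) = supp (l *\<^sub>R pt w) \<union> supp y" using nn by (intro supp_add_nonneg) auto
  then have "supp (l *\<^sub>R pt w + y) - {w} = supp y" "w \<in> supp (l *\<^sub>R pt w + y) ==> l \<noteq> 0"
   using w0[OF yD] by (auto simp: in_keys_iff)
  then have "supp (l *\<^sub>R pt w + y) \<in> ?S"
   unfolding mem_stellar_iff[OF w] using yD ny yu by (simp add: fan_def)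
  then have "l *\<^sub>R pt w + y \<in> fan ?S" using nn by (simp add: fan_def lookup_add)
  moreover have "?T (l *\<^sub>R pt w + y) = u" using T[OF w0[OF yD]] by (simp add: y_def)
  ultimately show "u \<in> ?T ` fan ?S" by (rule image_eqI[rotated, OF _ sym])
 qed
 ultimately show ?thesis
  using D cpx_stellar[OF D \<sigma> w] mem lin by (auto simp: subdiv_def bij_betw_def)
qed

section \<open>Common subdivisions and links\<close>

lemma subdiv_id: "cpx K ==> subdiv id K K"
 by (simp add: subdiv_def linear_id[unfolded id_def[symmetric]] bij_betw_id module_hom_id)

definition one_sided :: "(('a \<Rightarrow>\<^sub>0 real) => real) => 'a set set => bool" where
 "one_sided m D \<longleftrightarrow> (\<forall>s\<in>D. (\<forall>v\<in>s. 0 \<le> m (pt v)) \<or> (\<forall>v\<in>s. m (pt v) \<le> 0))"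

lemma linear_real_expansion:
 fixes m :: "('a \<Rightarrow>\<^sub>0 real) => real"
 assumes "linear m"
 shows "m x = (\<Sum>v\<in>supp x. coord x v * m (pt v))"
 using linear_expansion[OF assms, of x] by simp

lemma one_sided_subdiv:
 assumes S: "subdiv S F D" and m: "linear m" "one_sided m D"
 shows "one_sided (m \<circ> S) F"
 unfolding one_sided_def
proof
 fix s assume s: "s \<in> F"
 define t where "t = (\<Union>v\<in>s. supp (S (pt v)))"
 have "t \<in> D" unfolding t_def by (rule subdiv_simplex[OF S s])
 have nn: "0 \<le> coord (S (pt v)) w" if "v \<in> s" for v w
  using subdiv_unit(3)[OF S] s that by blast
 have sub: "w \<in> t" if "v \<in> s" "w \<in> supp (S (pt v))" for v w
  using that by (auto simp: t_def)
 consider "\<forall>w\<in>t. 0 \<le> m (pt w)" | "\<forall>w\<in>t. m (pt w) \<le> 0"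
  using m(2) \<open>t \<in> D\<close> unfolding one_sided_def by blast
 then show "(\<forall>v\<in>s. 0 \<le> (m \<circ> S) (pt v)) \<or> (\<forall>v\<in>s. (m \<circ> S) (pt v) \<le> 0)"
 proof cases
  case 1
  then have "0 \<le> (m \<circ> S) (pt v)" if "v \<in> s" for v
   unfolding o_apply linear_real_expansion[OF m(1), of "S (pt v)"]
   using nn[OF that] sub[OF that] by (intro sum_nonneg) simp
  then show ?thesis by blast
 next
  case 2
  then have "(m \<circ> S) (pt v) \<le> 0" if "v \<in> s" for v
   unfolding o_apply linear_real_expansion[OF m(1), of "S (pt v)"]
   using nn[OF that] sub[OF that] by (intro sum_nonpos) (simp add: mult_nonneg_nonpos)
  then show ?thesis by blast
 qed
qed

definition crossed_edges :: "(('a \<Rightarrow>\<^sub>0 real) => real) => 'a set set => ('a \<times> 'a) set" where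
 "crossed_edges m D = {(a, b). {a, b} \<in> D \<and> m (pt a) < 0 \<and> 0 < m (pt b)}"

lemma finite_crossed_edges:
 assumes "cpx D"
 shows "finite (crossed_edges m D)"
 by (rule finite_subset[of _ "\<Union>D \<times> \<Union>D"]) (use cpxD(5)[OF assms] in \<open>auto simp: crossed_edges_def\<close>)

text \<open>
 Starring an edge whose ends lie strictly on different sides, at its zero of
 \<open>m\<close>, destroys this edge and creates no other crossed edge, since
 \<open>m\<close> vanishes at the new vertex.
\<close>

lemma cut_by_functional:
 fixes D :: "nat set set"
 assumes "cpx D" "linear m"
 shows "\<exists>F S. subdiv S F D \<and> one_sided (m \<circ> S) (F :: nat set set)"
 using assms
proof (induction "card (crossed_edges m D)" arbitrary: D m rule: less_induct)
 case (less D m)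
 show ?case
 proof (cases "crossed_edges m D = {}")
  case True
  have "one_sided m D"
   unfolding one_sided_def
  proof (rule ballI, rule ccontr)
   fix s assume s: "s \<in> D" and "\<not> ((\<forall>v\<in>s. 0 \<le> m (pt v)) \<or> (\<forall>v\<in>s. m (pt v) \<le> 0))"
   then obtain a b where "a \<in> s" "b \<in> s" "m (pt a) < 0" "0 < m (pt b)"
    by (auto simp: not_le)
   moreover have "{a, b} \<in> D" using cpxD(4)[OF less.prems(1) s] \<open>a \<in> s\<close> \<open>b \<in> s\<close> by simp
   ultimately show False using True by (auto simp: crossed_edges_def)
  qed
  then have "one_sided (m \<circ> id) D" by simp
  with subdiv_id[OF less.prems(1)] show ?thesis by blast
 next
  case False
  then obtain a b where ab: "{a, b} \<in> D" "m (pt a) < 0" "0 < m (pt b)"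
   by (auto simp: crossed_edges_def)
  obtain w where w: "w \<notin> \<Union>D" using cpxD(5)[OF less.prems(1)] ex_new_if_finite infinite_UNIV_nat by blast
  define z where "z = m (pt b) *\<^sub>R pt a + (- m (pt a)) *\<^sub>R pt b"
  have ne: "a \<noteq> b" using ab by auto
  have nn: "(\<forall>v. 0 \<le> coord (m (pt b) *\<^sub>R pt a) v)"
   "(\<forall>v. 0 \<le> coord ((- m (pt a)) *\<^sub>R pt b) v)"
   using ab by (auto simp: lookup_single when_def)
  have z: "supp z = {a, b}" "\<And>v. 0 \<le> coord z v"
   unfolding z_def supp_add_nonneg[OF nn] using ab nn
   by (auto simp: lookup_add simp del: scaleR_minus_left coord_scaleR)
  have mz: "m z = 0"
   unfolding z_def linear_add[OF less.prems(2)] linear_scale[OF less.prems(2)] by simp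
  define D' where "D' = stellar D {a, b} w"
  define T where "T = lin_ext (\<lambda>v. if v = w then z else pt v)"
  have T: "subdiv T D' D"
   unfolding T_def D'_def
   by (rule subdiv_stellar[OF less.prems(1) ab(1) _ w]) (use z in auto)
  have lin: "linear (m \<circ> T)"
   unfolding T_def by (rule linear_compose[OF linear_lin_ext less.prems(2)])
  have Tv: "T (pt v) = (if v = w then z else pt v)" for v
   by (simp add: T_def)
  have "crossed_edges (m \<circ> T) D' \<subseteq> crossed_edges m D - {(a, b)}"
  proof
   fix e assume "e \<in> crossed_edges (m \<circ> T) D'"
   then obtain c d where e: "e = (c, d)" "{c, d} \<in> D'" "m (T (pt c)) < 0" "0 < m (T (pt d))"
    by (auto simp: crossed_edges_def)
   have "c \<noteq> w" "d \<noteq> w" using e(3,4) mz by (auto simp: Tv)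
   then have "m (pt c) < 0" "0 < m (pt d)" using e(3,4) by (simp_all add: Tv)
   moreover have "w \<notin> {c, d}" using \<open>c \<noteq> w\<close> \<open>d \<noteq> w\<close> by simp
   then have "{c, d} \<in> D \<and> \<not> {a, b} \<subseteq> {c, d}"
    using e(2) unfolding D'_def stellar_def by blast
   ultimately show "e \<in> crossed_edges m D - {(a, b)}"
    by (auto simp: crossed_edges_def e(1))
  qed
  moreover have "(a, b) \<in> crossed_edges m D" using ab by (simp add: crossed_edges_def)
  ultimately have "card (crossed_edges (m \<circ> T) D') < card (crossed_edges m D)"
   using finite_crossed_edges[OF less.prems(1), of m] by (intro psubset_card_mono) auto
  from less.hyps[OF this subdivD(1)[OF T] lin]
  obtain F S where "subdiv S F D'" "one_sided (m \<circ> T \<circ> S) (F :: nat set set)" by blast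
  with subdiv_comp[OF T, of S F] show ?thesis by (metis comp_assoc)
 qed
qed

lemma cut_by_functionals:
 fixes D :: "nat set set"
 assumes "finite M" "cpx D" "\<And>m. m \<in> M ==> linear m"
 shows "\<exists>F S. subdiv S F D \<and> (\<forall>m\<in>M. one_sided (m \<circ> S) (F :: nat set set))"
 using assms
proof (induction M rule: finite_induct)
 case empty
 then show ?case using subdiv_id[of D] by blast
next
 case (insert m M)
 then obtain F S where S: "subdiv S F D" "\<forall>m\<in>M. one_sided (m \<circ> S) (F :: nat set set)"
  using insert.IH[OF insert.prems(1)] insert.prems(2) by blast
 have lS: "linear S" using subdivD(3)[OF S(1)] .
 have "linear (m \<circ> S)" using insert.prems(2)[of m] lS by (simp add: linear_compose)
 from cut_by_functional[OF subdivD(1)[OF S(1)] this]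
 obtain G R where R: "subdiv R G F" "one_sided (m \<circ> S \<circ> R) (G :: nat set set)" by blast
 have "one_sided (m' \<circ> S \<circ> R) G" if "m' \<in> M" for m'
  using one_sided_subdiv[OF R(1), of "m' \<circ> S"] S(2) that insert.prems(2)[of m'] lS
  by (simp add: linear_compose)
 then show ?case using R subdiv_comp[OF S(1) R(1)] by (metis comp_assoc insert_iff)
qed

lemma subspace_supp: "subspace {x :: 'a \<Rightarrow>\<^sub>0 real. supp x \<subseteq> t}"
 unfolding subspace_def
proof (intro conjI ballI allI)
 show "x + y \<in> {x. supp x \<subseteq> t}" if "x \<in> {x. supp x \<subseteq> t}" "y \<in> {x. supp x \<subseteq> t}" for x y :: "'a \<Rightarrow>\<^sub>0 real"
  using that Poly_Mapping.keys_add[of x y] by blast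
 show "r *\<^sub>R x \<in> {x. supp x \<subseteq> t}" if "x \<in> {x. supp x \<subseteq> t}" for r and x :: "'a \<Rightarrow>\<^sub>0 real"
  using that by (cases "r = 0") auto
qed simp

text \<open>
 Every vector of the span of a simplex is a difference of two points of its cone.
\<close>

lemma subdiv_inj_span:
 assumes Q: "subdiv Q E K" and t: "t \<in> E"
 shows "inj_on Q {x. supp x \<subseteq> t}"
proof -
 note q = subdivD[OF Q]
 have "x = 0" if x: "supp x \<subseteq> t" "Q x = 0" for x
 proof -
  define y where "y = (\<Sum>v\<in>supp x. max 0 (coord x v) *\<^sub>R pt v)"
  define y' where "y' = (\<Sum>v\<in>supp x. max 0 (- coord x v) *\<^sub>R pt v)"
  have cy: "coord y v = max 0 (coord x v)" "coord y' v = max 0 (- coord x v)" for v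
   by (auto simp: y_def y'_def lookup_sum lookup_single when_def if_distrib sum.delta' in_keys_iff cong: if_cong)
  have "supp y \<subseteq> t" "supp y' \<subseteq> t" using x(1) by (auto simp: in_keys_iff cy max_def split: if_splits)
  then have "y \<in> fan E" "y' \<in> fan E" using cpxD(4)[OF q(1) t] by (auto simp: fan_def cy)
  moreover have xy: "x = y - y'" by (rule poly_mapping_eqI) (simp add: cy lookup_minus)
  then have "Q y = Q y'" using x(2) linear_diff[OF q(3)] by simp
  ultimately show ?thesis using inj_onD[OF q(6)] xy by fastforce
 qed
 then show ?thesis using linear_inj_on_iff_eq_0[OF q(3) subspace_supp] by blast
qed

text \<open>
 Each simplex \<open>t\<close> of \<open>E\<close> has a linear chart \<open>g t\<close>, a
 left inverse of \<open>Q\<close> on its span. If \<open>D\<close> is subdivided until the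
 coordinates of all charts, and the functionals measuring whether a point lies on the span of
 \<open>Q t\<close>, are one-sided, then every simplex of the subdivision is mapped by
 \<open>T\<close> into a single \<open>Q t\<close>: a one-sided functional that is positive
 (or zero) on the sum of the vertices of a simplex is nonnegative (or zero) at each of them.
\<close>

lemma common_refinement:
 fixes D :: "nat set set" and K :: "'a set set" and E :: "'b set set"
 assumes T: "subdiv T D K" and Q: "subdiv Q E K"
 shows "\<exists>(F :: nat set set) S R. subdiv S F D \<and> subdiv R F E \<and> (\<forall>x\<in>fan F. Q (R x) = T (S x))"
proof -
 note t = subdivD[OF T] and q = subdivD[OF Q]
 have "\<exists>g. linear g \<and> (\<forall>x. supp (g x) \<subseteq> t) \<and> (\<forall>x. supp x \<subseteq> t --> g (Q x) = x)" if "t \<in> E" for t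
  using linear_exists_left_inverse_on[OF q(3) subspace_supp subdiv_inj_span[OF Q that]] by blast
 then obtain g where g: "\<And>t. t \<in> E ==> linear (g t)" "\<And>t x. t \<in> E ==> supp (g t x) \<subseteq> t"
  "\<And>t x. t \<in> E ==> supp x \<subseteq> t ==> g t (Q x) = x" by metis
 \<comment> \<open>the coordinates of the charts, and the defects of \<open>Q \<circ> g
  t\<close> from the identity\<close>
 define M where "M = (\<lambda>(t, v) y. coord (g t (T y)) v) ` (E \<times> \<Union>E) \<union>
   (\<lambda>(t, w) y. coord (T y - Q (g t (T y))) w) ` (E \<times> \<Union>K)"
 have finM: "finite M" unfolding M_def using cpxD(1,5)[OF q(1)] cpxD(5)[OF q(2)] by auto
 have linM: "linear m" if "m \<in> M" for m
  using that g(1) t(3) q(3)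
  by (auto simp: M_def intro!: linearI simp: linear_add linear_scale lookup_add lookup_minus algebra_simps)
 from cut_by_functionals[OF finM t(1) linM]
 obtain F S where S: "subdiv S F D" and os: "\<And>m. m \<in> M ==> one_sided (m \<circ> S) (F :: nat set set)"
  by blast
 note s = subdivD[OF S]
 have TS: "subdiv (T \<circ> S) F K" by (rule subdiv_comp[OF T S])
 note ts = subdivD[OF TS]
 \<comment> \<open>\<open>t\<close> is the simplex whose interior contains the image of the
  sum of the vertices of \<open>s\<close>\<close>
 have cell: "\<exists>t\<in>E. \<forall>v\<in>s. T (S (pt v)) \<in> Q ` {y \<in> fan E. supp y \<subseteq> t}" if sF: "s \<in> F" for s
 proof -
  define x where "x = (\<Sum>v\<in>s. pt v :: nat \<Rightarrow>\<^sub>0 real)"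
  have fs: "finite s" using cpxD(3)[OF s(1) sF] .
  have xF: "x \<in> fan F" unfolding x_def by (rule fan_sum_units(1)[OF s(1) sF])
  have "T (S x) \<in> fan K" using ts(5)[OF xF] by simp
  then obtain y where y: "y \<in> fan E" "T (S x) = Q y" using q(7) by auto
  define t where "t = supp y"
  have tE: "t \<in> E" using y by (simp add: t_def fan_def)
  have gx: "g t (T (S x)) = y" using g(3)[OF tE, of y] y by (simp add: t_def)
  have msum: "m (S x) = (\<Sum>v\<in>s. m (S (pt v)))" if "m \<in> M" for m
   using linear_sum[OF linear_compose[OF s(3) linM[OF that]], of "\<lambda>v. pt v" s] by (simp add: x_def)
  have sgn: "(\<forall>v\<in>s. 0 \<le> m (S (pt v))) \<or> (\<forall>v\<in>s. m (S (pt v)) \<le> 0)" if "m \<in> M" for m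
   using os[OF that] sF unfolding one_sided_def by auto
  have "T (S (pt v)) \<in> Q ` {y \<in> fan E. supp y \<subseteq> t}" if v: "v \<in> s" for v
  proof -
   define zz where "zz = g t (T (S (pt v)))"
   have sz: "supp zz \<subseteq> t" using g(2)[OF tE] by (simp add: zz_def)
   have "0 \<le> coord zz u" for u
   proof (cases "u \<in> t")
    case False then show ?thesis using sz by (metis in_keys_iff order_refl subsetD)
   next
    case True
    define m where "m = (\<lambda>y. coord (g t (T y)) u)"
    have mM: "m \<in> M" using tE True unfolding M_def m_def by force
    have "0 < coord y u" using y True by (simp add: t_def fan_def in_keys_iff order_less_le)
    then have "0 < (\<Sum>v\<in>s. m (S (pt v)))"
     unfolding msum[OF mM, symmetric] by (simp add: m_def gx)
    then have "\<not> (\<forall>v\<in>s. m (S (pt v)) \<le> 0)" using sum_nonpos[of s] by fastforce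
    then show ?thesis using sgn[OF mM] v by (auto simp: m_def zz_def)
   qed
   then have zE: "zz \<in> fan E" using cpxD(4)[OF q(1) tE sz] by (simp add: fan_def)
   have "coord (T (S (pt v)) - Q zz) w = 0" for w
   proof (cases "w \<in> \<Union>K")
    case False
    have "pt v \<in> fan F" using cpxD(4)[OF s(1) sF, of "{v}"] v by (auto intro: pt_fan)
    then show ?thesis
     using fan_outside[OF q(5)[OF zE] False] fan_outside[OF ts(5) False] by (simp add: lookup_minus)
   next
    case True
    define m where "m = (\<lambda>y. coord (T y - Q (g t (T y))) w)"
    have mM: "m \<in> M" using tE True unfolding M_def m_def by force
    have z0: "(\<Sum>v\<in>s. m (S (pt v))) = 0"
     unfolding msum[OF mM, symmetric] by (simp add: m_def y(2) gx[unfolded y(2)])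
    from sgn[OF mM] have "\<forall>v\<in>s. m (S (pt v)) = 0"
    proof
     assume "\<forall>v\<in>s. 0 \<le> m (S (pt v))"
     then show ?thesis using z0 sum_nonneg_eq_0_iff[OF fs, of "\<lambda>v. m (S (pt v))"] by blast
    next
     assume "\<forall>v\<in>s. m (S (pt v)) \<le> 0"
     then have "\<forall>v\<in>s. 0 \<le> - m (S (pt v))" by simp
     moreover have "(\<Sum>v\<in>s. - m (S (pt v))) = 0" using z0 by (simp add: sum_negf)
     ultimately have "\<forall>v\<in>s. - m (S (pt v)) = 0"
      using sum_nonneg_eq_0_iff[OF fs, of "\<lambda>v. - m (S (pt v))"] by blast
     then show ?thesis by simp
    qed
    then show ?thesis using v by (simp add: m_def zz_def)
   qed
   then have "T (S (pt v)) = Q zz"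
    by (metis poly_mapping_eqI lookup_minus lookup_zero eq_iff_diff_eq_0)
   then show ?thesis using zE sz by blast
  qed
  then show ?thesis using tE by blast
 qed
 define r where "r w = inv_into (fan E) Q (T (S (pt w)))" for w
 define R where "R = lin_ext r"
 have main: "R x \<in> fan E \<and> Q (R x) = T (S x)" if x: "x \<in> fan F" for x
 proof -
  have xF: "supp x \<in> F" using x by (simp add: fan_def)
  from cell[OF this] obtain t where t: "t \<in> E" "\<And>v. v \<in> supp x ==> T (S (pt v)) \<in> Q ` {y \<in> fan E. supp y \<subseteq> t}"
   by blast
  have r: "r v \<in> fan E" "supp (r v) \<subseteq> t" "Q (r v) = T (S (pt v))" if "v \<in> supp x" for v
  proof -
   from t(2)[OF that] obtain y where y: "y \<in> fan E" "supp y \<subseteq> t" "T (S (pt v)) = Q y" by blast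
   have "r v = y" unfolding r_def y(3) by (rule inv_into_f_f[OF q(6) y(1)])
   with y show "r v \<in> fan E" "supp (r v) \<subseteq> t" "Q (r v) = T (S (pt v))" by auto
  qed
  have c: "0 < coord x v" if "v \<in> supp x" for v using x that by (simp add: fan_def in_keys_iff order_less_le)
  have "supp (R x) = (\<Union>v\<in>supp x. supp (r v))" "\<And>w. 0 \<le> coord (R x) w"
   unfolding R_def lin_ext_def by (rule supp_sum_nonneg; use c r(1) in \<open>auto simp: fan_def\<close>)+
  then have "R x \<in> fan E" using cpxD(4)[OF q(1) t(1)] r(2) by (simp add: fan_def UN_subset_iff)
  moreover have "Q (R x) = T (S x)"
   unfolding R_def lin_ext_def linear_sum[OF q(3)] linear_scale[OF q(3)]
   using linear_expansion[OF ts(3), of x] r(3) by simp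
  ultimately show ?thesis ..
 qed
 have "bij_betw (inv_into (fan E) Q \<circ> (T \<circ> S)) (fan F) (fan E)"
  by (rule bij_betw_trans[OF ts(4) bij_betw_inv_into[OF q(4)]])
 moreover have "R x = (inv_into (fan E) Q \<circ> (T \<circ> S)) x" if "x \<in> fan F" for x
  using main[OF that] inv_into_f_f[OF q(6), of "R x"] by simp
 ultimately have "bij_betw R (fan F) (fan E)" by (simp cong: bij_betw_cong)
 then have "subdiv R F E" using s(1) q(1) by (simp add: subdiv_def R_def linear_lin_ext)
 then show ?thesis using S main by blast
qed

definition lk :: "'a set set => 'a => 'a set set" where
 "lk K v = {t. v \<notin> t \<and> insert v t \<in> K}"

lemma cpx_lk:
 assumes "cpx K" "v \<in> \<Union>K"
 shows "cpx (lk K v)"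
 unfolding cpx_def
proof (intro conjI ballI allI impI)
 have "lk K v \<subseteq> K" using cpxD(4)[OF assms(1)] by (auto simp: lk_def)
 then show "finite (lk K v)" using cpxD(1)[OF assms(1)] finite_subset by blast
 show "{} \<in> lk K v" using cpxD(6)[OF assms] by (simp add: lk_def)
next
 fix s assume "s \<in> lk K v" then show "finite s" using cpxD(3)[OF assms(1), of "insert v s"] by (simp add: lk_def)
next
 fix s t assume "s \<in> lk K v" "t \<subseteq> s"
 then show "t \<in> lk K v" using cpxD(4)[OF assms(1), of "insert v s" "insert v t"] by (auto simp: lk_def)
qed

definition kill :: "'a => ('a \<Rightarrow>\<^sub>0 real) => ('a \<Rightarrow>\<^sub>0 real)" where
 "kill v x = x - coord x v *\<^sub>R pt v"

lemma coord_kill: "coord (kill v x) u = (if u = v then 0 else coord x u)"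
 by (simp add: kill_def lookup_minus lookup_single when_def)

lemma linear_kill: "linear (kill v)"
 by (rule linearI; rule poly_mapping_eqI) (simp_all add: coord_kill lookup_add)

lemma fan_lk_add: 
 assumes "x \<in> fan (lk K v)" "0 < c"
 shows "x + c *\<^sub>R pt v \<in> fan K" "coord x v = 0" "supp (x + c *\<^sub>R pt v) = insert v (supp x)"
proof -
 have nn: "\<forall>u. 0 \<le> coord x u" "\<forall>u. 0 \<le> coord (c *\<^sub>R pt v) u"
  using assms by (auto simp: fan_def lookup_single when_def)
 show su: "supp (x + c *\<^sub>R pt v) = insert v (supp x)" using supp_add_nonneg[OF nn] assms by simp
 show "x + c *\<^sub>R pt v \<in> fan K" unfolding fan_def mem_Collect_eq su using assms nn
  by (simp add: lk_def fan_def lookup_add)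
 show "coord x v = 0" using assms by (auto simp: fan_def lk_def in_keys_iff)
qed

lemma fan_lk_add0:
 assumes "cpx K" "x \<in> fan (lk K v)" "0 \<le> c"
 shows "x + c *\<^sub>R pt v \<in> fan K"
proof (cases "c = 0")
 case True
 then show ?thesis using assms cpxD(4)[OF assms(1), of "insert v (supp x)" "supp x"] by (auto simp: fan_def lk_def)
qed (use fan_lk_add(1)[OF assms(2)] assms(3) in auto)

lemma kill_fan_lk:
 assumes "cpx K" "x \<in> fan K" "insert v (supp x) \<in> K"
 shows "kill v x \<in> fan (lk K v)"
proof -
 have "supp (kill v x) = supp x - {v}" by (auto simp: in_keys_iff coord_kill split: if_splits)
 then show ?thesis using assms by (simp add: fan_def lk_def coord_kill)
qed

text \<open>
 Projection along the ray of a vertex turns its star into its link, and \<open>T\<close>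
 respects the projections along \<open>d\<close> and \<open>v\<close>. For surjectivity, push
 a point \<open>z\<close> of the fan of the link far in the direction of \<open>v\<close>:
 the preimages of \<open>z + k v\<close> lie in one simplex \<open>s\<close> for infinitely
 many \<open>k\<close>, hence so does the asymptotic direction, which is that of
 \<open>d\<close>, and \<open>s\<close> belongs to the star of \<open>d\<close>.
\<close>

lemma subdiv_lk:
 fixes D :: "'b set set" and K :: "'a set set"
 assumes T: "subdiv T D K" and d: "d \<in> \<Union>D" and v: "T (pt d) = c *\<^sub>R pt v"
 shows "subdiv (kill v \<circ> T) (lk D d) (lk K v)"
proof -
 note t = subdivD[OF T]
 have cpos: "0 < c"
  using subdiv_unit(2)[OF T d] subdiv_unit(3)[OF T d, of v] v by (auto simp: order_less_le)
 have "supp (T (pt d)) \<in> K" using subdiv_unit(1)[OF T d] by (simp add: fan_def)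
 then have vK: "v \<in> \<Union>K" using v cpos by auto
 have cD: "cpx (lk D d)" "cpx (lk K v)" using cpx_lk[OF t(1) d] cpx_lk[OF t(2) vK] by blast+
 have mem: "kill v (T x) \<in> fan (lk K v)" if x: "x \<in> fan (lk D d)" for x
 proof (rule kill_fan_lk[OF t(2)])
  have xD: "x \<in> fan D" using fan_lk_add0[OF t(1) x, of 0] by simp
  then show "T x \<in> fan K" by (rule t(5))
  have "x + 1 *\<^sub>R pt d \<in> fan D" "supp (x + 1 *\<^sub>R pt d) = insert d (supp x)"
   using fan_lk_add(1,3)[OF x, of 1] by auto
  then have "supp (T (x + 1 *\<^sub>R pt d)) = insert v (supp (T x))"
   "supp (T (x + 1 *\<^sub>R pt d)) \<in> K"
   using t(5)[of "x + 1 *\<^sub>R pt d"] subdiv_supp[OF T, of "x + 1 *\<^sub>R pt d"]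
    subdiv_supp[OF T xD] v cpos by (simp_all add: fan_def)
  then show "insert v (supp (T x)) \<in> K" by simp
 qed
 have kT: "kill v y = y - coord y v *\<^sub>R pt v" for y by (simp add: kill_def)
 have inj: "x = y" if "x \<in> fan (lk D d)" "y \<in> fan (lk D d)" "kill v (T x) = kill v (T y)"
   "coord (T y) v \<le> coord (T x) v" for x y
 proof -
  define b where "b = (coord (T x) v - coord (T y) v) / c"
  have b: "0 \<le> b" using that(4) cpos by (simp add: b_def)
  have "T x = T y + b *\<^sub>R T (pt d)"
  proof -
   have "c * b = coord (T x) v - coord (T y) v" using cpos by (simp add: b_def)
   moreover have "T x = kill v (T x) + coord (T x) v *\<^sub>R pt v"
    "T y = kill v (T y) + coord (T y) v *\<^sub>R pt v" by (simp_all add: kT)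
   then have "T x - T y = coord (T x) v *\<^sub>R pt v - coord (T y) v *\<^sub>R pt v"
    using that(3) by (metis add_diff_cancel_left)
   ultimately have "T x - T y = (b * c) *\<^sub>R pt v"
    by (simp add: scaleR_diff_left mult.commute)
   then show ?thesis unfolding v by (simp add: algebra_simps)
  qed
  then have "T x = T (y + b *\<^sub>R pt d)" by (simp add: linear_add[OF t(3)] linear_scale[OF t(3)])
  moreover have "x \<in> fan D" using fan_lk_add0[OF t(1) that(1), of 0] by simp
  ultimately have xy: "x = y + b *\<^sub>R pt d"
   using inj_onD[OF t(6)] fan_lk_add0[OF t(1) that(2) b] by metis
  have "coord x d = 0" "coord y d = 0" using fan_lk_add(2)[OF that(1), of 1] fan_lk_add(2)[OF that(2), of 1] by auto
  then have "b = 0" using xy by (simp add: lookup_add)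
  then show ?thesis using xy by simp
 qed
 have "inj_on (kill v \<circ> T) (fan (lk D d))"
  using inj by (intro inj_onI) (metis comp_apply linear)
 moreover have "fan (lk K v) \<subseteq> (kill v \<circ> T) ` fan (lk D d)"
 proof
  fix z assume z: "z \<in> fan (lk K v)"
  have "\<exists>y\<in>fan D. T y = z + real k *\<^sub>R pt v" for k :: nat
   using fan_lk_add0[OF t(2) z, of "real k"] t(7) by force
  then obtain y where y: "\<And>k. y k \<in> fan D" "\<And>k. T (y k) = z + real k *\<^sub>R pt v" by metis
  have "finite ((supp \<circ> y) ` UNIV)"
   by (rule finite_subset[OF _ cpxD(1)[OF t(1)]]) (use y(1) in \<open>auto simp: fan_def\<close>)
  then obtain k0 where k0: "infinite {k. supp (y k) = supp (y k0)}"
   using pigeonhole_infinite[OF infinite_UNIV_nat, of "supp \<circ> y"] by auto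
  define s where "s = supp (y k0)"
  have sD: "s \<in> D" using y(1)[of k0] by (simp add: s_def fan_def)
  have fs: "finite s" by (simp add: s_def)
  obtain k1 where k1: "supp (y k1) = s" "k0 < k1"
   using k0 unfolding infinite_nat_iff_unbounded s_def by blast
  \<comment> \<open>the asymptotic direction of the preimages\<close>
  define u where "u = (1 / (real k1 - real k0)) *\<^sub>R (y k1 - y k0)"
  have Tu: "T u = pt v"
   using k1(2) by (simp add: u_def linear_diff[OF t(3)] linear_scale[OF t(3)] y(2) flip: scaleR_diff_left)
  have su: "supp u \<subseteq> s"
  proof -
   have "coord u w = 0" if "w \<notin> s" for w
    using that k1(1) in_keys_iff[of w "y k1"] in_keys_iff[of w "y k0"]
    by (simp add: u_def lookup_minus s_def)
   then show ?thesis by (meson in_keys_iff subsetI)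
  qed
  have yk: "y k = y k0 + (real k - real k0) *\<^sub>R u" if k: "supp (y k) = s" "k0 \<le> k" for k
  proof -
   have "supp (y k0 + (real k - real k0) *\<^sub>R u) \<subseteq> supp (y k0) \<union> supp u"
    by (rule order_trans[OF Poly_Mapping.keys_add]) (auto simp: in_keys_iff)
   then have "supp (y k0 + (real k - real k0) *\<^sub>R u) \<subseteq> s" using su s_def by blast
   moreover have "T (y k) = T (y k0 + (real k - real k0) *\<^sub>R u)"
    unfolding linear_add[OF t(3)] linear_scale[OF t(3)] y(2) Tu by (simp add: algebra_simps)
   ultimately show ?thesis using inj_onD[OF subdiv_inj_span[OF T sD]] k(1) by blast
  qed
  have unn: "0 \<le> coord u a" for a
  proof (rule ccontr)
   assume "\<not> 0 \<le> coord u a"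
   then have neg: "coord u a < 0" by simp
   obtain B :: nat where B: "coord (y k0) a / (- coord u a) < real B" using reals_Archimedean2 by blast
   obtain k where k: "supp (y k) = s" "k0 + B < k"
    using k0 unfolding infinite_nat_iff_unbounded s_def by blast
   have "coord (y k) a = coord (y k0) a + (real k - real k0) * coord u a"
    using yk[OF k(1)] k(2) by (simp add: lookup_add)
   moreover have "coord (y k0) a < (real k - real k0) * (- coord u a)"
   proof -
    have "coord (y k0) a < real B * (- coord u a)" using B neg by (simp add: field_simps)
    also have "\<dots> \<le> (real k - real k0) * (- coord u a)" using k(2) neg by (intro mult_right_mono) auto
    finally show ?thesis .
   qed
   moreover have "0 \<le> coord (y k) a" using y(1) by (simp add: fan_def)
   ultimately show False by simp
  qed
  have "u \<in> fan D" using unn cpxD(4)[OF t(1) sD su] by (simp add: fan_def)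
  moreover have "(1 / c) *\<^sub>R pt d \<in> fan D"
   using cpos cpxD(6)[OF t(1) d] by (intro fan_scaleR[OF t(1)] pt_fan) auto
  moreover have "T ((1 / c) *\<^sub>R pt d) = T u" using v cpos by (simp add: linear_scale[OF t(3)] Tu)
  ultimately have "u = (1 / c) *\<^sub>R pt d" using inj_onD[OF t(6)] by metis
  then have ds: "d \<in> s" using su cpos by auto
  have "insert d (supp (y k0)) \<in> D" using ds sD s_def by (simp add: insert_absorb)
  then have "kill d (y k0) \<in> fan (lk D d)" by (rule kill_fan_lk[OF t(1) y(1)])
  moreover have "(kill v \<circ> T) (kill d (y k0)) = z"
  proof -
   have "T (kill d (y k0)) = z + (real k0 - coord (y k0) d * c) *\<^sub>R pt v"
    by (simp add: kill_def linear_diff[OF t(3)] linear_scale[OF t(3)] y(2) v algebra_simps)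
   moreover have "coord z v = 0" using fan_lk_add(2)[OF z, of 1] by simp
   ultimately show ?thesis
    by (intro poly_mapping_eqI) (simp add: coord_kill lookup_add lookup_single when_def)
  qed
  ultimately show "z \<in> (kill v \<circ> T) ` fan (lk D d)" by (metis image_eqI)
 qed
 ultimately show ?thesis
  using cD mem linear_compose[OF t(3) linear_kill] by (auto simp: subdiv_def bij_betw_def)
qed

section \<open>Joins and spheres\<close>

definition restr :: "'a set => ('a \<Rightarrow>\<^sub>0 real) => ('a \<Rightarrow>\<^sub>0 real)" where
 "restr A = lin_ext (\<lambda>v. if v \<in> A then pt v else 0)"

lemma coord_restr: "coord (restr A x) v = (if v \<in> A then coord x v else 0)"
proof -
 have "coord (restr A x) v = (\<Sum>u\<in>supp x. if u = v then (if v \<in> A then coord x v else 0) else 0)"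
  unfolding restr_def lin_ext_def lookup_sum
  by (intro sum.cong) (auto simp: lookup_single when_def)
 then show ?thesis by (auto simp: sum.delta in_keys_iff)
qed

lemma supp_restr: "supp (restr A x) = supp x \<inter> A"
 by (auto simp: in_keys_iff coord_restr split: if_splits)

definition join :: "'a set set => 'a set set => 'a set set" where
 "join K L = {s \<union> t |s t. s \<in> K \<and> t \<in> L}"

lemma cpx_join:
 assumes K: "cpx K" and L: "cpx L"
 shows "cpx (join K L)"
 unfolding cpx_def
proof (intro conjI ballI allI impI)
 have "join K L = (\<lambda>(s, t). s \<union> t) ` (K \<times> L)" by (auto simp: join_def)
 then show "finite (join K L)" using cpxD(1)[OF K] cpxD(1)[OF L] by simp
 have "{} \<union> {} \<in> join K L" unfolding join_def using cpxD(2)[OF K] cpxD(2)[OF L] by blast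
 then show "{} \<in> join K L" by simp
next
 fix s assume "s \<in> join K L" then show "finite s" using cpxD(3)[OF K] cpxD(3)[OF L] by (auto simp: join_def)
next
 fix r t assume "r \<in> join K L" and t: "t \<subseteq> r"
 then obtain s u where su: "r = s \<union> u" "s \<in> K" "u \<in> L" by (auto simp: join_def)
 have "t = (t \<inter> s) \<union> (t \<inter> u)" using t su by auto
 moreover have "t \<inter> s \<in> K" "t \<inter> u \<in> L" using cpxD(4)[OF K su(2)] cpxD(4)[OF L su(3)] by auto
 ultimately show "t \<in> join K L" unfolding join_def by blast
qed

lemma fan_join_split:
 assumes "cpx K" "cpx L" "\<Union>K \<inter> \<Union>L = {}"
 shows "x \<in> fan (join K L) \<longleftrightarrow> restr (\<Union>K) x \<in> fan K \<and> restr (\<Union>L) x \<in> fan L \<and> x = restr (\<Union>K) x + restr (\<Union>L) x"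
proof
 assume x: "x \<in> fan (join K L)"
 then obtain s t where st: "supp x = s \<union> t" "s \<in> K" "t \<in> L" by (auto simp: fan_def join_def)
 then have "supp x \<inter> \<Union>K = s" "supp x \<inter> \<Union>L = t" using assms(3) by blast+
 then have "restr (\<Union>K) x \<in> fan K" "restr (\<Union>L) x \<in> fan L"
  using st x by (auto simp: fan_def supp_restr coord_restr)
 moreover have "x = restr (\<Union>K) x + restr (\<Union>L) x"
 proof (rule poly_mapping_eqI)
  fix v
  have "coord x v = 0" if "v \<notin> \<Union>K" "v \<notin> \<Union>L"
   using that st unfolding not_in_keys_iff_lookup_eq_zero[symmetric] by blast
  then show "coord x v = coord (restr (\<Union>K) x + restr (\<Union>L) x) v"
   using assms(3) unfolding lookup_add coord_restr by auto
 qed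
 ultimately show "restr (\<Union>K) x \<in> fan K \<and> restr (\<Union>L) x \<in> fan L \<and> x = restr (\<Union>K) x + restr (\<Union>L) x"
  by blast
next
 assume r: "restr (\<Union>K) x \<in> fan K \<and> restr (\<Union>L) x \<in> fan L \<and> x = restr (\<Union>K) x + restr (\<Union>L) x"
 then have "supp (restr (\<Union>K) x + restr (\<Union>L) x) = supp (restr (\<Union>K) x) \<union> supp (restr (\<Union>L) x)"
  by (intro supp_add_nonneg) (auto simp: fan_def)
 then have "supp x = supp (restr (\<Union>K) x) \<union> supp (restr (\<Union>L) x)" using r by metis
 then have "supp x \<in> join K L" using r unfolding join_def fan_def by blast
 moreover have "0 \<le> coord x v" for v
  using r lookup_add[of "restr (\<Union>K) x" "restr (\<Union>L) x" v] by (auto simp: fan_def)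
 ultimately show "x \<in> fan (join K L)" by (simp add: fan_def)
qed

lemma fan_join_add:
 assumes "cpx K" "cpx L" "\<Union>K \<inter> \<Union>L = {}" and y: "y \<in> fan K" and z: "z \<in> fan L"
 shows "y + z \<in> fan (join K L)" "restr (\<Union>K) (y + z) = y" "restr (\<Union>L) (y + z) = z"
proof -
 have "coord y v = 0" if "v \<notin> \<Union>K" for v using fan_outside[OF y that] .
 moreover have "coord z v = 0" if "v \<notin> \<Union>L" for v using fan_outside[OF z that] .
 ultimately show 1: "restr (\<Union>K) (y + z) = y" and 2: "restr (\<Union>L) (y + z) = z"
  using assms(3) by (intro poly_mapping_eqI; auto simp: coord_restr lookup_add)+
 show "y + z \<in> fan (join K L)"
  unfolding fan_join_split[OF assms(1-3)] 1 2 using y z by simp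
qed

lemma subdiv_join:
 assumes T: "subdiv T D K" and T': "subdiv T' E L"
  and disj: "\<Union>D \<inter> \<Union>E = {}" "\<Union>K \<inter> \<Union>L = {}"
 shows "subdiv (lin_ext (\<lambda>v. if v \<in> \<Union>D then T (pt v) else T' (pt v))) (join D E) (join K L)"
  (is "subdiv ?J _ _")
proof -
 note t = subdivD[OF T] and t' = subdivD[OF T']
 have lin: "linear ?J" by (rule linear_lin_ext)
 have JD: "?J y = T y" if "y \<in> fan D" for y
  by (rule subdiv_cong(2)[OF T lin _ that]) simp
 have JE: "?J y = T' y" if "y \<in> fan E" for y
  by (rule subdiv_cong(2)[OF T' lin _ that]) (use disj in auto)
 note spD = fan_join_split[OF t(1) t'(1) disj(1)] and adD = fan_join_add[OF t(1) t'(1) disj(1)]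
 note spK = fan_join_split[OF t(2) t'(2) disj(2)] and adK = fan_join_add[OF t(2) t'(2) disj(2)]
 have J: "?J x = T (restr (\<Union>D) x) + T' (restr (\<Union>E) x)" if "x \<in> fan (join D E)" for x
 proof -
  have r: "restr (\<Union>D) x \<in> fan D" "restr (\<Union>E) x \<in> fan E" "x = restr (\<Union>D) x + restr (\<Union>E) x"
   using that spD by blast+
  have "?J x = ?J (restr (\<Union>D) x) + ?J (restr (\<Union>E) x)"
   using r(3) linear_add[OF lin] by metis
  then show ?thesis using JD[OF r(1)] JE[OF r(2)] by simp
 qed
 have mem: "?J x \<in> fan (join K L)" if "x \<in> fan (join D E)" for x
  unfolding J[OF that] using that spD[of x] t(5) t'(5) by (intro adK(1)) auto
 have "inj_on ?J (fan (join D E))"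
 proof (rule inj_onI)
  fix x y assume x: "x \<in> fan (join D E)" and y: "y \<in> fan (join D E)" and e: "?J x = ?J y"
  have rx: "restr (\<Union>D) x \<in> fan D" "restr (\<Union>E) x \<in> fan E" "restr (\<Union>D) y \<in> fan D" "restr (\<Union>E) y \<in> fan E"
   using spD x y by blast+
  have "T (restr (\<Union>D) x) = T (restr (\<Union>D) y)" "T' (restr (\<Union>E) x) = T' (restr (\<Union>E) y)"
   using e adK(2,3) t(5) t'(5) rx unfolding J[OF x] J[OF y] by metis+
  then have "restr (\<Union>D) x = restr (\<Union>D) y" "restr (\<Union>E) x = restr (\<Union>E) y"
   using inj_onD[OF t(6)] inj_onD[OF t'(6)] rx by auto
  then show "x = y" using spD x y by metis
 qed
 moreover have "fan (join K L) \<subseteq> ?J ` fan (join D E)"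
 proof
  fix z assume z: "z \<in> fan (join K L)"
  then have "restr (\<Union>K) z \<in> T ` fan D" "restr (\<Union>L) z \<in> T' ` fan E" "z = restr (\<Union>K) z + restr (\<Union>L) z"
   using spK t(7) t'(7) by blast+
  then obtain a b where ab: "a \<in> fan D" "b \<in> fan E" "z = T a + T' b" by (metis (no_types, lifting) imageE)
  have "?J (a + b) = z" using J[OF adD(1)[OF ab(1,2)]] adD(2,3)[OF ab(1,2)] ab(3) by simp
  then show "z \<in> ?J ` fan (join D E)" using adD(1)[OF ab(1,2)] by blast
 qed
 ultimately show ?thesis
  using cpx_join[OF t(1) t'(1)] cpx_join[OF t(2) t'(2)] mem lin
  by (auto simp: subdiv_def bij_betw_def)
qed

text \<open>
 A PL sphere of dimension \<open>k - 1\<close>, as a complex with a subdivision in common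
 with the boundary of a simplex. The index \<open>k\<close> is the number of vertices of a
 facet: the empty sphere \<open>{{}}\<close> has index \<open>0\<close>, and indices add up
 under joins.
\<close>

definition sph :: "nat => 'a set set => bool" where
 "sph k L \<longleftrightarrow> (\<exists>(D :: nat set set) T T'. subdiv T D L \<and> subdiv T' D (simplex_boundary k))"

lemma sph_cpx: "sph k L ==> cpx L"
 by (auto simp: sph_def subdiv_def)

lemma sph_subdiv_up: "sph k L ==> subdiv P L K ==> sph k K"
 unfolding sph_def using subdiv_comp by blast

lemma sph_subdiv_down:
 assumes "sph k L" "subdiv P K L"
 shows "sph k K"
proof -
 obtain D T T' where T: "subdiv T (D :: nat set set) L" "subdiv T' D (simplex_boundary k)"
  using assms(1) by (auto simp: sph_def)
 from common_refinement[OF T(1) assms(2)] obtain F S R where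
  "subdiv S (F :: nat set set) D" "subdiv R F K" by blast
 then show ?thesis unfolding sph_def using subdiv_comp[OF T(2)] by blast
qed

lemma sph_iso: "sph k K ==> inj_on \<phi> (\<Union>K) ==> sph k ((`) \<phi> ` K)"
 using sph_subdiv_up subdiv_iso sph_cpx by metis

definition bdry :: "'a set => 'a set set" where
 "bdry A = {s. s \<subset> A}"

lemma cpx_bdry: "finite A ==> A \<noteq> {} ==> cpx (bdry A)"
 unfolding cpx_def bdry_def
 by (auto intro: finite_subset[of _ "Pow A"] finite_subset[of _ A])

lemma sph_simplex_boundary: "sph k (simplex_boundary k)"
proof -
 have "simplex_boundary k = bdry {..k}" by (simp add: simplex_boundary_def bdry_def)
 then have "cpx (simplex_boundary k)" using cpx_bdry[of "{..k}"] by simp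
 then show ?thesis unfolding sph_def using subdiv_id by blast
qed

lemma sph_bdry:
 assumes "finite A" "card A = Suc k"
 shows "sph k (bdry A)"
proof -
 obtain \<phi> where \<phi>: "bij_betw \<phi> {..k} A"
  using assms by (metis card_atMost finite_atMost finite_same_card_bij)
 have "(`) \<phi> ` simplex_boundary k = bdry A"
 proof (intro equalityI subsetI)
  fix t assume "t \<in> (`) \<phi> ` simplex_boundary k"
  then obtain s where "s \<subset> {..k}" "t = \<phi> ` s" by (auto simp: simplex_boundary_def)
  then show "t \<in> bdry A" using \<phi> image_strict_mono[of \<phi> "{..k}" s]
   by (simp add: bdry_def bij_betw_def)
 next
  fix t assume t: "t \<in> bdry A"
  define s where "s = {v \<in> {..k}. \<phi> v \<in> t}"
  have "\<phi> ` s = t" using t \<phi> by (auto simp: s_def bdry_def bij_betw_def)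
  moreover from this have "s \<noteq> {..k}" using t \<phi> by (auto simp: bdry_def bij_betw_def)
  moreover have "s \<subseteq> {..k}" by (auto simp: s_def)
  ultimately have "t = \<phi> ` s" "s \<in> simplex_boundary k" by (auto simp: simplex_boundary_def)
  then show "t \<in> (`) \<phi> ` simplex_boundary k" by blast
 qed
 moreover have "\<Union>(simplex_boundary k) \<subseteq> {..k}" by (auto simp: simplex_boundary_def)
 moreover have "inj_on \<phi> (\<Union>(simplex_boundary k))"
  by (rule inj_on_subset[OF _ calculation(2)]) (use \<phi> in \<open>simp add: bij_betw_def\<close>)
 ultimately show ?thesis
  using sph_iso[OF sph_simplex_boundary, of \<phi> k] by simp
qed

lemma sph_stellar:
 assumes K: "sph k K" and \<sigma>: "\<sigma> \<in> K" "\<sigma> \<noteq> {}" and w: "w \<notin> \<Union>K"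
 shows "sph k (stellar K \<sigma> w)"
 using sph_subdiv_down[OF K subdiv_stellar[OF sph_cpx[OF K] \<sigma> w]] fan_sum_units[OF sph_cpx[OF K] \<sigma>(1)] by auto

lemma join_bdry_iff:
 assumes "A \<inter> B = {}"
 shows "s \<in> join (bdry A) (bdry B) \<longleftrightarrow> s \<subseteq> A \<union> B \<and> \<not> A \<subseteq> s \<and> \<not> B \<subseteq> s"
proof
 assume "s \<subseteq> A \<union> B \<and> \<not> A \<subseteq> s \<and> \<not> B \<subseteq> s"
 then have "s = (s \<inter> A) \<union> (s \<inter> B)" "s \<inter> A \<subset> A" "s \<inter> B \<subset> B" by auto
 then show "s \<in> join (bdry A) (bdry B)" unfolding join_def bdry_def by blast
qed (use assms in \<open>unfold join_def bdry_def, blast\<close>)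

lemma stellar_bdry:
 assumes "\<sigma> \<subset> V" "w \<notin> V"
 shows "stellar (bdry V) \<sigma> w = join (bdry (insert w (V - \<sigma>))) (bdry \<sigma>)"
proof (rule set_eqI)
 fix s
 have "s \<in> stellar (bdry V) \<sigma> w \<longleftrightarrow>
   s - {w} \<subset> V \<and> \<not> \<sigma> \<subseteq> s - {w} \<and> (w \<in> s --> s - {w} \<union> \<sigma> \<subset> V)"
  using assms(2) by (subst mem_stellar_iff) (auto simp: bdry_def)
 also have "\<dots> \<longleftrightarrow> s \<subseteq> insert w V \<and> \<not> insert w (V - \<sigma>) \<subseteq> s \<and> \<not> \<sigma> \<subseteq> s"
  using assms unfolding psubset_eq by (cases "w \<in> s") blast+
 finally have "s \<in> stellar (bdry V) \<sigma> w \<longleftrightarrow>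
   s \<subseteq> insert w V \<and> \<not> insert w (V - \<sigma>) \<subseteq> s \<and> \<not> \<sigma> \<subseteq> s" .
 moreover have "insert w (V - \<sigma>) \<inter> \<sigma> = {}" "insert w (V - \<sigma>) \<union> \<sigma> = insert w V" using assms by auto
 ultimately show "s \<in> stellar (bdry V) \<sigma> w \<longleftrightarrow>
   s \<in> join (bdry (insert w (V - \<sigma>))) (bdry \<sigma>)"
  by (simp add: join_bdry_iff)
qed

text \<open>
 Starring a proper face of a simplex turns the boundary of the simplex into the join of two
 smaller boundaries (\<open>stellar_bdry\<close>).
\<close>

lemma sph_join_bdry:
 assumes "finite A" "finite B" "A \<inter> B = {}" "card A = Suc a" "card B = Suc b"
 shows "sph (a + b) (join (bdry A) (bdry B))"
proof -
 obtain w where w: "w \<in> A" using assms(4) by fastforce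
 define A0 where "A0 = A - {w}"
 have cA0: "card A0 = a" using w assms by (simp add: A0_def)
 have disj: "A0 \<inter> B = {}" "w \<notin> A0 \<union> B" "(A0 \<union> B) - B = A0" "insert w A0 = A"
  using assms(3) w by (auto simp: A0_def)
 have B: "B \<noteq> {}" using assms(5) by auto
 show ?thesis
 proof (cases "A0 = {}")
  case True
  then have "join (bdry A) (bdry B) = bdry B"
   using disj(4) by (auto simp: join_def bdry_def)
  then show ?thesis using sph_bdry[OF assms(2,5)] cA0 True by simp
 next
  case False
  then have BV: "B \<subset> A0 \<union> B" using disj(1) by auto
  have "card (A0 \<union> B) = Suc (a + b)" using cA0 assms disj by (subst card_Un_disjoint) (auto simp: A0_def)
  then have "sph (a + b) (bdry (A0 \<union> B))" using assms by (intro sph_bdry) (simp add: A0_def)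
  from sph_stellar[OF this _ B, of w] show ?thesis
   using BV disj(2) unfolding stellar_bdry[OF BV disj(2)] disj(3,4) by (auto simp: bdry_def)
 qed
qed

text \<open>
 The range of \<open>f\<close> allows two such subdivisions to be made disjoint, as the join
 requires.
\<close>

lemma sph_common_subdivision:
 assumes L: "sph k L" and M: "sph k M" and f: "inj (f :: nat => nat)"
 obtains D T T' where "subdiv T D L" "subdiv T' D M" "\<Union>D \<subseteq> range f"
proof -
 obtain D T T' where T: "subdiv T (D :: nat set set) L" "subdiv T' D (simplex_boundary k)"
  using L by (auto simp: sph_def)
 obtain E S S' where S: "subdiv S (E :: nat set set) M" "subdiv S' E (simplex_boundary k)"
  using M by (auto simp: sph_def)
 obtain F P R where P: "subdiv P (F :: nat set set) D" "subdiv R F E"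
  using common_refinement[OF T(2) S(2)] by blast
 define G where "G = (`) f ` F"
 have "(\<lambda>s. inv f ` s) ` G = F" using f by (simp add: G_def image_image)
 moreover have "inj_on (inv f) (\<Union>G)" using f by (auto simp: G_def inj_on_def)
 ultimately have "subdiv (lin_ext (\<lambda>v. pt (inv f v))) G F"
  using subdiv_iso[OF cpx_image[OF subdivD(1)[OF P(1)]], of "inv f" f] unfolding G_def by simp
 from subdiv_comp[OF subdiv_comp[OF T(1) P(1)] this] subdiv_comp[OF subdiv_comp[OF S(1) P(2)] this]
 show thesis by (rule that) (auto simp: G_def)
qed

lemma sph_join:
 assumes K: "sph a K" and L: "sph b L" and disj: "\<Union>K \<inter> \<Union>L = {}"
 shows "sph (a + b) (join K L)"
proof -
 define ev od where "ev = (\<lambda>x :: nat. 2 * x)" and "od = (\<lambda>x :: nat. Suc (2 * x))"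
 have inj: "inj ev" "inj od" by (auto simp: ev_def od_def inj_on_def)
 have dj: "range ev \<inter> range od = {}" unfolding ev_def od_def using double_not_eq_Suc_double by fastforce
 define A B where "A = ev ` {..a}" and "B = od ` {..b}"
 have AB: "finite A" "card A = Suc a" "finite B" "card B = Suc b" "A \<inter> B = {}"
  using inj dj by (auto simp: A_def B_def card_image inj_on_subset)
 obtain D T T' where D: "subdiv T D K" "subdiv T' D (bdry A)" "\<Union>D \<subseteq> range ev"
  by (rule sph_common_subdivision[OF K sph_bdry[OF AB(1,2)] inj(1)])
 obtain E S S' where E: "subdiv S E L" "subdiv S' E (bdry B)" "\<Union>E \<subseteq> range od"
  by (rule sph_common_subdivision[OF L sph_bdry[OF AB(3,4)] inj(2)])
 have d: "\<Union>D \<inter> \<Union>E = {}" "\<Union>(bdry A) \<inter> \<Union>(bdry B) = {}"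
  using D(3) E(3) dj AB(5) by (auto simp: bdry_def)
 from sph_subdiv_down[OF sph_join_bdry[OF AB(1,3,5,2,4)] subdiv_join[OF D(2) E(2) d]]
 show ?thesis by (rule sph_subdiv_up[OF _ subdiv_join[OF D(1) E(1) d(1) disj]])
qed

lemma vertex_preimage:
 assumes S: "subdiv S F D" and d: "d \<in> \<Union>D"
 obtains d' c where "d' \<in> \<Union>F" "0 < c" "S (pt d') = c *\<^sub>R pt d"
proof -
 note s = subdivD[OF S]
 have "pt d \<in> fan D" using cpxD(6)[OF s(2) d] by (rule pt_fan)
 then obtain y where y: "y \<in> fan F" "S y = pt d" using s(7) by force
 have "y \<noteq> 0" using y(2) linear_0[OF s(3)] by (metis keys_single keys_zero insert_not_empty zero_neq_one)
 then obtain v where v: "v \<in> supp y" by (metis equals0I keys_eq_empty)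
 have vF: "v \<in> \<Union>F" using v y(1) by (auto simp: fan_def)
 have sub: "supp (S (pt v)) \<subseteq> {d}" using subdiv_supp[OF S y(1)] y(2) v by auto
 define c where "c = coord (S (pt v)) d"
 have "S (pt v) = c *\<^sub>R pt d"
  by (rule poly_mapping_eqI) (use sub in \<open>auto simp: c_def lookup_single when_def in_keys_iff subset_iff\<close>)
 moreover from this have "0 < c"
  using subdiv_unit(2,3)[OF S vF] c_def by (metis order_less_le scaleR_zero_left)
 ultimately show ?thesis using that vF by blast
qed

text \<open>
 Links of corresponding vertices of \<open>L\<close> and of a subdivision have a subdivision
 relation (\<open>subdiv_lk\<close>). The point of the simplex boundary that corresponds
 to \<open>v\<close> need not be a vertex, so the boundary is starred there first; the link
 of the new vertex is a join of two simplex boundaries.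
\<close>

lemma sph_lk:
 assumes L: "sph k L" and v: "v \<in> \<Union>L"
 shows "\<exists>j. k = Suc j \<and> sph j (lk L v)"
proof -
 obtain D T T' where T: "subdiv T (D :: nat set set) L" and T': "subdiv T' D (simplex_boundary k)"
  using L by (auto simp: sph_def)
 have bd: "simplex_boundary k = bdry {..k}" by (simp add: simplex_boundary_def bdry_def)
 obtain d c where d: "d \<in> \<Union>D" "0 < c" "T (pt d) = c *\<^sub>R pt v"
  by (rule vertex_preimage[OF T v])
 define q where "q = T' (pt d)"
 have q: "q \<in> fan (simplex_boundary k)" "q \<noteq> 0" "\<And>w. 0 \<le> coord q w"
  using subdiv_unit[OF T' d(1)] by (auto simp: q_def)
 define \<sigma> where "\<sigma> = supp q"
 have \<sigma>: "\<sigma> \<in> simplex_boundary k" "\<sigma> \<noteq> {}" using q by (auto simp: \<sigma>_def fan_def)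
 define w where "w = Suc k"
 have w: "w \<notin> \<Union>(simplex_boundary k)" by (auto simp: w_def simplex_boundary_def)
 define St where "St = stellar (simplex_boundary k) \<sigma> w"
 define P where "P = lin_ext (\<lambda>v. if v = w then q else pt v)"
 have P: "subdiv P St (simplex_boundary k)"
  unfolding P_def St_def using q \<sigma>
  by (intro subdiv_stellar[OF subdivD(2)[OF T'] \<sigma> w]) (auto simp: \<sigma>_def)
 \<comment> \<open>\<open>T'\<close> and the starring \<open>P\<close> have a common
  refinement, in which \<open>d'\<close> corresponds to \<open>d\<close> and to
  \<open>w\<close>\<close>
 from common_refinement[OF T' P] obtain F S R where S: "subdiv S (F :: nat set set) D"
  and R: "subdiv R F St" and comm: "\<And>x. x \<in> fan F ==> P (R x) = T' (S x)" by blast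
 obtain d' c' where d': "d' \<in> \<Union>F" "0 < c'" "S (pt d') = c' *\<^sub>R pt d"
  by (rule vertex_preimage[OF S d(1)])
 have uF: "pt d' \<in> fan F" using cpxD(6)[OF subdivD(1)[OF S] d'(1)] by (rule pt_fan)
 have "{w} \<in> St"
  using \<sigma> cpxD(2)[OF subdivD(2)[OF T']] unfolding St_def stellar_def by auto
 then have "c' *\<^sub>R pt w \<in> fan St" using d'(2)
  by (intro fan_scaleR[OF subdivD(1)[OF P]] pt_fan) auto
 moreover have "P (pt w) = q" by (simp add: P_def)
 then have "P (R (pt d')) = P (c' *\<^sub>R pt w)"
  using comm[OF uF] d'(3) linear_scale[OF subdivD(3)[OF P], of c' "pt w"]
   linear_scale[OF subdivD(3)[OF T'], of c' "pt d"] by (simp only: q_def)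
 ultimately have Rd: "R (pt d') = c' *\<^sub>R pt w"
  using inj_onD[OF subdivD(6)[OF P]] subdivD(5)[OF R uF] by blast
 have \<sigma>k: "\<sigma> \<subset> {..k}" using \<sigma> by (simp add: simplex_boundary_def)
 then have fs: "finite \<sigma>" by (meson finite_atMost finite_subset psubset_imp_subset)
 obtain p where p: "card \<sigma> = Suc p" using \<sigma>(2) fs by (metis card_gt_0_iff gr0_implies_Suc)
 have "card \<sigma> < Suc k" using psubset_card_mono[OF _ \<sigma>k] by simp
 then obtain j where j: "k = Suc j" "p \<le> j" using p by (cases k) auto
 have cr: "card ({..k} - \<sigma>) = Suc (j - p)" using \<sigma>k fs j p by (subst card_Diff_subset) auto
 have "insert w ({..k} - \<sigma>) \<inter> \<sigma> = {}" "\<sigma> \<inter> ({..k} - \<sigma>) = {}" using \<sigma>k by (auto simp: w_def)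
 moreover have "w \<notin> {..k}" by (simp add: w_def)
 ultimately have "t \<in> lk St w \<longleftrightarrow> t \<in> join (bdry \<sigma>) (bdry ({..k} - \<sigma>))" for t
  using \<sigma>k unfolding St_def bd stellar_bdry[OF \<sigma>k \<open>w \<notin> {..k}\<close>] lk_def mem_Collect_eq
  by (subst (1 2) join_bdry_iff) blast+
 then have "lk St w = join (bdry \<sigma>) (bdry ({..k} - \<sigma>))" by blast
 moreover have "sph (p + (j - p)) (join (bdry \<sigma>) (bdry ({..k} - \<sigma>)))"
  using fs p cr by (intro sph_join_bdry) auto
 ultimately have "sph j (lk St w)" using j by simp
 from sph_subdiv_down[OF this subdiv_lk[OF R d'(1) Rd]] have "sph j (lk F d')" .
 from sph_subdiv_up[OF sph_subdiv_up[OF this subdiv_lk[OF S d'(1,3)]] subdiv_lk[OF T d(1,3)]]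
 show ?thesis using j by blast
qed

definition lks :: "'a set set => 'a set => 'a set set" where
 "lks K s = {t. t \<inter> s = {} \<and> t \<union> s \<in> K}"

lemma lks_insert: "v \<notin> s ==> lks K (insert v s) = lk (lks K s) v"
 by (auto simp: lks_def lk_def)

lemma lks_insert': "v \<notin> s ==> lks K (insert v s) = lks (lk K v) s"
 by (auto simp: lks_def lk_def)

lemma sph_lks:
 assumes "sph k K" "s \<in> K"
 shows "card s \<le> k \<and> sph (k - card s) (lks K s)"
proof -
 have "finite s" using cpxD(3)[OF sph_cpx[OF assms(1)] assms(2)] .
 then show ?thesis using assms(2)
 proof (induction s rule: finite_induct)
  case empty
  then show ?case using assms(1) by (simp add: lks_def)
 next
  case (insert v s)
  have "s \<in> K" using cpxD(4)[OF sph_cpx[OF assms(1)] insert.prems] by blast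
  then have IH: "card s \<le> k" "sph (k - card s) (lks K s)" using insert.IH by auto
  have "{v} \<in> lks K s" using insert by (simp add: lks_def)
  then obtain j where "k - card s = Suc j" "sph j (lk (lks K s) v)" using sph_lk[OF IH(2), of v] by blast
  moreover from this have "j = k - Suc (card s)" "Suc (card s) \<le> k" by arith+
  ultimately show ?case using insert(1,2) by (simp add: lks_insert)
 qed
qed

lemma subdiv_empty:
 assumes "subdiv T D K"
 shows "D = {{}} \<longleftrightarrow> K = {{}}"
proof -
 note t = subdivD[OF assms]
 have e: "X = {{}} \<longleftrightarrow> \<Union>X = {}" if "cpx X" for X :: "'z set set" using cpxD(2)[OF that] by auto
 show ?thesis
 proof
  assume "D = {{}}"
  show "K = {{}}"
  proof (rule ccontr)
   assume "K \<noteq> {{}}"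
   then obtain v where "v \<in> \<Union>K" using e[OF t(2)] by blast
   then show False using vertex_preimage[OF assms] \<open>D = {{}}\<close> by blast
  qed
 next
  assume K: "K = {{}}"
  show "D = {{}}"
  proof (rule ccontr)
   assume "D \<noteq> {{}}"
   then obtain v where "v \<in> \<Union>D" using e[OF t(1)] by blast
   then have "supp (T (pt v)) = {}" using subdiv_unit(1)[OF assms, of v] K by (simp add: fan_def)
   then show False using subdiv_unit(2)[OF assms \<open>v \<in> \<Union>D\<close>] by simp
  qed
 qed
qed

lemma simplex_boundary_empty: "simplex_boundary k = {{}} \<longleftrightarrow> k = 0"
proof
 assume "simplex_boundary k = {{}}"
 show "k = 0"
 proof (rule ccontr)
  assume "k \<noteq> 0"
  then have "k \<in> {..k} - {0}" by simp
  then have "{0} \<subset> {..k}" by (intro psubsetI) (simp, blast)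
  then have "{0} \<in> simplex_boundary k" by (simp add: simplex_boundary_def)
  then show False using \<open>simplex_boundary k = {{}}\<close> by simp
 qed
next
 assume "k = 0"
 then show "simplex_boundary k = {{}}" by (auto simp: simplex_boundary_def psubset_eq)
qed

lemma sph_empty_iff: "sph k K ==> K = {{}} \<longleftrightarrow> k = 0"
 unfolding sph_def using subdiv_empty simplex_boundary_empty by metis

lemma sph_facet:
 assumes "sph k K" "s \<in> K"
 shows "\<exists>t\<in>K. s \<subseteq> t \<and> card t = k"
proof -
 have fin: "finite {t \<in> K. s \<subseteq> t}" using cpxD(1)[OF sph_cpx[OF assms(1)]] by simp
 then obtain t where t: "t \<in> K" "s \<subseteq> t" "\<And>u. u \<in> K ==> s \<subseteq> u ==> t \<subseteq> u ==> t = u"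
  using finite_has_maximal2[OF fin, of s] assms(2) by auto
 have "lks K t = {{}}"
 proof (intro equalityI subsetI)
  fix u assume "u \<in> lks K t"
  then have "u \<inter> t = {}" "u \<union> t \<in> K" by (auto simp: lks_def)
  then have "t = u \<union> t" using t by blast
  then show "u \<in> {{}}" using \<open>u \<inter> t = {}\<close> by blast
 qed (use t in \<open>auto simp: lks_def\<close>)
 then show ?thesis using sph_lks[OF assms(1) t(1)] sph_empty_iff t by (metis diff_is_0_eq le_antisym)
qed

text \<open>Subdividing a complex without edges does not change its number of vertices.\<close>

lemma sph_1_points:
 assumes "sph 1 K"
 shows "\<exists>a b. a \<noteq> b \<and> K = {{}, {a}, {b}}"
proof -
 have dis: "s = {} \<or> (\<exists>v. s = {v})" if X: "sph 1 X" and s: "s \<in> X" for X :: "'z set set" and s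
 proof -
  have "card s \<le> 1" "finite s" using sph_lks[OF X s] cpxD(3)[OF sph_cpx[OF X] s] by auto
  then show ?thesis by (metis One_nat_def card_0_eq card_1_singletonE le_Suc_eq le_zero_eq)
 qed
 have verts: "card (\<Union>D) = card (\<Union>K)" if T: "subdiv T D K" and K: "sph 1 K"
  for T and D :: "nat set set" and K :: "'z set set"
 proof -
  note t = subdivD[OF T]
  have "\<exists>d c. d \<in> \<Union>D \<and> 0 < c \<and> T (pt d) = c *\<^sub>R pt v" if "v \<in> \<Union>K" for v
   using vertex_preimage[OF T that] by metis
  then obtain \<psi> c where \<psi>: "\<And>v. v \<in> \<Union>K ==> \<psi> v \<in> \<Union>D \<and> 0 < c v \<and> T (pt (\<psi> v)) = c v *\<^sub>R pt v"
   by metis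
  have uD: "r *\<^sub>R pt d \<in> fan D" if "d \<in> \<Union>D" "0 < r" for d r
   using fan_scaleR[OF t(1) _ pt_fan] cpxD(6)[OF t(1) that(1)] that(2) by simp
  have "inj_on \<psi> (\<Union>K)"
  proof (rule inj_onI)
   fix v w assume "v \<in> \<Union>K" "w \<in> \<Union>K" "\<psi> v = \<psi> w"
   then have "supp (c v *\<^sub>R pt v) = supp (c w *\<^sub>R pt w)" "0 < c v" "0 < c w" using \<psi> by metis+
   then show "v = w" by simp
  qed
  moreover have "d \<in> \<psi> ` \<Union>K" if d: "d \<in> \<Union>D" for d
  proof -
   have s: "supp (T (pt d)) \<in> K" using subdiv_unit(1)[OF T d] by (simp add: fan_def)
   moreover have "supp (T (pt d)) \<noteq> {}" using subdiv_unit(2)[OF T d] by simp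
   ultimately obtain v where v: "supp (T (pt d)) = {v}" using dis[OF K s] by auto
   define r where "r = coord (T (pt d)) v"
   have r: "T (pt d) = r *\<^sub>R pt v" using unit_expansion[of "T (pt d)"] v by (simp add: r_def)
   have r0: "0 < r"
    using v subdiv_unit(3)[OF T d, of v] unfolding r_def by (metis in_keys_iff order_less_le singletonI)
   have vK: "v \<in> \<Union>K" using s v by auto
   have "T (c v *\<^sub>R pt d) = T (r *\<^sub>R pt (\<psi> v))" using r \<psi>[OF vK] by (simp add: linear_scale[OF t(3)])
   then have "c v *\<^sub>R pt d = r *\<^sub>R pt (\<psi> v)" using inj_onD[OF t(6)] uD d r0 \<psi>[OF vK] by blast
   then have "supp (c v *\<^sub>R pt d) = supp (r *\<^sub>R pt (\<psi> v))" by simp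
   then show ?thesis using r0 \<psi>[OF vK] vK by auto
  qed
  ultimately show ?thesis using \<psi> by (metis card_image image_subsetI subsetI subset_antisym)
 qed
 obtain D T T' where T: "subdiv T (D :: nat set set) K" "subdiv T' D (simplex_boundary 1)"
  using assms by (auto simp: sph_def)
 have "card (\<Union>K) = card (\<Union>(simplex_boundary 1))"
  using verts[OF T(1) assms] verts[OF T(2) sph_simplex_boundary] by simp
 also have "\<Union>(simplex_boundary 1) = {0, 1}"
  unfolding simplex_boundary_def by (auto simp: psubset_eq intro!: exI[of _ "{_}"])
 finally have "card (\<Union>K) = 2" by simp
 then obtain a b where ab: "\<Union>K = {a, b}" "a \<noteq> b" by (meson card_2_iff)
 have "s \<in> {{}, {a}, {b}}" if "s \<in> K" for s using dis[OF assms that] ab that by auto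
 moreover have "{{}, {a}, {b}} \<subseteq> K" using cpxD(2,6)[OF sph_cpx[OF assms]] ab by auto
 ultimately show ?thesis using ab by blast
qed

section \<open>Comparison with PL homeomorphism\<close>

lemma simplicial_cpx_eq_cpx: "simplicial_cpx K \<longleftrightarrow> cpx K"
 by (simp add: simplicial_cpx_def cpx_def)

definition mass :: "('a \<Rightarrow>\<^sub>0 real) => real" where
 "mass = lin_ext (\<lambda>v. 1)"

lemma linear_mass: "linear mass"
 unfolding mass_def by (rule linear_lin_ext)

lemma mass_eq: "finite A ==> supp x \<subseteq> A ==> mass x = (\<Sum>v\<in>A. coord x v)"
 by (simp add: mass_def lin_ext_superset)

lemma mass_unit [simp]: "mass (pt v) = 1"
 by (simp add: mass_def)

definition spx :: "'a set => ('a \<Rightarrow>\<^sub>0 real) set" where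
 "spx s = convex hull (pt ` s)"

lemma spx_iff:
 assumes "finite s"
 shows "x \<in> spx s \<longleftrightarrow> supp x \<subseteq> s \<and> (\<forall>v. 0 \<le> coord x v) \<and> mass x = 1"
proof
 assume "x \<in> spx s"
 then obtain u where u0: "\<forall>y\<in>pt ` s. 0 \<le> u y" "sum u (pt ` s) = 1"
  "(\<Sum>y\<in>pt ` s. u y *\<^sub>R y) = x"
  using assms convex_hull_finite[of "pt ` s"] unfolding spx_def by auto
 have "inj_on (pt :: 'a => _) s" by (rule inj_onI) (metis keys_single singleton_inject zero_neq_one)
 then have u: "\<And>v. v \<in> s ==> 0 \<le> u (pt v)" "(\<Sum>v\<in>s. u (pt v)) = 1"
  "x = (\<Sum>v\<in>s. u (pt v) *\<^sub>R pt v)"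
  using u0 by (auto simp: sum.reindex)
 have c: "coord x v = (if v \<in> s then u (pt v) else 0)" for v
  using assms by (auto simp: u(3) lookup_sum lookup_single when_def if_distrib sum.delta' cong: if_cong)
 then have "supp x \<subseteq> s" by (auto simp: in_keys_iff split: if_splits)
 moreover have "mass x = 1" using u(2) c by (simp add: mass_eq[OF assms calculation])
 ultimately show "supp x \<subseteq> s \<and> (\<forall>v. 0 \<le> coord x v) \<and> mass x = 1" using c u(1) by simp
next
 assume x: "supp x \<subseteq> s \<and> (\<forall>v. 0 \<le> coord x v) \<and> mass x = 1"
 have "x = (\<Sum>v\<in>s. coord x v *\<^sub>R pt v)"
  using unit_expansion[of x] x assms
  by (simp add: sum.mono_neutral_left[of s "supp x" "\<lambda>v. coord x v *\<^sub>R pt v"] in_keys_iff)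
 also have "\<dots> \<in> spx s"
  unfolding spx_def using x mass_eq[OF assms, of x] assms
  by (intro convex_sum convex_convex_hull) (auto intro: hull_inc)
 finally show "x \<in> spx s" .
qed

text \<open>The geometric realisation.\<close>

definition body :: "'a set set => ('a \<Rightarrow>\<^sub>0 real) set" where
 "body K = {x \<in> fan K. mass x = 1}"

lemma body_spx:
 assumes "cpx K"
 shows "body K = \<Union>(spx ` K)"
proof (intro equalityI subsetI)
 fix x assume x: "x \<in> body K"
 then have "x \<in> spx (supp x)" by (subst spx_iff) (auto simp: body_def fan_def)
 then show "x \<in> \<Union>(spx ` K)" using x by (auto simp: body_def fan_def)
next
 fix x assume "x \<in> \<Union>(spx ` K)"
 then obtain s where "s \<in> K" "x \<in> spx s" by blast
 then show "x \<in> body K" using spx_iff[OF cpxD(3)[OF assms]] cpxD(4)[OF assms]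
  by (auto simp: body_def fan_def)
qed

lemma realisation_std: "realisation K = spx ` K"
 by (simp add: realisation_def spx_def)

lemma Union_realisation: "cpx K ==> \<Union>(realisation K) = body K"
 by (simp add: realisation_std body_spx)

lemma mass_nonneg: "x \<in> fan K ==> 0 \<le> mass x"
 by (simp add: mass_eq[OF finite_keys order_refl] fan_def sum_nonneg)

lemma mass_pos: "x \<in> fan K ==> x \<noteq> 0 ==> 0 < mass x"
proof -
 assume x: "x \<in> fan K" "x \<noteq> 0"
 have "0 < (\<Sum>v\<in>supp x. coord x v)"
  using x by (intro sum_pos) (auto simp: fan_def in_keys_iff order_less_le)
 then show ?thesis by (simp add: mass_eq[OF finite_keys order_refl])
qed

lemma bij_betw_fan_if_body:
 assumes D: "cpx D" and K: "cpx K" and T: "linear T" and m: "\<And>x. x \<in> fan D ==> mass (T x) = mass x"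
  and bij: "bij_betw T (body D) (body K)"
 shows "subdiv T D K"
proof -
 have z: "0 \<in> fan X" if "cpx X" for X :: "'z set set" using cpxD(2)[OF that] by (simp add: fan_def)
 have nrm: "(1 / mass x) *\<^sub>R x \<in> body X" if "cpx X" "x \<in> fan X" "x \<noteq> 0" for x and X :: "'z set set"
  using mass_pos[OF that(2,3)] that fan_scaleR[OF that(1) _ that(2)] 
  by (simp add: body_def linear_scale[OF linear_mass])
 have mem: "T x \<in> fan K" if "x \<in> fan D" for x
 proof (cases "x = 0")
  case False
  have "T ((1 / mass x) *\<^sub>R x) \<in> fan K"
   using nrm[OF D that False] bij unfolding bij_betw_def body_def by blast
  then have "mass x *\<^sub>R T ((1 / mass x) *\<^sub>R x) \<in> fan K" by (intro fan_scaleR[OF K] mass_nonneg[OF that])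
  then show ?thesis using mass_pos[OF that False] by (simp add: linear_scale[OF T])
 qed (use z[OF K] linear_0[OF T] in simp)
 have "inj_on T (fan D)"
 proof (rule inj_onI)
  fix x y assume xy: "x \<in> fan D" "y \<in> fan D" "T x = T y"
  then have mm: "mass x = mass y" using m by metis
  show "x = y"
  proof (cases "x = 0 \<or> y = 0")
   case True
   then have "mass x = 0" "mass y = 0" using mm linear_0[OF linear_mass] by auto
   then show ?thesis using mass_pos xy by (metis less_irrefl)
  next
   case False
   have "T ((1 / mass x) *\<^sub>R x) = T ((1 / mass x) *\<^sub>R y)" using xy(3) by (simp add: linear_scale[OF T])
   then have "(1 / mass x) *\<^sub>R x = (1 / mass x) *\<^sub>R y"
    using nrm[OF D xy(1)] nrm[OF D xy(2)] mm False bij by (auto simp: bij_betw_def dest: inj_onD)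
   then show ?thesis using mass_pos[OF xy(1)] False by simp
  qed
 qed
 moreover have "fan K \<subseteq> T ` fan D"
 proof
  fix y assume y: "y \<in> fan K"
  show "y \<in> T ` fan D"
  proof (cases "y = 0")
   case True then show ?thesis using z[OF D] linear_0[OF T] by force
  next
   case False
   then obtain x where x: "x \<in> body D" "(1 / mass y) *\<^sub>R y = T x"
    using nrm[OF K y] bij by (auto simp: bij_betw_def)
   have "T (mass y *\<^sub>R x) = y" using x(2)[symmetric] mass_pos[OF y False] by (simp add: linear_scale[OF T])
   moreover have "mass y *\<^sub>R x \<in> fan D"
    using x(1) by (intro fan_scaleR[OF D] mass_nonneg[OF y]) (simp add: body_def)
   ultimately show ?thesis by (metis image_eqI)
  qed
 qed
 ultimately show ?thesis using D K T mem by (auto simp: subdiv_def bij_betw_def)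
qed

lemma affine_map_on_sum:
 assumes h: "affine_map_on S h" and S: "convex S"
  and "finite A" "\<And>v. v \<in> A ==> y v \<in> S" "\<And>v. v \<in> A ==> 0 \<le> u v" "sum u A = (1::real)"
 shows "h (\<Sum>v\<in>A. u v *\<^sub>R y v) = (\<Sum>v\<in>A. u v *\<^sub>R h (y v))"
 using assms(3-6)
proof (induction A arbitrary: u rule: finite_induct)
 case (insert a A)
 show ?case
 proof (cases "u a = 1")
  case True
  then have "sum u A = 0" using insert by simp
  then have "\<forall>v\<in>A. u v = 0" using insert sum_nonneg_eq_0_iff[of A u] by auto
  then show ?thesis using insert True by simp
 next
  case False
  have sA: "sum u A = 1 - u a" using insert by simp
  then have "u a < 1" using False insert.prems(2) insert.hyps(1) sum_nonneg[of A u] by fastforce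
  define z where "z = (\<Sum>v\<in>A. (u v / (1 - u a)) *\<^sub>R y v)"
  have s1: "(\<Sum>v\<in>A. u v / (1 - u a)) = 1" using sA \<open>u a < 1\<close> by (simp flip: sum_divide_distrib)
  have "z \<in> S" unfolding z_def
   by (rule convex_sum[OF insert.hyps(1) S s1]) (use insert.prems \<open>u a < 1\<close> in auto)
  have IH: "h z = (\<Sum>v\<in>A. (u v / (1 - u a)) *\<^sub>R h (y v))"
   unfolding z_def using insert.prems \<open>u a < 1\<close> s1 by (intro insert.IH) auto
  have pull: "(\<Sum>v\<in>A. u v *\<^sub>R g v) = (1 - u a) *\<^sub>R (\<Sum>v\<in>A. (u v / (1 - u a)) *\<^sub>R g v)"
   for g :: "_ => 'z::real_vector" using \<open>u a < 1\<close> by (simp add: scaleR_sum_right)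
  have "h ((1 - u a) *\<^sub>R z + u a *\<^sub>R y a) = (1 - u a) *\<^sub>R h z + u a *\<^sub>R h (y a)"
   using h \<open>z \<in> S\<close> insert.prems \<open>u a < 1\<close> unfolding affine_map_on_def by auto
  then show ?thesis using insert.hyps IH pull[of y] pull[of "\<lambda>v. h (y v)"]
   by (simp add: z_def add.commute)
 qed
qed simp

lemma face_of_convex_sum:
 assumes F: "F face_of S" and S: "convex S"
  and A: "finite A" "\<And>v. v \<in> A ==> y v \<in> S" "\<And>v. v \<in> A ==> 0 \<le> u v" "sum u A = (1::real)"
  and "(\<Sum>v\<in>A. u v *\<^sub>R y v) \<in> F" "a \<in> A" "0 < u a"
 shows "y a \<in> F"
proof (cases "u a = 1")
 case True
 have "sum u (A - {a}) = 0" using A(1,4) True assms(8) by (simp add: sum_diff1)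
 then have "\<forall>v\<in>A - {a}. u v = 0" using A sum_nonneg_eq_0_iff[of "A - {a}" u] by auto
 then have "(\<Sum>v\<in>A. u v *\<^sub>R y v) = y a" using A(1) assms(8) True by (subst sum.remove[of A a]) auto
 then show ?thesis using assms(7) by simp
next
 case False
 have sA: "sum u (A - {a}) = 1 - u a" using A assms(8) by (simp add: sum_diff1)
 have "0 \<le> sum u (A - {a})" using A by (intro sum_nonneg) auto
 then have "u a < 1" using sA False by simp
 define z where "z = (\<Sum>v\<in>A - {a}. (u v / (1 - u a)) *\<^sub>R y v)"
 have s1: "(\<Sum>v\<in>A - {a}. u v / (1 - u a)) = 1" using sA \<open>u a < 1\<close> by (simp flip: sum_divide_distrib)
 have zS: "z \<in> S" unfolding z_def
  by (rule convex_sum[OF _ S s1]) (use A \<open>u a < 1\<close> in auto)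
 have "(\<Sum>v\<in>A. u v *\<^sub>R y v) = u a *\<^sub>R y a + (1 - u a) *\<^sub>R z"
  using A(1) assms(8) \<open>u a < 1\<close> by (subst sum.remove[of A a]) (auto simp: z_def scaleR_sum_right)
 then have e: "u a *\<^sub>R y a + (1 - u a) *\<^sub>R z \<in> F" using assms(7) by simp
 show ?thesis
 proof (cases "z = y a")
  case True then show ?thesis using e by (simp flip: scaleR_add_left)
 next
  case False
  then have "u a *\<^sub>R y a + (1 - u a) *\<^sub>R z \<in> open_segment z (y a)"
   using assms(9) \<open>u a < 1\<close> by (auto simp: in_segment add.commute intro!: exI[of _ "u a"])
  then show ?thesis using F e zS A(2)[OF assms(8)] unfolding face_of_def by blast
 qed
qed

lemma vertex_face_of_simplex:
 assumes C: "finite C" "\<not> affine_dependent C" and w: "w \<in> C"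
 shows "w extreme_point_of (convex hull C)"
proof -
 have "w \<notin> convex hull (C - {w})"
  using C(2) w convex_hull_subset_affine_hull unfolding affine_dependent_def by blast
 from extreme_point_of_convex_hull_insert[OF _ this] show ?thesis using C(1) w by (simp add: insert_absorb)
qed

text \<open>
 Take a subdivision of the realisation of \<open>K\<close> on whose simplices the
 homeomorphism \<open>h\<close> is affine, and let \<open>D\<close> be the abstract complex
 of its vertices. Sending the vertices to their positions, and to the images of these under
 \<open>h\<close>, defines the two subdivision maps.
\<close>

lemma pl_homeomorphic_imp_span:
 assumes K: "cpx K" and L: "cpx L" and "pl_homeomorphic K L"
 shows "\<exists>(D :: nat set set) T T'. subdiv T D K \<and> subdiv T' D L"
proof -
 obtain h k \<D> where hom: "homeomorphism (\<Union>(realisation K)) (\<Union>(realisation L)) h k"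
  and \<D>: "geom_subdivision \<D> (realisation K)" and aff: "\<And>S. S \<in> \<D> ==> affine_map_on S h"
  using assms(3) unfolding pl_homeomorphic_def pl_map_on_def by blast
 have hbij: "bij_betw h (body K) (body L)"
  using hom Union_realisation K L unfolding homeomorphism_def bij_betw_def by (metis inj_on_inverseI)
 have gc: "geom_complex \<D>" and U\<D>: "\<Union>\<D> = body K"
  using \<D> Union_realisation[OF K] by (auto simp: geom_subdivision_def)
 have "\<exists>C. finite C \<and> \<not> affine_dependent C \<and> S = convex hull C" if "S \<in> \<D>" for S
  using gc that by (simp add: geom_complex_def geom_simplex_def)
 then obtain V where V: "\<And>S. S \<in> \<D> ==> finite (V S)" "\<And>S. S \<in> \<D> ==> \<not> affine_dependent (V S)"
  "\<And>S. S \<in> \<D> ==> S = convex hull (V S)" by metis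
 define W where "W = \<Union>(V ` \<D>)"
 have finD: "finite \<D>" using gc by (simp add: geom_complex_def)
 have finW: "finite W" using finD V(1) by (auto simp: W_def)
 obtain e where e: "bij_betw e {0..<card W} W" using ex_bij_betw_nat_finite[OF finW] by blast
 define D where "D = insert {} {s. s \<subseteq> {0..<card W} \<and> (\<exists>S\<in>\<D>. e ` s \<subseteq> V S)}"
 have inD: "s \<in> D \<longleftrightarrow> s = {} \<or> s \<subseteq> {0..<card W} \<and> (\<exists>S\<in>\<D>. e ` s \<subseteq> V S)" for s
  by (simp add: D_def)
 have cD: "cpx D"
  unfolding cpx_def
 proof (intro conjI ballI allI impI)
  have "D \<subseteq> Pow {0..<card W}" using inD by blast
  then show "finite D" by (rule finite_subset) simp
  show "{} \<in> D" by (simp add: inD)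
  show "finite s" if "s \<in> D" for s using that finite_subset[of s "{0..<card W}"] by (auto simp: inD)
  show "t \<in> D" if "s \<in> D" "t \<subseteq> s" for s t using that unfolding inD by blast
 qed
 define T where "T = lin_ext e"
 define T' where "T' = lin_ext (h \<circ> e)"
 have eW: "e v \<in> body K" if "v \<in> \<Union>D" for v
 proof -
  from that obtain S where "S \<in> \<D>" "e v \<in> V S" unfolding D_def by auto
  then have "e v \<in> S" using V(3) hull_inc by metis
  then show ?thesis using U\<D> \<open>S \<in> \<D>\<close> by blast
 qed
 have cell: "\<exists>S\<in>\<D>. e ` supp x \<subseteq> V S" if "x \<in> body D" for x
 proof -
  have "mass (0 :: nat \<Rightarrow>\<^sub>0 real) = 0" by (rule linear_0[OF linear_mass])
  then have "supp x \<noteq> {}" using that by (auto simp: body_def)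
  then show ?thesis using that by (auto simp: body_def fan_def inD)
 qed
 have sumT: "T x = (\<Sum>v\<in>supp x. coord x v *\<^sub>R e v)" "T' x = (\<Sum>v\<in>supp x. coord x v *\<^sub>R h (e v))" for x
  by (simp_all add: T_def T'_def lin_ext_def)
 have m1: "sum (coord x) (supp x) = 1" "\<And>v. v \<in> supp x ==> 0 < coord x v" if "x \<in> body D" for x
  using that mass_eq[OF finite_keys order_refl, of x] by (auto simp: body_def fan_def in_keys_iff order_less_le)
 have eS: "e v \<in> S" if "S \<in> \<D>" "e v \<in> V S" for v S using V(3)[OF that(1)] that(2) hull_inc by metis
 have cS: "convex S" if "S \<in> \<D>" for S using V(3)[OF that] convex_convex_hull by metis
 have TS: "T x \<in> S" if "x \<in> body D" "S \<in> \<D>" "e ` supp x \<subseteq> V S" for x S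
  unfolding sumT using m1[OF that(1)] that eS by (intro convex_sum[OF _ cS]) (auto intro: less_imp_le)
 have T'h: "T' x = h (T x)" if x: "x \<in> body D" for x
 proof -
  from cell[OF x] obtain S where S: "S \<in> \<D>" "e ` supp x \<subseteq> V S" by blast
  show ?thesis unfolding sumT
   using m1[OF x] S eS by (intro affine_map_on_sum[OF aff[OF S(1)] cS[OF S(1)], symmetric]) (auto intro: less_imp_le)
 qed
 have Tbody: "T x \<in> body K" if "x \<in> body D" for x
  using cell[OF that] TS[OF that] U\<D> by blast
 \<comment> \<open>simplices of the subdivision that share the point \<open>T x\<close> share
  a face, and this face contains every vertex of positive weight in \<open>x\<close>\<close>
 have key: "e ` supp x \<subseteq> V S'" if x: "x \<in> body D" and y: "y \<in> body D" and eq: "T x = T y"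
   and S': "S' \<in> \<D>" "e ` supp y \<subseteq> V S'" for x y S'
 proof
  fix w assume "w \<in> e ` supp x"
  then obtain v where v: "v \<in> supp x" "w = e v" by blast
  from cell[OF x] obtain S where S: "S \<in> \<D>" "e ` supp x \<subseteq> V S" by blast
  have F: "(S \<inter> S') face_of S" "(S' \<inter> S) face_of S'" using gc S(1) S'(1) unfolding geom_complex_def by blast+
  have "T x \<in> S \<inter> S'" using TS[OF x S] TS[OF y S'] eq by simp
  then have TF: "(\<Sum>v\<in>supp x. coord x v *\<^sub>R e v) \<in> S \<inter> S'" by (simp add: sumT)
  have "e v \<in> S \<inter> S'"
  proof (rule face_of_convex_sum[OF F(1) cS[OF S(1)] finite_keys _ _ m1(1)[OF x] TF v(1) m1(2)[OF x v(1)]])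
   show "e u \<in> S" if "u \<in> supp x" for u using eS[OF S(1)] S(2) that by blast
   show "0 \<le> coord x u" if "u \<in> supp x" for u using m1(2)[OF x that] by simp
  qed
  have "e v extreme_point_of S"
   using vertex_face_of_simplex[OF V(1,2)[OF S(1)], of "e v"] V(3)[OF S(1)] S(2) v by auto
  then have "{e v} face_of S" by (simp add: face_of_singleton)
  then have "{e v} \<in> \<D>" using gc S(1) unfolding geom_complex_def by blast
  then have "(S' \<inter> {e v}) face_of S'" using gc S'(1) unfolding geom_complex_def by blast
  moreover have "S' \<inter> {e v} = {e v}" using \<open>e v \<in> S \<inter> S'\<close> by blast
  ultimately have "e v extreme_point_of (convex hull (V S'))"
   using V(3)[OF S'(1)] by (simp add: face_of_singleton)
  then show "w \<in> V S'" using extreme_point_of_convex_hull v by blast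
 qed
 have inj: "inj_on T (body D)"
 proof (rule inj_onI)
  fix x y assume x: "x \<in> body D" and y: "y \<in> body D" and eq: "T x = T y"
  from cell[OF y] obtain S where S: "S \<in> \<D>" "e ` supp y \<subseteq> V S" by blast
  have S2: "e ` supp x \<subseteq> V S" by (rule key[OF x y eq S])
  define A where "A = supp x \<union> supp y"
  have AW: "A \<subseteq> {0..<card W}" using x y by (auto simp: A_def body_def fan_def inD)
  then have ie: "inj_on e A" using e by (meson bij_betw_def inj_on_subset)
  have eA: "e ` A \<subseteq> V S" using S S2 by (auto simp: A_def)
  have nd: "\<not> affine_dependent (e ` A)" using affine_dependent_subset[OF _ eA] V(2)[OF S(1)] by blast
  have fA: "finite A" by (simp add: A_def)
  define U where "U w = coord x (inv_into A e w) - coord y (inv_into A e w)" for w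
  have "sum U (e ` A) = mass x - mass y"
   using ie by (simp add: sum.reindex U_def sum_subtractf mass_eq[OF fA] A_def)
  then have "sum U (e ` A) = 0" using x y by (simp add: body_def)
  moreover have "(\<Sum>w\<in>e ` A. U w *\<^sub>R w) = T x - T y"
   using ie lin_ext_superset[OF fA, of x e] lin_ext_superset[OF fA, of y e]
   by (simp add: sum.reindex U_def sum_subtractf scaleR_diff_left T_def A_def)
  ultimately have "\<forall>w\<in>e ` A. U w = 0"
   using nd eq affine_dependent_explicit_finite[of "e ` A"] fA by auto
  then have "coord x v = coord y v" if "v \<in> A" for v using ie that by (simp add: U_def)
  moreover have "coord x v = coord y v" if "v \<notin> A" for v
   using that by (simp add: A_def in_keys_iff)
  ultimately show "x = y" by (metis poly_mapping_eqI)
 qed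
 have surj: "body K \<subseteq> T ` body D"
 proof
  fix z assume z: "z \<in> body K"
  then obtain S where S: "S \<in> \<D>" "z \<in> S" using U\<D> by blast
  have VW: "V S \<subseteq> W" using S(1) by (auto simp: W_def)
  define A where "A = {v \<in> {0..<card W}. e v \<in> V S}"
  have "\<exists>v\<in>{0..<card W}. w = e v" if "w \<in> W" for w
   using e that unfolding bij_betw_def image_iff[symmetric] by simp
  then have "w \<in> e ` A" if "w \<in> V S" for w using subsetD[OF VW that] that by (force simp: A_def)
  then have eA: "e ` A = V S" by (auto simp: A_def)
  have "A \<in> D" using eA S(1) unfolding inD A_def by blast
  moreover have "T ` spx A = convex hull (e ` A)"
   unfolding spx_def T_def convex_hull_linear_image[OF linear_lin_ext] by (simp add: image_image)
  then have "T ` spx A = S" using V(3)[OF S(1)] eA by simp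
  ultimately show "z \<in> T ` body D" using S(2) body_spx[OF cD] by blast
 qed
 have bT: "bij_betw T (body D) (body K)" using inj surj Tbody by (auto simp: bij_betw_def)
 then have "bij_betw (h \<circ> T) (body D) (body L)" using hbij by (rule bij_betw_trans)
 then have bT': "bij_betw T' (body D) (body L)" using T'h by (simp cong: bij_betw_cong)
 have hb: "h (e v) \<in> body L" if "v \<in> \<Union>D" for v using eW[OF that] hbij by (auto simp: bij_betw_def)
 have mT: "mass (lin_ext g x) = mass x" if "x \<in> fan D" "\<And>v. v \<in> \<Union>D ==> mass (g v) = 1"
  for x and g :: "nat => nat \<Rightarrow>\<^sub>0 real"
 proof -
  have "v \<in> \<Union>D" if "v \<in> supp x" for v using \<open>x \<in> fan D\<close> that by (auto simp: fan_def)
  then show ?thesis unfolding mass_eq[OF finite_keys order_refl, of x] using that(2)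
   by (simp add: lin_ext_def linear_sum[OF linear_mass] linear_scale[OF linear_mass])
 qed
 have m1: "mass (e v) = 1" "mass ((h \<circ> e) v) = 1" if "v \<in> \<Union>D" for v
  using eW[OF that] hb[OF that] by (simp_all add: body_def)
 have "subdiv T D K"
  using mT[of _ e, OF _ m1(1)] by (intro bij_betw_fan_if_body[OF cD K _ _ bT]) (simp_all add: T_def linear_lin_ext)
 moreover have "subdiv T' D L"
  using mT[of _ "h \<circ> e", OF _ m1(2)]
  by (intro bij_betw_fan_if_body[OF cD L _ _ bT']) (simp_all add: T'_def linear_lin_ext)
 ultimately show ?thesis by blast
qed

lemma continuous_on_coord: "continuous_on A (\<lambda>x :: 'a \<Rightarrow>\<^sub>0 real. coord x v)"
proof (rule continuous_on_iff[THEN iffD2], intro ballI allI impI)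
 fix x :: "'a \<Rightarrow>\<^sub>0 real" and e :: real assume "0 < e"
 have "dist (coord y v) (coord x v) \<le> dist y x" for y
 proof (cases "v \<in> supp y \<union> supp x")
  case True
  then show ?thesis unfolding dist_poly_mapping_def
   by (intro member_le_sum[of v _ "\<lambda>n. dist (coord y n) (coord x n)"]) auto
 qed (simp add: in_keys_iff)
 then show "\<exists>d>0. \<forall>y\<in>A. dist y x < d --> dist (coord y v) (coord x v) < e"
  using \<open>0 < e\<close> by (intro exI[of _ e]) (meson le_less_trans)
qed

lemma continuous_on_lin_ext:
 fixes p :: "'a => 'b::real_normed_vector"
 assumes "finite s" "\<And>x. x \<in> A ==> supp x \<subseteq> s"
 shows "continuous_on A (lin_ext p)"
proof -
 have "continuous_on A (\<lambda>x. \<Sum>v\<in>s. coord x v *\<^sub>R p v)"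
  by (intro continuous_intros continuous_on_coord)
 moreover have "(\<Sum>v\<in>s. coord x v *\<^sub>R p v) = lin_ext p x" if "x \<in> A" for x
  by (rule lin_ext_superset[OF assms(1) assms(2)[OF that], symmetric])
 ultimately show ?thesis by (simp cong: continuous_on_cong)
qed

text \<open>
 Conversely, maps \<open>T\<close> and \<open>T'\<close> from a common subdivision should
 give the PL homeomorphism \<open>T' \<circ> T\<^sup>-\<^sup>1\<close>. They need not map
 realisations onto realisations, but do so after the vertices of \<open>D\<close> are
 rescaled.
\<close>

definition normal_map :: "(('a \<Rightarrow>\<^sub>0 real) => ('b \<Rightarrow>\<^sub>0 real)) => 'a set set => 'b set set => bool" where
 "normal_map T D K \<longleftrightarrow> subdiv T D K \<and> (\<forall>x\<in>fan D. mass (T x) = mass x)"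

lemma normalise_subdiv:
 assumes T: "subdiv T D K"
 shows "\<exists>S. normal_map S D K"
proof -
 note t = subdivD[OF T]
 define c where "c v = 1 / mass (T (pt v))" for v
 have cp: "0 < c v" if "v \<in> \<Union>D" for v
  using mass_pos[OF subdiv_unit(1,2)[OF T that]] by (simp add: c_def)
 \<comment> \<open>rescaling the vertices by positive factors maps the fan to itself\<close>
 have dil: "lin_ext (\<lambda>v. b v *\<^sub>R pt v) x \<in> fan D \<and>
   (\<forall>v. coord (lin_ext (\<lambda>v. b v *\<^sub>R pt v) x) v = b v * coord x v)"
  if "x \<in> fan D" "\<And>v. v \<in> \<Union>D ==> 0 < b v" for b x
 proof -
  have co: "coord (lin_ext (\<lambda>v. b v *\<^sub>R pt v) x) v = b v * coord x v" for v
   by (auto simp: lin_ext_def lookup_sum lookup_single when_def if_distrib sum.delta' in_keys_iff cong: if_cong)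
  have vD: "v \<in> \<Union>D" if "v \<in> supp x" for v using that \<open>x \<in> fan D\<close> by (auto simp: fan_def)
  have "supp (lin_ext (\<lambda>v. b v *\<^sub>R pt v) x) \<subseteq> supp x" by (auto simp: in_keys_iff co)
  moreover have "0 \<le> b v * coord x v" for v
  proof (cases "v \<in> supp x")
   case True then show ?thesis using that vD[OF True] by (auto simp: fan_def less_imp_le)
  qed (simp add: in_keys_iff)
  ultimately show ?thesis using fan_subset_supp[OF t(1) that(1)] co by simp
 qed
 define A where "A = lin_ext (\<lambda>v. c v *\<^sub>R pt v)"
 define B where "B = lin_ext (\<lambda>v. (1 / c v) *\<^sub>R pt v)"
 have A: "A x \<in> fan D" "coord (A x) v = c v * coord x v" if "x \<in> fan D" for x v
  using dil[OF that, of c] cp by (auto simp: A_def)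
 have B: "B x \<in> fan D" "coord (B x) v = (1 / c v) * coord x v" if "x \<in> fan D" for x v
  using dil[OF that, of "\<lambda>v. 1 / c v"] cp by (auto simp: B_def)
 have cc: "c v \<noteq> 0 \<or> coord x v = 0" if "x \<in> fan D" for x v
  using cp fan_outside[OF that] by (metis less_irrefl)
 have "B (A x) = x" "A (B x) = x" if "x \<in> fan D" for x
  using that cc[OF that] by (intro poly_mapping_eqI; force simp: A B)+
 then have "bij_betw A (fan D) (fan D)" using A(1) B(1) by (intro bij_betwI[where g = B]) auto
 then have "subdiv A D D" using t(1) by (simp add: subdiv_def A_def linear_lin_ext)
 then have TA: "subdiv (T \<circ> A) D K" by (rule subdiv_comp[OF T])
 have mu: "mass ((T \<circ> A) (pt v)) = 1" if "v \<in> \<Union>D" for v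
  using cp[OF that] by (simp add: A_def linear_scale[OF t(3)] linear_scale[OF linear_mass] c_def)
 have "mass ((T \<circ> A) x) = mass x" if x: "x \<in> fan D" for x
 proof -
  have vD: "v \<in> \<Union>D" if "v \<in> supp x" for v using that x by (auto simp: fan_def)
  have "mass ((T \<circ> A) x) = (\<Sum>v\<in>supp x. coord x v *\<^sub>R mass ((T \<circ> A) (pt v)))"
   using linear_expansion[OF linear_compose[OF subdivD(3)[OF TA] linear_mass], of x] by simp
  then show ?thesis unfolding mass_eq[OF finite_keys order_refl, of x] using mu vD by simp
 qed
 then show ?thesis unfolding normal_map_def using TA by blast
qed

lemma normal_mapD:
 assumes "normal_map T D K"
 shows "subdiv T D K" "bij_betw T (body D) (body K)"
proof -
 show s: "subdiv T D K" using assms by (simp add: normal_map_def)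
 note t = subdivD[OF s]
 have m: "mass (T x) = mass x" if "x \<in> fan D" for x using assms that by (simp add: normal_map_def)
 have "inj_on T (body D)" using t(6) by (rule inj_on_subset) (auto simp: body_def)
 moreover have "T ` body D = body K"
 proof (intro equalityI subsetI)
  fix y assume y: "y \<in> body K"
  then obtain x where "x \<in> fan D" "y = T x" using t(7) by (auto simp: body_def)
  then show "y \<in> T ` body D" using y m by (auto simp: body_def)
 qed (use t(5) m in \<open>auto simp: body_def\<close>)
 ultimately show "bij_betw T (body D) (body K)" by (simp add: bij_betw_def)
qed

lemma geom_subdivision_image:
 fixes K :: "nat set set"
 assumes T: "normal_map T D K"
 shows "geom_subdivision ((\<lambda>s. T ` spx s) ` D) (realisation K)"
proof -
 note s = normal_mapD[OF T]
 note t = subdivD[OF s(1)]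
 have fin: "finite s" if "s \<in> D" for s using cpxD(3)[OF t(1) that] .
 have sub: "spx s \<subseteq> body D" if "s \<in> D" for s using body_spx[OF t(1)] that by blast
 have inj: "x = y" if "T x = T y" "x \<in> body D" "y \<in> body D" for x y
  using s(2) that by (auto simp: bij_betw_def dest: inj_onD)
 have hull: "T ` spx s = convex hull ((\<lambda>v. T (pt v)) ` s)" for s
  by (simp add: spx_def convex_hull_linear_image[OF t(3)] image_image)
 let ?g = "\<lambda>v. T (pt v)"
 have aff: "affine hull (?g ` r) \<subseteq> T ` {x. supp x \<subseteq> r}" for r
  by (rule hull_minimal) (auto simp: subspace_imp_affine linear_subspace_image[OF t(3) subspace_supp])
 have span: "x = y" if "s \<in> D" "supp x \<subseteq> s" "supp y \<subseteq> s" "T x = T y" for s x y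
  using inj_onD[OF subdiv_inj_span[OF s(1) that(1)]] that(2-) by blast
 have face: "T ` spx r face_of T ` spx s" if sD: "s \<in> D" and rs: "r \<subseteq> s" for r s
 proof -
  have "False" if z: "z \<in> affine hull (?g ` r)" "z \<in> convex hull (?g ` s - ?g ` r)" for z
  proof -
   obtain x where x: "supp x \<subseteq> r" "z = T x" using z(1) aff by blast
   have "?g ` s - ?g ` r \<subseteq> ?g ` (s - r)" by blast
   then have "z \<in> T ` spx (s - r)" using z(2) hull_mono[of _ _ convex] unfolding hull by blast
   then obtain y where y: "supp y \<subseteq> s - r" "mass y = 1" "z = T y"
    using spx_iff[of "s - r"] fin[OF sD] by blast
   have "x = y" using x y rs by (intro span[OF sD]) auto
   then have "supp y = {}" using x(1) y(1) by blast
   then show False using y(2) mass_eq[of "{}" y] by simp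
  qed
  then show ?thesis unfolding hull using fin[OF sD] rs by (intro face_of_convex_hulls) auto
 qed
 have "geom_complex ((\<lambda>s. T ` spx s) ` D)"
  unfolding geom_complex_def
 proof (intro conjI ballI allI impI)
  show "finite ((\<lambda>s. T ` spx s) ` D)" using cpxD(1)[OF t(1)] by simp
 next
  fix S assume "S \<in> (\<lambda>s. T ` spx s) ` D"
  then obtain s where sD: "s \<in> D" "S = T ` spx s" by blast
  have "\<not> affine_dependent (?g ` s)"
   unfolding affine_dependent_def
  proof clarify
   fix v assume v: "v \<in> s" "?g v \<in> affine hull (?g ` s - {?g v})"
   have "?g ` s - {?g v} \<subseteq> ?g ` (s - {v})" by blast
   then obtain x where x: "supp x \<subseteq> s - {v}" "?g v = T x" using v(2) hull_mono[of _ _ affine] aff by blast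
   then have "pt v = x" using v(1) by (intro span[OF sD(1)]) auto
   then show False using x(1) by auto
  qed
  then show "geom_simplex S" unfolding geom_simplex_def sD(2) hull using fin[OF sD(1)] by blast
 next
  fix F S assume "S \<in> (\<lambda>s. T ` spx s) ` D \<and> F face_of S"
  then obtain s where sD: "s \<in> D" and F: "F face_of T ` spx s" by blast
  define r where "r = {v \<in> s. T (pt v) \<in> F}"
  have rD: "r \<in> D" using cpxD(4)[OF t(1) sD] by (simp add: r_def)
  have conv: "convex (T ` spx s)" unfolding hull by (rule convex_convex_hull)
  have "F = T ` spx r"
  proof (intro equalityI subsetI)
   fix z assume z: "z \<in> F"
   then obtain x where x: "x \<in> spx s" "z = T x" using F unfolding face_of_def by blast
   have sx: "supp x \<subseteq> s" "\<And>v. 0 \<le> coord x v" "mass x = 1" using x spx_iff[OF fin[OF sD]] by auto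
   have "T (pt v) \<in> F" if v: "v \<in> supp x" for v
   proof (rule face_of_convex_sum[OF F conv, where u = "coord x" and A = "supp x"])
    show "T (pt w) \<in> T ` spx s" if "w \<in> supp x" for w
     using that sx(1) unfolding hull by (auto intro: hull_inc)
    show "(\<Sum>w\<in>supp x. coord x w *\<^sub>R T (pt w)) \<in> F" using z x(2) linear_expansion[OF t(3), of x] by simp
    show "0 < coord x v" using v sx(2)[of v] by (simp add: in_keys_iff order_less_le)
   qed (use sx v mass_eq[OF finite_keys order_refl, of x] in auto)
   then have "x \<in> spx r" using sx by (subst spx_iff[OF fin[OF rD]]) (auto simp: r_def)
   then show "z \<in> T ` spx r" using x by blast
  next
   fix z assume "z \<in> T ` spx r"
   moreover have "convex F" using F by (simp add: face_of_def)
   ultimately show "z \<in> F" using hull_minimal[of "(\<lambda>v. T (pt v)) ` r" F convex] unfolding hull r_def by blast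
  qed
  then show "F \<in> (\<lambda>s. T ` spx s) ` D" using rD by blast
 next
  fix S S' assume "S \<in> (\<lambda>s. T ` spx s) ` D \<and> S' \<in> (\<lambda>s. T ` spx s) ` D"
  then obtain s s' where ss: "s \<in> D" "S = T ` spx s" "s' \<in> D" "S' = T ` spx s'" by blast
  have "spx s \<inter> spx s' = spx (s \<inter> s')"
   using spx_iff[OF fin[OF ss(1)]] spx_iff[OF fin[OF ss(3)]] spx_iff[of "s \<inter> s'"] fin[OF ss(1)]
   by blast
  then have "S \<inter> S' = T ` spx (s \<inter> s')"
   using s(2) sub[OF ss(1)] sub[OF ss(3)] unfolding ss(2,4) bij_betw_def
   by (metis inj_on_image_Int)
  then show "S \<inter> S' face_of S" using face[OF ss(1), of "s \<inter> s'"] ss(2) by simp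
 qed
 moreover have "\<Union>((\<lambda>s. T ` spx s) ` D) = \<Union>(realisation K)"
 proof -
  have "\<Union>((\<lambda>s. T ` spx s) ` D) = T ` body D" by (auto simp: body_spx[OF t(1)])
  then show ?thesis using s(2) Union_realisation[OF t(2)] by (simp add: bij_betw_def)
 qed
 moreover have "\<exists>C\<in>realisation K. S \<subseteq> C" if "S \<in> (\<lambda>s. T ` spx s) ` D" for S
 proof -
  from that obtain s where sD: "s \<in> D" "S = T ` spx s" by blast
  define r where "r = (\<Union>v\<in>s. supp (T (pt v)))"
  have r: "r \<in> K" unfolding r_def by (rule subdiv_simplex[OF \<open>subdiv T D K\<close> sD(1)])
  have "T x \<in> spx r" if x: "x \<in> spx s" for x
  proof -
   have xb: "x \<in> body D" using sub[OF sD(1)] x by blast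
   then have "T x \<in> body K" using s(2) by (auto simp: bij_betw_def)
   moreover have "supp x \<subseteq> s" using x spx_iff[OF fin[OF sD(1)]] by blast
   then have "supp (T x) \<subseteq> r" using subdiv_supp[OF s(1), of x] xb by (auto simp: r_def body_def)
   ultimately show ?thesis using spx_iff[OF cpxD(3)[OF t(2) r]] by (auto simp: body_def fan_def)
  qed
  then show ?thesis using r sD(2) by (auto simp: realisation_std)
 qed
 ultimately show ?thesis by (simp add: geom_subdivision_def)
qed

lemma pl_map_of_span:
 fixes K L :: "nat set set"
 assumes T: "normal_map T D K" and T': "normal_map T' D L"
 defines "h \<equiv> T' \<circ> inv_into (body D) T"
 shows "pl_map_on K h" "continuous_on (body K) h"
proof -
 note s = normal_mapD[OF T] and s' = normal_mapD[OF T']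
 note t = subdivD[OF s(1)] and t' = subdivD[OF s'(1)]
 have inv: "inv_into (body D) T (T x) = x" if "x \<in> body D" for x
  using s(2) that by (simp add: bij_betw_def)
 have hT: "h (T x) = T' x" if "x \<in> body D" for x by (simp add: h_def inv[OF that])
 have fin: "finite s" if "s \<in> D" for s using cpxD(3)[OF t(1) that] .
 have sub: "spx s \<subseteq> body D" if "s \<in> D" for s using body_spx[OF t(1)] that by blast
 have "affine_map_on (T ` spx s) h" if sD: "s \<in> D" for s
  unfolding affine_map_on_def
 proof (intro ballI)
  fix a b u assume "a \<in> T ` spx s" "b \<in> T ` spx s" and u: "u \<in> {0..1::real}"
  then obtain x y where xy: "x \<in> spx s" "a = T x" "y \<in> spx s" "b = T y" by blast
  have z: "(1 - u) *\<^sub>R x + u *\<^sub>R y \<in> spx s"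
   using xy u by (intro convexD[OF convex_convex_hull[of "pt ` s", folded spx_def]]) auto
  have "h ((1 - u) *\<^sub>R a + u *\<^sub>R b) = h (T ((1 - u) *\<^sub>R x + u *\<^sub>R y))"
   using xy by (simp add: linear_add[OF t(3)] linear_scale[OF t(3)])
  also have "\<dots> = T' ((1 - u) *\<^sub>R x + u *\<^sub>R y)" using hT sub[OF sD] z by blast
  also have "\<dots> = (1 - u) *\<^sub>R h a + u *\<^sub>R h b"
   using xy hT sub[OF sD] by (auto simp: linear_add[OF t'(3)] linear_scale[OF t'(3)] subset_iff)
  finally show "h ((1 - u) *\<^sub>R a + u *\<^sub>R b) = (1 - u) *\<^sub>R h a + u *\<^sub>R h b" .
 qed
 then show "pl_map_on K h" unfolding pl_map_on_def using geom_subdivision_image[OF T] by blast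
 have cont: "continuous_on (spx s) S" if "s \<in> D" "linear S"
  for s and S :: "(_ \<Rightarrow>\<^sub>0 real) => (nat \<Rightarrow>\<^sub>0 real)"
 proof -
  have "supp x \<subseteq> s" if "x \<in> spx s" for x using that spx_iff[OF fin[OF \<open>s \<in> D\<close>]] by blast
  then show ?thesis
   by (subst linear_eq_lin_ext[OF that(2)]) (rule continuous_on_lin_ext[OF fin[OF that(1)]])
 qed
 have comp: "compact (spx s)" if "s \<in> D" for s
  unfolding spx_def using fin[OF that] by (intro finite_imp_compact_convex_hull) simp
 have "continuous_on (\<Union>s\<in>D. T ` spx s) h"
 proof (rule continuous_on_closed_Union)
  show "finite D" using cpxD(1)[OF t(1)] .
  show "closed (T ` spx s)" if "s \<in> D" for s
   using compact_continuous_image[OF cont[OF that t(3)] comp[OF that]] by (rule compact_imp_closed)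
  show "continuous_on (T ` spx s) h" if "s \<in> D" for s
  proof -
   have "continuous_on (T ` spx s) (inv_into (body D) T)"
    by (rule continuous_on_inv[OF cont[OF that t(3)] comp[OF that]]) (use inv sub[OF that] in blast)
   moreover have "inv_into (body D) T ` T ` spx s = spx s"
    using inv sub[OF that] by (force simp: image_image)
   ultimately show ?thesis unfolding h_def
    using cont[OF that t'(3)] by (intro continuous_on_compose) auto
  qed
 qed
 moreover have "(\<Union>s\<in>D. T ` spx s) = body K"
 proof -
  have "T ` body D = (\<Union>s\<in>D. T ` spx s)" unfolding body_spx[OF t(1)] by blast
  then show ?thesis using s(2) by (simp add: bij_betw_def)
 qed
 ultimately show "continuous_on (body K) h" by simp
qed

lemma pl_homeomorphic_of_span:
 fixes K L :: "nat set set"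
 assumes "subdiv T D K" "subdiv T' D L"
 shows "pl_homeomorphic K L"
proof -
 obtain S S' where S: "normal_map S D K" "normal_map S' D L"
  using normalise_subdiv assms by metis
 note s = normal_mapD[OF S(1)] and s' = normal_mapD[OF S(2)]
 define h where "h = S' \<circ> inv_into (body D) S"
 define k where "k = S \<circ> inv_into (body D) S'"
 have inv: "inv_into (body D) S (S x) = x" "inv_into (body D) S' (S' x) = x" if "x \<in> body D" for x
  using s(2) s'(2) that by (simp_all add: bij_betw_def)
 have "homeomorphism (body K) (body L) h k"
  unfolding homeomorphism_def
 proof (intro conjI ballI)
  show "continuous_on (body K) h" "continuous_on (body L) k"
   unfolding h_def k_def using pl_map_of_span(2) S by blast+
  show "h ` body K = body L" "k ` body L = body K"
   using s(2) s'(2) unfolding h_def k_def bij_betw_def image_comp[symmetric]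
   by (metis inj_on_imp_bij_betw bij_betw_inv_into bij_betw_def)+
  show "k (h x) = x" if "x \<in> body K" for x
   using inv(2)[OF inv_into_into[of x S "body D"]] f_inv_into_f[of x S "body D"] that s(2)
   by (simp add: h_def k_def bij_betw_def)
  show "h (k x) = x" if "x \<in> body L" for x
   using inv(1)[OF inv_into_into[of x S' "body D"]] f_inv_into_f[of x S' "body D"] that s'(2)
   by (simp add: h_def k_def bij_betw_def)
 qed
 moreover have "pl_map_on K h" "pl_map_on L k"
  unfolding h_def k_def using pl_map_of_span(1) S by blast+
 ultimately show ?thesis
  unfolding pl_homeomorphic_def
  using Union_realisation[OF subdivD(2)[OF assms(1)]] Union_realisation[OF subdivD(2)[OF assms(2)]] by metis
qed

theorem pl_sphere_iff_sph:
 fixes L :: "nat set set"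
 shows "pl_sphere k L \<longleftrightarrow> k \<ge> -1 \<and> sph (nat (k + 1)) L"
proof -
 have "sph j L \<longleftrightarrow> simplicial_cpx L \<and> pl_homeomorphic L (simplex_boundary j)" for j
  unfolding simplicial_cpx_eq_cpx
  using pl_homeomorphic_imp_span[OF _ sph_cpx[OF sph_simplex_boundary], of L j]
   pl_homeomorphic_of_span[of _ _ L _ "simplex_boundary j"] sph_cpx[of j L]
  unfolding sph_def by metis
 then show ?thesis by (auto simp: pl_sphere_def)
qed

section \<open>Orientations and oriented isomorphisms\<close>

definition alternating :: "('a list => int) => bool" where
 "alternating \<omega> \<longleftrightarrow> (\<forall>us a b vs. \<omega> (us @ b # a # vs) = - \<omega> (us @ a # b # vs))"

lemma alternatingD: "alternating \<omega> ==> \<omega> (us @ b # a # vs) = - \<omega> (us @ a # b # vs)"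
 unfolding alternating_def by blast

lemma alternatingI: "(\<And>us a b vs. \<omega> (us @ b # a # vs) = - \<omega> (us @ a # b # vs)) ==> alternating \<omega>"
 unfolding alternating_def by blast

lemma alternating_Cons: "alternating \<omega> ==> alternating (\<lambda>vs. \<omega> (a # vs))"
 by (rule alternatingI, subst (1 2) append_Cons[symmetric]) (rule alternatingD)

lemma alternating_append: "alternating \<omega> ==> alternating (\<lambda>vs. \<omega> (vs @ ws))"
 by (rule alternatingI, simp only: append_assoc append_Cons) (rule alternatingD)

lemma alternating_map: "alternating \<omega> ==> alternating (\<lambda>vs. \<omega> (map f vs))"
 by (rule alternatingI, simp only: map_append list.map) (rule alternatingD)

lemma alternating_move:
 assumes "alternating \<omega>"
 shows "\<omega> (us @ a # vs) = (- 1) ^ length us * \<omega> (a # us @ vs)"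
proof (induction us arbitrary: vs rule: rev_induct)
 case (snoc b us)
 have "\<omega> ((us @ [b]) @ a # vs) = - \<omega> (us @ a # b # vs)"
  using alternatingD[OF assms, of us a b vs] by simp
 then show ?case using snoc.IH[of "b # vs"] by simp
qed simp

text \<open>The sign of a permutation never has to be defined: it cancels in the product of two alternating functions.\<close>

lemma alternating_prod:
 assumes "alternating F" "alternating G" "mset ws = mset ws'"
 shows "F ws * G ws = F ws' * G ws'"
 using assms
proof (induction ws' arbitrary: F G ws)
 case (Cons a ws')
 then have "a \<in> set ws" by (metis list.set_intros(1) set_mset_mset)
 then obtain us vs where ws: "ws = us @ a # vs" by (meson split_list)
 have "mset (us @ vs) = mset ws'" using Cons.prems(3) ws by simp
 from Cons.IH[OF alternating_Cons[OF Cons.prems(1), of a] alternating_Cons[OF Cons.prems(2), of a] this]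
 show ?case unfolding ws alternating_move[OF Cons.prems(1)] alternating_move[OF Cons.prems(2)]
  by (simp add: algebra_simps flip: power_add mult_2)
qed simp

text \<open>
 As in \<open>sph\<close>, the index \<open>k\<close> is the number of vertices of a facet,
 one more than the dimension.
\<close>

definition oface :: "nat => 'a set set => 'a list => bool" where
 "oface k X vs \<longleftrightarrow> distinct vs \<and> set vs \<in> X \<and> length vs = k"

definition ori :: "nat => 'a set set => ('a list => int) => bool" where
 "ori k X \<omega> \<longleftrightarrow>
   (\<forall>vs. if oface k X vs then \<omega> vs \<in> {1, -1} else \<omega> vs = 0) \<and> alternating \<omega> \<and>
   (\<forall>a b vs. a \<noteq> b \<and> oface k X (a # vs) \<and> oface k X (b # vs) --> \<omega> (b # vs) = - \<omega> (a # vs))"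

lemma oriD:
 assumes "ori k X \<omega>"
 shows "oface k X vs ==> \<omega> vs = 1 \<or> \<omega> vs = -1" "\<not> oface k X vs ==> \<omega> vs = 0"
  "alternating \<omega>"
  "a \<noteq> b ==> oface k X (a # vs) ==> oface k X (b # vs) ==> \<omega> (b # vs) = - \<omega> (a # vs)"
  "oface k X vs ==> \<omega> vs * \<omega> vs = 1"
proof -
 have *: "if oface k X vs then \<omega> vs \<in> {1, -1} else \<omega> vs = 0" for vs using assms unfolding ori_def by blast
 show "oface k X vs ==> \<omega> vs = 1 \<or> \<omega> vs = -1" using *[of vs] by simp
 then show "oface k X vs ==> \<omega> vs * \<omega> vs = 1" by fastforce
 show "\<not> oface k X vs ==> \<omega> vs = 0" using *[of vs] by simp
 show "alternating \<omega>"
  "a \<noteq> b ==> oface k X (a # vs) ==> oface k X (b # vs) ==> \<omega> (b # vs) = - \<omega> (a # vs)"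
  using assms unfolding ori_def by blast+
qed

lemma is_orientation_iff_ori: "is_orientation (int k - 1) L \<omega> \<longleftrightarrow> ori k L \<omega>"
proof -
 have "ordered_simplex (int k - 1) L vs \<longleftrightarrow> oface k L vs" for vs
  by (auto simp: ordered_simplex_def oface_def sdim_def distinct_card)
 then show ?thesis by (simp add: is_orientation_def ori_def alternating_def)
qed

lemma ori_replace:
 assumes \<omega>: "ori k X \<omega>" and r: "oface k X r" "oface k X (r[i := b])" "i < k" "r ! i \<noteq> b"
 shows "\<omega> (r[i := b]) = - \<omega> r"
proof -
 note o = oriD[OF \<omega>]
 define us vs where "us = take i r" and "vs = drop (Suc i) r"
 have len: "length r = k" using r by (simp add: oface_def)
 have rs: "r = us @ r ! i # vs" "r[i := b] = us @ b # vs"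
  using r(3) len by (auto simp: us_def vs_def id_take_nth_drop upd_conv_take_nth_drop)
 have of: "oface k X (c # us @ vs) \<longleftrightarrow> oface k X (us @ c # vs)" for c
  by (auto simp: oface_def)
 have "oface k X (r ! i # us @ vs)" "oface k X (b # us @ vs)"
  using r rs unfolding of by metis+
 then have "\<omega> (b # us @ vs) = - \<omega> (r ! i # us @ vs)" using o(4) r(4) by blast
 then have "\<omega> (us @ b # vs) = - \<omega> (us @ r ! i # vs)"
  unfolding alternating_move[OF o(3), of us] by simp
 then show ?thesis using rs by metis
qed

lemma ori_agree:
 assumes \<omega>: "alternating \<omega>" "alternating \<eta>" and r: "\<omega> r * \<omega> r = 1" "\<eta> r = c * \<omega> r"
  and vs: "mset vs = mset r" "\<omega> vs * \<omega> vs = 1"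
 shows "\<eta> vs = c * \<omega> vs"
proof -
 have "\<omega> vs * \<eta> vs = \<omega> r * \<eta> r" by (rule alternating_prod[OF \<omega> vs(1)])
 also have "\<dots> = c * (\<omega> r * \<omega> r)" by (simp only: r(2) mult.left_commute)
 finally have "\<omega> vs * \<eta> vs = c" using r(1) by simp
 have "\<eta> vs = (\<omega> vs * \<omega> vs) * \<eta> vs" using vs(2) by simp
 also have "\<dots> = (\<omega> vs * \<eta> vs) * \<omega> vs" by (simp add: mult_ac)
 finally show ?thesis using \<open>\<omega> vs * \<eta> vs = c\<close> by simp
qed

lemma oface_mset:
 "oface k X vs ==> distinct r ==> set r = set vs ==> mset vs = mset r"
 by (metis oface_def set_eq_iff_mset_eq_distinct)

text \<open>The sign of the permutation that sorts the list, by counting inversions.\<close>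

fun parity :: "nat list => int" where
 "parity [] = 1"
| "parity (x # xs) = (- 1) ^ length (filter (\<lambda>y. y < x) xs) * parity xs"

lemma parity_swap: "a \<noteq> b ==> parity (us @ b # a # vs) = - parity (us @ a # b # vs)"
proof (induction us)
 case Nil
 then show ?case by (cases "a < b") auto
qed simp

lemma parity_sq: "parity xs * parity xs = 1"
proof (induction xs)
 case (Cons x xs)
 have "parity (x # xs) * parity (x # xs) = ((- 1) ^ length (filter (\<lambda>y. y < x) xs)) ^ 2 * (parity xs * parity xs)"
  by (simp add: power2_eq_square algebra_simps)
 then show ?case using Cons by (simp flip: power_mult)
qed simp

text \<open>
 An orientation may be prescribed by giving signs \<open>e\<close> to some orderings
 \<open>r\<close> of the facets, at least one for each facet (\<open>R2\<close>). The
 prescriptions have to agree on each facet, which is tested against an arbitrary alternating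
 function (\<open>R3\<close>), and to be opposite on the two sides of each ridge, which needs
 one pair of prescribed orderings that differ in a single place (\<open>R4\<close>).
\<close>

lemma exists_ori:
 fixes X :: "'a set set"
 assumes X: "cpx X"
  and R1: "\<And>r e. (r, e) \<in> R ==> oface k X r \<and> (e = 1 \<or> e = -1)"
  and R2: "\<And>s. s \<in> X ==> card s = k ==> \<exists>r e. (r, e) \<in> R \<and> set r = s"
  and R3: "\<And>r e r' e' F. (r, e) \<in> R ==> (r', e') \<in> R ==> set r = set r' ==> alternating F ==> e * F r = e' * F r'"
  and R4: "\<And>a b s. a \<noteq> b ==> a \<notin> s ==> b \<notin> s ==> insert a s \<in> X ==> insert b s \<in> X ==> Suc (card s) = k ==>
   \<exists>r i e. (r, e) \<in> R \<and> i < k \<and> r ! i = a \<and> set r = insert a s \<and> (r[i := b], - e) \<in> R"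
 shows "\<exists>\<omega>. ori k X \<omega> \<and> (\<forall>(r, e)\<in>R. \<omega> r = e)"
proof -
 obtain \<rho> :: "'a => nat" where \<rho>: "inj_on \<rho> (\<Union>X)"
  using finite_imp_inj_to_nat_seg[OF cpxD(5)[OF X]] by blast
 \<comment> \<open>an alternating sign that has nothing to do with the geometry; it
  transports the prescribed signs\<close>
 define p where "p ws = (if oface k X ws then parity (map \<rho> ws) else 0)" for ws
 have of_swap: "oface k X (us @ b # a # vs) \<longleftrightarrow> oface k X (us @ a # b # vs)" for us a b vs
  by (auto simp: oface_def insert_commute)
 have psw: "p (us @ b # a # vs) = - p (us @ a # b # vs)" for us a b vs
 proof (cases "oface k X (us @ a # b # vs)")
  case True
  then have d: "distinct (us @ a # b # vs)" and "set (us @ a # b # vs) \<in> X"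
   by (simp_all add: oface_def del: set_append)
  then have "a \<in> \<Union>X" "b \<in> \<Union>X" by (auto intro: UnionI[of "set (us @ a # b # vs)"] simp del: Union_iff)
  moreover have "a \<noteq> b" using d by simp
  ultimately have "\<rho> a \<noteq> \<rho> b" using \<rho> by (auto dest: inj_onD)
  then show ?thesis using True parity_swap[of "\<rho> a" "\<rho> b" "map \<rho> us" "map \<rho> vs"] by (simp add: p_def of_swap)
 qed (simp add: p_def of_swap)
 then have altp: "alternating p" unfolding alternating_def by blast
 have p2: "p ws * p ws = 1" if "oface k X ws" for ws using that parity_sq by (simp add: p_def)
 define q where "q ws = (SOME re. re \<in> R \<and> set (fst re) = set ws)" for ws
 define \<omega> where "\<omega> ws = snd (q ws) * p (fst (q ws)) * p ws" for ws
 have q: "(fst (q ws), snd (q ws)) \<in> R \<and> set (fst (q ws)) = set ws" if "oface k X ws" for ws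
 proof -
  have "card (set ws) = k" "set ws \<in> X" using that by (auto simp: oface_def distinct_card)
  then have "\<exists>re. re \<in> R \<and> set (fst re) = set ws" using R2 by fastforce
  then show ?thesis unfolding q_def prod.collapse by (rule someI_ex)
 qed
 have \<omega>0: "\<omega> ws = 0" if "\<not> oface k X ws" for ws using that by (simp add: \<omega>_def p_def)
 have pm: "x = 1 \<or> x = -1" if "x * x = 1" for x :: int using that by (metis mult_1 square_eq_iff)
 have \<omega>1: "\<omega> ws = 1 \<or> \<omega> ws = -1" if "oface k X ws" for ws
  
 proof -
  have "oface k X (fst (q ws))" "snd (q ws) = 1 \<or> snd (q ws) = -1" using R1 q[OF that] by blast+
  then show ?thesis using pm[OF p2[OF that]] pm[OF p2[of "fst (q ws)"]] unfolding \<omega>_def by auto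
 qed
 have alt: "alternating \<omega>"
  unfolding alternating_def
 proof (intro allI)
  fix us a b vs
  have "q (us @ b # a # vs) = q (us @ a # b # vs)" by (simp add: q_def insert_commute)
  then show "\<omega> (us @ b # a # vs) = - \<omega> (us @ a # b # vs)" using psw[of us b a vs] by (simp add: \<omega>_def)
 qed
 have \<omega>R: "\<omega> r = e" if "(r, e) \<in> R" for r e
 proof -
  have o: "oface k X r" using R1[OF that] by blast
  have "snd (q r) * p (fst (q r)) = e * p r" using q[OF o] by (intro R3[OF _ that _ altp]) auto
  then show ?thesis using p2[OF o] by (simp add: \<omega>_def mult.assoc)
 qed
 have "\<omega> (b # vs) = - \<omega> (a # vs)" if ab: "a \<noteq> b" "oface k X (a # vs)" "oface k X (b # vs)" for a b vs
 proof -
  have "\<exists>r i e. (r, e) \<in> R \<and> i < k \<and> r ! i = a \<and> set r = insert a (set vs) \<and> (r[i := b], - e) \<in> R"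
   using ab by (intro R4) (auto simp: oface_def distinct_card)
  then obtain r i e where r: "(r, e) \<in> R" "i < k" "r ! i = a" "set r = insert a (set vs)" "(r[i := b], - e) \<in> R"
   by blast
  define us ws where "us = take i r" and "ws = drop (Suc i) r"
  have ro: "oface k X r" using R1[OF r(1)] by blast
  then have rs: "r = us @ a # ws" "r[i := b] = us @ b # ws"
   using r(2,3) by (auto simp: us_def ws_def oface_def id_take_nth_drop upd_conv_take_nth_drop)
  have "mset (a # vs) = mset r"
   by (rule oface_mset[OF ab(2)]) (use ro r(4) in \<open>auto simp: oface_def\<close>)
  then have m: "mset vs = mset (us @ ws)" using rs by simp
  have "\<omega> (a # vs) * \<omega> (b # vs) = \<omega> (a # us @ ws) * \<omega> (b # us @ ws)"
   by (rule alternating_prod[OF alternating_Cons[OF alt] alternating_Cons[OF alt] m])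
  also have "\<dots> = \<omega> r * \<omega> (r[i := b])"
  proof -
   have "\<omega> r = (-1) ^ length us * \<omega> (a # us @ ws)" "\<omega> (r[i := b]) = (-1) ^ length us * \<omega> (b # us @ ws)"
    using alternating_move[OF alt] rs by metis+
   then show ?thesis by (simp add: algebra_simps flip: power_add mult_2)
  qed
  also have "\<dots> = -1" using \<omega>R[OF r(1)] \<omega>R[OF r(5)] R1[OF r(1)] by auto
  finally show ?thesis using \<omega>1[OF ab(2)] \<omega>1[OF ab(3)] by auto
 qed
 then have "ori k X \<omega>" unfolding ori_def using \<omega>0 \<omega>1 alt by auto
 then show ?thesis using \<omega>R by blast
qed

definition ind :: "'a => ('a list => int) => 'a list => int" where
 "ind v \<omega> vs = \<omega> (v # vs)"

lemma ind_induced: "induced v \<omega> = ind v \<omega>"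
 by (rule ext) (simp add: induced_def ind_def)

lemma link_lk: "cpx K ==> link K {v} = lk K v"
 using cpxD(4)[of K] by (auto simp: link_def lk_def)

lemma oface_lk: "oface k (lk X v) vs \<longleftrightarrow> oface (Suc k) X (v # vs)"
 by (auto simp: oface_def lk_def)

lemma ori_lk:
 assumes \<omega>: "ori (Suc k) X \<omega>"
 shows "ori k (lk X v) (ind v \<omega>)"
 unfolding ori_def oface_lk
proof (intro conjI allI impI)
 note o = oriD[OF \<omega>]
 show "if oface (Suc k) X (v # vs) then ind v \<omega> vs \<in> {1, -1} else ind v \<omega> vs = 0" for vs
  using o(1,2)[of "v # vs"] by (auto simp: ind_def)
 show "alternating (ind v \<omega>)" using alternating_Cons[OF o(3)] unfolding ind_def .
 show "ind v \<omega> (b # vs) = - ind v \<omega> (a # vs)"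
  if "a \<noteq> b \<and> oface (Suc k) X (v # a # vs) \<and> oface (Suc k) X (v # b # vs)" for a b vs
 proof -
  have "oface (Suc k) X (a # v # vs)" "oface (Suc k) X (b # v # vs)"
   using that by (auto simp: oface_def insert_commute)
  then have "\<omega> (b # v # vs) = - \<omega> (a # v # vs)" using o(4) that by blast
  moreover have "\<omega> (v # c # vs) = - \<omega> (c # v # vs)" for c using alternatingD[OF o(3), of "[]" v c vs] by simp
  ultimately show ?thesis by (simp add: ind_def)
 qed
qed

text \<open>The factor \<open>c = 1\<close> or \<open>c = -1\<close> tells whether the orientation is preserved or reversed.\<close>

definition oiso :: "int => ('a => 'b) => 'a set set => ('a list => int) => 'b set set => ('b list => int) => bool" where
 "oiso c \<phi> X \<omega> Y \<eta> \<longleftrightarrow> inj_on \<phi> (\<Union>X) \<and> (`) \<phi> ` X = Y \<and> (\<forall>vs. set vs \<in> X --> \<eta> (map \<phi> vs) = c * \<omega> vs)"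

lemma Union_image_image: "\<Union>((`) \<phi> ` K) = \<phi> ` \<Union>K"
 by auto

lemma oiso_comp:
 assumes "oiso c \<phi> X \<omega> Y \<eta>" "oiso d \<psi> Y \<eta> Z \<zeta>"
 shows "oiso (c * d) (\<psi> \<circ> \<phi>) X \<omega> Z \<zeta>"
proof -
 have Y: "Y = (`) \<phi> ` X" using assms(1) by (simp add: oiso_def)
 have "inj_on (\<psi> \<circ> \<phi>) (\<Union>X)"
  using assms unfolding oiso_def by (intro comp_inj_on) (auto simp: Union_image_image)
 moreover have "(\<lambda>s. (\<psi> \<circ> \<phi>) ` s) ` X = Z"
  using assms(2) unfolding Y oiso_def by (simp add: image_image image_comp)
 moreover have "\<zeta> (map (\<psi> \<circ> \<phi>) vs) = c * d * \<omega> vs" if "set vs \<in> X" for vs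
 proof -
  have "set (map \<phi> vs) \<in> Y" using that Y by auto
  then have "\<zeta> (map \<psi> (map \<phi> vs)) = d * \<eta> (map \<phi> vs)" using assms(2) unfolding oiso_def by blast
  then show ?thesis using assms(1) that by (simp add: oiso_def)
 qed
 ultimately show ?thesis unfolding oiso_def by blast
qed

lemma oiso_sym:
 assumes "oiso c \<phi> X \<omega> Y \<eta>" "c * c = 1"
 shows "oiso c (inv_into (\<Union>X) \<phi>) Y \<eta> X \<omega>"
proof -
 let ?\<psi> = "inv_into (\<Union>X) \<phi>"
 have inj: "inj_on \<phi> (\<Union>X)" and Y: "Y = (`) \<phi> ` X" using assms(1) by (auto simp: oiso_def)
 have "\<Union>Y = \<phi> ` \<Union>X" unfolding Y by (rule Union_image_image)
 then have "inj_on ?\<psi> (\<Union>Y)" by (simp add: inj_on_inv_into)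
 moreover have inv: "?\<psi> ` \<phi> ` s = s" if "s \<in> X" for s using inv_into_image_cancel[OF inj, of s] that by blast
 then have "(\<lambda>s. ?\<psi> ` s) ` Y = X" unfolding Y by (simp add: image_image)
 moreover have "\<omega> (map ?\<psi> ws) = c * \<eta> ws" if "set ws \<in> Y" for ws
 proof -
  obtain s where s: "s \<in> X" "set ws = \<phi> ` s" using \<open>set ws \<in> Y\<close> unfolding Y by blast
  have "\<phi> (?\<psi> w) = w" if "w \<in> set ws" for w
   using that s by (intro f_inv_into_f) blast
  then have "map \<phi> (map ?\<psi> ws) = ws" by (simp add: map_idI)
  moreover have "set (map ?\<psi> ws) \<in> X" using s inv by simp
  ultimately have "\<eta> ws = c * \<omega> (map ?\<psi> ws)" using assms(1) unfolding oiso_def by metis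
  then show ?thesis using assms(2) by (simp add: mult.assoc[symmetric])
 qed
 ultimately show ?thesis unfolding oiso_def by blast
qed

lemma oisoI_flags:
 assumes "inj_on \<phi> (\<Union>X)" "(`) \<phi> ` X = Y" and \<omega>: "ori k X \<omega>" and \<eta>: "ori k Y \<eta>"
  and R: "\<And>s. s \<in> X ==> card s = k ==> \<exists>r. distinct r \<and> set r = s \<and> \<eta> (map \<phi> r) = c * \<omega> r"
 shows "oiso c \<phi> X \<omega> Y \<eta>"
 unfolding oiso_def
proof (intro conjI allI impI)
 note o = oriD[OF \<omega>] and e = oriD[OF \<eta>]
 fix vs assume vs: "set vs \<in> X"
 have ordY: "oface k X vs" if "oface k Y (map \<phi> vs)"
  using that vs by (auto simp: oface_def distinct_map)
 show "\<eta> (map \<phi> vs) = c * \<omega> vs"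
 proof (cases "oface k X vs")
  case True
  then have "card (set vs) = k" by (auto simp: oface_def distinct_card)
  then obtain r where r: "distinct r" "set r = set vs" "\<eta> (map \<phi> r) = c * \<omega> r" using R[OF vs] by blast
  have "oface k X r"
   using True r by (auto simp: oface_def) (metis distinct_card)
  then show ?thesis
   by (intro ori_agree[OF o(3) alternating_map[OF e(3)] o(5) r(3) oface_mset[OF True r(1,2)] o(5)[OF True]])
 next
  case False
  then have "\<not> oface k Y (map \<phi> vs)" using ordY by blast
  then show ?thesis using o(2)[OF False] e(2) by simp
 qed
qed (use assms in auto)

definition transfer_ori :: "('a => 'b) => 'a set set => ('a list => int) => 'b list => int" where
 "transfer_ori \<phi> X \<omega> ws = (if set ws \<subseteq> \<phi> ` \<Union>X then \<omega> (map (inv_into (\<Union>X) \<phi>) ws) else 0)"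

lemma transfer_ori:
 assumes inj: "inj_on \<phi> (\<Union>X)" and \<omega>: "ori k X \<omega>"
 shows "ori k ((`) \<phi> ` X) (transfer_ori \<phi> X \<omega>)" "oiso 1 \<phi> X \<omega> ((`) \<phi> ` X) (transfer_ori \<phi> X \<omega>)"
proof -
 let ?\<psi> = "inv_into (\<Union>X) \<phi>" and ?Y = "(`) \<phi> ` X"
 note o = oriD[OF \<omega>]
 have inv: "?\<psi> ` \<phi> ` s = s" if "s \<in> X" for s using inv_into_image_cancel[OF inj, of s] that by blast
 have ip: "inj_on ?\<psi> (\<phi> ` \<Union>X)" by (simp add: inj_on_inv_into)
 have of: "oface k ?Y ws \<longleftrightarrow> oface k X (map ?\<psi> ws)" if ws: "set ws \<subseteq> \<phi> ` \<Union>X" for ws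
 proof -
  have "set ws \<in> ?Y \<longleftrightarrow> ?\<psi> ` set ws \<in> X"
  proof
   assume "?\<psi> ` set ws \<in> X"
   moreover have "\<phi> ` ?\<psi> ` set ws = set ws" using ws by (rule image_inv_into_cancel[OF refl])
   ultimately show "set ws \<in> ?Y" by (metis image_eqI)
  qed (use inv in auto)
  then show ?thesis using inj_on_subset[OF ip ws] by (simp add: oface_def distinct_map)
 qed
 have nof: "\<not> oface k ?Y ws" if "\<not> set ws \<subseteq> \<phi> ` \<Union>X" for ws
  using that unfolding oface_def by blast
 show "ori k ?Y (transfer_ori \<phi> X \<omega>)"
  unfolding ori_def
 proof (intro conjI allI impI)
  show "if oface k ?Y ws then transfer_ori \<phi> X \<omega> ws \<in> {1, -1} else transfer_ori \<phi> X \<omega> ws = 0" for ws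
   using of[of ws] nof[of ws] o(1,2)[of "map ?\<psi> ws"] by (auto simp: transfer_ori_def)
  show "alternating (transfer_ori \<phi> X \<omega>)"
  proof (rule alternatingI)
   fix us a b vs
   show "transfer_ori \<phi> X \<omega> (us @ b # a # vs) = - transfer_ori \<phi> X \<omega> (us @ a # b # vs)"
    using alternatingD[OF o(3), of "map ?\<psi> us" "?\<psi> b" "?\<psi> a" "map ?\<psi> vs"]
    by (auto simp: transfer_ori_def)
  qed
  show "transfer_ori \<phi> X \<omega> (b # ws) = - transfer_ori \<phi> X \<omega> (a # ws)"
   if ab: "a \<noteq> b \<and> oface k ?Y (a # ws) \<and> oface k ?Y (b # ws)" for a b ws
  proof -
   have sub: "set (a # ws) \<subseteq> \<phi> ` \<Union>X" "set (b # ws) \<subseteq> \<phi> ` \<Union>X" using ab nof by blast+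
   then have "?\<psi> a \<noteq> ?\<psi> b" using ab ip by (auto dest: inj_onD)
   moreover have "oface k X (?\<psi> a # map ?\<psi> ws)" "oface k X (?\<psi> b # map ?\<psi> ws)"
    using of[OF sub(1)] of[OF sub(2)] ab by auto
   ultimately show ?thesis using o(4) sub by (simp add: transfer_ori_def)
  qed
 qed
 show "oiso 1 \<phi> X \<omega> ?Y (transfer_ori \<phi> X \<omega>)"
  unfolding oiso_def
 proof (intro conjI allI impI)
  fix vs assume vs: "set vs \<in> X"
  then have "map ?\<psi> (map \<phi> vs) = vs" using inj by (auto simp: intro!: map_idI inv_into_f_f)
  moreover have "set (map \<phi> vs) \<subseteq> \<phi> ` \<Union>X" using vs by auto
  ultimately show "transfer_ori \<phi> X \<omega> (map \<phi> vs) = 1 * \<omega> vs" by (simp add: transfer_ori_def del: map_map)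
 qed (use inj in auto)
qed

text \<open>
 A function \<open>f\<close> on isomorphism classes is evaluated at a complex with arbitrary vertices by numbering
 the vertices. The choice of the numbering is immaterial (\<open>at_cpx_oiso\<close>).
\<close>

definition numbering :: "'a set set => 'a => nat" where
 "numbering X = (SOME \<phi>. inj_on \<phi> (\<Union>X))"

lemma numbering: "cpx X ==> inj_on (numbering X) (\<Union>X)"
 unfolding numbering_def using finite_imp_inj_to_nat_seg[OF cpxD(5)] by (metis (mono_tags) someI_ex)

definition at_cpx :: "(oriented_cpx set => 'g) => nat => 'a set set => ('a list => int) => 'g" where
 "at_cpx f k X \<omega> = f (iso_class (int k - 1) ((`) (numbering X) ` X, transfer_ori (numbering X) X \<omega>))"

lemma iso_class_eq_of_oiso:
 assumes "oiso 1 \<phi> X \<omega> Y \<eta>" "cpx X" "ori k X \<omega>" "cpx Y" "ori k Y \<eta>"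
 shows "iso_class (int k - 1) (X, \<omega>) = iso_class (int k - 1) (Y, \<eta>)"
proof -
 have v: "verts X = \<Union>X" if "cpx X" for X :: "nat set set" using cpxD(4,6)[OF that] by (auto simp: verts_def)
 have "((X, \<omega>), (Y, \<eta>)) \<in> oriented_iso (int k - 1)"
  by (rule oriented_isoI[where \<phi> = \<phi>])
    (use assms in \<open>auto simp: simplicial_cpx_eq_cpx is_orientation_iff_ori v oiso_def\<close>)
 then show ?thesis unfolding iso_class_def by (rule equiv_class_eq[OF equiv_oriented_iso])
qed

lemma at_cpx_oiso:
 assumes "oiso 1 \<phi> X \<omega> Y \<eta>" "cpx X" "ori k X \<omega>" "cpx Y" "ori k Y \<eta>"
 shows "at_cpx f k X \<omega> = at_cpx f k Y \<eta>"
proof -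
 note tX = transfer_ori[OF numbering[OF assms(2)] assms(3)] and tY = transfer_ori[OF numbering[OF assms(4)] assms(5)]
 have "\<exists>\<psi>. oiso 1 \<psi> ((`) (numbering X) ` X) (transfer_ori (numbering X) X \<omega>)
   ((`) (numbering Y) ` Y) (transfer_ori (numbering Y) Y \<eta>)"
  using oiso_comp[OF oiso_comp[OF oiso_sym[OF tX(2)] assms(1)] tY(2)] by auto
 then show ?thesis
  unfolding at_cpx_def using iso_class_eq_of_oiso cpx_image assms(2,4) tX(1) tY(1) by metis
qed

lemma at_cpx_nat:
 assumes "cpx X" "ori k X \<omega>"
 shows "at_cpx f k X \<omega> = f (iso_class (int k - 1) (X, \<omega>))"
 using iso_class_eq_of_oiso[OF transfer_ori(2)[OF numbering[OF assms(1)] assms(2)] assms(1,2)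
   cpx_image[OF assms(1)] transfer_ori(1)[OF numbering[OF assms(1)] assms(2)]]
 by (simp add: at_cpx_def)

definition opp :: "('a list => int) => 'a list => int" where
 "opp \<omega> vs = - \<omega> vs"

lemma ori_opp: "ori k X \<omega> ==> ori k X (opp \<omega>)"
proof -
 assume o: "ori k X \<omega>"
 have "alternating (opp \<omega>)"
  by (rule alternatingI) (simp add: opp_def alternatingD[OF oriD(3)[OF o], symmetric])
 then show ?thesis using oriD(1,2,4)[OF o] unfolding ori_def by (auto simp: opp_def)
qed

lemma sphere_iff: "(L, \<omega>) \<in> oriented_spheres (int k - 1) \<longleftrightarrow> sph k L \<and> ori k L \<omega>"
 by (simp add: oriented_spheres_def pl_sphere_iff_sph is_orientation_iff_ori)

lemma at_cpx_opp:
 assumes f: "f \<in> sphere_cochains (int k)" and X: "sph k X" "ori k X \<omega>"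
 shows "at_cpx f k X (opp \<omega>) = - at_cpx f k X \<omega>"
proof -
 note t = transfer_ori[OF numbering[OF sph_cpx[OF X(1)]] X(2)]
 have "((`) (numbering X) ` X, transfer_ori (numbering X) X \<omega>) \<in> oriented_spheres (int k - 1)"
  unfolding sphere_iff using t(1) sph_iso[OF X(1) numbering[OF sph_cpx[OF X(1)]]] by blast
 moreover have "transfer_ori (numbering X) X (opp \<omega>) = opposite (transfer_ori (numbering X) X \<omega>)"
  by (rule ext) (simp add: transfer_ori_def opp_def opposite_def)
 ultimately show ?thesis using f unfolding sphere_cochains_def at_cpx_def by auto
qed

lemma oiso_opp: "oiso (-1) \<phi> X \<omega> Y \<eta> ==> oiso 1 \<phi> X (opp \<omega>) Y \<eta>"
 by (simp add: oiso_def opp_def)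

lemma at_cpx_oiso_neg:
 assumes f: "f \<in> sphere_cochains (int k)" and "oiso (-1) \<phi> X \<omega> Y \<eta>" "sph k X" "ori k X \<omega>" "cpx Y" "ori k Y \<eta>"
 shows "at_cpx f k Y \<eta> = - at_cpx f k X \<omega>"
 using at_cpx_oiso[OF oiso_opp[OF assms(2)] sph_cpx[OF assms(3)] ori_opp[OF assms(4)] assms(5,6), of f]
  at_cpx_opp[OF f assms(3,4)] by simp

text \<open>
 This removes the unwanted vertices from all sums over the vertices of a manifold: only those
 without an orientation-reversing symmetry of the link remain.
\<close>

lemma at_cpx_reflection:
 fixes f :: "oriented_cpx set => rat"
 assumes f: "f \<in> sphere_cochains (int k)" and "oiso (-1) \<phi> X \<omega> X \<omega>" "sph k X" "ori k X \<omega>"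
 shows "at_cpx f k X \<omega> = 0"
 using at_cpx_oiso_neg[OF f assms(2-4) sph_cpx[OF assms(3)] assms(4)] by simp

text \<open>
 Links of larger simplices are iterated links, so it suffices to require that vertex links
 are spheres.
\<close>

definition omfd :: "nat => 'a set set => ('a list => int) => bool" where
 "omfd n X \<omega> \<longleftrightarrow> cpx X \<and> ori (Suc n) X \<omega> \<and> (\<forall>v\<in>\<Union>X. sph n (lk X v))"

text \<open>What the proof uses of the hypothesis on \<open>f\<close>.\<close>

definition kills_manifolds :: "nat => (oriented_cpx set => rat) => bool" where
 "kills_manifolds n f \<longleftrightarrow>
   (\<forall>K \<omega>. omfd n (K :: nat set set) \<omega> --> (\<Sum>v\<in>\<Union>K. at_cpx f n (lk K v) (ind v \<omega>)) = 0)"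

lemma oiso_lk:
 assumes i: "oiso c \<phi> X \<omega> Y \<eta>" and X: "cpx X" and v: "v \<in> \<Union>X"
 shows "oiso c \<phi> (lk X v) (ind v \<omega>) (lk Y (\<phi> v)) (ind (\<phi> v) \<eta>)"
proof -
 have inj: "inj_on \<phi> (\<Union>X)" and Y: "Y = (`) \<phi> ` X" using i by (auto simp: oiso_def)
 have sub: "\<Union>(lk X v) \<subseteq> \<Union>X" by (auto simp: lk_def)
 have "(`) \<phi> ` lk X v = lk Y (\<phi> v)"
 proof (intro equalityI subsetI)
  fix t assume "t \<in> (`) \<phi> ` lk X v"
  then obtain s where s: "v \<notin> s" "insert v s \<in> X" "t = \<phi> ` s" by (auto simp: lk_def)
  have "\<phi> v \<notin> \<phi> ` s" using inj s v by (metis Union_upper inj_on_image_mem_iff insert_subset)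
  moreover have "insert (\<phi> v) t \<in> Y" using s unfolding Y by (metis image_eqI image_insert)
  ultimately show "t \<in> lk Y (\<phi> v)" using s by (simp add: lk_def)
 next
  fix t assume "t \<in> lk Y (\<phi> v)"
  then obtain u where u: "u \<in> X" "insert (\<phi> v) t = \<phi> ` u" "\<phi> v \<notin> t" unfolding lk_def Y by auto
  have vu: "v \<in> u" using u(1,2) inj v by (metis Union_upper inj_on_image_mem_iff insertI1)
  have "t = \<phi> ` (u - {v})"
  proof -
   have "\<phi> ` (u - {v}) = \<phi> ` u - {\<phi> v}"
    using inj u(1) vu by (subst inj_on_image_set_diff[of \<phi> u]) (auto intro: inj_on_subset)
   then show ?thesis using u by auto
  qed
  moreover have "u - {v} \<in> lk X v" using u(1) vu by (simp add: lk_def insert_absorb)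
  ultimately show "t \<in> (`) \<phi> ` lk X v" by blast
 qed
 moreover have "inj_on \<phi> (\<Union>(lk X v))" using inj sub by (rule inj_on_subset)
 moreover have "ind (\<phi> v) \<eta> (map \<phi> vs) = c * ind v \<omega> vs" if "set vs \<in> lk X v" for vs
 proof -
  have "set (v # vs) \<in> X" using that by (simp add: lk_def)
  then have "\<eta> (map \<phi> (v # vs)) = c * \<omega> (v # vs)" using i unfolding oiso_def by blast
  then show ?thesis by (simp add: ind_def)
 qed
 ultimately show ?thesis unfolding oiso_def by blast
qed

lemma sph_oiso: "oiso c \<phi> X \<omega> Y \<eta> ==> sph k X ==> sph k Y"
 unfolding oiso_def using sph_iso by blast

lemma kills_manifolds_generic:
 fixes X :: "'a set set"
 assumes f: "kills_manifolds n f" and X: "omfd n X \<omega>"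
 shows "(\<Sum>v\<in>\<Union>X. at_cpx f n (lk X v) (ind v \<omega>)) = 0"
proof -
 have c: "cpx X" and o: "ori (Suc n) X \<omega>" and l: "\<And>v. v \<in> \<Union>X ==> sph n (lk X v)"
  using X by (auto simp: omfd_def)
 let ?\<phi> = "numbering X" let ?Y = "(\<lambda>s. ?\<phi> ` s) ` X" let ?\<eta> = "transfer_ori ?\<phi> X \<omega>"
 note t = transfer_ori[OF numbering[OF c] o]
 note lki = oiso_lk[OF t(2) c]
 have "omfd n ?Y ?\<eta>"
  unfolding omfd_def using cpx_image[OF c] t(1) sph_oiso[OF lki l] by (auto simp: Union_image_image)
 then have "(\<Sum>v\<in>\<Union>?Y. at_cpx f n (lk ?Y v) (ind v ?\<eta>)) = 0" using f unfolding kills_manifolds_def by blast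
 moreover have "(\<Sum>v\<in>\<Union>?Y. at_cpx f n (lk ?Y v) (ind v ?\<eta>)) = (\<Sum>v\<in>\<Union>X. at_cpx f n (lk ?Y (?\<phi> v)) (ind (?\<phi> v) ?\<eta>))"
  unfolding Union_image_image using numbering[OF c] by (simp add: sum.reindex)
 moreover have "\<dots> = (\<Sum>v\<in>\<Union>X. at_cpx f n (lk X v) (ind v \<omega>))"
 proof (rule sum.cong[OF refl])
  fix v assume v: "v \<in> \<Union>X"
  show "at_cpx f n (lk ?Y (?\<phi> v)) (ind (?\<phi> v) ?\<eta>) = at_cpx f n (lk X v) (ind v \<omega>)"
   by (rule at_cpx_oiso[OF lki[OF v] sph_cpx[OF l[OF v]] ori_lk[OF o]
     sph_cpx[OF sph_oiso[OF lki[OF v] l[OF v]]] ori_lk[OF t(1)], symmetric])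
 qed
 ultimately show ?thesis by simp
qed

lemma combinatorial_manifold_of_links:
 assumes c: "cpx K" and l: "\<And>v. v \<in> \<Union>K ==> sph n (lk K v)"
 shows "combinatorial_manifold (int n) K"
 unfolding combinatorial_manifold_def
proof (intro conjI ballI impI)
 show "simplicial_cpx K" using c by (simp add: simplicial_cpx_eq_cpx)
 fix s assume s: "s \<in> K" "s \<noteq> {}"
 then obtain v where v: "v \<in> s" by blast
 define t where "t = s - {v}"
 have st: "s = insert v t" "v \<notin> t" using v by (auto simp: t_def)
 have fs: "finite t" using cpxD(3)[OF c s(1)] by (simp add: t_def)
 have "t \<in> lk K v" using s st by (simp add: lk_def)
 then have *: "card t \<le> n" "sph (n - card t) (lks (lk K v) t)" using sph_lks[OF l] s(1) v by blast+
 have "link K s = lks K s" using cpxD(4)[OF c] by (auto simp: link_def lks_def)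
 then have "link K s = lks (lk K v) t" using lks_insert'[OF st(2)] st(1) by simp
 moreover have "sdim s = int (card t)" using st fs by (simp add: sdim_def)
 ultimately show "pl_sphere (int n - sdim s - 1) (link K s)"
  unfolding pl_sphere_iff_sph using * by (simp add: nat_diff_distrib of_nat_diff)
qed

text \<open>
 Each edge \<open>v w\<close> occurs twice in the sum, and the orientations of its link
 induced by way of \<open>v\<close> and of \<open>w\<close> are opposite.
\<close>

lemma double_link_sum_zero:
 fixes h :: "'a set => ('a list => int) => rat"
 assumes c: "cpx K" and \<omega>: "ori (Suc n) K \<omega>" and n: "n \<ge> 1"
  and h: "\<And>v w. v \<noteq> w ==> {v, w} \<in> K ==> h {v, w} (ind w (ind v (opp \<omega>))) = - h {v, w} (ind w (ind v \<omega>))"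
 shows "(\<Sum>v\<in>\<Union>K. \<Sum>w\<in>\<Union>(lk K v). h {v, w} (ind w (ind v \<omega>))) = 0"
proof -
 have fin: "finite (\<Union>K)" using cpxD(5)[OF c] .
 define E where "E = {(v, w). v \<noteq> w \<and> {v, w} \<in> K}"
 have lkv: "\<Union>(lk K v) = {w. (v, w) \<in> E}" if "v \<in> \<Union>K" for v
 proof (intro equalityI subsetI)
  fix w assume "w \<in> \<Union>(lk K v)"
  then obtain t where "v \<notin> t" "insert v t \<in> K" "w \<in> t" by (auto simp: lk_def)
  then show "w \<in> {w. (v, w) \<in> E}" using cpxD(4)[OF c, of "insert v t" "{v, w}"] by (auto simp: E_def)
 next
  fix w assume "w \<in> {w. (v, w) \<in> E}"
  then have "{w} \<in> lk K v" by (auto simp: E_def lk_def)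
  then show "w \<in> \<Union>(lk K v)" by blast
 qed
 have fE: "finite E" by (rule finite_subset[of _ "\<Union>K \<times> \<Union>K"]) (use fin in \<open>auto simp: E_def\<close>)
 have "E = Sigma (\<Union>K) (\<lambda>v. {w. (v, w) \<in> E})" by (auto simp: E_def)
 moreover have "finite {w. (v, w) \<in> E}" for v
  by (rule finite_subset[of _ "snd ` E"]) (use fE in \<open>force+\<close>)
 ultimately have "(\<Sum>v\<in>\<Union>K. \<Sum>w\<in>\<Union>(lk K v). h {v, w} (ind w (ind v \<omega>))) = (\<Sum>(v, w)\<in>E. h {v, w} (ind w (ind v \<omega>)))"
  using fin sum.Sigma[of "\<Union>K" "\<lambda>v. {w. (v, w) \<in> E}" "\<lambda>v w. h {v, w} (ind w (ind v \<omega>))"]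
   sum.cong[OF refl, of "\<Union>K" "\<lambda>v. \<Sum>w\<in>\<Union>(lk K v). h {v, w} (ind w (ind v \<omega>))"
    "\<lambda>v. \<Sum>w\<in>{w. (v, w) \<in> E}. h {v, w} (ind w (ind v \<omega>))"] lkv by simp
 also have "\<dots> = (\<Sum>(v, w)\<in>E. h {w, v} (ind v (ind w \<omega>)))"
  by (rule sum.reindex_bij_witness[of _ prod.swap prod.swap]) (auto simp: E_def insert_commute)
 also have "\<dots> = (\<Sum>(v, w)\<in>E. - h {v, w} (ind w (ind v \<omega>)))"
 proof (rule sum.cong[OF refl], clarify)
  fix v w assume vw: "(v, w) \<in> E"
  have "ind v (ind w \<omega>) = ind w (ind v (opp \<omega>))"
  proof
   fix xs show "ind v (ind w \<omega>) xs = ind w (ind v (opp \<omega>)) xs"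
    using alternatingD[OF oriD(3)[OF \<omega>], of "[]" w v xs] by (simp add: ind_def opp_def)
  qed
  then show "h {w, v} (ind v (ind w \<omega>)) = - h {v, w} (ind w (ind v \<omega>))"
   using h vw by (simp add: E_def insert_commute)
 qed
 also have "\<dots> = - (\<Sum>(v, w)\<in>E. h {v, w} (ind w (ind v \<omega>)))" by (simp add: sum_negf case_prod_unfold)
 finally show ?thesis
  using \<open>(\<Sum>v\<in>\<Union>K. \<Sum>w\<in>\<Union>(lk K v). h {v, w} (ind w (ind v \<omega>))) = (\<Sum>(v, w)\<in>E. h {v, w} (ind w (ind v \<omega>)))\<close>
  by simp
qed

section \<open>Barycentric subdivision\<close>

definition nested :: "'a set set => bool" where
 "nested c \<longleftrightarrow> (\<forall>s\<in>c. \<forall>t\<in>c. s \<subseteq> t \<or> t \<subseteq> s)"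

lemma nested_subset: "nested c ==> d \<subseteq> c ==> nested d"
 unfolding nested_def by blast

definition sd :: "'a set set => 'a set set set" where
 "sd X = {c. c \<subseteq> X - {{}} \<and> nested c}"

definition small_dim :: "nat => 'a set set => bool" where
 "small_dim k X \<longleftrightarrow> (\<forall>s\<in>X. card s \<le> k)"

lemma sph_small_dim: "sph k X ==> small_dim k X"
 using sph_lks by (auto simp: small_dim_def)

lemma cpx_sd:
 assumes "cpx X"
 shows "cpx (sd X)"
 unfolding cpx_def
proof (intro conjI ballI allI impI)
 have "sd X \<subseteq> Pow X" by (auto simp: sd_def)
 then show "finite (sd X)" using cpxD(1)[OF assms] finite_subset by blast
 show "{} \<in> sd X" by (simp add: sd_def nested_def)
next
 fix c assume "c \<in> sd X" then show "finite c" using cpxD(1)[OF assms] finite_subset[of c X] by (auto simp: sd_def)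
next
 fix c d assume "c \<in> sd X" "d \<subseteq> c"
 then show "d \<in> sd X" using nested_subset by (auto simp: sd_def)
qed

lemma Union_sd: "\<Union>(sd X) = X - {{}}"
proof (intro equalityI subsetI)
 fix s assume "s \<in> X - {{}}"
 then have "{s} \<in> sd X" by (simp add: sd_def nested_def)
 then show "s \<in> \<Union>(sd X)" by blast
qed (auto simp: sd_def)

lemma nested_card_inj:
 assumes "nested c" "\<And>s. s \<in> c ==> finite s"
 shows "inj_on card c"
proof (rule inj_onI)
 fix s t assume "s \<in> c" "t \<in> c" "card s = card t"
 moreover have "s \<subseteq> t \<or> t \<subseteq> s" using assms(1) calculation by (simp add: nested_def)
 ultimately show "s = t" using card_subset_eq[of t s] card_subset_eq[of s t] assms(2) by auto
qed

lemma small_dim_sd: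
 assumes "cpx X" "small_dim k X"
 shows "small_dim k (sd X)"
 unfolding small_dim_def
proof
 fix c assume c: "c \<in> sd X"
 have fin: "finite s" if "s \<in> c" for s using c that cpxD(3)[OF assms(1)] by (auto simp: sd_def)
 have "card ` c \<subseteq> {1..k}"
 proof
  fix j assume "j \<in> card ` c"
  then obtain s where s: "s \<in> c" "j = card s" by blast
  then have "s \<noteq> {}" "card s \<le> k" using c assms(2) by (auto simp: sd_def small_dim_def)
  then show "j \<in> {1..k}" using s fin by (simp add: Suc_le_eq card_gt_0_iff)
 qed
 moreover have "inj_on card c" using c fin by (intro nested_card_inj) (auto simp: sd_def)
 ultimately show "card c \<le> k" using card_inj_on_le[of card c "{1..k}"] by simp
qed

text \<open>
 The ordered facet of the barycentric subdivision whose members arise by adding the vertices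
 one at a time.
\<close>

definition flag :: "'a list => 'a set list" where
 "flag vs = map (\<lambda>i. set (take (Suc i) vs)) [0..<length vs]"

lemma flag_simps [simp]: "flag [] = []" "flag (vs @ [v]) = flag vs @ [set (vs @ [v])]"
 by (simp_all add: flag_def)

lemma length_flag [simp]: "length (flag vs) = length vs"
 by (simp add: flag_def)

lemma nth_flag: "i < length vs ==> flag vs ! i = set (take (Suc i) vs)"
 by (simp add: flag_def)

lemma set_flag: "set (flag vs) = {set (take (Suc i) vs) |i. i < length vs}"
 by (auto simp: flag_def)

lemma card_nth_flag: "distinct vs ==> i < length vs ==> card (flag vs ! i) = Suc i"
 by (simp add: nth_flag distinct_card)

lemma distinct_flag:
 assumes "distinct vs"
 shows "distinct (flag vs)"
 unfolding distinct_conv_nth[of "flag vs"] length_flag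
proof (intro allI impI)
 fix i j assume "i < length vs" "j < length vs" "i \<noteq> j"
 then have "card (flag vs ! i) \<noteq> card (flag vs ! j)" by (simp add: card_nth_flag[OF assms])
 then show "flag vs ! i \<noteq> flag vs ! j" by metis
qed

lemma nested_flag: "nested (set (flag vs))"
proof -
 have "set (take i vs) \<subseteq> set (take j vs) \<or> set (take j vs) \<subseteq> set (take i vs)" for i j
  using set_take_subset_set_take[of i j vs] set_take_subset_set_take[of j i vs] by linarith
 then show ?thesis unfolding nested_def set_flag by blast
qed

lemma flag_ne: "{} \<notin> set (flag vs)"
 by (auto simp: set_flag)

lemma flag_map: "flag (map f vs) = map (\<lambda>s. f ` s) (flag vs)"
 by (simp add: flag_def take_map)

lemma eq_if_takes_eq:
 assumes "distinct vs" "distinct ws" "length vs = length ws"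
  and "\<And>j. j \<le> length vs ==> set (take j vs) = set (take j ws)"
 shows "vs = ws"
proof -
 have "take j vs = take j ws" if "j \<le> length vs" for j
  using that
 proof (induction j)
  case (Suc j)
  then have j: "j < length vs" "j < length ws" using assms(3) by auto
  have "set (take (Suc j) vs) - set (take j vs) = {vs ! j}" "set (take (Suc j) ws) - set (take j ws) = {ws ! j}"
   using j assms(1,2) by (auto simp: take_Suc_conv_app_nth set_take_disj_set_drop_if_distinct
     in_set_conv_nth nth_eq_iff_index_eq)
  then have "vs ! j = ws ! j" using assms(4)[of j] assms(4)[OF Suc.prems] j by auto
  then show ?case using Suc j by (simp add: take_Suc_conv_app_nth)
 qed simp
 from this[of "length vs"] show ?thesis using assms(3) by simp
qed

lemma flag_nth_unique:
 assumes "distinct ws" "s \<in> set (flag ws)"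
 shows "card s - 1 < length ws" "s = flag ws ! (card s - 1)" "card s > 0"
 using assms card_nth_flag[OF assms(1)] by (auto simp: in_set_conv_nth)

lemma flag_inj:
 assumes "distinct vs" "distinct ws" "set (flag vs) = set (flag ws)"
 shows "vs = ws"
proof (rule eq_if_takes_eq[OF assms(1,2)])
 show l: "length vs = length ws"
  using distinct_card[OF distinct_flag[OF assms(1)]] distinct_card[OF distinct_flag[OF assms(2)]] assms(3) by simp
 show "set (take j vs) = set (take j ws)" if "j \<le> length vs" for j
 proof (cases j)
  case (Suc i)
  then have i: "i < length vs" using that by simp
  then have "flag vs ! i \<in> set (flag ws)" using assms(3) by (metis length_flag nth_mem)
  then have "flag vs ! i = flag ws ! i" using flag_nth_unique(2)[OF assms(2)] card_nth_flag[OF assms(1) i] by (metis diff_Suc_1)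
  then show ?thesis using Suc i l by (simp add: nth_flag)
 qed simp
qed

lemma flag_exists:
 assumes "nested c" "{} \<notin> c" "\<And>s. s \<in> c ==> finite s" "finite c" "card c = k" "\<And>s. s \<in> c ==> card s \<le> k"
 shows "\<exists>vs. distinct vs \<and> length vs = k \<and> set (flag vs) = c"
 using assms
proof (induction k arbitrary: c)
 case 0
 then show ?case by (intro exI[of _ "[]"]) simp
next
 case (Suc k)
 have "c \<noteq> {}" using Suc.prems(5) by auto
 then have "Max (card ` c) \<in> card ` c" using Suc.prems(4) by (intro Max_in) auto
 then obtain s where s: "s \<in> c" "Max (card ` c) = card s" by auto
 have le: "card t \<le> card s" if "t \<in> c" for t unfolding s(2)[symmetric] using that Suc.prems(4) by simp
 have sub: "t \<subset> s" if t: "t \<in> c - {s}" for t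
 proof -
  have "t \<subseteq> s \<or> s \<subseteq> t" using Suc.prems(1) s t by (auto simp: nested_def)
  moreover have "\<not> s \<subset> t" using psubset_card_mono[of t s] Suc.prems(3) t le[of t] by auto
  ultimately show ?thesis using t by blast
 qed
 have lt: "card t \<le> k" if "t \<in> c - {s}" for t
  using psubset_card_mono[OF Suc.prems(3)[OF s(1)] sub[OF that]] Suc.prems(6)[OF s(1)] by simp
 have "\<exists>vs. distinct vs \<and> length vs = k \<and> set (flag vs) = c - {s}"
  using Suc.prems s lt nested_subset[OF Suc.prems(1), of "c - {s}"] by (intro Suc.IH) auto
 then obtain vs where vs: "distinct vs" "length vs = k" "set (flag vs) = c - {s}" by blast
 have vss: "set vs \<subset> s"
 proof (cases "k = 0")
  case True then show ?thesis using vs s Suc.prems(2) by auto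
 next
  case False
  then have "set vs \<in> set (flag vs)" unfolding set_flag using vs(2) by (auto intro!: exI[of _ "k - 1"])
  then show ?thesis using sub vs(3) by blast
 qed
 have "card (set vs) = k" using vs distinct_card by metis
 then have "card (s - set vs) = 1"
  using Suc.prems(6)[OF s(1)] psubset_card_mono[OF Suc.prems(3)[OF s(1)] vss] vss
  by (subst card_Diff_subset) auto
 then obtain v where "s - set vs = {v}" by (auto simp: card_1_singleton_iff)
 then have v: "s = insert v (set vs)" "v \<notin> set vs" using vss by auto
 have "set (flag (vs @ [v])) = c" using v vs(3) s(1) by auto
 then show ?case using vs v by (intro exI[of _ "vs @ [v]"]) auto
qed

lemma sd_facet_flag:
 assumes X: "cpx X" "small_dim k X" and c: "c \<in> sd X" "card c = k" and k: "k > 0"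
 shows "\<exists>vs. oface k X vs \<and> set (flag vs) = c"
proof -
 have "\<exists>vs. distinct vs \<and> length vs = k \<and> set (flag vs) = c"
  using c X cpxD(1,3)[OF X(1)] finite_subset[of c X] by (intro flag_exists) (auto simp: sd_def small_dim_def)
 then obtain vs where vs: "distinct vs" "length vs = k" "set (flag vs) = c" by blast
 have "set vs \<in> set (flag vs)" unfolding set_flag using vs(2) k by (auto intro!: exI[of _ "k - 1"])
 then have "oface k X vs" using vs c by (auto simp: oface_def sd_def)
 then show ?thesis using vs by blast
qed

lemma flag_in_sd: "cpx X ==> set vs \<in> X ==> set (flag vs) \<in> sd X"
proof -
 assume X: "cpx X" "set vs \<in> X"
 have "set (flag vs) \<subseteq> X"
  unfolding set_flag using cpxD(4)[OF X] set_take_subset[of _ vs] by blast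
 then show ?thesis using nested_flag[of vs] flag_ne[of vs] by (auto simp: sd_def)
qed

lemma oface_flag: "cpx X ==> oface k X vs ==> oface k (sd X) (flag vs)"
 by (simp add: oface_def distinct_flag flag_in_sd)

definition exchange :: "'a => 'a => 'a => 'a" where
 "exchange a b x = (if x = a then b else if x = b then a else x)"

lemma exchange_simps [simp]: "exchange a b a = b" "exchange a b b = a" "exchange a b (exchange a b x) = x"
 by (auto simp: exchange_def)

lemma exchange_image:
 assumes "a \<in> s \<longleftrightarrow> b \<in> s"
 shows "exchange a b ` s = s"
proof (intro equalityI subsetI)
 have e: "exchange a b x \<in> s" if "x \<in> s" for x
  using that assms unfolding exchange_def by (metis (full_types))
 show "x \<in> s" if "x \<in> exchange a b ` s" for x using that e by (elim imageE) simp
 show "x \<in> exchange a b ` s" if "x \<in> s" for x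
  using imageI[OF e[OF that], of "exchange a b"] by simp
qed

lemma alternating_exchange:
 assumes F: "alternating F" and d: "distinct vs" and ab: "a \<in> set vs" "b \<in> set vs" "a \<noteq> b"
 shows "F (map (exchange a b) vs) = - F vs"
proof -
 let ?r = "remove1 b (remove1 a vs)" and ?G = "\<lambda>l. F (map (exchange a b) l)"
 have rm: "mset l = add_mset x (mset (remove1 x l))" if "x \<in> set l" for x and l :: "'a list" using that by simp
 have "mset vs = add_mset a (add_mset b (mset ?r))"
  using rm[OF ab(1)] rm[of b "remove1 a vs"] ab by (metis in_set_remove1)
 then have m: "mset vs = mset (a # b # ?r)" by simp
 have r: "map (exchange a b) ?r = ?r" using d by (intro map_idI) (auto simp: exchange_def)
 have G: "alternating ?G" by (rule alternating_map[OF F])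
 have "F vs * F vs = F (a # b # ?r) * F (a # b # ?r)" "F vs * ?G vs = F (a # b # ?r) * F (b # a # ?r)"
  "?G vs * ?G vs = F (b # a # ?r) * F (b # a # ?r)"
  using alternating_prod[OF F F m] alternating_prod[OF F G m] alternating_prod[OF G G m] r by simp_all
 moreover have "F (b # a # ?r) = - F (a # b # ?r)" using alternatingD[OF F, of "[]" b a ?r] by simp
 ultimately have "(F vs + ?G vs)\<^sup>2 = 0" by (simp add: power2_eq_square algebra_simps)
 then show ?thesis by simp
qed

text \<open>
 Suppose that the flags differ in their \<open>i\<close>-th members only, and let \<open>a\<close> and \<open>b\<close> be the vertices added in
 the two flags at this stage. If the flags have a larger member, then the two lists differ by the
 exchange of \<open>a\<close> and \<open>b\<close>, otherwise \<open>b\<close> replaces \<open>a\<close>; an orientation changes its sign in both cases.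
\<close>

lemma flag_flip:
 assumes \<omega>: "ori k X \<omega>" and o: "oface k X vs" "oface k X ws" and i: "i < k" and ne: "vs \<noteq> ws"
  and eq: "\<And>j. j < k ==> j \<noteq> i ==> flag vs ! j = flag ws ! j"
 shows "\<omega> ws = - \<omega> vs"
proof -
 have l: "distinct vs" "distinct ws" "length vs = k" "length ws = k" using o by (auto simp: oface_def)
 have eq': "set (take j vs) = set (take j ws)" if "j \<le> k" "j \<noteq> Suc i" for j
  using eq[of "j - 1"] that l by (cases j) (auto simp: nth_flag)
 have p: "take i vs = take i ws"
  by (rule eq_if_takes_eq) (use l i eq' in \<open>auto simp: min_def\<close>)
 define a b where "a = vs ! i" and "b = ws ! i"
 have t: "take (Suc i) vs = take i vs @ [a]" "take (Suc i) ws = take i vs @ [b]"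
  using l i p by (simp_all add: a_def b_def take_Suc_conv_app_nth)
 have "a \<noteq> b"
 proof
  assume "a = b"
  then have "set (take j vs) = set (take j ws)" if "j \<le> length vs" for j
   using t eq' that l by (cases "j = Suc i") auto
  then show False using eq_if_takes_eq[OF l(1,2)] l ne by simp
 qed
 show ?thesis
 proof (cases "Suc i = k")
  case True
  then have "ws = vs[i := b]" using t l i by (simp add: upd_conv_take_nth_drop)
  then show ?thesis using ori_replace[OF \<omega> o(1) _ i, of b] o(2) \<open>a \<noteq> b\<close> by (simp add: a_def)
 next
  case False
  have n: "a \<notin> set (take i vs)" "b \<notin> set (take i vs)"
   using distinct_take[OF l(1), of "Suc i"] distinct_take[OF l(2), of "Suc i"] unfolding t by auto
  have m: "a \<in> set (take j vs)" "b \<in> set (take j vs)" if "Suc i < j" "j \<le> k" for j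
   using t set_take_subset_set_take[of "Suc i" j vs] set_take_subset_set_take[of "Suc i" j ws] eq'[of j] that by auto
  have "map (exchange a b) vs = ws"
  proof (rule eq_if_takes_eq)
   have "inj (exchange a b)" by (metis exchange_simps(3) injI)
   then show "distinct (map (exchange a b) vs)" using l(1) by (auto simp: distinct_map intro: inj_on_subset)
   fix j assume "j \<le> length (map (exchange a b) vs)"
   then have j: "j \<le> k" using l by simp
   consider "j \<le> i" | "j = Suc i" | "Suc i < j" by linarith
   then show "set (take j (map (exchange a b) vs)) = set (take j ws)"
    unfolding take_map set_map
   proof cases
    case 1
    then have "a \<notin> set (take j vs)" "b \<notin> set (take j vs)" using n set_take_subset_set_take[of j i vs] by auto
    then show "exchange a b ` set (take j vs) = set (take j ws)" using eq'[OF j] 1 by (simp add: exchange_image)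
   next
    case 2
    then show "exchange a b ` set (take j vs) = set (take j ws)" using t n by (simp add: exchange_image)
   next
    case 3
    then show "exchange a b ` set (take j vs) = set (take j ws)" using eq'[OF j] m[OF _ j] by (simp add: exchange_image)
   qed
  qed (use l in auto)
  moreover have "a \<in> set vs" "b \<in> set vs" using m[of k] False i l by auto
  ultimately show ?thesis using alternating_exchange[OF oriD(3)[OF \<omega>] l(1) _ _ \<open>a \<noteq> b\<close>] by metis
 qed
qed

lemma flag_update:
 assumes d: "distinct vs" "distinct ws" "length vs = k" "length ws = k"
  and s: "set (flag vs) = insert a s" "set (flag ws) = insert b s" "a \<notin> s" "b \<notin> s"
 shows "\<exists>i<k. flag vs ! i = a \<and> (flag vs)[i := b] = flag ws \<and> (\<forall>j<k. j \<noteq> i --> flag vs ! j = flag ws ! j)"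
proof -
 obtain i where i: "i < k" "flag vs ! i = a" using s(1) d(3) by (metis insertI1 in_set_conv_nth length_flag)
 obtain i' where i': "i' < k" "flag ws ! i' = b" using s(2) d(4) by (metis insertI1 in_set_conv_nth length_flag)
 have same: "flag vs ! j = flag ws ! j" if "j < k" "j \<noteq> i" for j
 proof -
  have "flag vs ! j \<noteq> a" using that i d distinct_flag[OF d(1)] by (metis length_flag nth_eq_iff_index_eq)
  then have "flag vs ! j \<in> s" using s(1) that d by (metis insertE length_flag nth_mem)
  then have "flag vs ! j \<in> set (flag ws)" using s by blast
  then show ?thesis using flag_nth_unique(2)[OF d(2)] card_nth_flag[OF d(1), of j] that d by (metis diff_Suc_1)
 qed
 have "i' = i"
 proof (rule ccontr)
  assume "i' \<noteq> i"
  then have "flag vs ! i' = b" using same i' by simp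
  then have "b \<in> insert a s" using s(1) i' d by (metis length_flag nth_mem)
  then have "b = a" using s by simp
  then show False using \<open>flag vs ! i' = b\<close> i i' \<open>i' \<noteq> i\<close> distinct_flag[OF d(1)] d by (metis length_flag nth_eq_iff_index_eq)
 qed
 then have "(flag vs)[i := b] = flag ws"
  using i i' same d by (intro nth_equalityI) (auto simp: nth_list_update)
 then show ?thesis using i same by blast
qed

definition sdo :: "nat => 'a set set => ('a list => int) => 'a set list => int" where
 "sdo k X \<omega> = (SOME \<omega>'. ori k (sd X) \<omega>' \<and> (\<forall>vs. oface k X vs --> \<omega>' (flag vs) = \<omega> vs))"

text \<open>The signs prescribed for flags are consistent by \<open>flag_flip\<close>.\<close>

lemma sdo:
 assumes X: "cpx X" "small_dim k X" and \<omega>: "ori k X \<omega>" and k: "k > 0"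
 shows "ori k (sd X) (sdo k X \<omega>)" "oface k X vs ==> sdo k X \<omega> (flag vs) = \<omega> vs"
proof -
 define R where "R = (\<lambda>vs. (flag vs, \<omega> vs)) ` {vs. oface k X vs}"
 have "\<exists>\<omega>'. ori k (sd X) \<omega>' \<and> (\<forall>(r, e)\<in>R. \<omega>' r = e)"
 proof (rule exists_ori[OF cpx_sd[OF X(1)]])
  fix r e assume "(r, e) \<in> R"
  then show "oface k (sd X) r \<and> (e = 1 \<or> e = -1)"
   using oface_flag[OF X(1)] oriD(1)[OF \<omega>] by (auto simp: R_def)
 next
  fix c assume "c \<in> sd X" "card c = k"
  from sd_facet_flag[OF X this k] obtain vs where "oface k X vs" "set (flag vs) = c" by blast
  then show "\<exists>r e. (r, e) \<in> R \<and> set r = c" unfolding R_def by blast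
 next
  fix r e r' e' and F :: "'a set list => int" assume "(r, e) \<in> R" "(r', e') \<in> R" "set r = set r'"
  then show "e * F r = e' * F r'" using flag_inj by (auto simp: R_def oface_def)
 next
  fix a b s assume ab: "a \<noteq> b" "a \<notin> s" "b \<notin> s" "insert a s \<in> sd X" "insert b s \<in> sd X" "Suc (card s) = k"
  then have fs: "finite s" using cpxD(3)[OF cpx_sd[OF X(1)] ab(4)] by simp
  obtain vs where vs: "oface k X vs" "set (flag vs) = insert a s"
   using sd_facet_flag[OF X ab(4) _ k] ab fs by auto
  obtain ws where ws: "oface k X ws" "set (flag ws) = insert b s"
   using sd_facet_flag[OF X ab(5) _ k] ab fs by auto
  obtain i where i: "i < k" "flag vs ! i = a" "(flag vs)[i := b] = flag ws"
   "\<And>j. j < k ==> j \<noteq> i ==> flag vs ! j = flag ws ! j"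
   using flag_update[OF _ _ _ _ vs(2) ws(2) ab(2,3), of k] vs(1) ws(1) by (auto simp: oface_def)
  have "vs \<noteq> ws" using vs ws ab by auto
  then have "\<omega> ws = - \<omega> vs" using flag_flip[OF \<omega> vs(1) ws(1) i(1) _ i(4)] by blast
  then show "\<exists>r i e. (r, e) \<in> R \<and> i < k \<and> r ! i = a \<and> set r = insert a s \<and> (r[i := b], - e) \<in> R"
   using i vs ws by (intro exI[of _ "flag vs"] exI[of _ i] exI[of _ "\<omega> vs"]) (auto simp: R_def)
 qed
 then have "\<exists>\<omega>'. ori k (sd X) \<omega>' \<and> (\<forall>vs. oface k X vs --> \<omega>' (flag vs) = \<omega> vs)"
  by (auto simp: R_def)
 from someI_ex[OF this] show "ori k (sd X) (sdo k X \<omega>)"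
  "oface k X vs ==> sdo k X \<omega> (flag vs) = \<omega> vs" unfolding sdo_def by blast+
qed

lemma sdo_natural:
 assumes X: "cpx X" "small_dim k X" "ori k X \<omega>" and Y: "cpx Y" "small_dim k Y" "ori k Y \<eta>" and k: "k > 0"
  and \<phi>: "\<And>vs. oface k X vs ==> oface k Y (map \<phi> vs) \<and> \<eta> (map \<phi> vs) = c * \<omega> vs"
  and l: "oface k (sd X) l"
 shows "sdo k Y \<eta> (map (\<lambda>s. \<phi> ` s) l) = c * sdo k X \<omega> l"
proof -
 note oX = sdo[OF X k] and oY = sdo[OF Y k]
 have "set l \<in> sd X" "card (set l) = k" using l by (auto simp: oface_def distinct_card)
 then obtain vs where vs: "oface k X vs" "set (flag vs) = set l" using sd_facet_flag[OF X(1,2) _ _ k] by blast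
 have of: "oface k (sd X) (flag vs)" by (rule oface_flag[OF X(1) vs(1)])
 have "sdo k Y \<eta> (map (\<lambda>s. \<phi> ` s) (flag vs)) = c * sdo k X \<omega> (flag vs)"
  using \<phi>[OF vs(1)] oY(2)[of "map \<phi> vs"] oX(2)[OF vs(1)] by (simp add: flag_map)
 moreover have "distinct (flag vs)" using of by (simp add: oface_def)
 ultimately show ?thesis
  by (intro ori_agree[OF oriD(3)[OF oX(1)] alternating_map[OF oriD(3)[OF oY(1)]] oriD(5)[OF oX(1) of] _
     oface_mset[OF l _ vs(2)] oriD(5)[OF oX(1) l]])
qed

lemma sd_image:
 assumes inj: "inj_on \<phi> (\<Union>X)"
 shows "(\<lambda>c. (`) \<phi> ` c) ` sd X = sd ((`) \<phi> ` X)"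
proof (intro equalityI subsetI)
 fix d assume "d \<in> (\<lambda>c. (`) \<phi> ` c) ` sd X"
 then obtain c where c: "c \<in> sd X" "d = (`) \<phi> ` c" by blast
 have "nested d"
  unfolding nested_def c(2)
 proof (intro ballI)
  fix p q assume "p \<in> (`) \<phi> ` c" "q \<in> (`) \<phi> ` c"
  then obtain s t where "s \<in> c" "t \<in> c" "p = \<phi> ` s" "q = \<phi> ` t" by blast
  moreover from this have "s \<subseteq> t \<or> t \<subseteq> s" using c(1) by (auto simp: sd_def nested_def)
  ultimately show "p \<subseteq> q \<or> q \<subseteq> p" by (metis image_mono)
 qed
 moreover have "d \<subseteq> (`) \<phi> ` X - {{}}" using c by (auto simp: sd_def)
 ultimately show "d \<in> sd ((`) \<phi> ` X)" by (simp add: sd_def)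
next
 fix d assume d: "d \<in> sd ((`) \<phi> ` X)"
 define c where "c = {s \<in> X. \<phi> ` s \<in> d}"
 have dc: "d = (`) \<phi> ` c" using d by (auto simp: c_def sd_def)
 have "s \<subseteq> t \<or> t \<subseteq> s" if "s \<in> c" "t \<in> c" for s t
 proof -
  have "\<phi> ` s \<subseteq> \<phi> ` t \<or> \<phi> ` t \<subseteq> \<phi> ` s" using d that by (auto simp: sd_def nested_def c_def)
  moreover have "s \<subseteq> \<Union>X" "t \<subseteq> \<Union>X" using that by (auto simp: c_def)
  ultimately show ?thesis using inj inj_on_image_subset_iff by metis
 qed
 moreover have "{} \<notin> c" using d by (auto simp: c_def sd_def)
 ultimately have "c \<in> sd X" by (auto simp: sd_def nested_def c_def)
 then show "d \<in> (\<lambda>c. (`) \<phi> ` c) ` sd X" using dc by blast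
qed

lemma inj_on_image_sets: "inj_on \<phi> (\<Union>X) ==> inj_on (\<lambda>s. \<phi> ` s) X"
 by (meson inj_on_image)

lemma oiso_sd:
 assumes i: "oiso c \<phi> X \<omega> Y \<eta>" and X: "cpx X" "small_dim k X" "ori k X \<omega>" and Y: "cpx Y" "small_dim k Y" "ori k Y \<eta>"
  and k: "k > 0"
 shows "oiso c (\<lambda>s. \<phi> ` s) (sd X) (sdo k X \<omega>) (sd Y) (sdo k Y \<eta>)"
proof (rule oisoI_flags)
 have inj: "inj_on \<phi> (\<Union>X)" and YX: "Y = (`) \<phi> ` X" using i by (auto simp: oiso_def)
 show "inj_on (\<lambda>s. \<phi> ` s) (\<Union>(sd X))"
  unfolding Union_sd using inj_on_image_sets[OF inj] by (rule inj_on_subset) blast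
 show "(\<lambda>c. (`) \<phi> ` c) ` sd X = sd Y" unfolding YX by (rule sd_image[OF inj])
 show "ori k (sd X) (sdo k X \<omega>)" "ori k (sd Y) (sdo k Y \<eta>)" using sdo X Y k by blast+
 fix d assume d: "d \<in> sd X" "card d = k"
 from sd_facet_flag[OF X(1,2) this k] obtain vs where vs: "oface k X vs" "set (flag vs) = d" by blast
 have of: "oface k (sd X) (flag vs)" by (rule oface_flag[OF X(1) vs(1)])
 have "oface k Y (map \<phi> us) \<and> \<eta> (map \<phi> us) = c * \<omega> us" if us: "oface k X us" for us
 proof -
  have "set us \<in> X" using us by (simp add: oface_def)
  moreover from this have "inj_on \<phi> (set us)" using inj by (auto intro: inj_on_subset)
  ultimately show ?thesis using i us YX by (auto simp: oface_def oiso_def distinct_map)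
 qed
 then show "\<exists>r. distinct r \<and> set r = d \<and> sdo k Y \<eta> (map (\<lambda>s. \<phi> ` s) r) = c * sdo k X \<omega> r"
  using sdo_natural[OF X Y k _ of] of vs by (intro exI[of _ "flag vs"]) (simp add: oface_def)
qed

section \<open>The cylinder over a sphere\<close>

text \<open>
 A triangulation of \<open>L \<times> [0, 1]\<close> with both ends coned off: the vertices
 \<open>Old v\<close> span a copy of \<open>L\<close>, with the apex \<open>Top\<close> over
 it, and the vertices \<open>Bar s\<close> with \<open>s \<noteq> {}\<close> span the
 barycentric subdivision of \<open>L\<close>, with the apex \<open>Bar {}\<close>.
\<close>

datatype 'a cyl = Old 'a | Bar "'a set" | Top

definition olds :: "'a cyl set => 'a set" where "olds u = {v. Old v \<in> u}"
definition bars :: "'a cyl set => 'a set set" where "bars u = {s. Bar s \<in> u}"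

definition cyl :: "'a set set => 'a cyl set set" where
 "cyl L = {u. olds u \<in> L \<and> bars u \<subseteq> L \<and> nested (bars u) \<and> (\<forall>s\<in>bars u. olds u \<subseteq> s) \<and> (Top \<in> u --> bars u = {})}"

lemma cyl_set_decomp: "u = Old ` olds u \<union> Bar ` bars u \<union> (if Top \<in> u then {Top} else {})"
proof (intro equalityI subsetI)
 fix x assume "x \<in> u"
 then show "x \<in> Old ` olds u \<union> Bar ` bars u \<union> (if Top \<in> u then {Top} else {})"
  by (cases x) (auto simp: olds_def bars_def)
qed (auto simp: olds_def bars_def split: if_splits)

lemma olds_bars_simps [simp]:
 "olds {} = {}" "bars {} = {}" "olds (u \<union> w) = olds u \<union> olds w" "bars (u \<union> w) = bars u \<union> bars w"
 "olds (insert (Old v) u) = insert v (olds u)" "bars (insert (Old v) u) = bars u"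
 "olds (insert (Bar s) u) = olds u" "bars (insert (Bar s) u) = insert s (bars u)"
 "olds (insert Top u) = olds u" "bars (insert Top u) = bars u"
 "olds (Old ` t) = t" "bars (Old ` t) = {}" "olds (Bar ` c) = {}" "bars (Bar ` c) = c"
 by (auto simp: olds_def bars_def)

lemma cyl_eqI: "olds u = olds w ==> bars u = bars w ==> Top \<in> u \<longleftrightarrow> Top \<in> w ==> u = w"
 using cyl_set_decomp[of u] cyl_set_decomp[of w] by simp

definition susp :: "'a set set => 'a cyl set set" where
 "susp L = join {{}, {Top}, {Bar {}}} ((`) Old ` L)"

lemma susp_iff: "u \<in> susp L \<longleftrightarrow> olds u \<in> L \<and> bars u \<subseteq> {{}} \<and> (Top \<in> u --> bars u = {})"
proof
 assume "u \<in> susp L"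
 then show "olds u \<in> L \<and> bars u \<subseteq> {{}} \<and> (Top \<in> u --> bars u = {})" by (auto simp: susp_def join_def)
next
 assume u: "olds u \<in> L \<and> bars u \<subseteq> {{}} \<and> (Top \<in> u --> bars u = {})"
 define p where "p = Bar ` bars u \<union> (if Top \<in> u then {Top} else {})"
 have "bars u = {} \<or> bars u = {{}}" using u by auto
 then have "p \<in> {{}, {Top}, {Bar {}}}" using u by (auto simp: p_def)
 moreover have "u = p \<union> Old ` olds u" by (subst cyl_set_decomp) (auto simp: p_def)
 ultimately show "u \<in> susp L" using u unfolding susp_def join_def by blast
qed

lemma sph_two_points:
 assumes "a \<noteq> b"
 shows "sph 1 {{}, {a}, {b}}"
proof -
 have "bdry {a, b} = {{}, {a}, {b}}" using assms by (auto simp: bdry_def)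
 then show ?thesis using sph_bdry[of "{a, b}" 1] assms by simp
qed

lemma sph_susp:
 assumes "sph k L"
 shows "sph (Suc k) (susp L)"
proof -
 have "sph k ((`) Old ` L)" by (rule sph_iso[OF assms]) (simp add: inj_on_def)
 then have "sph (1 + k) (susp L)"
  unfolding susp_def by (intro sph_join sph_two_points) (auto simp: Union_image_image)
 then show ?thesis by simp
qed

text \<open>
 The cylinder arises from the suspension of \<open>L\<close> with apexes \<open>Top\<close>
 and \<open>Bar {}\<close> by starring the simplices spanned by \<open>Bar {}\<close> and
 \<open>Old ` p\<close> at \<open>Bar p\<close>, the larger \<open>p\<close> first. This is
 the stage at which the simplices \<open>p \<in> Q\<close> have been treated. Stellar
 subdivisions of spheres being spheres, so is the cylinder.
\<close>

definition partial_cyl :: "'a set set => 'a set set => 'a cyl set set" where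
 "partial_cyl L Q = {u. olds u \<in> L \<and> bars u \<subseteq> insert {} Q \<and> nested (bars u) \<and> (\<forall>s\<in>bars u - {{}}. olds u \<subseteq> s) \<and>
   ({} \<in> bars u --> (\<forall>q\<in>Q. \<not> q \<subseteq> olds u)) \<and> (Top \<in> u --> bars u = {})}"

lemma stellar_partial_cyl:
 assumes p: "p \<in> L" "p \<noteq> {}" and Q: "{r \<in> L. p \<subset> r} \<subseteq> Q" "\<forall>q\<in>Q. \<not> q \<subseteq> p" "{} \<notin> Q"
 shows "stellar (partial_cyl L Q) (insert (Bar {}) (Old ` p)) (Bar p) = partial_cyl L (insert p Q)"
proof -
 let ?\<sigma> = "insert (Bar {}) (Old ` p)"
 have sub: "?\<sigma> \<subseteq> u \<longleftrightarrow> {} \<in> bars u \<and> p \<subseteq> olds u" for u by (auto simp: bars_def olds_def)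
 show ?thesis
 proof (intro equalityI subsetI)
  fix u assume "u \<in> stellar (partial_cyl L Q) ?\<sigma> (Bar p)"
  then consider "u \<in> partial_cyl L Q" "\<not> ?\<sigma> \<subseteq> u"
   | s where "u = insert (Bar p) s" "s \<in> partial_cyl L Q" "\<not> ?\<sigma> \<subseteq> s" "s \<union> ?\<sigma> \<in> partial_cyl L Q"
   unfolding stellar_def by blast
  then show "u \<in> partial_cyl L (insert p Q)"
  proof cases
   case 1
   then show ?thesis unfolding sub partial_cyl_def by blast
  next
   case 2
   from 2(4) have j: "olds s \<union> p \<in> L" "\<forall>q\<in>Q. \<not> q \<subseteq> olds s \<union> p" "\<forall>q\<in>bars s - {{}}. olds s \<union> p \<subseteq> q" "Top \<notin> s"
    by (auto simp: partial_cyl_def)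
   have "\<not> p \<subset> olds s \<union> p" using j(1,2) Q(1) by blast
   then have "olds s \<subseteq> p" by blast
   moreover have "nested (insert p (bars s))" using 2(2) j(3) unfolding partial_cyl_def nested_def by blast
   ultimately show ?thesis using 2(2,3) j p(2) unfolding sub 2(1) partial_cyl_def by auto
  qed
 next
  fix u assume u: "u \<in> partial_cyl L (insert p Q)"
  show "u \<in> stellar (partial_cyl L Q) ?\<sigma> (Bar p)"
  proof (cases "p \<in> bars u")
   case False
   then show ?thesis using u p(2) unfolding stellar_def sub partial_cyl_def by blast
  next
   case True
   define s where "s = u - {Bar p}"
   have s: "u = insert (Bar p) s" "olds s = olds u" "bars s = bars u - {p}" "Top \<in> s \<longleftrightarrow> Top \<in> u"
    using True by (auto simp: s_def bars_def olds_def)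
   have op: "olds u \<subseteq> p" "Top \<notin> u" using u True p(2) by (auto simp: partial_cyl_def)
   have up: "p \<subseteq> q" if "q \<in> bars u - {p}" "q \<noteq> {}" for q
   proof -
    have "p \<subseteq> q \<or> q \<subseteq> p" "q \<in> Q" using u True that by (auto simp: partial_cyl_def nested_def)
    then show ?thesis using Q(2) by blast
   qed
   have "s \<in> partial_cyl L Q" using u nested_subset[of "bars u" "bars u - {p}"] by (auto simp: partial_cyl_def s(2-4))
   moreover have "\<not> ?\<sigma> \<subseteq> s" using u p(2) unfolding sub s(2,3) partial_cyl_def by blast
   moreover have "s \<union> ?\<sigma> \<in> partial_cyl L Q"
   proof -
    have "olds u \<union> p = p" using op by blast
    then have "olds (s \<union> ?\<sigma>) = p" "bars (s \<union> ?\<sigma>) = insert {} (bars u - {p})" "Top \<notin> s \<union> ?\<sigma>" using s(2-4) op by auto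
    moreover have "nested (bars u - {p})" using u nested_subset[of "bars u" "bars u - {p}"] by (simp add: partial_cyl_def)
    then have "nested (insert {} (bars u - {p}))" unfolding nested_def ball_simps by simp
    moreover have "bars u - {p} \<subseteq> insert {} Q" using u by (auto simp: partial_cyl_def)
    ultimately show ?thesis using p(1) up Q(2) by (simp add: partial_cyl_def)
   qed
   ultimately show ?thesis using s(1) unfolding stellar_def by blast
  qed
 qed
qed

lemma sph_partial_cyl:
 assumes L: "sph k L"
 shows "Q \<subseteq> L - {{}} ==> (\<And>q r. q \<in> Q ==> r \<in> L ==> q \<subseteq> r ==> r \<in> Q) ==> sph (Suc k) (partial_cyl L Q)"
proof (induction "card Q" arbitrary: Q)
 have fL: "finite Q" if "Q \<subseteq> L - {{}}" for Q
  using that cpxD(1)[OF sph_cpx[OF L]] by (meson Diff_subset finite_subset subset_trans)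
 case 0
 then have "Q = {}" using fL by simp
 moreover have "partial_cyl L {} = susp L" unfolding partial_cyl_def susp_iff[abs_def] set_eq_iff
  by (auto simp: susp_iff nested_def)
 ultimately show ?case using sph_susp[OF L] by simp
next
 case (Suc n)
 have fQ: "finite Q" "Q \<noteq> {}" using Suc(2) by (auto intro: card_ge_0_finite)
 then obtain p where p: "p \<in> Q" "\<forall>q\<in>Q. q \<subseteq> p --> q = p" using finite_has_minimal by metis
 define Q' where "Q' = Q - {p}"
 have Q': "Q = insert p Q'" using p by (auto simp: Q'_def)
 have "card Q' = n" using Suc(2) fQ p by (simp add: Q'_def card_Diff_singleton)
 then have S: "sph (Suc k) (partial_cyl L Q')"
  using Suc(3,4) p by (intro Suc(1)) (auto simp: Q'_def)
 have pL: "p \<in> L" "p \<noteq> {}" using p Suc(3) by auto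
 have q: "{r \<in> L. p \<subset> r} \<subseteq> Q'" "\<forall>q\<in>Q'. \<not> q \<subseteq> p" "{} \<notin> Q'" using p Suc(3,4) by (auto simp: Q'_def)
 have "insert (Bar {}) (Old ` p) \<in> partial_cyl L Q'" using pL q by (auto simp: partial_cyl_def nested_def)
 moreover have "Bar p \<notin> \<Union>(partial_cyl L Q')" using pL(2) by (auto simp: partial_cyl_def Q'_def bars_def)
 ultimately show ?case
  using sph_stellar[OF S] unfolding Q' stellar_partial_cyl[OF pL q, symmetric] by simp
qed

lemma sph_cyl:
 assumes L: "sph k L"
 shows "sph (Suc k) (cyl L)"
proof -
 have "partial_cyl L (L - {{}}) = cyl L"
  using cpxD(2)[OF sph_cpx[OF L]] unfolding partial_cyl_def cyl_def set_eq_iff mem_Collect_eq by blast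
 then show ?thesis using sph_partial_cyl[OF L, of "L - {{}}"] by auto
qed

lemma lk_cyl_apex:
 assumes "cpx L"
 shows "lk (cyl L) (Bar {}) = (`) Bar ` sd L"
proof (intro equalityI subsetI)
 fix u assume "u \<in> lk (cyl L) (Bar {})"
 then have u: "Bar {} \<notin> u" "insert (Bar {}) u \<in> cyl L" by (auto simp: lk_def)
 then have "olds u = {}" "Top \<notin> u" by (auto simp: cyl_def)
 then have "u = Bar ` bars u" by (intro cyl_eqI) auto
 moreover have "nested (bars u)" using u(2) nested_subset[of "insert {} (bars u)" "bars u"] by (auto simp: cyl_def)
 then have "bars u \<in> sd L" using u by (auto simp: cyl_def sd_def bars_def)
 ultimately show "u \<in> (`) Bar ` sd L" by blast
next
 fix u assume "u \<in> (`) Bar ` sd L"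
 then obtain c where c: "u = Bar ` c" "c \<subseteq> L - {{}}" "nested c" by (auto simp: sd_def)
 have "nested (insert {} c)" using c(3) unfolding nested_def by blast
 then show "u \<in> lk (cyl L) (Bar {})" using cpxD(2)[OF assms] c by (auto simp: lk_def cyl_def)
qed

lemma sph_sd:
 assumes L: "sph k L"
 shows "sph k (sd L)"
proof -
 have c: "cpx L" by (rule sph_cpx[OF L])
 have "Bar {} \<in> \<Union>(cyl L)"
  using cpxD(2)[OF c] by (intro UnionI[of "{Bar {}}"]) (auto simp: cyl_def nested_def)
 then have "sph k (lk (cyl L) (Bar {}))" using sph_lk[OF sph_cyl[OF L]] by auto
 then have "sph k ((`) bars' ` (`) Bar ` sd L)" if "bars' = (\<lambda>x. case x of Bar s => s | _ => {})" for bars'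
  unfolding lk_cyl_apex[OF c] by (rule sph_iso) (auto simp: that inj_on_def)
 then show ?thesis by (simp add: image_image)
qed

section \<open>The orientation of the cylinder\<close>

lemma sph_two_facets:
 assumes L: "sph k L" and a: "a \<notin> s" "insert a s \<in> L" "Suc (card s) = k"
 shows "\<exists>b. b \<noteq> a \<and> b \<notin> s \<and> insert b s \<in> L \<and> (\<forall>c. c \<notin> s --> insert c s \<in> L --> c = a \<or> c = b)"
proof -
 have "s \<in> L" using cpxD(4)[OF sph_cpx[OF L] a(2)] by blast
 then have "sph (k - card s) (lks L s)" using sph_lks[OF L] by blast
 moreover have "k - card s = 1" using a(3) by simp
 ultimately have "sph 1 (lks L s)" by simp
 from sph_1_points[OF this] obtain p q where pq: "p \<noteq> q" "lks L s = {{}, {p}, {q}}" by blast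
 have iff: "c \<notin> s \<and> insert c s \<in> L \<longleftrightarrow> c = p \<or> c = q" for c
 proof -
  have "c \<notin> s \<and> insert c s \<in> L \<longleftrightarrow> {c} \<in> lks L s" by (auto simp: lks_def)
  then show ?thesis using pq by auto
 qed
 then have "a = p \<or> a = q" using a by blast
 then show ?thesis using iff pq(1) by metis
qed

text \<open>
 A ridge of a sphere lies in exactly two facets, so one neighbour of opposite sign for each
 facet and each of its vertices is enough.
\<close>

lemma exists_ori_sphere:
 fixes X :: "'a set set"
 assumes X: "sph k X"
  and R1: "\<And>r e. (r, e) \<in> R ==> oface k X r \<and> (e = 1 \<or> e = -1)"
  and R2: "\<And>s. s \<in> X ==> card s = k ==> \<exists>r e. (r, e) \<in> R \<and> set r = s"
  and R3: "\<And>r e r' e' F. (r, e) \<in> R ==> (r', e') \<in> R ==> set r = set r' ==> alternating F ==> e * F r = e' * F r'"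
  and R4: "\<And>a s. a \<notin> s ==> insert a s \<in> X ==> Suc (card s) = k ==>
   \<exists>r i e b. (r, e) \<in> R \<and> i < k \<and> r ! i = a \<and> set r = insert a s \<and> b \<noteq> a \<and> (r[i := b], - e) \<in> R"
 shows "\<exists>\<omega>. ori k X \<omega> \<and> (\<forall>(r, e)\<in>R. \<omega> r = e)"
proof (rule exists_ori[OF sph_cpx[OF X] R1 R2 R3])
 fix a b s assume ab: "a \<noteq> b" "a \<notin> s" "b \<notin> s" "insert a s \<in> X" "insert b s \<in> X" "Suc (card s) = k"
 from R4[OF ab(2,4,6)] obtain r i e b' where r: "(r, e) \<in> R" "i < k" "r ! i = a" "set r = insert a s"
  "b' \<noteq> a" "(r[i := b'], - e) \<in> R" by blast
 have o: "oface k X r" "oface k X (r[i := b'])" using R1 r by blast+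
 define us vs where "us = take i r" and "vs = drop (Suc i) r"
 have rs: "r = us @ a # vs" "r[i := b'] = us @ b' # vs"
  using r(2,3) o(1) by (auto simp: us_def vs_def oface_def id_take_nth_drop upd_conv_take_nth_drop)
 have "set us \<union> set vs = s" using r(4) o(1) ab(2) unfolding rs(1) oface_def by auto
 then have "b' \<notin> s" "insert b' s \<in> X" using o(2) unfolding rs(2) oface_def by auto
 then have "b' = b" using sph_two_facets[OF X ab(2,4,6)] ab r(5) by metis
 then show "\<exists>r i e. (r, e) \<in> R \<and> i < k \<and> r ! i = a \<and> set r = insert a s \<and> (r[i := b], - e) \<in> R"
  using r by blast
qed

lemma oisoI_facets:
 assumes X: "sph k X" "ori k X \<omega>" and Y: "sph k Y" "ori k Y \<eta>" and inj: "inj_on \<phi> (\<Union>X)"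
  and 1: "\<And>s. s \<in> X ==> card s = k ==> \<exists>r. distinct r \<and> set r = s \<and> \<phi> ` s \<in> Y \<and> \<eta> (map \<phi> r) = c * \<omega> r"
  and 2: "\<And>t. t \<in> Y ==> card t = k ==> \<exists>s\<in>X. \<phi> ` s = t"
 shows "oiso c \<phi> X \<omega> Y \<eta>"
proof (rule oisoI_flags[OF inj _ X(2) Y(2)])
 show "(`) \<phi> ` X = Y"
 proof (intro equalityI subsetI)
  fix t assume "t \<in> (`) \<phi> ` X"
  then obtain s where s: "s \<in> X" "t = \<phi> ` s" by blast
  obtain u where u: "u \<in> X" "s \<subseteq> u" "card u = k" using sph_facet[OF X(1) s(1)] by blast
  have "\<phi> ` u \<in> Y" using 1[OF u(1,3)] by blast
  then show "t \<in> Y" using cpxD(4)[OF sph_cpx[OF Y(1)], of "\<phi> ` u" t] s u(2) by blast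
 next
  fix t assume t: "t \<in> Y"
  obtain u where u: "u \<in> Y" "t \<subseteq> u" "card u = k" using sph_facet[OF Y(1) t] by blast
  obtain s where s: "s \<in> X" "\<phi> ` s = u" using 2[OF u(1,3)] by blast
  have "t = \<phi> ` {v \<in> s. \<phi> v \<in> t}" using s u(2) by blast
  moreover have "{v \<in> s. \<phi> v \<in> t} \<in> X" by (rule cpxD(4)[OF sph_cpx[OF X(1)] s(1)]) blast
  ultimately show "t \<in> (`) \<phi> ` X" by blast
 qed
qed (use 1 in blast)

text \<open>
 The facets of the cylinder within the prism over the simplex with vertex list \<open>vs\<close>: the first \<open>j\<close>
 vertices below, and above them the members of the flag of \<open>vs\<close> that contain these. The prism has one
 more facet, for \<open>j = Suc (length vs)\<close>, the cone with apex \<open>Top\<close>. Consecutive facets differ in place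
 \<open>j\<close> only, so their orientations alternate with \<open>j\<close>.
\<close>

definition cface :: "'a list => nat => 'a cyl list" where
 "cface vs j = map Old (take j vs) @
   (if j \<le> length vs then map (\<lambda>i. Bar (set (take i vs))) [j..<Suc (length vs)] else [Top])"

lemma length_cface: "j \<le> Suc (length vs) ==> length (cface vs j) = Suc (length vs)"
 by (auto simp: cface_def)

lemma nth_cface:
 assumes "j \<le> Suc (length vs)" "i \<le> length vs"
 shows "cface vs j ! i = (if i < j then (if i < length vs then Old (vs ! i) else Top) else Bar (set (take i vs)))"
 using assms by (auto simp: cface_def nth_append min_def simp del: upt_Suc)

lemma cface_step:
 assumes "j \<le> length vs"
 shows "cface vs (Suc j) = (cface vs j)[j := if j < length vs then Old (vs ! j) else Top]"
  "cface vs j = (cface vs (Suc j))[j := Bar (set (take j vs))]"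
 using assms by (intro nth_equalityI; auto simp: length_cface nth_cface nth_list_update)+

lemma cface_change:
 assumes "j < i" "i \<le> length vs" "length ws = length vs" "take j ws = take j vs"
  and "\<And>m. m \<le> length vs ==> m \<noteq> i ==> set (take m ws) = set (take m vs)"
 shows "cface ws j = (cface vs j)[i := Bar (set (take i ws))]"
proof (rule nth_equalityI)
 show "length (cface ws j) = length ((cface vs j)[i := Bar (set (take i ws))])"
  using assms by (simp add: length_cface)
 fix m assume "m < length (cface ws j)"
 then have m: "m \<le> length vs" using assms by (simp add: length_cface)
 have "ws ! m = vs ! m" if "m < j" using nth_take[OF that, of ws] nth_take[OF that, of vs] assms(4) by simp
 then show "cface ws j ! m = (cface vs j)[i := Bar (set (take i ws))] ! m"
  using assms m by (auto simp: length_cface nth_cface nth_list_update)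
qed

lemma set_cface:
 assumes "j \<le> Suc (length vs)"
 shows "olds (set (cface vs j)) = set (take j vs)"
  "bars (set (cface vs j)) = (if j \<le> length vs then {set (take i vs) |i. j \<le> i \<and> i \<le> length vs} else {})"
  "Top \<in> set (cface vs j) \<longleftrightarrow> j = Suc (length vs)"
proof -
 have "bars (set (cface vs j)) = (if j \<le> length vs then (\<lambda>i. set (take i vs)) ` set [j..<Suc (length vs)] else {})"
  unfolding cface_def bars_def by (auto simp del: upt_Suc)
 then show "bars (set (cface vs j)) = (if j \<le> length vs then {set (take i vs) |i. j \<le> i \<and> i \<le> length vs} else {})"
  by (auto simp del: upt_Suc)
qed (use assms in \<open>auto simp: cface_def olds_def\<close>)

lemma distinct_cface:
 assumes "distinct vs" "j \<le> Suc (length vs)"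
 shows "distinct (cface vs j)"
 unfolding distinct_conv_nth
proof (intro allI impI)
 fix m i assume "m < length (cface vs j)" "i < length (cface vs j)" "m \<noteq> i"
 then have mi: "m \<le> length vs" "i \<le> length vs" "m \<noteq> i" using assms by (simp_all add: length_cface)
 then have "card (set (take m vs)) \<noteq> card (set (take i vs))" using assms(1) by (simp add: distinct_card min_def)
 then have "set (take m vs) \<noteq> set (take i vs)" by metis
 moreover have "vs ! m \<noteq> vs ! i" if "m < length vs" "i < length vs" using that mi assms(1) by (simp add: nth_eq_iff_index_eq)
 ultimately show "cface vs j ! m \<noteq> cface vs j ! i" using mi assms(2) by (auto simp: nth_cface)
qed

lemma cface_mem:
 assumes "cpx L" "set vs \<in> L" "j \<le> Suc (length vs)"
 shows "set (cface vs j) \<in> cyl L"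
proof -
 have sub: "set (take i vs) \<in> L" for i by (rule cpxD(4)[OF assms(1,2) set_take_subset])
 have tt: "set (take i vs) \<subseteq> set (take m vs) \<or> set (take m vs) \<subseteq> set (take i vs)" for i m
  using set_take_subset_set_take[of i m vs] set_take_subset_set_take[of m i vs] by linarith
 have "nested {set (take i vs) |i. j \<le> i \<and> i \<le> length vs}"
  unfolding nested_def using tt by blast
 moreover have "set (take j vs) \<subseteq> set (take i vs)" if "j \<le> i" for i
  using that by (rule set_take_subset_set_take)
 moreover have "{set (take i vs) |i. j \<le> i \<and> i \<le> length vs} \<subseteq> L" using sub by blast
 moreover have "nested ({} :: 'a set set)" by (simp add: nested_def)
 ultimately have "bars (set (cface vs j)) \<subseteq> L \<and> nested (bars (set (cface vs j))) \<and>
  (\<forall>s\<in>bars (set (cface vs j)). set (take j vs) \<subseteq> s)"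
 proof (cases "j \<le> length vs")
  case True
  then have b: "bars (set (cface vs j)) = {set (take i vs) |i. j \<le> i \<and> i \<le> length vs}"
   using set_cface(2)[OF assms(3)] by simp
  show ?thesis unfolding b
   using \<open>nested {set (take i vs) |i. j \<le> i \<and> i \<le> length vs}\<close>
    \<open>{set (take i vs) |i. j \<le> i \<and> i \<le> length vs} \<subseteq> L\<close> set_take_subset_set_take[of j _ vs] by blast
 qed (simp add: set_cface(2)[OF assms(3)])
 moreover have "Top \<in> set (cface vs j) ==> bars (set (cface vs j)) = {}"
  unfolding set_cface[OF assms(3)] by simp
 ultimately show ?thesis
  unfolding cyl_def mem_Collect_eq set_cface(1)[OF assms(3)] using sub by blast
qed

lemma ordered_cface:
 assumes "cpx L" "oface k L vs" "j \<le> Suc k"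
 shows "oface (Suc k) (cyl L) (cface vs j)"
 using assms cface_mem[OF assms(1), of vs j]
 by (auto simp: oface_def distinct_cface length_cface)

lemma nested_Un: "nested c ==> nested d ==> (\<And>s t. s \<in> c ==> t \<in> d ==> s \<subseteq> t) ==> nested (c \<union> d)"
 unfolding nested_def by (intro ballI) (elim UnE; simp)

text \<open>
 Every facet is of the form \<open>cface\<close>, and the order of its lower vertices may be
 prescribed partially, by \<open>ts\<close>. The upper vertices together with a flag of the
 simplex of lower vertices form a maximal chain.
\<close>

lemma cyl_facet:
 assumes L: "sph k L" and u: "u \<in> cyl L" "card u = Suc k" and ts: "distinct ts" "set ts \<subseteq> olds u"
 shows "\<exists>vs. oface k L (ts @ vs) \<and> set (cface (ts @ vs) (if Top \<in> u then Suc k else card (olds u))) = u \<and>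
   length ts \<le> card (olds u) \<and> card (olds u) \<le> k"
proof -
 have c: "cpx L" by (rule sph_cpx[OF L])
 have oL: "olds u \<in> L" using u(1) by (simp add: cyl_def)
 have fo: "finite (olds u)" using cpxD(3)[OF c oL] .
 have ok: "card (olds u) \<le> k" using oL sph_small_dim[OF L] by (simp add: small_dim_def)
 obtain t2 where t2: "distinct t2" "set t2 = olds u - set ts" using finite_distinct_list fo by (metis finite_Diff)
 define t where "t = ts @ t2"
 have t: "distinct t" "set t = olds u" using ts t2 by (auto simp: t_def)
 have lt: "length t = card (olds u)" using distinct_card[OF t(1)] t(2) by simp
 then have lts: "length ts \<le> card (olds u)" by (simp add: t_def)
 have "\<exists>ws. oface k L (t @ ws) \<and> set (cface (t @ ws) (if Top \<in> u then Suc k else card (olds u))) = u"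
 proof (cases "Top \<in> u")
  case True
  then have "u = insert Top (Old ` olds u)" using u(1) by (intro cyl_eqI) (auto simp: cyl_def)
  moreover have "card (insert Top (Old ` olds u)) = Suc (card (olds u))"
   using fo by (subst card_insert_disjoint) (auto simp: card_image inj_on_def)
  ultimately have k: "length t = k" using u(2) lt by simp
  then have "oface k L (t @ [])" using t oL by (simp add: oface_def)
  moreover have "set (cface t (Suc k)) = u"
   using u(1) t True k by (intro cyl_eqI) (auto simp: set_cface cyl_def)
  ultimately show ?thesis using True by (intro exI[of _ "[]"]) simp
 next
  case False
  let ?b = "bars u" and ?o = "olds u"
  have b: "?b \<subseteq> L" "nested ?b" "\<And>s. s \<in> ?b ==> ?o \<subseteq> s" using u(1) by (auto simp: cyl_def)
  have fb: "finite ?b" using b(1) cpxD(1)[OF c] finite_subset by blast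
  have "u = Old ` ?o \<union> Bar ` ?b" using False by (intro cyl_eqI) auto
  moreover have "card (Old ` ?o \<union> Bar ` ?b) = card ?o + card ?b"
   using fo fb by (subst card_Un_disjoint) (auto simp: card_image inj_on_def)
  ultimately have cc: "card ?o + card ?b = Suc k" using u(2) by metis
  define d where "d = set (flag t) \<union> (?b - {?o})"
  have fl: "s \<subseteq> ?o" "s \<in> L" "s \<noteq> {}" if "s \<in> set (flag t)" for s
   using that flag_in_sd[OF c, of t] t(2) oL by (auto simp: sd_def set_flag dest: in_set_takeD)
  have "nested d" unfolding d_def
  proof (rule nested_Un[OF nested_flag nested_subset[OF b(2)]])
   show "s \<subseteq> s'" if "s \<in> set (flag t)" "s' \<in> ?b - {?o}" for s s' using fl(1)[OF that(1)] b(3) that(2) by blast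
  qed blast
  moreover have "d \<subseteq> L - {{}}" unfolding d_def using fl b(1,3) by blast
  ultimately have dsd: "d \<in> sd L" by (simp add: sd_def)
  have "set (flag t) \<inter> (?b - {?o}) = {}" using fl(1) b(3) by blast
  then have cd: "card d = card ?o + card (?b - {?o})"
   unfolding d_def using fb distinct_card[OF distinct_flag[OF t(1)]] lt by (subst card_Un_disjoint) auto
  have "card d \<le> k" using small_dim_sd[OF c sph_small_dim[OF L]] dsd by (simp add: small_dim_def)
  then have ob: "?o \<in> ?b" using cd cc by (cases "?o \<in> ?b") auto
  then have dk: "card d = k" using cd cc fb card_gt_0_iff[of ?b] by (auto simp: card_Diff_singleton)
  have "\<exists>vs. oface k L vs \<and> set (flag vs) = d"
  proof (cases "k = 0")
   case True
   have "finite d" unfolding d_def using fb by simp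
   then have "d = {}" using dk True by simp
   then show ?thesis using True cpxD(2)[OF c] by (intro exI[of _ "[]"]) (simp add: oface_def)
  qed (use sd_facet_flag[OF c sph_small_dim[OF L] dsd dk] in simp)
  then obtain vs where vs: "oface k L vs" "set (flag vs) = d" by blast
  have lv: "length vs = k" "distinct vs" using vs(1) by (auto simp: oface_def)
  have inter: "flag vs ! i = s" if "s \<in> d" "card s = Suc i" for s i
   using flag_nth_unique[OF lv(2), of s] that vs(2) by simp
  have "take (length t) vs = t"
  proof (rule eq_if_takes_eq)
   fix j assume j: "j \<le> length (take (length t) vs)"
   show "set (take j (take (length t) vs)) = set (take j t)"
   proof (cases j)
    case (Suc i)
    then have i: "i < length t" using j lv by simp
    then have "flag t ! i \<in> d" "card (flag t ! i) = Suc i" using card_nth_flag[OF t(1)] by (auto simp: d_def)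
    from inter[OF this] have "flag vs ! i = flag t ! i" .
    then show ?thesis using i lv Suc lt ok by (simp add: nth_flag min_def)
   qed simp
  qed (use t(1) lv lt ok in auto)
  then have tv: "vs = t @ drop (length t) vs" by (metis append_take_drop_id)
  have "bars (set (cface vs (card ?o))) = ?b"
  proof -
   have "set (take i vs) \<in> ?b" if i: "card ?o \<le> i" "i \<le> k" for i
   proof (cases "i = card ?o")
    case True
    then show ?thesis using \<open>take (length t) vs = t\<close> lt t(2) ob by simp
   next
    case False
    then obtain m where m: "i = Suc m" "m < k" using i by (cases i) auto
    then have "flag vs ! m \<in> d" "card (flag vs ! m) = i" using vs(2) lv card_nth_flag[OF lv(2), of m] by auto
    moreover have "card s \<le> card ?o" if "s \<in> set (flag t)" for s using card_mono[OF fo fl(1)[OF that]] .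
    ultimately have "flag vs ! m \<in> ?b" using False i unfolding d_def by fastforce
    then show ?thesis using m lv by (simp add: nth_flag)
   qed
   moreover have "\<exists>i. s = set (take i vs) \<and> card ?o \<le> i \<and> i \<le> k" if s: "s \<in> ?b" for s
   proof (cases "s = ?o")
    case True
    then show ?thesis using \<open>take (length t) vs = t\<close> lt t(2) ok by (intro exI[of _ "card ?o"]) simp
   next
    case False
    then have sd: "s \<in> set (flag vs)" using s vs(2) by (simp add: d_def)
    have "finite s" using cpxD(3)[OF c] b(1) s by blast
    then have "card ?o \<le> card s" by (rule card_mono[OF _ b(3)[OF s]])
    moreover have "s = set (take (card s) vs)" "card s \<le> k"
     using flag_nth_unique[OF lv(2) sd] lv(1) by (auto simp: nth_flag)
    ultimately show ?thesis by blast
   qed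
   ultimately show ?thesis using ok lv by (auto simp: set_cface)
  qed
  then have "set (cface vs (card ?o)) = u"
   using \<open>take (length t) vs = t\<close> t(2) lt lv ok False by (intro cyl_eqI) (simp_all add: set_cface)
  then show ?thesis using False vs(1) tv by metis
 qed
 then obtain ws where "oface k L (t @ ws)" "set (cface (t @ ws) (if Top \<in> u then Suc k else card (olds u))) = u" by blast
 then show ?thesis using lts ok unfolding t_def by (intro exI[of _ "t2 @ ws"]) simp
qed

lemma flag_neighbour:
 assumes L: "sph k L" and vs: "oface k L vs" and m: "m < k"
 shows "\<exists>ws. oface k L ws \<and> ws \<noteq> vs \<and> (\<forall>i<k. i \<noteq> m --> flag ws ! i = flag vs ! i)"
proof -
 note c = sph_cpx[OF L]
 let ?a = "flag vs ! m" and ?s = "set (flag vs) - {flag vs ! m}"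
 have l: "length vs = k" "distinct vs" using vs by (auto simp: oface_def)
 have a: "?a \<in> set (flag vs)" using m l by simp
 have ord: "oface k (sd L) (flag vs)" by (rule oface_flag[OF c vs])
 have "insert ?a ?s \<in> sd L" using ord insert_Diff[OF a] by (simp add: oface_def)
 moreover have "Suc (card ?s) = k" using ord a m by (simp add: oface_def distinct_card card_Diff_singleton)
 ultimately obtain b where b: "b \<noteq> ?a" "b \<notin> ?s" "insert b ?s \<in> sd L" using sph_two_facets[OF sph_sd[OF L], of ?a ?s] by blast
 have "card (insert b ?s) = k" using b(2) \<open>Suc (card ?s) = k\<close> by simp
 from sd_facet_flag[OF c sph_small_dim[OF L] b(3) this] m obtain ws where
  ws: "oface k L ws" "set (flag ws) = insert b ?s" by auto
 have "set (flag vs) = insert ?a ?s" using a by blast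
 with flag_update[of vs ws k ?a ?s b] ws l b(2) obtain i where
  i: "i < k" "flag vs ! i = ?a" "\<forall>j<k. j \<noteq> i --> flag vs ! j = flag ws ! j" by (auto simp: oface_def)
 have "i = m" using i(1,2) m l distinct_flag[OF l(2)] by (simp add: nth_eq_iff_index_eq)
 moreover have "b \<notin> set (flag vs)" using b(1,2) by blast
 then have "ws \<noteq> vs" using ws(2) by blast
 ultimately show ?thesis using ws(1) i(3) by (intro exI[of _ ws]) simp
qed

lemma set_take_drop:
 assumes "distinct us"
 shows "set (take m (drop j us)) = set (take (j + m) us) - set (take j us)"
proof -
 have "take (j + m) us = take j us @ take m (drop j us)" by (rule take_add)
 moreover have "distinct (take (j + m) us)" using assms by simp
 ultimately show ?thesis by auto
qed

definition cylo :: "nat => 'a set set => ('a list => int) => 'a cyl list => int" where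
 "cylo k L \<omega> = (SOME \<omega>'. ori (Suc k) (cyl L) \<omega>' \<and>
   (\<forall>vs j. oface k L vs --> j \<le> Suc k --> \<omega>' (cface vs j) = (- 1) ^ j * \<omega> vs))"

text \<open>
 The facets next to \<open>cface vs j\<close> are \<open>cface vs (j - 1)\<close> and
 \<open>cface vs (j + 1)\<close>, and those obtained by moving one member of the flag of
 \<open>vs\<close> that is above the first \<open>j\<close> vertices; facets through
 \<open>Top\<close> and a lower vertex continue into the neighbouring simplex of
 \<open>L\<close>.
\<close>

lemma cylo:
 assumes L: "sph k L" and \<omega>: "ori k L \<omega>"
 shows "ori (Suc k) (cyl L) (cylo k L \<omega>)"
  "oface k L vs ==> j \<le> Suc k ==> cylo k L \<omega> (cface vs j) = (- 1) ^ j * \<omega> vs"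
proof -
 have c: "cpx L" and sm: "small_dim k L" using sph_cpx[OF L] sph_small_dim[OF L] by auto
 define R where "R = {(cface vs j, (- 1) ^ j * \<omega> vs) |vs j. oface k L vs \<and> j \<le> Suc k}"
 have inR: "(cface vs j, (- 1) ^ j * \<omega> vs) \<in> R" if "oface k L vs" "j \<le> Suc k" for vs j
  using that unfolding R_def by blast
 have "\<exists>\<omega>'. ori (Suc k) (cyl L) \<omega>' \<and> (\<forall>(r, e)\<in>R. \<omega>' r = e)"
 proof (rule exists_ori_sphere[OF sph_cyl[OF L]])
  fix r e assume "(r, e) \<in> R"
  then obtain vs j where vs: "r = cface vs j" "e = (- 1) ^ j * \<omega> vs" "oface k L vs" "j \<le> Suc k"
   unfolding R_def by blast
  have "(- 1 :: int) ^ j = 1 \<or> (- 1 :: int) ^ j = -1" using neg_one_even_power neg_one_odd_power by blast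
  then show "oface (Suc k) (cyl L) r \<and> (e = 1 \<or> e = -1)"
   using ordered_cface[OF c vs(3,4)] oriD(1)[OF \<omega> vs(3)] vs by auto
 next
  fix u assume u: "u \<in> cyl L" "card u = Suc k"
  from cyl_facet[OF L u, of "[]"] obtain vs where "oface k L vs"
   "set (cface vs (if Top \<in> u then Suc k else card (olds u))) = u" "card (olds u) \<le> k" by auto
  then obtain j where "oface k L vs" "j \<le> Suc k" "set (cface vs j) = u"
   by (cases "Top \<in> u") (auto intro: le_SucI)
  then show "\<exists>r e. (r, e) \<in> R \<and> set r = u" using inR by blast
 next
  fix r e r' e' and F :: "'a cyl list => int"
  assume "(r, e) \<in> R" "(r', e') \<in> R" and eq: "set r = set r'" and F: "alternating F"
  then obtain vs j ws j' where v: "r = cface vs j" "e = (- 1) ^ j * \<omega> vs" "oface k L vs" "j \<le> Suc k"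
   and w: "r' = cface ws j'" "e' = (- 1) ^ j' * \<omega> ws" "oface k L ws" "j' \<le> Suc k"
   unfolding R_def by blast
  have l: "length vs = k" "length ws = k" "distinct vs" "distinct ws" using v w by (auto simp: oface_def)
  have jv: "j \<le> Suc (length vs)" "j' \<le> Suc (length ws)" using v w l by auto
  note sv = set_cface[OF jv(1), folded v(1)] and sw = set_cface[OF jv(2), folded w(1)]
  have ct: "card (set (take m vs)) = m" "card (set (take m ws)) = m" if "m \<le> k" for m
   using l that by (simp_all add: distinct_card min_def)
  have top: "j = Suc k \<longleftrightarrow> j' = Suc k" using sv(3) sw(3) eq l by simp
  have set: "set (take j vs) = set (take j' ws)" using sv(1) sw(1) eq by simp
  have jj: "j' = j"
  proof (cases "j = Suc k")
   case False
   then have "j \<le> k" "j' \<le> k" using v(4) w(4) top by auto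
   then show ?thesis using ct set by metis
  qed (use top in simp)
  have bars: "set (take m vs) = set (take m ws)" if "j \<le> m" "m \<le> k" for m
  proof -
   have "set (take m vs) \<in> bars (set r)" unfolding sv(2) using that l by auto
   then have "set (take m vs) \<in> bars (set r')" using eq by simp
   then obtain i where "i \<le> k" "set (take m vs) = set (take i ws)" unfolding sw(2) using l by (auto split: if_splits)
   moreover from this have "m = i" using ct that by metis
   ultimately show ?thesis by simp
  qed
  define rest where "rest = (if j \<le> k then map (\<lambda>i. Bar (set (take i vs))) [j..<Suc k] else [Top])"
  have "map (\<lambda>i. Bar (set (take i vs))) [j..<Suc k] = map (\<lambda>i. Bar (set (take i ws))) [j..<Suc k]"
   using bars by (intro map_cong) auto
  then have r: "r = map Old (take j vs) @ rest" "r' = map Old (take j ws) @ rest"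
   using v(1) w(1) l jj by (auto simp: cface_def rest_def)
  have tail: "drop j vs = drop j ws"
  proof (rule eq_if_takes_eq)
   fix m assume m: "m \<le> length (drop j vs)"
   show "set (take m (drop j vs)) = set (take m (drop j ws))"
   proof (cases "j \<le> k")
    case True
    then show ?thesis using m l bars[of "j + m"] bars[of j] by (simp add: set_take_drop)
   qed (use l in simp)
  qed (use l in auto)
  have "mset (take j vs) = mset (take j ws)" using set jj l by (simp add: set_eq_iff_mset_eq_distinct[symmetric])
  from alternating_prod[OF alternating_append[OF oriD(3)[OF \<omega>]] alternating_map[OF alternating_append[OF F]] this,
    of "drop j vs" Old rest]
  have "\<omega> vs * F r = \<omega> ws * F r'" unfolding r using tail by (metis append_take_drop_id)
  then show "e * F r = e' * F r'" using v(2) w(2) jj by simp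
 next
  fix a s assume a: "a \<notin> s" "insert a s \<in> cyl L" "Suc (card s) = Suc k"
  let ?u = "insert a s"
  have fu: "finite ?u" using cpxD(3)[OF sph_cpx[OF sph_cyl[OF L]] a(2)] .
  then have cu: "card ?u = Suc k" using a by simp
  have oL: "olds ?u \<in> L" using a(2) by (simp add: cyl_def)
  have fo: "finite (olds ?u)" using cpxD(3)[OF c oL] .
  have fin: "\<exists>r i e b. (r, e) \<in> R \<and> i < Suc k \<and> r ! i = a \<and> set r = ?u \<and> b \<noteq> a \<and> (r[i := b], - e) \<in> R"
   if "oface k L vs" "j \<le> Suc k" "set (cface vs j) = ?u" "i \<le> k" "cface vs j ! i = a"
    "(cface vs j)[i := b] = cface ws j'" "oface k L ws" "j' \<le> Suc k"
    "(- 1) ^ j' * \<omega> ws = - ((- 1) ^ j * \<omega> vs)" "b \<noteq> a" for vs j i b ws j'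
   using inR[OF that(1,2)] inR[OF that(7,8)] that
   by (intro exI[of _ "cface vs j"] exI[of _ i] exI[of _ "(- 1) ^ j * \<omega> vs"] exI[of _ b]) auto
  \<comment> \<open>moving one member of the flag of \<open>vs\<close>\<close>
  have flip: "\<exists>ws. oface k L ws \<and> \<omega> ws = - \<omega> vs \<and> take m ws = take m vs \<and> set (take (Suc m) ws) \<noteq> set (take (Suc m) vs) \<and>
    (\<forall>i\<le>k. i \<noteq> Suc m --> set (take i ws) = set (take i vs))"
   if vs: "oface k L vs" and m: "m < k" for vs m
  proof -
   obtain ws where ws: "oface k L ws" "ws \<noteq> vs" "\<forall>i<k. i \<noteq> m --> flag ws ! i = flag vs ! i"
    using flag_neighbour[OF L vs m] by blast
   have l: "length vs = k" "length ws = k" "distinct vs" "distinct ws" using vs ws(1) by (auto simp: oface_def)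
   have eq: "set (take i ws) = set (take i vs)" if "i \<le> k" "i \<noteq> Suc m" for i
   proof (cases i)
    case (Suc i')
    then show ?thesis using ws(3)[rule_format, of i'] that l by (simp add: nth_flag)
   qed simp
   have "take m ws = take m vs"
    using l eq m by (intro eq_if_takes_eq) (auto simp: min_def)
   moreover have "set (take (Suc m) ws) \<noteq> set (take (Suc m) vs)"
   proof
    assume "set (take (Suc m) ws) = set (take (Suc m) vs)"
    then have "set (take i ws) = set (take i vs)" if "i \<le> length ws" for i using eq that l by (cases "i = Suc m") auto
    then have "ws = vs" using l by (intro eq_if_takes_eq) auto
    then show False using ws(2) by simp
   qed
   ultimately show ?thesis using ws(1) eq flag_flip[OF \<omega> vs ws(1) m] ws(2,3) by (intro exI[of _ ws]) simp
  qed
  show "\<exists>r i e b. (r, e) \<in> R \<and> i < Suc k \<and> r ! i = a \<and> set r = ?u \<and> b \<noteq> a \<and> (r[i := b], - e) \<in> R"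
  proof (cases a)
   case (Old v)
   then have vo: "v \<in> olds ?u" by (simp add: olds_def)
   obtain ts0 where ts0: "distinct ts0" "set ts0 = olds ?u - {v}" using finite_distinct_list fo by (metis finite_Diff)
   have co: "Suc (length ts0) = card (olds ?u)"
    using distinct_card[OF ts0(1)] ts0(2) vo fo by (metis card.remove)
   obtain ws where ws: "oface k L ((ts0 @ [v]) @ ws)" "card (olds ?u) \<le> k"
    "set (cface ((ts0 @ [v]) @ ws) (if Top \<in> ?u then Suc k else card (olds ?u))) = ?u"
    using cyl_facet[OF L a(2) cu, of "ts0 @ [v]"] ts0 vo by auto
   define vs j where "vs = ts0 @ v # ws" and "j = length ts0"
   have l: "length vs = k" "distinct vs" "oface k L vs" using ws(1) by (auto simp: oface_def vs_def)
   have j: "j < k" "vs ! j = v" "card (olds ?u) = Suc j" using co ws(2) by (simp_all add: j_def vs_def)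
   show ?thesis
   proof (cases "Top \<in> ?u")
    case False
    show ?thesis
     by (rule fin[OF l(3), of "Suc j" j "Bar (set (take j vs))" vs j])
      (use ws False j l cface_step(2)[of j vs] Old in \<open>simp_all add: vs_def nth_cface\<close>)
   next
    case True
    have su: "set (cface vs (Suc k)) = ?u" using ws(3) True by (simp add: vs_def)
    then have "set vs = olds ?u" using set_cface(1)[of "Suc k" vs] l by simp
    then have jk: "Suc j = k" using j(3) l distinct_card by metis
    obtain ws' where ws': "oface k L ws'" "\<omega> ws' = - \<omega> vs" "take j ws' = take j vs" "set (take (Suc j) ws') \<noteq> set (take (Suc j) vs)"
     using flip[OF l(3) j(1)] by blast
    have l': "length ws' = k" using ws'(1) by (simp add: oface_def)
    have e: "vs = take j vs @ [v]" "ws' = take j vs @ [ws' ! j]"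
     using jk l l' j(2) ws'(3) by (metis lessI take_Suc_conv_app_nth take_all_iff order_refl)+
    have "ws' ! j \<noteq> v" using ws'(4) l l' jk e by (metis take_all_iff order_refl)
    moreover have "ws' = vs[j := ws' ! j]" using e(2) jk l by (simp add: upd_conv_take_nth_drop)
    then have "(cface vs (Suc k))[j := Old (ws' ! j)] = cface ws' (Suc k)"
     using jk l l' by (simp add: cface_def list_update_append1 flip: map_update)
    ultimately show ?thesis
     by (intro fin[OF l(3), of "Suc k" j "Old (ws' ! j)" ws' "Suc k"]) (use su l j ws' Old in \<open>simp_all add: nth_cface\<close>)
   qed
  next
   case Top
   obtain vs where vs: "oface k L vs" "set (cface vs (Suc k)) = ?u" using cyl_facet[OF L a(2) cu, of "[]"] Top by auto
   show ?thesis
    by (rule fin[OF vs(1), of "Suc k" k "Bar (set (take k vs))" vs k])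
     (use vs Top cface_step(2)[of k vs] in \<open>auto simp: oface_def nth_cface\<close>)
  next
   case (Bar p)
   then have "Top \<notin> ?u" using a(2) by (auto simp: cyl_def bars_def)
   then obtain vs j where vs: "oface k L vs" "set (cface vs j) = ?u" "j \<le> k"
    using cyl_facet[OF L a(2) cu, of "[]"] by auto
   have l: "length vs = k" "distinct vs" using vs(1) by (auto simp: oface_def)
   have "p \<in> bars (set (cface vs j))" using vs(2) Bar by (simp add: bars_def)
   then obtain i where i: "j \<le> i" "i \<le> k" "p = set (take i vs)" using vs(3) l by (auto simp: set_cface)
   have nth: "cface vs j ! i = a" using i l Bar by (simp add: nth_cface)
   show ?thesis
   proof (cases "i = j")
    case True
    show ?thesis
     by (rule fin[OF vs(1) _ vs(2) i(2) nth, of "if j < k then Old (vs ! j) else Top" vs "Suc j"])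
      (use cface_step(1)[of j vs] True l vs Bar in auto)
   next
    case False
    then obtain m where m: "i = Suc m" "m < k" "j \<le> m" using i by (cases i) auto
    obtain ws where ws: "oface k L ws" "\<omega> ws = - \<omega> vs" "take m ws = take m vs" "set (take (Suc m) ws) \<noteq> set (take (Suc m) vs)"
     "\<forall>i\<le>k. i \<noteq> Suc m --> set (take i ws) = set (take i vs)" using flip[OF vs(1) m(2)] by blast
    have "take j ws = take j vs" using ws(3) m(3) by (metis min.absorb1 take_take)
    then have e: "(cface vs j)[i := Bar (set (take i ws))] = cface ws j"
     using m l ws(1,5) by (intro cface_change[symmetric]) (auto simp: oface_def)
    show ?thesis
     by (rule fin[OF vs(1) _ vs(2) i(2) nth e ws(1)]) (use vs(3) ws(2,4) i(3) Bar m(1) in simp_all)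
   qed
  qed
 qed
 then obtain \<omega>' where \<omega>': "ori (Suc k) (cyl L) \<omega>'" "\<forall>(r, e)\<in>R. \<omega>' r = e" by blast
 have "\<omega>' (cface vs j) = (- 1) ^ j * \<omega> vs" if "oface k L vs" "j \<le> Suc k" for vs j
  using bspec[OF \<omega>'(2) inR[OF that]] by simp
 then have "\<exists>\<omega>'. ori (Suc k) (cyl L) \<omega>' \<and>
   (\<forall>vs j. oface k L vs --> j \<le> Suc k --> \<omega>' (cface vs j) = (- 1) ^ j * \<omega> vs)"
  using \<omega>'(1) by (intro exI[of _ \<omega>']) simp
 from someI_ex[OF this] show "ori (Suc k) (cyl L) (cylo k L \<omega>)"
  "oface k L vs ==> j \<le> Suc k ==> cylo k L \<omega> (cface vs j) = (- 1) ^ j * \<omega> vs"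
  unfolding cylo_def by blast+
qed

section \<open>Vertex links of the cylinder\<close>

lemma oiso_ordered:
 assumes i: "oiso c \<phi> X \<omega> Y \<eta>" and us: "oface k X us"
 shows "oface k Y (map \<phi> us)" "\<eta> (map \<phi> us) = c * \<omega> us"
proof -
 have s: "set us \<in> X" using us by (simp add: oface_def)
 moreover have "inj_on \<phi> (set us)" using i s by (auto simp: oiso_def intro: inj_on_subset)
 ultimately show "oface k Y (map \<phi> us)" "\<eta> (map \<phi> us) = c * \<omega> us"
  using i us by (auto simp: oface_def oiso_def distinct_map)
qed

lemma oiso_inj: "oiso c \<phi> X \<omega> Y \<eta> ==> inj_on \<phi> (\<Union>X)" and oiso_image: "oiso c \<phi> X \<omega> Y \<eta> ==> (`) \<phi> ` X = Y"
 by (simp_all add: oiso_def)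

fun cmap :: "('a => 'b) => 'a cyl => 'b cyl" where
 "cmap \<phi> (Old v) = Old (\<phi> v)" | "cmap \<phi> (Bar s) = Bar (\<phi> ` s)" | "cmap \<phi> Top = Top"

lemma cface_map: "map (cmap \<phi>) (cface vs j) = cface (map \<phi> vs) j"
 by (simp add: cface_def take_map del: upt_Suc)

lemma cyl_facet_ex:
 assumes L: "sph k L" and u: "u \<in> cyl L" "card u = Suc k" and ts: "distinct ts" "set ts \<subseteq> olds u"
 shows "\<exists>vs j. oface k L (ts @ vs) \<and> length ts \<le> j \<and> j \<le> Suc k \<and> set (cface (ts @ vs) j) = u"
proof -
 let ?j = "if Top \<in> u then Suc k else card (olds u)"
 obtain vs where "oface k L (ts @ vs)" "set (cface (ts @ vs) ?j) = u" "length ts \<le> card (olds u)" "card (olds u) \<le> k"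
  using cyl_facet[OF assms] by blast
 then show ?thesis by (intro exI[of _ vs] exI[of _ ?j]) auto
qed

lemma oiso_cyl:
 assumes i: "oiso c \<phi> X \<omega> Y \<eta>" and X: "sph k X" "ori k X \<omega>" and Y: "sph k Y" "ori k Y \<eta>"
 shows "oiso c (cmap \<phi>) (cyl X) (cylo k X \<omega>) (cyl Y) (cylo k Y \<eta>)"
proof (rule oisoI_facets[OF sph_cyl[OF X(1)] cylo(1)[OF X] sph_cyl[OF Y(1)] cylo(1)[OF Y]])
 note inj = oiso_inj[OF i]
 have sub: "s \<subseteq> \<Union>X" if "s \<in> X" for s using that by blast
 show "inj_on (cmap \<phi>) (\<Union>(cyl X))"
 proof (rule inj_onI)
  fix x y assume xy: "x \<in> \<Union>(cyl X)" "y \<in> \<Union>(cyl X)" "cmap \<phi> x = cmap \<phi> y"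
  have o: "v \<in> \<Union>X" if "Old v \<in> \<Union>(cyl X)" for v using that by (auto simp: cyl_def olds_def)
  have b: "s \<in> X" if "Bar s \<in> \<Union>(cyl X)" for s using that by (auto simp: cyl_def bars_def)
  have "s = t" if "s \<in> X" "t \<in> X" "\<phi> ` s = \<phi> ` t" for s t using that inj_on_image_eq_iff[OF inj sub sub] by blast
  then show "x = y" using xy o b inj_onD[OF inj] by (cases x; cases y) simp_all
 qed
next
 fix u assume u: "u \<in> cyl X" "card u = Suc k"
 from cyl_facet_ex[OF X(1) this, of "[]"] obtain vs j where vs: "oface k X vs" "j \<le> Suc k" "set (cface vs j) = u"
  by auto
 note o = oiso_ordered[OF i vs(1)]
 have "cmap \<phi> ` u = set (cface (map \<phi> vs) j)" by (simp flip: vs(3) cface_map)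
 moreover have "set (cface (map \<phi> vs) j) \<in> cyl Y"
  using ordered_cface[OF sph_cpx[OF Y(1)] o(1) vs(2)] by (simp add: oface_def)
 moreover have "distinct (cface vs j)" using vs(1,2) by (simp add: oface_def distinct_cface)
 moreover have "cylo k Y \<eta> (map (cmap \<phi>) (cface vs j)) = c * cylo k X \<omega> (cface vs j)"
  unfolding cface_map using cylo(2)[OF Y o(1) vs(2)] cylo(2)[OF X vs(1,2)] o(2) by simp
 ultimately show "\<exists>r. distinct r \<and> set r = u \<and> cmap \<phi> ` u \<in> cyl Y \<and> cylo k Y \<eta> (map (cmap \<phi>) r) = c * cylo k X \<omega> r"
  using vs(3) by (intro exI[of _ "cface vs j"]) auto
next
 fix t assume t: "t \<in> cyl Y" "card t = Suc k"
 from cyl_facet_ex[OF Y(1) this, of "[]"] obtain ws j where ws: "oface k Y ws" "j \<le> Suc k" "set (cface ws j) = t"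
  by auto
 define vs where "vs = map (inv_into (\<Union>X) \<phi>) ws"
 have UY: "\<Union>Y = \<phi> ` \<Union>X" using oiso_image[OF i] Union_image_image by metis
 have "set ws \<subseteq> \<Union>Y" using ws(1) by (auto simp: oface_def)
 then have mv: "map \<phi> vs = ws" unfolding vs_def UY by (simp add: map_idI f_inv_into_f subset_iff)
 obtain s where s: "s \<in> X" "set ws = \<phi> ` s" using ws(1) oiso_image[OF i] by (auto simp: oface_def)
 have sv: "set vs = s" using inv_into_image_cancel[OF oiso_inj[OF i] Union_upper[OF s(1)]] s(2) by (simp add: vs_def)
 have "set (cface vs j) \<in> cyl X"
  using ws(1,2) s sv mv by (intro cface_mem[OF sph_cpx[OF X(1)]]) (auto simp: oface_def)
 moreover have "cmap \<phi> ` set (cface vs j) = t" by (simp flip: ws(3) mv cface_map)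
 ultimately show "\<exists>s\<in>cyl X. cmap \<phi> ` s = t" by blast
qed

lemma lk_reflection:
 assumes X: "cpx X" "ori (Suc k) X \<omega>" and w: "w \<in> \<Union>X" and S: "sph k (lk X w)"
  and \<tau>: "\<tau> w = w" "\<And>x. \<tau> (\<tau> x) = x"
  and facets: "\<And>u. u \<in> X ==> w \<in> u ==> card u = Suc k ==>
   \<exists>r. distinct r \<and> set r = u \<and> \<tau> ` u \<in> X \<and> \<omega> (map \<tau> r) = - \<omega> r"
 shows "oiso (- 1) \<tau> (lk X w) (ind w \<omega>) (lk X w) (ind w \<omega>)"
proof -
 have inj: "inj_on \<tau> A" for A by (metis \<tau>(2) inj_onI)
 note \<omega>' = ori_lk[OF X(2), of w] and alt = oriD(3)[OF X(2)]
 have one: "\<exists>r. distinct r \<and> set r = t \<and> \<tau> ` t \<in> lk X w \<and> ind w \<omega> (map \<tau> r) = - 1 * ind w \<omega> r"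
  if t: "t \<in> lk X w" "card t = k" for t
 proof -
  have u: "insert w t \<in> X" "w \<notin> t" using t by (auto simp: lk_def)
  have "finite t" using cpxD(3)[OF X(1) u(1)] by simp
  then have "card (insert w t) = Suc k" using u t by simp
  then obtain r where r: "distinct r" "set r = insert w t" "\<tau> ` insert w t \<in> X" "\<omega> (map \<tau> r) = - \<omega> r"
   using facets[OF u(1)] by blast
  obtain x y where xy: "r = x @ w # y" using r(2) by (metis insertI1 split_list)
  have st: "set (x @ y) = t" "distinct (x @ y)" using r(1,2) xy u(2) by auto
  have "\<omega> r = (- 1) ^ length x * \<omega> (w # x @ y)" unfolding xy by (rule alternating_move[OF alt])
  moreover have "\<omega> (map \<tau> r) = (- 1) ^ length x * \<omega> (w # map \<tau> (x @ y))"
   using alternating_move[OF alt, of "map \<tau> x" w "map \<tau> y"] by (simp add: xy \<tau>(1))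
  ultimately have "(- 1) ^ length x * \<omega> (w # map \<tau> (x @ y)) = (- 1) ^ length x * - \<omega> (w # x @ y)" using r(4) by simp
  then have "\<omega> (w # map \<tau> (x @ y)) = - \<omega> (w # x @ y)" unfolding mult_cancel_left by simp
  moreover have "\<tau> ` t \<in> lk X w"
  proof -
   have "w \<notin> \<tau> ` t" using u(2) \<tau> by (metis imageE)
   then show ?thesis using r(3) \<tau>(1) by (simp add: lk_def)
  qed
  ultimately show ?thesis using st by (intro exI[of _ "x @ y"]) (simp add: ind_def)
 qed
 show ?thesis
 proof (rule oisoI_facets[OF S \<omega>' S \<omega>' inj one])
  fix t assume t: "t \<in> lk X w" "card t = k"
  have "\<tau> ` t \<in> lk X w" using one[OF t] by blast
  moreover have "\<tau> ` \<tau> ` t = t" using \<tau>(2) by (simp add: image_image)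
  ultimately show "\<exists>s\<in>lk X w. \<tau> ` s = t" by blast
 qed
qed

lemma cyl_vertices:
 assumes "cpx L"
 shows "\<Union>(cyl L) = insert Top (Old ` \<Union>L \<union> Bar ` L)"
proof (intro equalityI subsetI)
 fix x assume "x \<in> \<Union>(cyl L)"
 then show "x \<in> insert Top (Old ` \<Union>L \<union> Bar ` L)" by (cases x) (auto simp: cyl_def olds_def bars_def)
next
 fix x assume x: "x \<in> insert Top (Old ` \<Union>L \<union> Bar ` L)"
 have "{v} \<in> L" if "v \<in> s" "s \<in> L" for v s using that cpxD(6)[OF assms] by blast
 then have "{x} \<in> cyl L"
  using x cpxD(2)[OF assms] by (auto simp: cyl_def nested_def olds_def bars_def)
 then show "x \<in> \<Union>(cyl L)" by blast
qed

lemma lk_cyl_Top: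
 assumes L: "sph k L" "ori k L \<omega>"
 shows "oiso (- 1) Old L \<omega> (lk (cyl L) Top) (ind Top (cylo k L \<omega>))"
proof (rule oisoI_flags[OF _ _ L(2) ori_lk[OF cylo(1)[OF L]]])
 have c: "cpx L" by (rule sph_cpx[OF L(1)])
 show "inj_on Old (\<Union>L)" by (simp add: inj_on_def)
 show "(`) Old ` L = lk (cyl L) Top"
 proof (intro equalityI subsetI)
  fix u assume "u \<in> lk (cyl L) Top"
  then have u: "Top \<notin> u" "insert Top u \<in> cyl L" by (auto simp: lk_def)
  then have "u = Old ` olds u" by (intro cyl_eqI) (auto simp: cyl_def)
  then show "u \<in> (`) Old ` L" using u by (auto simp: cyl_def)
 qed (auto simp: lk_def cyl_def nested_def)
 fix s assume s: "s \<in> L" "card s = k"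
 obtain r where r: "distinct r" "set r = s" using finite_distinct_list[OF cpxD(3)[OF c s(1)]] by blast
 then have o: "oface k L r" using s by (auto simp: oface_def) (metis distinct_card)
 then have lr: "length r = k" by (simp add: oface_def)
 have "ind Top (cylo k L \<omega>) (map Old r) = - \<omega> r"
 proof -
  have "cface r (Suc k) = map Old r @ Top # []" using lr by (simp add: cface_def)
  then have "(- 1) ^ Suc k * \<omega> r = (- 1) ^ k * cylo k L \<omega> (Top # map Old r)"
   using cylo(2)[OF L o, of "Suc k"] alternating_move[OF oriD(3)[OF cylo(1)[OF L]], of "map Old r" Top "[]"] lr by simp
  then have "(- 1) ^ k * ((- 1) ^ k * cylo k L \<omega> (Top # map Old r)) = (- 1) ^ k * ((- 1) ^ Suc k * \<omega> r)" by simp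
  then show ?thesis by (simp add: ind_def mult.assoc[symmetric] flip: power_add mult_2)
 qed
 then show "\<exists>r. distinct r \<and> set r = s \<and> ind Top (cylo k L \<omega>) (map Old r) = - 1 * \<omega> r"
  using r by (intro exI[of _ r]) simp
qed

lemma cface_0: "cface vs 0 = Bar {} # map Bar (flag vs)"
proof -
 have "[0..<Suc (length vs)] = 0 # map Suc [0..<length vs]" by (simp add: map_Suc_upt upt_conv_Cons del: upt_Suc)
 then show ?thesis by (simp add: cface_def flag_def del: upt_Suc)
qed

lemma lk_cyl_apex_oiso:
 assumes L: "sph k L" "ori k L \<omega>" and k: "k > 0"
 shows "oiso 1 Bar (sd L) (sdo k L \<omega>) (lk (cyl L) (Bar {})) (ind (Bar {}) (cylo k L \<omega>))"
proof -
 have c: "cpx L" and sm: "small_dim k L" using sph_cpx[OF L(1)] sph_small_dim[OF L(1)] by auto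
 note s = sdo[OF c sm L(2) k]
 show ?thesis
 proof (rule oisoI_flags[OF _ _ s(1) ori_lk[OF cylo(1)[OF L]]])
  show "inj_on Bar (\<Union>(sd L))" by (simp add: inj_on_def)
  show "(`) Bar ` sd L = lk (cyl L) (Bar {})" using lk_cyl_apex[OF c] by simp
  fix d assume "d \<in> sd L" "card d = k"
  from sd_facet_flag[OF c sm this k] obtain vs where vs: "oface k L vs" "set (flag vs) = d" by blast
  have "ind (Bar {}) (cylo k L \<omega>) (map Bar (flag vs)) = sdo k L \<omega> (flag vs)"
   using cylo(2)[OF L vs(1), of 0] s(2)[OF vs(1)] by (simp add: cface_0 ind_def)
  then show "\<exists>r. distinct r \<and> set r = d \<and> ind (Bar {}) (cylo k L \<omega>) (map Bar r) = 1 * sdo k L \<omega> r"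
   using vs by (intro exI[of _ "flag vs"]) (simp add: distinct_flag oface_def)
 qed
qed

fun cins :: "'a => 'a cyl => 'a cyl" where
 "cins v (Old u) = Old u" | "cins v (Bar r) = Bar (insert v r)" | "cins v Top = Top"

lemma cface_Cons: "cface (v # ws) (Suc j) = Old v # map (cins v) (cface ws j)"
proof -
 have "[Suc j..<Suc (Suc (length ws))] = map Suc [j..<Suc (length ws)]" by (simp add: map_Suc_upt del: upt_Suc)
 then show ?thesis by (simp add: cface_def del: upt_Suc)
qed

lemma lk_cyl_Old:
 assumes L: "sph (Suc k) L" "ori (Suc k) L \<omega>" and v: "v \<in> \<Union>L"
 shows "oiso (- 1) (cins v) (cyl (lk L v)) (cylo k (lk L v) (ind v \<omega>)) (lk (cyl L) (Old v)) (ind (Old v) (cylo (Suc k) L \<omega>))"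
proof -
 have c: "cpx L" by (rule sph_cpx[OF L(1)])
 have S: "sph k (lk L v)" using sph_lk[OF L(1) v] by auto
 note o = ori_lk[OF L(2), of v]
 have "Old v \<in> \<Union>(cyl L)" using v by (simp add: cyl_vertices[OF c])
 then have S': "sph (Suc k) (lk (cyl L) (Old v))" using sph_lk[OF sph_cyl[OF L(1)]] by auto
 show ?thesis
 proof (rule oisoI_facets[OF sph_cyl[OF S] cylo(1)[OF S o] S' ori_lk[OF cylo(1)[OF L]]])
  show "inj_on (cins v) (\<Union>(cyl (lk L v)))"
  proof (rule inj_onI)
   fix x y assume xy: "x \<in> \<Union>(cyl (lk L v))" "y \<in> \<Union>(cyl (lk L v))" "cins v x = cins v y"
   have b: "v \<notin> s" if "Bar s \<in> \<Union>(cyl (lk L v))" for s using that by (auto simp: cyl_def bars_def lk_def)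
   show "x = y" using xy b by (cases x; cases y) (auto simp: insert_ident)
  qed
 next
  fix u assume u: "u \<in> cyl (lk L v)" "card u = Suc k"
  from cyl_facet_ex[OF S this, of "[]"] obtain ws j where ws: "oface k (lk L v) ws" "j \<le> Suc k" "set (cface ws j) = u"
   by auto
  have ov: "oface (Suc k) L (v # ws)" using ws(1) by (simp add: oface_lk)
  have of: "oface (Suc (Suc k)) (cyl L) (Old v # map (cins v) (cface ws j))"
   using ordered_cface[OF c ov, of "Suc j"] ws(2) by (simp add: cface_Cons)
  have "cins v ` u \<in> lk (cyl L) (Old v)"
   using of ws(3) by (auto simp: oface_def lk_def)
  moreover have "ind (Old v) (cylo (Suc k) L \<omega>) (map (cins v) (cface ws j)) = - 1 * cylo k (lk L v) (ind v \<omega>) (cface ws j)"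
   using cylo(2)[OF L ov, of "Suc j"] cylo(2)[OF S o ws(1,2)] ws(2) by (simp add: cface_Cons ind_def)
  moreover have "distinct (cface ws j)" using ws by (simp add: oface_def distinct_cface)
  ultimately show "\<exists>r. distinct r \<and> set r = u \<and> cins v ` u \<in> lk (cyl L) (Old v) \<and>
    ind (Old v) (cylo (Suc k) L \<omega>) (map (cins v) r) = - 1 * cylo k (lk L v) (ind v \<omega>) r"
   using ws(3) by blast
 next
  fix t assume t: "t \<in> lk (cyl L) (Old v)" "card t = Suc k"
  have u: "insert (Old v) t \<in> cyl L" "Old v \<notin> t" using t by (auto simp: lk_def)
  have "finite t" using cpxD(3)[OF sph_cpx[OF sph_cyl[OF L(1)]] u(1)] by simp
  then have "card (insert (Old v) t) = Suc (Suc k)" using u t by simp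
  from cyl_facet_ex[OF L(1) u(1) this, of "[v]"] obtain ws j' where
   ws: "oface (Suc k) L (v # ws)" "1 \<le> j'" "j' \<le> Suc (Suc k)" "set (cface (v # ws) j') = insert (Old v) t" by auto
  obtain j where j: "j' = Suc j" using ws(2) by (cases j') auto
  have o': "oface k (lk L v) ws" using ws(1) by (simp add: oface_lk)
  have "set (cface ws j) \<in> cyl (lk L v)"
   using ordered_cface[OF cpx_lk[OF c v] o', of j] ws(3) j by (simp add: oface_def)
  moreover have "distinct (cface (v # ws) j')" using ws by (intro distinct_cface) (auto simp: oface_def)
  then have "Old v \<notin> cins v ` set (cface ws j)" by (simp add: j cface_Cons)
  then have "cins v ` set (cface ws j) = t" using ws(4) u(2) unfolding j cface_Cons by (simp add: insert_ident)
  ultimately show "\<exists>s\<in>cyl (lk L v). cins v ` s = t" by blast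
 qed
qed

text \<open>
 The symmetry exchanges two vertices of \<open>p\<close>; if there is only one vertex
 \<open>v\<close>, the link is a suspension, and its apexes \<open>Old v\<close> and
 \<open>Bar {}\<close> are exchanged.
\<close>

lemma lk_cyl_Bar:
 assumes L: "sph k L" "ori k L \<omega>" and p: "p \<in> L" "p \<noteq> {}"
 shows "\<exists>\<tau>. oiso (- 1) \<tau> (lk (cyl L) (Bar p)) (ind (Bar p) (cylo k L \<omega>)) (lk (cyl L) (Bar p)) (ind (Bar p) (cylo k L \<omega>))"
proof -
 have c: "cpx L" by (rule sph_cpx[OF L(1)])
 have fp: "finite p" by (rule cpxD(3)[OF c p(1)])
 have w: "Bar p \<in> \<Union>(cyl L)" using p by (simp add: cyl_vertices[OF c])
 have S: "sph k (lk (cyl L) (Bar p))" using sph_lk[OF sph_cyl[OF L(1)] w] by auto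
 \<comment> \<open>it suffices to find an involution that carries each ordered facet through \<open>Bar p\<close> to another one of opposite sign\<close>
 have reflect: ?thesis
  if \<tau>: "\<tau> (Bar p) = Bar p" "\<And>x. \<tau> (\<tau> x) = x"
   and facets: "\<And>vs j. oface k L vs ==> j \<le> card p ==> card p \<le> k ==> p = set (take (card p) vs) ==>
    \<exists>ws i. oface k L ws \<and> i \<le> Suc k \<and> map \<tau> (cface vs j) = cface ws i \<and> (- 1) ^ i * \<omega> ws = - ((- 1) ^ j * \<omega> vs)"
  for \<tau>
 proof (rule exI[of _ \<tau>], rule lk_reflection[OF sph_cpx[OF sph_cyl[OF L(1)]] cylo(1)[OF L] w S \<tau>])
  fix u assume u: "u \<in> cyl L" "Bar p \<in> u" "card u = Suc k"
  from cyl_facet_ex[OF L(1) u(1,3), of "[]"] obtain vs j where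
   vs: "oface k L vs" "j \<le> Suc k" "set (cface vs j) = u" by auto
  have l: "length vs = k" "distinct vs" using vs(1) by (auto simp: oface_def)
  have "p \<in> bars (set (cface vs j))" using vs(3) u(2) by (simp add: bars_def)
  then obtain i where i: "j \<le> i" "i \<le> k" "p = set (take i vs)" using vs(2) l by (auto simp: set_cface split: if_splits)
  have "card p = i" using i l by (simp add: distinct_card min_def)
  then obtain ws i where ws: "oface k L ws" "i \<le> Suc k" "map \<tau> (cface vs j) = cface ws i"
   "(- 1) ^ i * \<omega> ws = - ((- 1) ^ j * \<omega> vs)" using facets[OF vs(1)] i by blast
  have "\<tau> ` u \<in> cyl L"
   using ordered_cface[OF c ws(1,2)] unfolding vs(3)[symmetric] by (simp add: oface_def flip: ws(3))
  moreover have "cylo k L \<omega> (map \<tau> (cface vs j)) = - cylo k L \<omega> (cface vs j)"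
   unfolding ws(3) cylo(2)[OF L ws(1,2)] cylo(2)[OF L vs(1,2)] by (rule ws(4))
  ultimately show "\<exists>r. distinct r \<and> set r = u \<and> \<tau> ` u \<in> cyl L \<and> cylo k L \<omega> (map \<tau> r) = - cylo k L \<omega> r"
   using vs(2,3) l distinct_cface by blast
 qed
 show ?thesis
 proof (cases "card p = 1")
  case True
  then obtain v where v: "p = {v}" by (auto simp: card_1_singleton_iff)
  define \<tau> where "\<tau> = exchange (Bar {}) (Old v)"
  show ?thesis
  proof (rule reflect[of \<tau>])
   show "\<tau> (Bar p) = Bar p" using v by (simp add: \<tau>_def exchange_def)
   show "\<tau> (\<tau> x) = x" for x by (simp add: \<tau>_def)
   fix vs j assume vs: "oface k L vs" "j \<le> card p" "card p \<le> k" "p = set (take (card p) vs)"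
   have l: "length vs = k" "distinct vs" using vs(1) by (auto simp: oface_def)
   obtain ws where ws: "vs = v # ws" using vs(3,4) l v by (cases vs) auto
   have d: "distinct (cface vs 0)" "distinct (cface vs 1)" using l by (simp_all add: distinct_cface)
   obtain R where R: "cface vs 0 = Bar {} # R" using cface_0 by metis
   have "cface vs 1 = (cface vs 0)[0 := Old v]" using cface_step(1)[of 0 vs] ws by simp
   then have R1: "cface vs 1 = Old v # R" using R by simp
   have nR: "map \<tau> R = R"
    using d unfolding R R1 by (intro map_idI) (auto simp: \<tau>_def exchange_def)
   have m: "map \<tau> (cface vs 0) = cface vs 1" "map \<tau> (cface vs 1) = cface vs 0"
    unfolding R R1 using nR by (simp_all add: \<tau>_def)
   have "j = 0 \<or> j = 1" using vs(2) True by auto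
   then have "map \<tau> (cface vs j) = cface vs (1 - j)" "(- 1 :: int) ^ (1 - j) = - ((- 1) ^ j)" using m by auto
   then show "\<exists>ws i. oface k L ws \<and> i \<le> Suc k \<and> map \<tau> (cface vs j) = cface ws i \<and>
     (- 1) ^ i * \<omega> ws = - ((- 1) ^ j * \<omega> vs)"
    using vs(1) by (intro exI[of _ vs] exI[of _ "1 - j"]) simp
  qed
 next
  case False
  moreover have "card p > 0" using fp p(2) by (simp add: card_gt_0_iff)
  ultimately have "card p \<ge> 2" by simp
  then obtain a b where ab: "a \<in> p" "b \<in> p" "a \<noteq> b"
   using card_le_Suc0_iff_eq[OF fp] by auto
  define \<tau> where "\<tau> = cmap (exchange a b)"
  show ?thesis
  proof (rule reflect[of \<tau>])
   show "\<tau> (Bar p) = Bar p" using ab by (simp add: \<tau>_def exchange_image)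
   show "\<tau> (\<tau> x) = x" for x by (cases x) (simp_all add: \<tau>_def image_image)
   fix vs j assume vs: "oface k L vs" "j \<le> card p" "card p \<le> k" "p = set (take (card p) vs)"
   have pv: "p \<subseteq> set vs" by (subst vs(4)) (rule set_take_subset)
   define ws where "ws = map (exchange a b) vs"
   have sw: "set ws = set vs" using ab pv exchange_image[of a "set vs" b] by (auto simp: ws_def)
   have o: "oface k L ws"
    using vs(1) sw by (auto simp: oface_def ws_def distinct_map inj_on_def) (metis exchange_simps(3))
   have "\<omega> ws = - \<omega> vs"
    unfolding ws_def using vs(1) ab pv by (intro alternating_exchange[OF oriD(3)[OF L(2)]]) (auto simp: oface_def)
   then show "\<exists>ws i. oface k L ws \<and> i \<le> Suc k \<and> map \<tau> (cface vs j) = cface ws i \<and>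
     (- 1) ^ i * \<omega> ws = - ((- 1) ^ j * \<omega> vs)"
    using o vs(2,3) by (intro exI[of _ ws] exI[of _ j]) (simp add: \<tau>_def cface_map ws_def)
  qed
 qed
qed

text \<open>
 The cylinder is a manifold, and only three kinds of its vertex links have no symmetry: that
 of \<open>Top\<close> is \<open>- L\<close>, that of \<open>Bar {}\<close> is the
 barycentric subdivision of \<open>L\<close>, and that of \<open>Old v\<close> is the
 cylinder over the link of \<open>v\<close>, with the opposite orientation.
\<close>

lemma cyl_formula:
 assumes f: "f \<in> sphere_cochains (int (Suc k))" "kills_manifolds (Suc k) f"
  and L: "sph (Suc k) L" "ori (Suc k) L \<omega>"
 shows "at_cpx f (Suc k) L \<omega> = at_cpx f (Suc k) (sd L) (sdo (Suc k) L \<omega>)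
   - (\<Sum>v\<in>\<Union>L. at_cpx f (Suc k) (cyl (lk L v)) (cylo k (lk L v) (ind v \<omega>)))"
proof -
 let ?C = "cyl L" and ?o = "cylo (Suc k) L \<omega>" and ?f = "at_cpx f (Suc k)"
 have c: "cpx L" by (rule sph_cpx[OF L(1)])
 note oC = cylo(1)[OF L] and sC = sph_cyl[OF L(1)] and cC = sph_cpx[OF sph_cyl[OF L(1)]]
 have sl: "sph (Suc k) (lk ?C x)" if "x \<in> \<Union>?C" for x using sph_lk[OF sC that] by auto
 have "omfd (Suc k) ?C ?o" using cC oC sl by (simp add: omfd_def)
 from kills_manifolds_generic[OF f(2) this]
 have sum0: "(\<Sum>x\<in>insert Top (Old ` \<Union>L \<union> Bar ` L). ?f (lk ?C x) (ind x ?o)) = 0"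
  by (simp add: cyl_vertices[OF c])
 have fin: "finite (\<Union>L)" "finite L" using cpxD[OF c] by auto
 have vx: "Top \<in> \<Union>?C" "Bar {} \<in> \<Union>?C" "\<And>v. v \<in> \<Union>L ==> Old v \<in> \<Union>?C" "\<And>p. p \<in> L ==> Bar p \<in> \<Union>?C"
  using cpxD(2)[OF c] by (auto simp: cyl_vertices[OF c])
 have top: "?f (lk ?C Top) (ind Top ?o) = - ?f L \<omega>"
  by (rule at_cpx_oiso_neg[OF f(1) lk_cyl_Top[OF L] L sph_cpx[OF sl[OF vx(1)]] ori_lk[OF oC]])
 have s: "sph (Suc k) (sd L)" by (rule sph_sd[OF L(1)])
 have os: "ori (Suc k) (sd L) (sdo (Suc k) L \<omega>)" by (rule sdo(1)[OF c sph_small_dim[OF L(1)] L(2)]) simp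
 have apex: "?f (lk ?C (Bar {})) (ind (Bar {}) ?o) = ?f (sd L) (sdo (Suc k) L \<omega>)"
  by (rule at_cpx_oiso[OF lk_cyl_apex_oiso[OF L] sph_cpx[OF s] os sph_cpx[OF sl[OF vx(2)]] ori_lk[OF oC], symmetric]) simp
 have old: "?f (lk ?C (Old v)) (ind (Old v) ?o) = - ?f (cyl (lk L v)) (cylo k (lk L v) (ind v \<omega>))" if v: "v \<in> \<Union>L" for v
 proof -
  have S: "sph k (lk L v)" using sph_lk[OF L(1) v] by auto
  show ?thesis
   by (rule at_cpx_oiso_neg[OF f(1) lk_cyl_Old[OF L v] sph_cyl[OF S] cylo(1)[OF S ori_lk[OF L(2)]]
      sph_cpx[OF sl[OF vx(3)[OF v]]] ori_lk[OF oC]])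
 qed
 have bar: "?f (lk ?C (Bar p)) (ind (Bar p) ?o) = 0" if p: "p \<in> L" "p \<noteq> {}" for p
  using at_cpx_reflection[OF f(1) _ sl[OF vx(4)[OF p(1)]] ori_lk[OF oC]] lk_cyl_Bar[OF L p] by blast
 have "(\<Sum>x\<in>insert Top (Old ` \<Union>L \<union> Bar ` L). ?f (lk ?C x) (ind x ?o))
   = ?f (lk ?C Top) (ind Top ?o) + ((\<Sum>x\<in>Old ` \<Union>L. ?f (lk ?C x) (ind x ?o)) + (\<Sum>x\<in>Bar ` L. ?f (lk ?C x) (ind x ?o)))"
  using fin by (subst sum.insert, simp, force, subst sum.union_disjoint) auto
 also have "(\<Sum>x\<in>Old ` \<Union>L. ?f (lk ?C x) (ind x ?o)) = (\<Sum>v\<in>\<Union>L. ?f (lk ?C (Old v)) (ind (Old v) ?o))"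
  by (rule sum.reindex[unfolded o_def]) (simp add: inj_on_def)
 also have "\<dots> = - (\<Sum>v\<in>\<Union>L. ?f (cyl (lk L v)) (cylo k (lk L v) (ind v \<omega>)))"
  using old by (simp add: sum_negf)
 also have "(\<Sum>x\<in>Bar ` L. ?f (lk ?C x) (ind x ?o)) = (\<Sum>p\<in>L. ?f (lk ?C (Bar p)) (ind (Bar p) ?o))"
  by (rule sum.reindex[unfolded o_def]) (simp add: inj_on_def)
 also have "\<dots> = ?f (lk ?C (Bar {})) (ind (Bar {}) ?o)"
  using fin bar cpxD(2)[OF c] by (subst sum.remove[of L "{}"]) (auto intro!: sum.neutral)
 finally show ?thesis using sum0 top apex by simp
qed

text \<open>
 The cochain that takes the values of an invariant \<open>H\<close> of oriented spheres.
\<close>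

definition class_fun :: "nat => (nat set set => (nat list => int) => rat) => oriented_cpx set => rat" where
 "class_fun k H C = (if C \<in> sphere_classes (int k)
   then case_prod H (SOME X. X \<in> oriented_spheres (int k - 1) \<and> iso_class (int k - 1) X = C) else 0)"

lemma oiso_of_iso_class_eq:
 assumes X: "sph k X" "ori k X \<omega>" and Y: "sph k Y" "ori k Y \<eta>"
  and eq: "iso_class (int k - 1) (X, \<omega>) = iso_class (int k - 1) (Y, \<eta>)"
 shows "\<exists>\<phi>. oiso 1 \<phi> X \<omega> Y \<eta>"
proof -
 have v: "verts X = \<Union>X" if "cpx X" for X :: "nat set set" using cpxD(4,6)[OF that] by (auto simp: verts_def)
 have "(Y, \<eta>) \<in> oriented_cpxs (int k - 1)"
  using Y by (simp add: oriented_cpxs_def simplicial_cpx_eq_cpx sph_cpx is_orientation_iff_ori)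
 then have "(Y, \<eta>) \<in> iso_class (int k - 1) (X, \<omega>)"
  unfolding eq unfolding iso_class_def by (rule equiv_class_self[OF equiv_oriented_iso])
 then have "((X, \<omega>), (Y, \<eta>)) \<in> oriented_iso (int k - 1)" by (simp add: iso_class_def)
 then obtain \<phi> where "inj_on \<phi> (verts X)" "(`) \<phi> ` X = Y" "\<And>vs. set vs \<in> X ==> \<eta> (map \<phi> vs) = \<omega> vs"
  by (rule oriented_isoE) blast
 then show ?thesis using v[OF sph_cpx[OF X(1)]] unfolding oiso_def by (intro exI[of _ \<phi>]) simp
qed

lemma class_fun:
 assumes inv: "\<And>\<phi> X \<omega> Y \<eta> c. oiso c \<phi> X \<omega> Y \<eta> ==> sph k X ==> ori k X \<omega> ==> sph k Y ==> ori k Y \<eta> ==>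
   c = 1 \<or> c = -1 ==> H Y \<eta> = of_int c * H X \<omega>"
 shows "class_fun k H \<in> sphere_cochains (int k)"
  "sph k X ==> ori k X \<omega> ==> class_fun k H (iso_class (int k - 1) (X, \<omega>)) = H X \<omega>"
proof -
 have val: "class_fun k H (iso_class (int k - 1) (X, \<omega>)) = H X \<omega>" if X: "sph k X" "ori k X \<omega>" for X \<omega>
 proof -
  define Z where "Z = (SOME Z. Z \<in> oriented_spheres (int k - 1) \<and> iso_class (int k - 1) Z = iso_class (int k - 1) (X, \<omega>))"
  have XS: "(X, \<omega>) \<in> oriented_spheres (int k - 1)" using X by (simp add: sphere_iff)
  then have Z: "Z \<in> oriented_spheres (int k - 1) \<and> iso_class (int k - 1) Z = iso_class (int k - 1) (X, \<omega>)"
   unfolding Z_def by (rule someI[where P = "\<lambda>Z. Z \<in> _ \<and> _ Z = _", OF conjI[OF _ refl]])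
  obtain Y \<eta> where Y: "Z = (Y, \<eta>)" by (metis surj_pair)
  have SY: "sph k Y" "ori k Y \<eta>" using Z unfolding Y sphere_iff by blast+
  obtain \<phi> where "oiso 1 \<phi> Y \<eta> X \<omega>" using oiso_of_iso_class_eq[OF SY X] Z unfolding Y by metis
  then have "H X \<omega> = H Y \<eta>" using inv[OF _ SY X] by fastforce
  moreover have "iso_class (int k - 1) (X, \<omega>) \<in> sphere_classes (int k)"
   unfolding sphere_classes_def using XS by blast
  ultimately show ?thesis unfolding class_fun_def Z_def[symmetric] Y by simp
 qed
 then show "sph k X ==> ori k X \<omega> ==> class_fun k H (iso_class (int k - 1) (X, \<omega>)) = H X \<omega>" .
 show "class_fun k H \<in> sphere_cochains (int k)"
  unfolding sphere_cochains_def mem_Collect_eq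
 proof (intro conjI allI impI)
  fix L \<omega> assume "(L, \<omega>) \<in> oriented_spheres (int k - 1)"
  then have L: "sph k L" "ori k L \<omega>" by (simp_all add: sphere_iff)
  have oo: "opposite \<omega> = opp \<omega>" by (rule ext) (simp add: opposite_def opp_def)
  have "oiso (- 1) id L \<omega> L (opp \<omega>)" by (simp add: oiso_def opp_def)
  from inv[OF this L L(1) ori_opp[OF L(2)]] have "H L (opp \<omega>) = - H L \<omega>" by simp
  then show "class_fun k H (iso_class (int k - 1) (L, opposite \<omega>)) = - class_fun k H (iso_class (int k - 1) (L, \<omega>))"
   unfolding oo val[OF L] val[OF L(1) ori_opp[OF L(2)]] .
 qed (simp add: class_fun_def)
qed

lemma at_cpx_class_fun:
 fixes X :: "'a set set"
 assumes inv: "\<And>\<phi> X \<omega> Y \<eta> c. oiso c \<phi> X \<omega> Y \<eta> ==> sph k X ==> ori k X \<omega> ==> sph k Y ==> ori k Y \<eta> ==>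
   c = 1 \<or> c = -1 ==> H Y \<eta> = of_int c * H X \<omega>"
  and X: "sph k X" "ori k X \<omega>"
 shows "at_cpx (class_fun k H) k X \<omega> = H ((`) (numbering X) ` X) (transfer_ori (numbering X) X \<omega>)"
 unfolding at_cpx_def
 by (rule class_fun(2)[OF inv sph_iso[OF X(1) numbering[OF sph_cpx[OF X(1)]]]
    transfer_ori(1)[OF numbering[OF sph_cpx[OF X(1)]] X(2)]])

lemma at_cpx_sign:
 fixes f :: "oriented_cpx set => rat"
 assumes "f \<in> sphere_cochains (int k)" "oiso c \<phi> X \<omega> Y \<eta>" "c = 1 \<or> c = -1" "sph k X" "ori k X \<omega>" "sph k Y" "ori k Y \<eta>"
 shows "at_cpx f k Y \<eta> = of_int c * at_cpx f k X \<omega>"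
 using assms at_cpx_oiso[of \<phi> X \<omega> Y \<eta> k f] at_cpx_oiso_neg[of f k \<phi> X \<omega> Y \<eta>] sph_cpx[OF assms(4)] sph_cpx[OF assms(6)] by auto

definition Sd :: "nat => (oriented_cpx set => rat) => oriented_cpx set => rat" where
 "Sd k f = class_fun k (\<lambda>L \<omega>. at_cpx f k (sd L) (sdo k L \<omega>))"

lemma sdo_sph: "sph k X ==> ori k X \<omega> ==> k > 0 ==> ori k (sd X) (sdo k X \<omega>)"
 using sdo(1)[OF sph_cpx sph_small_dim] by blast

lemma Sd:
 assumes f: "f \<in> sphere_cochains (int k)" and k: "k > 0"
 shows "Sd k f \<in> sphere_cochains (int k)"
  "sph k X ==> ori k X \<omega> ==> at_cpx (Sd k f) k X \<omega> = at_cpx f k (sd X) (sdo k X \<omega>)"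
proof -
 have inv: "at_cpx f k (sd Y) (sdo k Y \<eta>) = of_int c * at_cpx f k (sd X) (sdo k X \<omega>)"
  if i: "oiso c \<phi> X \<omega> Y \<eta>" and X: "sph k X" "ori k X \<omega>" and Y: "sph k Y" "ori k Y \<eta>" and c: "c = 1 \<or> c = -1"
  for \<phi> :: "'x => 'y" and X \<omega> Y \<eta> c
  by (rule at_cpx_sign[OF f oiso_sd[OF i sph_cpx[OF X(1)] sph_small_dim[OF X(1)] X(2) sph_cpx[OF Y(1)] sph_small_dim[OF Y(1)] Y(2) k]
     c sph_sd[OF X(1)] sdo_sph[OF X k] sph_sd[OF Y(1)] sdo_sph[OF Y k]])
 show "Sd k f \<in> sphere_cochains (int k)" unfolding Sd_def by (rule class_fun(1)) (rule inv)
 show "at_cpx (Sd k f) k X \<omega> = at_cpx f k (sd X) (sdo k X \<omega>)" if X: "sph k X" "ori k X \<omega>"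
 proof -
  note n = numbering[OF sph_cpx[OF X(1)]]
  have "at_cpx (Sd k f) k X \<omega> = at_cpx f k (sd ((`) (numbering X) ` X)) (sdo k ((`) (numbering X) ` X) (transfer_ori (numbering X) X \<omega>))"
   unfolding Sd_def by (rule at_cpx_class_fun[OF inv X])
  also have "\<dots> = of_int 1 * at_cpx f k (sd X) (sdo k X \<omega>)"
   by (rule inv[OF transfer_ori(2)[OF n X(2)] X sph_iso[OF X(1) n] transfer_ori(1)[OF n X(2)]]) simp
  finally show ?thesis by simp
 qed
qed

text \<open>
 In other words, \<open>f\<close> and \<open>Sd f\<close> differ by a coboundary. By
 \<open>cyl_formula\<close>, the cochain \<open>g\<close> takes the value \<open>- f (cyl
 S)\<close> at \<open>S\<close>.
\<close>

lemma Sd_step: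
 assumes f: "f \<in> sphere_cochains (int (Suc k))" "kills_manifolds (Suc k) f"
 shows "\<exists>g\<in>sphere_cochains (int k). \<forall>L \<omega>. sph (Suc k) (L :: nat set set) \<and> ori (Suc k) L \<omega> -->
   at_cpx f (Suc k) L \<omega> = at_cpx (Sd (Suc k) f) (Suc k) L \<omega> + (\<Sum>v\<in>\<Union>L. at_cpx g k (lk L v) (ind v \<omega>))"
proof -
 define H where "H S \<eta> = - at_cpx f (Suc k) (cyl S) (cylo k S \<eta>)" for S :: "nat set set" and \<eta>
 have inv0: "at_cpx f (Suc k) (cyl Y) (cylo k Y \<eta>) = of_int c * at_cpx f (Suc k) (cyl X) (cylo k X \<omega>)"
  if i: "oiso c \<phi> X \<omega> Y \<eta>" and X: "sph k X" "ori k X \<omega>" and Y: "sph k Y" "ori k Y \<eta>" and c: "c = 1 \<or> c = -1"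
  for \<phi> :: "'x => 'y" and X \<omega> Y \<eta> c
  by (rule at_cpx_sign[OF f(1) oiso_cyl[OF i X Y] c sph_cyl[OF X(1)] cylo(1)[OF X] sph_cyl[OF Y(1)] cylo(1)[OF Y]])
 have inv: "H Y \<eta> = of_int c * H X \<omega>"
  if "oiso c \<phi> X \<omega> Y \<eta>" "sph k X" "ori k X \<omega>" "sph k Y" "ori k Y \<eta>" "c = 1 \<or> c = -1" for \<phi> X \<omega> Y \<eta> c
  using inv0[OF that] by (simp add: H_def)
 define g where "g = class_fun k H"
 have g: "g \<in> sphere_cochains (int k)" unfolding g_def by (rule class_fun(1)[OF inv])
 have gv: "at_cpx g k S \<eta> = - at_cpx f (Suc k) (cyl S) (cylo k S \<eta>)" if "sph k S" "ori k S \<eta>" for S :: "nat set set" and \<eta>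
  using at_cpx_nat[OF sph_cpx[OF that(1)] that(2), of g] class_fun(2)[OF inv that] by (simp add: g_def H_def)
 have "at_cpx f (Suc k) L \<omega> = at_cpx (Sd (Suc k) f) (Suc k) L \<omega> + (\<Sum>v\<in>\<Union>L. at_cpx g k (lk L v) (ind v \<omega>))"
  if L: "sph (Suc k) L" "ori (Suc k) L \<omega>" for L :: "nat set set" and \<omega>
 proof -
  have "sph k (lk L v)" if "v \<in> \<Union>L" for v using sph_lk[OF L(1) that] by auto
  then have "(\<Sum>v\<in>\<Union>L. at_cpx g k (lk L v) (ind v \<omega>)) = - (\<Sum>v\<in>\<Union>L. at_cpx f (Suc k) (cyl (lk L v)) (cylo k (lk L v) (ind v \<omega>)))"
   using gv ori_lk[OF L(2)] by (simp add: sum_negf)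
  then show ?thesis using cyl_formula[OF f L] Sd(2)[OF f(1) _ L] by simp
 qed
 then show ?thesis using g by blast
qed

lemma link_cochain_sum_zero:
 fixes K :: "nat set set"
 assumes g: "g \<in> sphere_cochains (int k)" and K: "omfd (Suc k) K \<omega>"
 shows "(\<Sum>v\<in>\<Union>K. \<Sum>w\<in>\<Union>(lk K v). at_cpx g k (lk (lk K v) w) (ind w (ind v \<omega>))) = (0 :: rat)"
proof -
 have c: "cpx K" and o: "ori (Suc (Suc k)) K \<omega>" and l: "\<And>v. v \<in> \<Union>K ==> sph (Suc k) (lk K v)"
  using K by (auto simp: omfd_def)
 define h where "h s \<eta> = at_cpx g k (lks K s) \<eta>" for s \<eta>
 have lk2: "lk (lk K v) w = lks K {v, w}" if "v \<noteq> w" for v w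
  using that by (auto simp: lk_def lks_def insert_commute)
 have "(\<Sum>v\<in>\<Union>K. \<Sum>w\<in>\<Union>(lk K v). h {v, w} (ind w (ind v \<omega>))) = 0"
 proof (rule double_link_sum_zero[OF c o])
  fix v w assume vw: "v \<noteq> w" "{v, w} \<in> K"
  then have "w \<in> \<Union>(lk K v)" by (intro UnionI[of "{w}"]) (auto simp: lk_def)
  then have "sph k (lk (lk K v) w)" using sph_lk[OF l, of v w] vw by auto
  moreover have "ind w (ind v (opp \<omega>)) = opp (ind w (ind v \<omega>))" by (rule ext) (simp add: ind_def opp_def)
  ultimately show "h {v, w} (ind w (ind v (opp \<omega>))) = - h {v, w} (ind w (ind v \<omega>))"
   using at_cpx_opp[OF g _ ori_lk[OF ori_lk[OF o]], of v w] by (simp add: h_def flip: lk2[OF vw(1)])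
 qed simp
 moreover have "at_cpx g k (lk (lk K v) w) (ind w (ind v \<omega>)) = h {v, w} (ind w (ind v \<omega>))" if "w \<in> \<Union>(lk K v)" for v w
  using that unfolding h_def by (subst lk2) (auto simp: lk_def)
 ultimately show ?thesis by simp
qed

lemma Sd_kills:
 assumes f: "f \<in> sphere_cochains (int (Suc k))" "kills_manifolds (Suc k) f"
 shows "kills_manifolds (Suc k) (Sd (Suc k) f)"
 unfolding kills_manifolds_def
proof (intro allI impI)
 fix K :: "nat set set" and \<omega> assume K: "omfd (Suc k) K \<omega>"
 then have o: "ori (Suc (Suc k)) K \<omega>" and l: "\<And>v. v \<in> \<Union>K ==> sph (Suc k) (lk K v)"
  by (auto simp: omfd_def)
 obtain g where g: "g \<in> sphere_cochains (int k)" "\<And>L \<omega>. sph (Suc k) (L :: nat set set) ==> ori (Suc k) L \<omega> ==>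
   at_cpx f (Suc k) L \<omega> = at_cpx (Sd (Suc k) f) (Suc k) L \<omega> + (\<Sum>v\<in>\<Union>L. at_cpx g k (lk L v) (ind v \<omega>))"
  using Sd_step[OF f] by blast
 have "(\<Sum>v\<in>\<Union>K. at_cpx f (Suc k) (lk K v) (ind v \<omega>)) = (\<Sum>v\<in>\<Union>K. at_cpx (Sd (Suc k) f) (Suc k) (lk K v) (ind v \<omega>))
   + (\<Sum>v\<in>\<Union>K. \<Sum>w\<in>\<Union>(lk K v). at_cpx g k (lk (lk K v) w) (ind w (ind v \<omega>)))"
  using g(2)[OF l ori_lk[OF o]] by (simp add: sum.distrib)
 moreover have "(\<Sum>v\<in>\<Union>K. at_cpx f (Suc k) (lk K v) (ind v \<omega>)) = 0" using f(2) K by (simp add: kills_manifolds_def)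
 ultimately show "(\<Sum>v\<in>\<Union>K. at_cpx (Sd (Suc k) f) (Suc k) (lk K v) (ind v \<omega>)) = 0"
  using link_cochain_sum_zero[OF g(1) K] by simp
qed

section \<open>Gluing cells along mirrors\<close>

lemma simplex_ori: "\<exists>\<omega>. ori n (Pow {..<n}) \<omega> \<and> \<omega> [0..<n] = 1"
proof -
 have top: "s = {..<n}" if "s \<in> Pow {..<n}" "card s = n" for s
  using that by (intro card_subset_eq) auto
 have "\<exists>\<omega>. ori n (Pow {..<n}) \<omega> \<and> (\<forall>(r, e)\<in>{([0..<n], 1)}. \<omega> r = e)"
 proof (rule exists_ori)
  show "cpx (Pow {..<n})" by (auto simp: cpx_def intro: finite_subset)
  show "\<exists>r e. (r, e) \<in> {([0..<n], 1)} \<and> set r = s" if "s \<in> Pow {..<n}" "card s = n" for s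
   using top[OF that] by (auto simp: atLeast0LessThan)
  fix a b and s :: "nat set"
  assume s: "a \<noteq> b" "a \<notin> s" "b \<notin> s" "insert a s \<in> Pow {..<n}" "insert b s \<in> Pow {..<n}" "Suc (card s) = n"
  then have "finite s" by (auto intro: finite_subset)
  then have "insert a s = insert b s" using s top[of "insert a s"] top[of "insert b s"] by simp
  then show "\<exists>r i e. (r, e) \<in> {([0..<n], 1)} \<and> i < n \<and> r ! i = a \<and> set r = insert a s \<and> (r[i := b], - e) \<in> {([0..<n], 1)}"
   using s(1-3) by blast
 qed (auto simp: oface_def atLeast0LessThan)
 then show ?thesis by simp
qed

lemma oface_map:
 assumes "inj_on f (\<Union>K)" "\<And>s. s \<in> K ==> f ` s \<in> L" "oface k K vs"
 shows "oface k L (map f vs)"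
 using assms by (auto simp: oface_def distinct_map intro: inj_on_subset)

lemma sd_mono: "K \<subseteq> L ==> sd K \<subseteq> sd L"
 by (auto simp: sd_def)

lemma nested_Union:
 assumes "finite d" "d \<noteq> {}" "nested d"
 shows "\<Union>d \<in> d"
 using assms
proof (induction rule: finite_ne_induct)
 case (insert s d)
 then have "\<Union>d \<in> d" by (auto intro: nested_subset)
 then have "s \<subseteq> \<Union>d \<or> \<Union>d \<subseteq> s" using insert.prems by (auto simp: nested_def)
 then have "\<Union>(insert s d) = \<Union>d \<or> \<Union>(insert s d) = s" by auto
 then show ?case using \<open>\<Union>d \<in> d\<close> by auto
qed simp

text \<open>
 The boundary of the cross-polytope: a simplex contains at most one of two opposite vertices
 for each element of \<open>A\<close>.
\<close>

definition cross :: "'a set => ('a \<times> bool) set set" where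
 "cross A = {t. fst ` t \<subseteq> A \<and> inj_on fst t}"

lemma sph_cross: "finite A ==> sph (card A) (cross A)"
proof (induction rule: finite_induct)
 case empty
 have "cross ({} :: 'a set) = {{}}" by (auto simp: cross_def)
 moreover have "bdry {undefined :: 'a \<times> bool} = {{}}" by (auto simp: bdry_def)
 ultimately show ?case using sph_bdry[of "{undefined :: 'a \<times> bool}" 0] by simp
next
 case (insert a A)
 let ?P = "{{}, {(a, True)}, {(a, False)}}"
 have "cross (insert a A) = join ?P (cross A)"
 proof (intro equalityI subsetI)
  fix t assume t: "t \<in> cross (insert a A)"
  let ?s = "t \<inter> {(a, True), (a, False)}"
  have "\<not> ((a, True) \<in> t \<and> (a, False) \<in> t)"
   using t inj_onD[of fst t "(a, True)" "(a, False)"] by (auto simp: cross_def)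
  then have "?s \<in> ?P" by blast
  moreover have "t - ?s \<in> cross A"
  proof -
   have "x \<in> A" if "(x, b) \<in> t" "x \<noteq> a" for x b using that t by (force simp: cross_def)
   then show ?thesis using t by (auto simp: cross_def intro: inj_on_subset)
  qed
  moreover have "t = ?s \<union> (t - ?s)" by blast
  ultimately show "t \<in> join ?P (cross A)" unfolding join_def mem_Collect_eq by (metis (no_types, lifting))
 next
  fix t assume "t \<in> join ?P (cross A)"
  then obtain s u where t: "t = s \<union> u" "s \<in> ?P" "u \<in> cross A" by (auto simp: join_def)
  have u: "fst ` u \<subseteq> A" "inj_on fst u" using t(3) by (simp_all add: cross_def)
  have "s = {} \<or> (\<exists>b. s = {(a, b)})" using t(2) by blast
  then show "t \<in> cross (insert a A)"
  proof (elim disjE exE)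
   fix b assume s: "s = {(a, b)}"
   have "a \<notin> fst ` u" using u(1) insert.hyps by blast
   then have "inj_on fst (insert (a, b) u)" using u(2) by (auto simp: inj_on_insert)
   then show ?thesis using u(1) unfolding t(1) s cross_def by auto
  qed (use u in \<open>auto simp: t(1) cross_def\<close>)
 qed
 moreover have "\<Union>?P \<inter> \<Union>(cross A) = {}" using insert.hyps by (auto simp: cross_def)
 moreover have "sph 1 ?P" by (rule sph_two_points) simp
 ultimately show ?case using sph_join[OF _ insert.IH, of 1 ?P] insert.hyps by simp
qed

definition agree :: "('y => 'i) => ('y => nat => 'v) => nat set => 'y => 'y => bool" where
 "agree cell p C y z \<longleftrightarrow> cell y = cell z \<and> (\<forall>c\<in>C. p y c = p z c)"

text \<open>
 A closed manifold is glued from cells. The link of the centre of cell \<open>i\<close> is the oriented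
 sphere \<open>X i\<close>, up to subdivision; its facets are the chambers \<open>y\<close> of the
 cell, and the vertices \<open>p y c\<close> of a chamber have distinct colours \<open>c <
 n\<close>. For each type \<open>C\<close>, a nonempty set of colours, the involution
 \<open>\<Phi> C\<close> says which chamber is met on passing from chamber \<open>y\<close>
 through the mirror dual to the face of \<open>y\<close> with the colours in
 \<open>C\<close>. Passages for nested types commute (\<open>\<Phi>_comm\<close>); chambers
 that share a face containing the one to be passed still share it afterwards
 (\<open>\<Phi>_agree\<close>); and orientations are reversed. The set \<open>g y\<close>
 records the parity of the number of passages of each type, so that no two chambers of the
 same cell are identified (\<open>fold_trivial\<close>).
\<close>

locale gluing =
 fixes n :: nat and Y :: "'y set" and cell :: "'y => 'i" and p :: "'y => nat => 'v"
  and X :: "'i => 'v set set" and \<eta> :: "'i => 'v list => int"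
  and \<Phi> :: "nat set => 'y => 'y" and g :: "'y => nat set set"
 assumes finY: "finite Y" and n: "n > 0"
  and sphX: "\<And>y. y \<in> Y ==> sph n (X (cell y))" and oriX: "\<And>y. y \<in> Y ==> ori n (X (cell y)) (\<eta> (cell y))"
  and facet: "\<And>y. y \<in> Y ==> oface n (X (cell y)) (map (p y) [0..<n])"
  and all_facets: "\<And>y s. y \<in> Y ==> s \<in> X (cell y) ==> \<exists>z\<in>Y. cell z = cell y \<and> s \<subseteq> p z ` {..<n}"
  and colour: "\<And>y z c d. y \<in> Y ==> z \<in> Y ==> cell y = cell z ==> c < n ==> d < n ==> p y c = p z d ==> c = d"
  and separated: "\<And>y z. y \<in> Y ==> z \<in> Y ==> agree cell p {..<n} y z ==> y = z"
  and \<Phi>_in: "\<And>C y. C \<in> Pow {..<n} - {{}} ==> y \<in> Y ==> \<Phi> C y \<in> Y"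
  and \<Phi>_inv: "\<And>C y. C \<in> Pow {..<n} - {{}} ==> y \<in> Y ==> \<Phi> C (\<Phi> C y) = y"
  and \<Phi>_comm: "\<And>B C y. B \<in> Pow {..<n} - {{}} ==> C \<in> Pow {..<n} - {{}} ==> B \<subseteq> C ==> y \<in> Y ==> \<Phi> C (\<Phi> B y) = \<Phi> B (\<Phi> C y)"
  and \<Phi>_agree: "\<And>C D y z. C \<in> Pow {..<n} - {{}} ==> C \<subseteq> D ==> D \<subseteq> {..<n} ==> y \<in> Y ==> z \<in> Y ==>
   agree cell p D y z ==> agree cell p D (\<Phi> C y) (\<Phi> C z)"
  and \<Phi>_sign: "\<And>C y. C \<in> Pow {..<n} - {{}} ==> y \<in> Y ==>
   \<eta> (cell (\<Phi> C y)) (map (p (\<Phi> C y)) [0..<n]) = - \<eta> (cell y) (map (p y) [0..<n])"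
  and g_cell: "\<And>y z. y \<in> Y ==> z \<in> Y ==> cell y = cell z ==> g y = g z"
  and g_\<Phi>: "\<And>B C y. C \<in> Pow {..<n} - {{}} ==> y \<in> Y ==> B \<in> g (\<Phi> C y) \<longleftrightarrow> (B \<in> g y) \<noteq> (B = C)"
begin

abbreviation types :: "nat set set set" where "types \<equiv> sd (Pow {..<n})"

text \<open>
 Chambers are related if passages through the mirrors of types in the chain \<open>D\<close>
 take the first into the cell of the second, to a chamber that shares with it the vertices of
 all colours occurring in \<open>D\<close>.
\<close>

definition rel :: "nat set set => 'y => 'y => bool" where
 "rel D y z \<longleftrightarrow> (\<exists>ws\<in>lists D. agree cell p (\<Union>D) (fold \<Phi> ws y) z)"

definition vx :: "'y => nat set set => nat set set \<times> 'y set" where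
 "vx y D = (D, {z \<in> Y. rel D y z})"

text \<open>
 The glued manifold is given by a triangulation. Its vertices are the classes of chambers
 under \<open>rel D\<close> for chains \<open>D\<close> of types: for \<open>D = {}\<close>
 the centre of a cell, otherwise the barycentre of an intersection of mirrors. A simplex
 consists of the classes of one chamber for a chain of such \<open>D\<close>.
\<close>

definition K :: "(nat set set \<times> 'y set) set set" where
 "K = {vx y ` \<sigma> | y \<sigma>. y \<in> Y \<and> \<sigma> \<subseteq> types \<and> nested \<sigma>}"

lemma typesD: "D \<in> types ==> C \<in> D ==> C \<in> Pow {..<n} - {{}}" "D \<in> types ==> \<Union>D \<subseteq> {..<n}" "D \<in> types ==> nested D"
 "D \<in> types ==> E \<subseteq> D ==> E \<in> types" "{} \<in> types" "finite types" "D \<in> types ==> finite D"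
proof -
 have "cpx (Pow {..<n})" by (auto simp: cpx_def intro: finite_subset)
 note c = cpxD[OF cpx_sd[OF this]]
 show "{} \<in> types" "finite types" "D \<in> types ==> finite D" "D \<in> types ==> E \<subseteq> D ==> E \<in> types" using c by blast+
qed (auto simp: sd_def)

lemma agree_equiv: "agree cell p C y y" "agree cell p C y z ==> agree cell p C z y"
 "agree cell p C x y ==> agree cell p C y z ==> agree cell p C x z" "agree cell p C y z ==> B \<subseteq> C ==> agree cell p B y z"
 by (auto simp: agree_def)

lemma comm: "D \<in> types ==> B \<in> D ==> C \<in> D ==> y \<in> Y ==> \<Phi> C (\<Phi> B y) = \<Phi> B (\<Phi> C y)"
 using \<Phi>_comm[OF typesD(1) typesD(1)] typesD(3)[of D] unfolding nested_def by metis

lemma fold_in: "D \<in> types ==> ws \<in> lists D ==> y \<in> Y ==> fold \<Phi> ws y \<in> Y"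
 by (induction ws arbitrary: y) (auto intro: \<Phi>_in dest: typesD(1))

lemma fold_comm: "D \<in> types ==> ws \<in> lists D ==> C \<in> D ==> y \<in> Y ==> fold \<Phi> ws (\<Phi> C y) = \<Phi> C (fold \<Phi> ws y)"
 by (induction ws arbitrary: y) (auto simp: comm[of D C] \<Phi>_in[OF typesD(1)])

lemma fold_rev: "D \<in> types ==> ws \<in> lists D ==> y \<in> Y ==> fold \<Phi> (rev ws) (fold \<Phi> ws y) = y"
 by (induction ws arbitrary: y) (auto simp: \<Phi>_in[OF typesD(1)] \<Phi>_inv[OF typesD(1)])

lemma fold_agree: "D \<in> types ==> ws \<in> lists D ==> y \<in> Y ==> z \<in> Y ==> agree cell p (\<Union>D) y z ==>
  agree cell p (\<Union>D) (fold \<Phi> ws y) (fold \<Phi> ws z)"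
proof (induction ws arbitrary: y z)
 case (Cons C ws)
 then have "agree cell p (\<Union>D) (\<Phi> C y) (\<Phi> C z)"
  by (intro \<Phi>_agree typesD(2) typesD(1)[of D]) auto
 then show ?case using Cons \<Phi>_in[OF typesD(1)[of D C]] by simp
qed simp

lemma g_fold: "D \<in> types ==> ws \<in> lists D ==> y \<in> Y ==> B \<notin> set ws ==> B \<in> g (fold \<Phi> ws y) \<longleftrightarrow> B \<in> g y"
 by (induction ws arbitrary: y) (auto simp: g_\<Phi>[OF typesD(1)] \<Phi>_in[OF typesD(1)])

text \<open>
 As the passages commute and are involutions, letters of a word cancel in pairs, and a letter
 left over would be recorded by \<open>g\<close>.
\<close>

lemma fold_trivial:
 assumes D: "D \<in> types"
 shows "ws \<in> lists D ==> y \<in> Y ==> g (fold \<Phi> ws y) = g y ==> fold \<Phi> ws y = y"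
proof (induction ws rule: length_induct)
 case (1 ws)
 show ?case
 proof (cases ws)
  case (Cons C us)
  have C: "C \<in> D" "us \<in> lists D" "\<Phi> C y \<in> Y" using 1 Cons \<Phi>_in[OF typesD(1)[OF D]] by auto
  have "C \<in> set us"
  proof (rule ccontr)
   assume "C \<notin> set us"
   then have "C \<in> g (fold \<Phi> ws y) \<longleftrightarrow> C \<notin> g y"
    using g_fold[OF D C(2,3), of C] g_\<Phi>[OF typesD(1)[OF D C(1)] "1.prems"(2), of C] by (simp add: Cons)
   then show False using 1 by simp
  qed
  then obtain a b where us: "us = a @ C # b" by (metis split_list)
  have ab: "a \<in> lists D" "b \<in> lists D" using C(2) us by auto
  have "fold \<Phi> ws y = fold \<Phi> b (\<Phi> C (\<Phi> C (fold \<Phi> a y)))"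
   using fold_comm[OF D ab(1) C(1)] 1 by (simp add: Cons us)
  also have "\<dots> = fold \<Phi> (a @ b) y"
   using \<Phi>_inv[OF typesD(1)[OF D C(1)] fold_in[OF D ab(1)]] 1 by simp
  finally have e: "fold \<Phi> ws y = fold \<Phi> (a @ b) y" .
  have "fold \<Phi> (a @ b) y = y"
   using "1.IH"[rule_format, of "a @ b"] 1 ab Cons us e by simp
  then show ?thesis using e by simp
 qed simp
qed

lemma fold_unique:
 assumes D: "D \<in> types" and ws: "ws \<in> lists D" "us \<in> lists D" and y: "y \<in> Y" and g: "g (fold \<Phi> ws y) = g (fold \<Phi> us y)"
 shows "fold \<Phi> ws y = fold \<Phi> us y"
proof -
 let ?z = "fold \<Phi> us y"
 have z: "?z \<in> Y" by (rule fold_in[OF D ws(2) y])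
 have y': "fold \<Phi> (rev us) ?z = y" by (rule fold_rev[OF D ws(2) y])
 have "rev us @ ws \<in> lists D" using ws by auto
 from fold_trivial[OF D this z] show ?thesis using g y' by simp
qed

lemma rel_refl: "rel D y y"
 unfolding rel_def by (intro bexI[of _ "[]"]) (auto simp: agree_equiv)

lemma rel_trans:
 assumes D: "D \<in> types" and Y: "x \<in> Y" "y \<in> Y" and r: "rel D x y" "rel D y z"
 shows "rel D x z"
proof -
 obtain us ws where us: "us \<in> lists D" "agree cell p (\<Union>D) (fold \<Phi> us x) y" and ws: "ws \<in> lists D" "agree cell p (\<Union>D) (fold \<Phi> ws y) z"
  using r by (auto simp: rel_def)
 have "agree cell p (\<Union>D) (fold \<Phi> ws (fold \<Phi> us x)) z"
  by (rule agree_equiv(3)[OF fold_agree[OF D ws(1) fold_in[OF D us(1) Y(1)] Y(2) us(2)] ws(2)])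
 then show ?thesis unfolding rel_def using us(1) ws(1) by (intro bexI[of _ "us @ ws"]) auto
qed

lemma rel_sym:
 assumes D: "D \<in> types" and Y: "x \<in> Y" "y \<in> Y" and r: "rel D x y"
 shows "rel D y x"
proof -
 obtain us where us: "us \<in> lists D" "agree cell p (\<Union>D) (fold \<Phi> us x) y" using r by (auto simp: rel_def)
 have "rev us \<in> lists D" using us(1) by auto
 from fold_agree[OF D this fold_in[OF D us(1) Y(1)] Y(2) us(2)] fold_rev[OF D us(1) Y(1)] this
 show ?thesis unfolding rel_def using agree_equiv(2) by (intro bexI[of _ "rev us"]) auto
qed

lemma vx_eq:
 assumes "y \<in> Y" "z \<in> Y" "D \<in> types"
 shows "vx y D = vx z D \<longleftrightarrow> rel D y z"
proof -
 have "{x \<in> Y. rel D y x} = {x \<in> Y. rel D z x}" if r: "rel D y z"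
 proof (intro Collect_cong conj_cong refl iffI)
  show "rel D z x" if "rel D y x" for x by (rule rel_trans[OF assms(3,2,1) rel_sym[OF assms(3,1,2) r] that])
  show "rel D y x" if "rel D z x" for x by (rule rel_trans[OF assms(3,1,2) r that])
 qed
 moreover have "rel D y z" if "{x \<in> Y. rel D y x} = {x \<in> Y. rel D z x}"
  using that rel_refl[of D z] assms(2) by blast
 ultimately have "{x \<in> Y. rel D y x} = {x \<in> Y. rel D z x} \<longleftrightarrow> rel D y z" by blast
 then show ?thesis by (simp add: vx_def)
qed

lemma fst_vx [simp]: "fst (vx y D) = D"
 by (simp add: vx_def)

lemma vx_inj: "inj_on (vx y) A"
 by (rule inj_onI) (simp add: vx_def)

lemma vx_in_image: "vx y D \<in> vx z ` \<sigma> \<longleftrightarrow> D \<in> \<sigma> \<and> vx y D = vx z D"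
 by (auto simp: vx_def)

lemma rel_agree:
 assumes D: "D \<in> types" and Y: "y \<in> Y" "z \<in> Y" and r: "rel D y z" and g: "g y = g z"
 shows "agree cell p (\<Union>D) y z"
proof -
 obtain us where us: "us \<in> lists D" "agree cell p (\<Union>D) (fold \<Phi> us y) z" using r by (auto simp: rel_def)
 have "g (fold \<Phi> us y) = g z" using g_cell[OF fold_in[OF D us(1) Y(1)] Y(2)] us(2) by (simp add: agree_def)
 then show ?thesis using fold_trivial[OF D us(1) Y(1)] us(2) g by simp
qed

lemma agree_rel: "agree cell p (\<Union>D) y z ==> rel D y z"
 unfolding rel_def by (intro bexI[of _ "[]"]) auto

lemma rel_empty: "rel {} y z \<longleftrightarrow> cell y = cell z"
 by (auto simp: rel_def agree_def)

text \<open>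
 The chamber \<open>w\<close> interpolates between \<open>y\<close> and \<open>z\<close>: it lies in the orbit of \<open>y\<close> and agrees with \<open>z\<close>, hence
 shares with \<open>z\<close> the vertices of \<open>K\<close> below \<open>D\<close>, and with \<open>y\<close> those above \<open>D\<close>.
\<close>

lemma rel_split:
 assumes D: "D \<in> types" and Y: "y \<in> Y" "z \<in> Y" and r: "rel D y z"
 obtains w where "w \<in> Y" "\<And>E. E \<subseteq> D ==> rel E w z" "\<And>E. D \<subseteq> E ==> rel E y w" "agree cell p (\<Union>D) w z" "rel D y w"
proof -
 obtain us where us: "us \<in> lists D" "agree cell p (\<Union>D) (fold \<Phi> us y) z" using r by (auto simp: rel_def)
 show thesis
 proof (rule that)
  show "fold \<Phi> us y \<in> Y" by (rule fold_in[OF D us(1) Y(1)])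
  show "rel E (fold \<Phi> us y) z" if "E \<subseteq> D" for E
   using agree_rel agree_equiv(4)[OF us(2) Union_mono[OF that]] by blast
  show up: "rel E y (fold \<Phi> us y)" if "D \<subseteq> E" for E
   unfolding rel_def using us(1) that agree_equiv(1) by (intro bexI[of _ us]) auto
  show "rel D y (fold \<Phi> us y)" by (rule up) simp
 qed (rule us(2))
qed

lemma in_K: "y \<in> Y ==> \<sigma> \<subseteq> types ==> nested \<sigma> ==> vx y ` \<sigma> \<in> K"
 unfolding K_def by blast

lemma cpx_K:
 assumes "Y \<noteq> {}"
 shows "cpx K"
proof -
 have "K \<subseteq> (\<lambda>(y, \<sigma>). vx y ` \<sigma>) ` (Y \<times> Pow types)" unfolding K_def by auto
 then have "finite K" using finY typesD(6) by (auto intro: finite_subset)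
 moreover have "{} \<in> K" using assms in_K[of _ "{}"] by (auto simp: nested_def)
 moreover have "finite s" if "s \<in> K" for s
  using that typesD(6) unfolding K_def by (auto intro: finite_subset)
 moreover have "t \<in> K" if s: "s \<in> K" "t \<subseteq> s" for s t
 proof -
  obtain y \<sigma> where y: "s = vx y ` \<sigma>" "y \<in> Y" "\<sigma> \<subseteq> types" "nested \<sigma>" using s(1) unfolding K_def by blast
  then obtain \<rho> where "\<rho> \<subseteq> \<sigma>" "t = vx y ` \<rho>" using s(2) by (auto simp: subset_image_iff)
  then show ?thesis using y in_K[of y \<rho>] nested_subset by blast
 qed
 ultimately show ?thesis by (auto simp: cpx_def)
qed

lemma vertices_K: "\<Union>K = {vx y D | y D. y \<in> Y \<and> D \<in> types}"
proof (intro equalityI subsetI)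
 fix v assume "v \<in> {vx y D | y D. y \<in> Y \<and> D \<in> types}"
 then obtain y D where v: "v = vx y D" "y \<in> Y" "D \<in> types" by blast
 have "vx y ` {D} \<in> K" using v by (intro in_K) (auto simp: nested_def)
 then show "v \<in> \<Union>K" using v by blast
qed (auto simp: K_def)

lemma lk_K:
 assumes y: "y \<in> Y" and D: "D \<in> types"
 shows "lk K (vx y D) = {vx z ` \<sigma> | z \<sigma>. z \<in> Y \<and> rel D y z \<and> \<sigma> \<subseteq> types \<and> D \<notin> \<sigma> \<and> nested (insert D \<sigma>)}"
proof (intro equalityI subsetI)
 fix t assume "t \<in> lk K (vx y D)"
 then have t: "vx y D \<notin> t" "insert (vx y D) t \<in> K" by (auto simp: lk_def)
 then obtain z \<sigma> where z: "insert (vx y D) t = vx z ` \<sigma>" "z \<in> Y" "\<sigma> \<subseteq> types" "nested \<sigma>" unfolding K_def by blast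
 then obtain E where E: "E \<in> \<sigma>" "vx y D = vx z E" by blast
 then have e: "E = D" "rel D y z" using vx_eq[OF y z(2) D] by (metis fst_vx)+
 have "t = vx z ` (\<sigma> - {D})"
  using t(1) z(1) E(2) e(1) vx_inj[of z UNIV] by (auto simp: inj_image_mem_iff image_set_diff[of "vx z"])
 moreover have "insert D (\<sigma> - {D}) = \<sigma>" using E e by blast
 ultimately show "t \<in> {vx z ` \<sigma> | z \<sigma>. z \<in> Y \<and> rel D y z \<and> \<sigma> \<subseteq> types \<and> D \<notin> \<sigma> \<and> nested (insert D \<sigma>)}"
  using z e(2) by (intro CollectI exI[of _ z] exI[of _ "\<sigma> - {D}"]) auto
next
 fix t assume "t \<in> {vx z ` \<sigma> | z \<sigma>. z \<in> Y \<and> rel D y z \<and> \<sigma> \<subseteq> types \<and> D \<notin> \<sigma> \<and> nested (insert D \<sigma>)}"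
 then obtain z \<sigma> where z: "t = vx z ` \<sigma>" "z \<in> Y" "rel D y z" "\<sigma> \<subseteq> types" "D \<notin> \<sigma>" "nested (insert D \<sigma>)" by blast
 have e: "vx y D = vx z D" using vx_eq[OF y z(2) D] z(3) by simp
 have "vx z ` insert D \<sigma> \<in> K" using z D by (intro in_K) auto
 moreover have "vx z D \<notin> t" using z(1,5) vx_inj[of z UNIV] by (auto simp: inj_image_mem_iff)
 ultimately show "t \<in> lk K (vx y D)" unfolding lk_def e using z(1) by simp
qed

end

section \<open>The orientation of the glued manifold\<close>

lemma set_in_flag:
 assumes "vs \<noteq> []"
 shows "set vs \<in> set (flag vs)"
proof -
 have "set vs = set (take (Suc (length vs - 1)) vs)" "length vs - 1 < length vs" using assms by simp_all
 then show ?thesis unfolding set_flag by blast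
qed

context gluing
begin

text \<open>
 The face of the twice subdivided chamber that corresponds to the chain \<open>D\<close> of
 types.
\<close>

definition place :: "'y => nat set set => 'v set set" where
 "place y D = (\<lambda>C. p y ` C) ` D"

abbreviation "S i \<equiv> sd (sd (X i))"
abbreviation "\<epsilon> i \<equiv> sdo n (sd (X i)) (sdo n (X i) (\<eta> i))"

text \<open>
 The identification of the twice subdivided \<open>X i\<close> with the link of the centre of
 cell \<open>i\<close>.
\<close>

definition \<xi> :: "'i => 'v set set => nat set set \<times> 'y set" where
 "\<xi> i s = (SOME v. \<exists>y D. y \<in> Y \<and> cell y = i \<and> D \<in> types \<and> s = place y D \<and> v = vx y D)"

lemma cpxs: "y \<in> Y ==> cpx (X (cell y))" "y \<in> Y ==> small_dim n (X (cell y))" "y \<in> Y ==> sph n (S (cell y))"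
 "y \<in> Y ==> ori n (S (cell y)) (\<epsilon> (cell y))"
 using sph_cpx[OF sphX] sph_small_dim[OF sphX] sphX oriX n by (simp_all add: sph_sd sdo_sph)

lemma simplex_cpx: "cpx (Pow {..<n})" "small_dim n (Pow {..<n})"
 by (auto simp: cpx_def small_dim_def intro: finite_subset) (metis card_lessThan card_mono finite_lessThan)

lemmas types_cpx = cpx_sd[OF simplex_cpx(1)] small_dim_sd[OF simplex_cpx]

lemma p_facet: "y \<in> Y ==> p y ` {..<n} \<in> X (cell y)" "y \<in> Y ==> inj_on (p y) {..<n}"
 using facet[of y] by (auto simp: oface_def distinct_map atLeast0LessThan)

lemma colour_image:
 assumes "y \<in> Y" "z \<in> Y" "cell y = cell z" "B \<subseteq> {..<n}" "C \<subseteq> {..<n}" "p y ` B = p z ` C"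
 shows "B = C" "\<And>c. c \<in> B ==> p y c = p z c"
proof -
 have 1: "c \<in> C \<and> p y c = p z c" if "c \<in> B" for c
 proof -
  have "p y c \<in> p z ` C" using that assms(6) by blast
  then obtain d where d: "d \<in> C" "p y c = p z d" by blast
  then have "c = d" using colour[OF assms(1-3), of c d] that assms(4,5) by auto
  then show ?thesis using d by simp
 qed
 have 2: "c \<in> B" if "c \<in> C" for c
 proof -
  have "p z c \<in> p y ` B" using that assms(6) by blast
  then obtain d where d: "d \<in> B" "p y d = p z c" by (metis imageE)
  then show ?thesis using colour[OF assms(1-3), of d c] that assms(4,5) by auto
 qed
 show "B = C" "\<And>c. c \<in> B ==> p y c = p z c" using 1 2 by blast+
qed

lemma place_eq:
 assumes "y \<in> Y" "z \<in> Y" "cell y = cell z" "D \<in> types" "E \<in> types" "place y D = place z E"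
 shows "D = E" "agree cell p (\<Union>D) y z"
proof -
 have sub: "C \<in> E \<and> (\<forall>c\<in>C. p y c = p z c)"
  if y: "y \<in> Y" "z \<in> Y" "cell y = cell z" "D \<in> types" "E \<in> types" "place y D = place z E" and C: "C \<in> D" for C D E y z
 proof -
  have "p y ` C \<in> (\<lambda>C. p z ` C) ` E" using C y(6) unfolding place_def by blast
  then obtain B where B: "B \<in> E" "p y ` C = p z ` B" by blast
  have "C \<subseteq> {..<n}" "B \<subseteq> {..<n}" using typesD(1)[OF y(4) C] typesD(1)[OF y(5) B(1)] by auto
  from colour_image[OF y(1-3) this B(2)] show ?thesis using B(1) by blast
 qed
 show "D = E" using sub[OF assms] sub[OF assms(2,1) assms(3)[symmetric] assms(5,4) assms(6)[symmetric]] by blast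
 show "agree cell p (\<Union>D) y z" using sub[OF assms] assms(3) by (auto simp: agree_def)
qed

lemma place_cong: "agree cell p (\<Union>D) y z ==> place y D = place z D"
 unfolding place_def agree_def by (intro image_cong refl) auto

lemma \<xi>:
 assumes "y \<in> Y" "D \<in> types"
 shows "\<xi> (cell y) (place y D) = vx y D"
 unfolding \<xi>_def
proof (rule some_equality)
 show "\<exists>z E. z \<in> Y \<and> cell z = cell y \<and> E \<in> types \<and> place y D = place z E \<and> vx y D = vx z E" using assms by blast
 fix v assume "\<exists>z E. z \<in> Y \<and> cell z = cell y \<and> E \<in> types \<and> place y D = place z E \<and> v = vx z E"
 then obtain z E where z: "z \<in> Y" "cell z = cell y" "E \<in> types" "place y D = place z E" "v = vx z E" by blast
 note e = place_eq[OF assms(1) z(1) z(2)[symmetric] assms(2) z(3,4)]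
 show "v = vx y D" using z(5) agree_rel[OF e(2)] vx_eq[OF assms(1) z(1) assms(2)] e(1) by simp
qed

lemma cell_sd2:
 assumes y0: "y0 \<in> Y"
 shows "S (cell y0) = {place y ` \<sigma> | y \<sigma>. y \<in> Y \<and> cell y = cell y0 \<and> \<sigma> \<in> sd types}"
proof -
 have im: "(\<lambda>\<sigma>. place y ` \<sigma>) ` sd types = sd (sd (Pow (p y ` {..<n})))" if y: "y \<in> Y" for y
 proof -
  have "inj_on (p y) (\<Union>(Pow {..<n}))" using p_facet(2)[OF y] by simp
  note i = sd_image[OF this] inj_on_image_sets[OF this]
  have "inj_on (\<lambda>s. p y ` s) (\<Union>types)" unfolding Union_sd by (rule inj_on_subset[OF i(2)]) auto
  from sd_image[OF this] show ?thesis
   using i(1) image_Pow_surj[OF refl, of "p y" "{..<n}"] by (simp add: place_def)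
 qed
 show ?thesis
 proof (intro equalityI subsetI)
  fix d assume d: "d \<in> S (cell y0)"
  have "\<exists>s\<in>X (cell y0). d \<in> sd (sd (Pow s))"
  proof (cases "d = {}")
   case True
   then show ?thesis using p_facet(1)[OF y0] by (auto simp: sd_def nested_def)
  next
   case False
   have d1: "finite d" "nested d" "d \<subseteq> sd (X (cell y0)) - {{}}"
    using d cpxD(3)[OF cpx_sd[OF cpx_sd[OF cpxs(1)[OF y0]]]] by (auto simp: sd_def)
   then have m: "\<Union>d \<in> d" using nested_Union False by blast
   then have m1: "\<Union>d \<in> sd (X (cell y0))" "\<Union>d \<noteq> {}" using d1 by auto
   then have "\<Union>(\<Union>d) \<in> \<Union>d"
    using cpxD(3)[OF cpx_sd[OF cpxs(1)[OF y0]]] by (intro nested_Union) (auto simp: sd_def)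
   then have "\<Union>(\<Union>d) \<in> X (cell y0)" using m1 by (auto simp: sd_def)
   moreover have "d \<in> sd (sd (Pow (\<Union>(\<Union>d))))" using d1 by (auto simp: sd_def)
   ultimately show ?thesis by blast
  qed
  then obtain s where s: "s \<in> X (cell y0)" "d \<in> sd (sd (Pow s))" by blast
  obtain z where z: "z \<in> Y" "cell z = cell y0" "s \<subseteq> p z ` {..<n}" using all_facets[OF y0 s(1)] by blast
  have "sd (sd (Pow s)) \<subseteq> sd (sd (Pow (p z ` {..<n})))" using z(3) by (intro sd_mono) auto
  then have "d \<in> (\<lambda>\<sigma>. place z ` \<sigma>) ` sd types" using s(2) im[OF z(1)] by auto
  then show "d \<in> {place y ` \<sigma> | y \<sigma>. y \<in> Y \<and> cell y = cell y0 \<and> \<sigma> \<in> sd types}" using z by blast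
 next
  fix d assume "d \<in> {place y ` \<sigma> | y \<sigma>. y \<in> Y \<and> cell y = cell y0 \<and> \<sigma> \<in> sd types}"
  then obtain y \<sigma> where y: "y \<in> Y" "cell y = cell y0" "\<sigma> \<in> sd types" "d = place y ` \<sigma>" by blast
  then have "d \<in> sd (sd (Pow (p y ` {..<n})))" using im[OF y(1)] by blast
  moreover have "Pow (p y ` {..<n}) \<subseteq> X (cell y0)"
   using p_facet(1)[OF y(1)] cpxD(4)[OF cpxs(1)[OF y0]] y(2) by auto
  ultimately show "d \<in> S (cell y0)" using sd_mono[OF sd_mono] by blast
 qed
qed

lemma in_sd_types: "\<sigma> \<in> sd types \<longleftrightarrow> \<sigma> \<subseteq> types \<and> {} \<notin> \<sigma> \<and> nested \<sigma>" "nested (insert {} \<sigma>) \<longleftrightarrow> nested \<sigma>"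
 by (auto simp: sd_def[of types] nested_def)

text \<open>
 Injectivity is due to \<open>g\<close>: related chambers of the same cell agree
 (\<open>rel_agree\<close>).
\<close>

lemma lk_cell:
 assumes y: "y \<in> Y"
 shows "inj_on (\<xi> (cell y)) (\<Union>(S (cell y)))" "(\<lambda>s. \<xi> (cell y) ` s) ` S (cell y) = lk K (vx y {})"
proof -
 have v: "\<exists>z D. z \<in> Y \<and> cell z = cell y \<and> D \<in> types \<and> s = place z D" if "s \<in> \<Union>(S (cell y))" for s
  using that unfolding cell_sd2[OF y] in_sd_types by blast
 show "inj_on (\<xi> (cell y)) (\<Union>(S (cell y)))"
 proof (rule inj_onI)
  fix s t assume st: "s \<in> \<Union>(S (cell y))" "t \<in> \<Union>(S (cell y))" "\<xi> (cell y) s = \<xi> (cell y) t"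
  obtain z D where z: "z \<in> Y" "cell z = cell y" "D \<in> types" "s = place z D" using v[OF st(1)] by blast
  obtain w E where w: "w \<in> Y" "cell w = cell y" "E \<in> types" "t = place w E" using v[OF st(2)] by blast
  have e: "vx z D = vx w E" using st(3) \<xi>[OF z(1,3)] \<xi>[OF w(1,3)] z w by simp
  then have DE: "D = E" by (metis fst_vx)
  then have "rel D z w" using e vx_eq[OF z(1) w(1) z(3)] by simp
  then have "agree cell p (\<Union>D) z w" using rel_agree[OF z(3,1) w(1)] g_cell[OF z(1) w(1)] z w by simp
  then show "s = t" using place_cong z w DE by simp
 qed
 have e: "\<xi> (cell y) ` place z ` \<sigma> = vx z ` \<sigma>" if "z \<in> Y" "cell z = cell y" "\<sigma> \<in> sd types" for z \<sigma>
  unfolding image_image using that \<xi>[OF that(1)] by (intro image_cong) (auto simp: in_sd_types)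
 show "(\<lambda>s. \<xi> (cell y) ` s) ` S (cell y) = lk K (vx y {})"
 proof (intro equalityI subsetI)
  fix t assume "t \<in> (\<lambda>s. \<xi> (cell y) ` s) ` S (cell y)"
  then obtain z \<sigma> where z: "z \<in> Y" "cell z = cell y" "\<sigma> \<in> sd types" "t = \<xi> (cell y) ` place z ` \<sigma>"
   unfolding cell_sd2[OF y] by blast
  then show "t \<in> lk K (vx y {})" unfolding lk_K[OF y typesD(5)] rel_empty in_sd_types(2)
   using e[OF z(1-3)] z(3) unfolding in_sd_types(1) by (intro CollectI exI[of _ z] exI[of _ \<sigma>]) simp
 next
  fix t assume "t \<in> lk K (vx y {})"
  then obtain z \<sigma> where z: "z \<in> Y" "cell y = cell z" "\<sigma> \<in> sd types" "t = vx z ` \<sigma>"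
   unfolding lk_K[OF y typesD(5)] in_sd_types rel_empty by blast
  then have "place z ` \<sigma> \<in> S (cell y)" unfolding cell_sd2[OF y] by auto
  then show "t \<in> (\<lambda>s. \<xi> (cell y) ` s) ` S (cell y)" using e[OF z(1) z(2)[symmetric] z(3)] z(4) by (metis image_eqI)
 qed
qed

definition sign :: "'y => int" where "sign y = \<eta> (cell y) (map (p y) [0..<n])"

text \<open>
 The orientation of a chamber by the order of its colours; \<open>\<kappa>\<close> is the one
 induced on the second subdivision.
\<close>

definition std :: "nat list => int" where "std = (SOME \<omega>. ori n (Pow {..<n}) \<omega> \<and> \<omega> [0..<n] = 1)"
abbreviation "\<kappa> \<equiv> sdo n types (sdo n (Pow {..<n}) std)"

lemma std: "ori n (Pow {..<n}) std" "std [0..<n] = 1"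
 using someI_ex[OF simplex_ori, of n] by (simp_all add: std_def)

lemma flags_of_chamber:
 assumes y: "y \<in> Y" and l: "oface n (sd types) l"
 shows "oface n (S (cell y)) (map (place y) l)" "map (\<xi> (cell y)) (map (place y) l) = map (vx y) l"
  "\<epsilon> (cell y) (map (place y) l) = sign y * \<kappa> l"
proof -
 let ?q = "\<lambda>s. p y ` s"
 have Pow: "(\<lambda>s. p y ` s) ` Pow {..<n} \<subseteq> X (cell y)"
  using cpxD(4)[OF cpxs(1)[OF y] p_facet(1)[OF y] image_mono] by auto
 have inj: "inj_on (p y) (\<Union>(Pow {..<n}))" using p_facet(2)[OF y] by simp
 have inj2: "inj_on ?q (\<Union>types)" unfolding Union_sd by (rule inj_on_subset[OF inj_on_image_sets[OF inj]]) auto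
 have inj3: "inj_on (place y) (\<Union>(sd types))" unfolding Union_sd place_def
  by (rule inj_on_subset[OF inj_on_image_sets[OF inj2]]) auto
 have im2: "(`) ?q ` types \<subseteq> sd (X (cell y))" unfolding sd_image[OF inj] by (rule sd_mono[OF Pow])
 have im3: "place y ` s \<in> S (cell y)" if "s \<in> sd types" for s using y that unfolding cell_sd2[OF y] by blast
 show "oface n (S (cell y)) (map (place y) l)" by (rule oface_map[OF inj3 im3 l])
 have "D \<in> types" if "D \<in> set l" for D using l that by (auto simp: oface_def in_sd_types)
 then show "map (\<xi> (cell y)) (map (place y) l) = map (vx y) l" using \<xi>[OF y] by simp
 have o1: "oface n (X (cell y)) (map (p y) vs) \<and> \<eta> (cell y) (map (p y) vs) = sign y * std vs"
  if vs: "oface n (Pow {..<n}) vs" for vs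
 proof
  show o: "oface n (X (cell y)) (map (p y) vs)"
   using vs Pow by (intro oface_map[OF inj]) auto
  have st: "oface n (Pow {..<n}) [0..<n]" by (auto simp: oface_def)
  have "set vs = {..<n}" using vs by (intro card_subset_eq) (auto simp: oface_def distinct_card)
  then have m: "mset vs = mset [0..<n]" using oface_mset[OF vs, of "[0..<n]"] by (simp add: atLeast0LessThan)
  show "\<eta> (cell y) (map (p y) vs) = sign y * std vs"
   using ori_agree[OF oriD(3)[OF std(1)] alternating_map[OF oriD(3)[OF oriX[OF y]]], of "[0..<n]" "p y" "sign y" vs]
    oriD(5)[OF std(1) st] oriD(5)[OF std(1) vs] m std(2) by (simp add: sign_def)
 qed
 have o2: "oface n (sd (X (cell y))) (map ?q l) \<and> sdo n (X (cell y)) (\<eta> (cell y)) (map ?q l) = sign y * sdo n (Pow {..<n}) std l"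
  if l: "oface n types l" for l
  using oface_map[OF inj2 _ l] im2 sdo_natural[OF simplex_cpx std(1) cpxs(1,2)[OF y] oriX[OF y] n o1 l] by blast
 show "\<epsilon> (cell y) (map (place y) l) = sign y * \<kappa> l"
  using sdo_natural[OF types_cpx sdo(1)[OF simplex_cpx std(1) n] cpx_sd[OF cpxs(1)[OF y]] small_dim_sd[OF cpxs(1,2)[OF y]]
   sdo(1)[OF cpxs(1,2)[OF y] oriX[OF y] n] n o2 l] y by (simp add: place_def[abs_def])
qed

lemma fst_lk_cell:
 assumes y: "y \<in> Y" and t: "t \<in> lk K (vx y {})" "v \<in> t"
 shows "fst v \<noteq> {}"
 using t unfolding lk_K[OF y typesD(5)] by auto

abbreviation "\<tau> y \<equiv> transfer_ori (\<xi> (cell y)) (S (cell y)) (\<epsilon> (cell y))"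

lemma cell_ori:
 assumes y: "y \<in> Y"
 shows "ori n (lk K (vx y {})) (\<tau> y)" "oiso 1 (\<xi> (cell y)) (S (cell y)) (\<epsilon> (cell y)) (lk K (vx y {})) (\<tau> y)"
 using transfer_ori[OF lk_cell(1)[OF y] cpxs(4)[OF y]] unfolding lk_cell(2)[OF y] .

lemma chamber_ori:
 assumes y: "y \<in> Y" and l: "oface n (sd types) l"
 shows "oface n (lk K (vx y {})) (map (vx y) l)" "\<tau> y (map (vx y) l) = sign y * \<kappa> l"
 using oiso_ordered[OF cell_ori(2)[OF y] flags_of_chamber(1)[OF assms]]
 unfolding flags_of_chamber(2,3)[OF assms] by simp_all

lemma facet_has_cell:
 assumes y: "y \<in> Y" and \<sigma>: "\<sigma> \<subseteq> types" "nested \<sigma>" "card \<sigma> = Suc n"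
 shows "{} \<in> \<sigma>" "\<sigma> - {{}} \<in> sd types" "card (\<sigma> - {{}}) = n"
proof -
 have f: "finite \<sigma>" using \<sigma>(3) by (metis card.infinite nat.distinct(1))
 show "{} \<in> \<sigma>"
 proof (rule ccontr)
  assume "{} \<notin> \<sigma>"
  then have "\<sigma> \<in> sd types" using \<sigma> by (simp add: in_sd_types)
  then show False using \<sigma>(3) small_dim_sd[OF types_cpx] by (auto simp: small_dim_def)
 qed
 then show "\<sigma> - {{}} \<in> sd types" "card (\<sigma> - {{}}) = n" using \<sigma> f nested_subset[OF \<sigma>(2), of "\<sigma> - {{}}"] by (auto simp: in_sd_types)
qed

lemma card_vx: "card (vx y ` \<sigma>) = card \<sigma>"
 by (rule card_image[OF vx_inj])

lemma facet_of_K: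
 assumes y: "y \<in> Y" and \<sigma>: "\<sigma> \<subseteq> types" "nested \<sigma>" "card \<sigma> = Suc n"
 obtains l where "oface n (sd types) l" "\<sigma> = insert {} (set l)" "{} \<notin> set l"
proof -
 note f = facet_has_cell[OF y \<sigma>]
 have "finite (\<sigma> - {{}})" using f(3) n by (intro card_ge_0_finite) simp
 then obtain l where l: "distinct l" "set l = \<sigma> - {{}}" using finite_distinct_list by metis
 then have "oface n (sd types) l" using f(2,3) distinct_card[OF l(1)] by (simp add: oface_def)
 then show thesis using that l f(1) by blast
qed

text \<open>
 The common facet of the two cells contains the class for a chain \<open>{C}\<close>. Since
 the cells are different, \<open>\<Phi> C y\<close> lies in the cell of \<open>z\<close>; it
 is \<open>z\<close>, as both agree in all colours, and \<open>\<Phi> C\<close> reverses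
 signs.
\<close>

lemma crossing:
 assumes y: "y \<in> Y" "z \<in> Y" "cell y \<noteq> cell z" and l: "oface n (sd types) l"
  and eq: "vx y ` set l = vx z ` set l"
 shows "sign z = - sign y"
proof -
 have e: "rel D y z" if "D \<in> set l" for D
 proof -
  have "vx y D \<in> vx z ` set l" using that eq by blast
  then have "vx y D = vx z D" by (simp add: vx_in_image)
  moreover have "D \<in> types" using that l by (auto simp: oface_def in_sd_types)
  ultimately show ?thesis using vx_eq[OF y(1,2)] by simp
 qed
 have "set l \<in> sd types" "card (set l) = n" using l by (auto simp: oface_def distinct_card)
 from sd_facet_flag[OF types_cpx this n] obtain Cs where Cs: "oface n types Cs" "set (flag Cs) = set l" by blast
 have CsT: "set Cs \<in> types" "card (set Cs) = n" using Cs(1) by (auto simp: oface_def distinct_card)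
 from sd_facet_flag[OF simplex_cpx this n] obtain cs where cs: "oface n (Pow {..<n}) cs" "set (flag cs) = set Cs" by blast
 have "set cs = {..<n}" using cs(1) by (intro card_subset_eq) (auto simp: oface_def distinct_card)
 moreover have "set cs \<in> set Cs"
  using set_in_flag[of cs] cs n by (auto simp: oface_def)
 ultimately have U: "\<Union>(set Cs) = {..<n}" using typesD(2)[OF CsT(1)] by (intro equalityI) auto
 have "set Cs \<in> set l"
  using set_in_flag[of Cs] Cs n by (auto simp: oface_def)
 note top = e[OF this]
 obtain C Cs' where C: "Cs = C # Cs'" using Cs(1) n by (cases Cs) (auto simp: oface_def)
 have "{C} \<in> set l" unfolding Cs(2)[symmetric] set_flag C by (auto intro!: exI[of _ 0])
 then have r: "rel {C} y z" by (rule e)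
 have CT: "C \<in> Pow {..<n} - {{}}" using typesD(1)[OF CsT(1)] C by simp
 note \<Phi>y = \<Phi>_in[OF CT y(1)]
 have "{C} \<in> types" by (rule typesD(4)[OF CsT(1)]) (simp add: C)
 have two: "fold \<Phi> ws y = y \<or> fold \<Phi> ws y = \<Phi> C y" if "ws \<in> lists {C}" for ws
  using that by (induction ws rule: rev_induct) (auto simp: \<Phi>_inv[OF CT y(1)])
 obtain ws where ws: "ws \<in> lists {C}" "agree cell p C (fold \<Phi> ws y) z" using r by (auto simp: rel_def)
 then have ag: "cell (\<Phi> C y) = cell z" using two[OF ws(1)] y(3) by (auto simp: agree_def)
 have "rel (set Cs) y (\<Phi> C y)"
  unfolding rel_def using C agree_equiv(1) by (intro bexI[of _ "[C]"]) auto
 then have "rel (set Cs) (\<Phi> C y) z" using rel_trans[OF CsT(1) \<Phi>y y(1) rel_sym[OF CsT(1) y(1) \<Phi>y] top] by simp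
 from rel_agree[OF CsT(1) \<Phi>y y(2) this g_cell[OF \<Phi>y y(2) ag]] have "\<Phi> C y = z"
  using separated[OF \<Phi>y y(2)] U by simp
 then show ?thesis using \<Phi>_sign[OF CT y(1)] by (simp add: sign_def)
qed

definition \<Omega> :: "(nat set set \<times> 'y set) list => int" where
 "\<Omega> = (SOME \<omega>. ori (Suc n) K \<omega> \<and>
   (\<forall>y\<in>Y. \<forall>ts. oface n (lk K (vx y {})) ts --> \<omega> (vx y {} # ts) = \<tau> y ts))"

text \<open>
 A ridge through the centre of a cell is dealt with in the link of the centre, a ridge
 opposite to a centre by \<open>crossing\<close>.
\<close>

lemma \<Omega>_exists:
 assumes ne: "Y \<noteq> {}"
 shows "\<exists>\<omega>. ori (Suc n) K \<omega> \<and>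
   (\<forall>y\<in>Y. \<forall>ts. oface n (lk K (vx y {})) ts --> \<omega> (vx y {} # ts) = \<tau> y ts)"
proof -
 define R where "R = {(vx y {} # ts, \<tau> y ts) | y ts. y \<in> Y \<and> oface n (lk K (vx y {})) ts}"
 have R: "(vx y {} # ts, \<tau> y ts) \<in> R" if "y \<in> Y" "oface n (lk K (vx y {})) ts" for y ts
  using that unfolding R_def by blast
 have R': "(vx y {} # map (vx y) l, sign y * \<kappa> l) \<in> R" if "y \<in> Y" "oface n (sd types) l" for y l
  using R[OF that(1) chamber_ori(1)[OF that]] unfolding chamber_ori(2)[OF that] .
 have "\<exists>\<omega>. ori (Suc n) K \<omega> \<and> (\<forall>(r, e)\<in>R. \<omega> r = e)"
 proof (rule exists_ori[OF cpx_K[OF ne]])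
  show "oface (Suc n) K r \<and> (e = 1 \<or> e = -1)" if re: "(r, e) \<in> R" for r e
   using re oriD(1)[OF cell_ori(1)] unfolding R_def by (auto simp: oface_lk)
 next
  fix s assume s: "s \<in> K" "card s = Suc n"
  then obtain y \<sigma> where y: "s = vx y ` \<sigma>" "y \<in> Y" "\<sigma> \<subseteq> types" "nested \<sigma>" unfolding K_def by blast
  obtain l where l: "oface n (sd types) l" "\<sigma> = insert {} (set l)"
   using facet_of_K[OF y(2-4)] s(2) unfolding y(1) card_vx by metis
  show "\<exists>r e. (r, e) \<in> R \<and> set r = s" using R'[OF y(2) l(1)] by (intro exI conjI) (auto simp: y(1) l(2))
 next
  fix r e r' e' and F :: "(nat set set \<times> 'y set) list => int"
  assume re: "(r, e) \<in> R" "(r', e') \<in> R" "set r = set r'" and F: "alternating F"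
  obtain y l where y: "y \<in> Y" "oface n (lk K (vx y {})) l" "r = vx y {} # l" "e = \<tau> y l"
   using re(1) unfolding R_def by blast
  obtain z m where z: "z \<in> Y" "oface n (lk K (vx z {})) m" "r' = vx z {} # m" "e' = \<tau> z m"
   using re(2) unfolding R_def by blast
  have mem: "set l \<in> lk K (vx y {})" "set m \<in> lk K (vx z {})" using y(2) z(2) by (simp_all add: oface_def)
  have "vx z {} \<in> set r" using re(3) z(3) by simp
  then have vz: "vx z {} = vx y {}" using fst_lk_cell[OF y(1) mem(1)] unfolding y(3) by (metis fst_vx set_ConsD)
  then have c: "cell y = cell z" using vx_eq[OF y(1) z(1) typesD(5)] rel_empty by simp
  have "set l = set m" using re(3) mem unfolding y(3) z(3) vz by (simp add: lk_def insert_ident)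
  then have "mset m = mset l" using oface_mset[OF z(2), of l] y(2) by (simp add: oface_def)
  then show "e * F r = e' * F r'"
   unfolding y(3,4) z(3,4) vz c
   by (intro alternating_prod[OF oriD(3)[OF cell_ori(1)[OF z(1)]] alternating_Cons[OF F]]) simp
 next
  fix a b s assume ab: "a \<noteq> b" "a \<notin> s" "b \<notin> s" "insert a s \<in> K" "insert b s \<in> K" "Suc (card s) = Suc n"
  have fin: "finite s" using cpxD(3)[OF cpx_K[OF ne] ab(4)] by simp
  have facet: "\<exists>y\<in>Y. \<exists>l. oface n (sd types) l \<and> insert c s = vx y ` insert {} (set l) \<and> {} \<notin> set l"
   if c: "c \<notin> s" "insert c s \<in> K" for c
  proof -
   obtain y \<sigma> where y: "insert c s = vx y ` \<sigma>" "y \<in> Y" "\<sigma> \<subseteq> types" "nested \<sigma>" using c unfolding K_def by blast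
   then have "card \<sigma> = Suc n" using c ab(6) fin by (metis card_vx card_insert_disjoint)
   then show ?thesis using facet_of_K[OF y(2-4)] y by metis
  qed
  obtain y l where y: "y \<in> Y" "oface n (sd types) l" "insert a s = vx y ` insert {} (set l)" "{} \<notin> set l"
   using facet[OF ab(2,4)] by blast
  show "\<exists>r i e. (r, e) \<in> R \<and> i < Suc n \<and> r ! i = a \<and> set r = insert a s \<and> (r[i := b], - e) \<in> R"
  proof (cases "vx y {} \<in> s")
   case True
   define t where "t = s - {vx y {}}"
   have st: "s = insert (vx y {}) t" "vx y {} \<notin> t" using True by (auto simp: t_def)
   have "finite t" "Suc (card t) = n" using fin True ab(6) n by (auto simp: t_def card_Diff_singleton)
   then obtain ts where ts: "distinct ts" "set ts = t" "Suc (length ts) = n"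
    using finite_distinct_list distinct_card by metis
   have o: "oface n (lk K (vx y {})) (a # ts)" "oface n (lk K (vx y {})) (b # ts)"
    using ab(2-5) st ts unfolding st(1) by (auto simp: oface_def lk_def insert_commute)
   from oriD(4)[OF cell_ori(1)[OF y(1)] ab(1) o]
   have "((vx y {} # a # ts)[1 := b], - \<tau> y (a # ts)) \<in> R" using R[OF y(1) o(2)] by simp
   moreover have "set (vx y {} # a # ts) = insert a s" using st(1) ts(2) by auto
   ultimately show ?thesis using R[OF y(1) o(1)] n
    by (intro exI[of _ "vx y {} # a # ts"] exI[of _ 1] exI[of _ "\<tau> y (a # ts)"]) simp
  next
   case False
   have "vx y {} \<in> insert a s" using y(3) by blast
   then have va: "vx y {} = a" using False by blast
   have nin: "vx x {} \<notin> vx x ` set l" if "{} \<notin> set l" for x l using that by (auto simp: vx_def)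
   have "insert a s = insert a (vx y ` set l)" using y(3) va by simp
   then have sa: "s = vx y ` set l" using nin[OF y(4), of y] ab(2) unfolding va by (simp add: insert_ident)
   obtain z m where z: "z \<in> Y" "oface n (sd types) m" "insert b s = vx z ` insert {} (set m)" "{} \<notin> set m"
    using facet[OF ab(3,5)] by blast
   have "vx z {} \<notin> s" using y(4) unfolding sa by (auto simp: vx_def)
   moreover have "vx z {} \<in> insert b s" using z(3) by blast
   ultimately have vb: "vx z {} = b" by blast
   have "insert b s = insert b (vx z ` set m)" using z(3) vb by simp
   then have sb: "s = vx z ` set m" using nin[OF z(4), of z] ab(3) unfolding vb by (simp add: insert_ident)
   have "fst ` vx y ` set l = fst ` vx z ` set m" using sa sb by simp
   then have lm: "set m = set l" by (simp add: image_image)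
   have c: "cell y \<noteq> cell z" using ab(1) va vb vx_eq[OF y(1) z(1) typesD(5)] rel_empty by auto
   have sz: "sign z = - sign y" using crossing[OF y(1) z(1) c y(2)] sa sb lm by simp
   have mz: "map (vx z) l = map (vx y) l"
   proof (rule map_cong[OF refl])
    fix D assume D: "D \<in> set l"
    then have "vx z D \<in> vx y ` set l" using sa sb lm by blast
    then show "vx z D = vx y D" by (simp add: vx_in_image)
   qed
   have "((vx y {} # map (vx y) l)[0 := b], - (sign y * \<kappa> l)) \<in> R"
    using R'[OF z(1) y(2)] unfolding mz sz vb by simp
   moreover have "set (vx y {} # map (vx y) l) = insert a s" using va sa by simp
   ultimately show ?thesis
    using R'[OF y(1,2)] va
    by (intro exI[of _ "vx y {} # map (vx y) l"] exI[of _ 0] exI[of _ "sign y * \<kappa> l"] conjI) simp_all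
  qed
 qed
 then obtain \<omega> where \<omega>: "ori (Suc n) K \<omega>" "\<forall>(r, e)\<in>R. \<omega> r = e" by blast
 have "\<omega> (vx y {} # ts) = \<tau> y ts" if "y \<in> Y" "oface n (lk K (vx y {})) ts" for y ts
  using bspec[OF \<omega>(2) R[OF that]] by simp
 then show ?thesis using \<omega>(1) by blast
qed

lemma \<Omega>: "Y \<noteq> {} ==> ori (Suc n) K \<Omega>"
 "y \<in> Y ==> oface n (lk K (vx y {})) ts ==> \<Omega> (vx y {} # ts) = \<tau> y ts"
 "y \<in> Y ==> oface n (sd types) m ==> \<Omega> (vx y {} # map (vx y) m) = sign y * \<kappa> m"
proof -
 show o: "Y \<noteq> {} ==> ori (Suc n) K \<Omega>" unfolding \<Omega>_def using someI_ex[OF \<Omega>_exists] by blast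
 show v: "\<Omega> (vx y {} # ts) = \<tau> y ts" if "y \<in> Y" "oface n (lk K (vx y {})) ts" for ts
  unfolding \<Omega>_def using someI_ex[OF \<Omega>_exists] that by blast
 show "\<Omega> (vx y {} # map (vx y) m) = sign y * \<kappa> m" if "y \<in> Y" "oface n (sd types) m"
  using v[OF that(1) chamber_ori(1)[OF that]] unfolding chamber_ori(2)[OF that] .
qed

lemma oiso_cell:
 assumes y: "y \<in> Y"
 shows "oiso 1 (\<xi> (cell y)) (S (cell y)) (\<epsilon> (cell y)) (lk K (vx y {})) (ind (vx y {}) \<Omega>)"
proof (rule oisoI_flags[OF lk_cell[OF y] cpxs(4)[OF y]])
 show "ori n (lk K (vx y {})) (ind (vx y {}) \<Omega>)" using \<Omega>(1) y by (intro ori_lk) auto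
 fix s assume s: "s \<in> S (cell y)" "card s = n"
 obtain l where l: "distinct l" "set l = s" using finite_distinct_list cpxD(3)[OF sph_cpx[OF cpxs(3)[OF y]] s(1)] by blast
 then have "oface n (S (cell y)) l" using s by (auto simp: oface_def distinct_card)
 from oiso_ordered[OF cell_ori(2)[OF y] this]
 show "\<exists>r. distinct r \<and> set r = s \<and> ind (vx y {}) \<Omega> (map (\<xi> (cell y)) r) = 1 * \<epsilon> (cell y) r"
  using l \<Omega>(2)[OF y] by (intro exI[of _ l]) (simp add: ind_def)
qed

end

section \<open>Vertex links of the glued manifold\<close>

lemma nested_image_antimono:
 assumes "nested d" "\<And>s t. s \<subseteq> t ==> f t \<subseteq> f s"
 shows "nested (f ` d)"
 unfolding nested_def ball_simps(9)
proof (intro ballI)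
 fix s t assume "s \<in> d" "t \<in> d"
 then have "s \<subseteq> t \<or> t \<subseteq> s" using assms(1) by (simp add: nested_def)
 then show "f s \<subseteq> f t \<or> f t \<subseteq> f s" using assms(2)[of s t] assms(2)[of t s] by argo
qed

context gluing
begin

lemma g_fold_distinct:
 "D \<in> types ==> ws \<in> lists D ==> distinct ws ==> y \<in> Y ==> B \<in> g (fold \<Phi> ws y) \<longleftrightarrow> (B \<in> g y) \<noteq> (B \<in> set ws)"
 by (induction ws arbitrary: y) (auto simp: g_\<Phi>[OF typesD(1)] \<Phi>_in[OF typesD(1)])

lemma rel_g:
 assumes "D \<in> types" "y \<in> Y" "z \<in> Y" "rel D y z" "C \<notin> D"
 shows "C \<in> g y \<longleftrightarrow> C \<in> g z"
proof -
 obtain ws where ws: "ws \<in> lists D" "agree cell p (\<Union>D) (fold \<Phi> ws y) z" using assms(4) by (auto simp: rel_def)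
 have "g (fold \<Phi> ws y) = g z" using g_cell[OF fold_in[OF assms(1) ws(1) assms(2)] assms(3)] ws(2) by (simp add: agree_def)
 moreover have "C \<notin> set ws" using ws(1) assms(5) by auto
 ultimately show ?thesis using g_fold[OF assms(1) ws(1) assms(2)] by simp
qed

text \<open>
 Two chambers of an orbit are related by the types in which their parities differ.
\<close>

lemma orbit_rel:
 assumes D: "D \<in> types" and E: "E \<subseteq> D" and us: "us \<in> lists D" and z: "z \<in> Y"
  and g: "\<And>C. C \<in> D ==> C \<notin> E ==> C \<in> g z \<longleftrightarrow> C \<in> g (fold \<Phi> us z)"
 shows "rel E z (fold \<Phi> us z)"
proof -
 let ?z = "fold \<Phi> us z"
 have "finite {C \<in> E. (C \<in> g z) \<noteq> (C \<in> g ?z)}" using typesD(7)[OF typesD(4)[OF D E]] by simp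
 from finite_distinct_list[OF this] obtain ws where ws: "distinct ws" "set ws = {C \<in> E. (C \<in> g z) \<noteq> (C \<in> g ?z)}" by blast
 then have wD: "ws \<in> lists E" "ws \<in> lists D" using E by auto
 have "C \<in> g (fold \<Phi> ws z) \<longleftrightarrow> C \<in> g ?z" for C
 proof (cases "C \<in> D")
  case True
  then show ?thesis using g_fold_distinct[OF D wD(2) ws(1) z] g ws(2) by auto
 next
  case False
  then have "C \<notin> set ws" "C \<notin> set us" using wD(2) us by auto
  then show ?thesis using g_fold[OF D wD(2) z] g_fold[OF D us z] by simp
 qed
 then have "g (fold \<Phi> ws z) = g ?z" by (rule set_eqI)
 then have "fold \<Phi> ws z = ?z" by (rule fold_unique[OF D wD(2) us z])
 then show ?thesis unfolding rel_def using wD(1) agree_equiv(1) by (intro bexI[of _ ws]) simp_all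
qed

text \<open>
 The link of the class of \<open>y\<close> for \<open>D\<close> is the join of its simplices
 with chains inside \<open>D\<close> and of those with chains around \<open>D\<close>.
\<close>

definition below :: "'y => nat set set => (nat set set \<times> 'y set) set set" where
 "below y D = {vx z ` \<sigma> | z \<sigma>. z \<in> Y \<and> rel D y z \<and> nested \<sigma> \<and> (\<forall>E\<in>\<sigma>. E \<subset> D)}"

definition above :: "'y => nat set set => (nat set set \<times> 'y set) set set" where
 "above y D = {vx z ` \<sigma> | z \<sigma>. z \<in> Y \<and> rel D y z \<and> \<sigma> \<subseteq> types \<and> nested \<sigma> \<and> (\<forall>E\<in>\<sigma>. D \<subset> E)}"

text \<open>
 The \<open>2 ^ card D\<close> chambers in the orbit of \<open>y\<close> are distinguished by
 their parities in \<open>D\<close>, that is, by the facets \<open>F z\<close> of the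
 cross-polytope on \<open>D\<close>. The class for \<open>E \<subset> D\<close> is determined
 by the parities in \<open>D - E\<close>, that is, by a nonempty face \<open>t\<close> with
 \<open>E = D - fst ` t\<close>. So this complex is isomorphic to the barycentric subdivision
 of \<open>cross D\<close>.
\<close>

lemma sph_below:
 assumes y: "y \<in> Y" and D: "D \<in> types"
 shows "sph (card D) (below y D)"
proof -
 define Orb where "Orb = {fold \<Phi> us y | us. us \<in> lists D}"
 define F where "F z = (\<lambda>C. (C, C \<in> g z)) ` D" for z
 define \<theta> where "\<theta> t = vx (SOME z. z \<in> Orb \<and> t \<subseteq> F z) (D - fst ` t)" for t
 have OY: "z \<in> Y" if "z \<in> Orb" for z using that fold_in[OF D _ y] by (auto simp: Orb_def)
 have orel: "rel E z w" if zw: "z \<in> Orb" "w \<in> Orb" and E: "E \<subseteq> D" and g: "\<And>C. C \<in> D ==> C \<notin> E ==> C \<in> g z \<longleftrightarrow> C \<in> g w" for E z w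
 proof -
  obtain us ws where us: "us \<in> lists D" "z = fold \<Phi> us y" and ws: "ws \<in> lists D" "w = fold \<Phi> ws y" using zw by (auto simp: Orb_def)
  have "w = fold \<Phi> (rev us @ ws) z" using fold_rev[OF D us(1) y] us(2) ws(2) by simp
  moreover have "rev us @ ws \<in> lists D" using us(1) ws(1) by auto
  ultimately show ?thesis using orbit_rel[OF D E _ OY[OF zw(1)]] g by metis
 qed
 have sub: "E \<in> types" if "E \<subseteq> D" for E using typesD(4)[OF D that] .
 have mem: "b \<longleftrightarrow> C \<in> g z" "C \<in> D" if "(C, b) \<in> t" "t \<subseteq> F z" for C b t z using that by (auto simp: F_def)
 have \<theta>: "\<theta> t = vx z (D - fst ` t)" if z: "z \<in> Orb" "t \<subseteq> F z" for t z
 proof -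
  define w where "w = (SOME z. z \<in> Orb \<and> t \<subseteq> F z)"
  have w: "w \<in> Orb \<and> t \<subseteq> F w" unfolding w_def by (rule someI[of _ z]) (use z in simp)
  have "rel (D - fst ` t) w z"
  proof (rule orel)
   fix C assume "C \<in> D" "C \<notin> D - fst ` t"
   then obtain b where "(C, b) \<in> t" by force
   then show "C \<in> g w \<longleftrightarrow> C \<in> g z" using mem(1)[of C b t z] mem(1)[of C b t w] w z by blast
  qed (use w z in blast)+
  then show ?thesis unfolding \<theta>_def w_def[symmetric] using w z OY by (intro vx_eq[THEN iffD2] sub) auto
 qed
 have F: "\<exists>z\<in>Orb. t \<subseteq> F z" if t: "t \<in> cross D" for t
 proof -
  have tD: "fst ` t \<subseteq> D" "inj_on fst t" using t by (auto simp: cross_def)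
  then have "finite {C \<in> fst ` t. (C \<in> g y) \<noteq> ((C, True) \<in> t)}" using finite_subset[OF _ typesD(7)[OF D]] by simp
  from finite_distinct_list[OF this]
  obtain ws where ws: "distinct ws" "set ws = {C \<in> fst ` t. (C \<in> g y) \<noteq> ((C, True) \<in> t)}" by blast
  have wD: "ws \<in> lists D" using ws(2) tD(1) by auto
  have "(C, b) \<in> F (fold \<Phi> ws y)" if Cb: "(C, b) \<in> t" for C b
  proof -
   have Ct: "C \<in> fst ` t" using imageI[OF Cb, of fst] by simp
   then have CD: "C \<in> D" using tD(1) by blast
   have "(C, True) \<in> t \<longleftrightarrow> b" using Cb inj_onD[OF tD(2), of "(C, True)" "(C, b)"] by (cases b) auto
   then have "C \<in> g (fold \<Phi> ws y) \<longleftrightarrow> b" using g_fold_distinct[OF D wD ws(1) y, of C] Ct ws(2) by auto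
   then show ?thesis using CD by (auto simp: F_def)
  qed
  then show ?thesis using wD unfolding Orb_def by (intro bexI[of _ "fold \<Phi> ws y"]) auto
 qed
 have cF: "t \<in> cross D" if "t \<subseteq> F z" for t z
 proof -
  have f: "fst ` F z \<subseteq> D" "inj_on fst (F z)" by (auto simp: F_def inj_on_def)
  show ?thesis using inj_on_subset[OF f(2) that] subset_trans[OF image_mono[OF that] f(1)] unfolding cross_def by simp
 qed
 have "inj_on \<theta> (\<Union>(sd (cross D)))"
 proof (rule inj_onI)
  fix s t assume st: "s \<in> \<Union>(sd (cross D))" "t \<in> \<Union>(sd (cross D))" "\<theta> s = \<theta> t"
  then have c: "s \<in> cross D" "t \<in> cross D" by (auto simp: Union_sd)
  obtain z where z: "z \<in> Orb" "s \<subseteq> F z" using F[OF c(1)] by blast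
  obtain w where w: "w \<in> Orb" "t \<subseteq> F w" using F[OF c(2)] by blast
  have e: "vx z (D - fst ` s) = vx w (D - fst ` t)" using st(3) \<theta>[OF z] \<theta>[OF w] by simp
  then have "D - fst ` s = D - fst ` t" by (metis fst_vx)
  moreover have "fst ` s \<subseteq> D" "fst ` t \<subseteq> D" using c by (auto simp: cross_def)
  ultimately have f: "fst ` s = fst ` t" by (metis double_diff order_refl)
  have sD: "D - fst ` s \<in> types" by (rule sub) simp
  have "rel (D - fst ` s) z w" using e f vx_eq[OF OY[OF z(1)] OY[OF w(1)] sD] by simp
  then have g: "C \<in> g z \<longleftrightarrow> C \<in> g w" if "C \<in> fst ` s" for C
   using rel_g[OF sD OY[OF z(1)] OY[OF w(1)], of C] that by simp
  have lift: "s = (\<lambda>C. (C, C \<in> g z)) ` fst ` s" if s: "s \<subseteq> F z" for s z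
  proof -
   have "x = (fst x, fst x \<in> g z)" if "x \<in> s" for x using subsetD[OF s that] unfolding F_def by auto
   then have "(\<lambda>x. (fst x, fst x \<in> g z)) ` s = id ` s" by (intro image_cong) simp_all
   then show ?thesis by (simp add: image_image)
  qed
  have "s = (\<lambda>C. (C, C \<in> g z)) ` fst ` s" by (rule lift[OF z(2)])
  also have "\<dots> = (\<lambda>C. (C, C \<in> g w)) ` fst ` t" unfolding f[symmetric] using g by (intro image_cong) simp_all
  finally show "s = t" using lift[OF w(2)] by simp
 qed
 moreover have "(`) \<theta> ` sd (cross D) = below y D"
 proof (intro equalityI subsetI)
  fix u assume "u \<in> (`) \<theta> ` sd (cross D)"
  then obtain d where d: "d \<in> sd (cross D)" "u = \<theta> ` d" by blast
  have "\<exists>z\<in>Orb. \<forall>t\<in>d. t \<subseteq> F z"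
  proof (cases "d = {}")
   case True
   have "fold \<Phi> [] y \<in> Orb" unfolding Orb_def by blast
   then show ?thesis using True by blast
  next
   case False
   have "finite d" using cpxD(3)[OF cpx_sd[OF sph_cpx[OF sph_cross[OF typesD(7)[OF D]]]] d(1)] .
   then have "\<Union>d \<in> d" using nested_Union False d(1) by (auto simp: sd_def)
   then have "\<Union>d \<in> cross D" using d(1) by (auto simp: sd_def)
   from F[OF this] show ?thesis unfolding Sup_le_iff .
  qed
  then obtain z where z: "z \<in> Orb" "\<forall>t\<in>d. t \<subseteq> F z" by (elim bexE)
  have "u = vx z ` (\<lambda>t. D - fst ` t) ` d" unfolding d(2) image_image using \<theta>[OF z(1)] z(2) by simp
  moreover have "nested d" using d(1) by (simp add: sd_def)
  then have "nested ((\<lambda>t. D - fst ` t) ` d)" by (rule nested_image_antimono) blast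
  moreover have "E \<subset> D" if E: "E \<in> (\<lambda>t. D - fst ` t) ` d" for E
  proof -
   obtain t where t: "t \<in> d" "E = D - fst ` t" using E by blast
   then have "t \<noteq> {}" "fst ` t \<subseteq> D" using d(1) by (auto simp: sd_def cross_def)
   then show ?thesis using t(2) by auto
  qed
  moreover obtain us where us: "us \<in> lists D" "z = fold \<Phi> us y" using z(1) unfolding Orb_def by blast
  have "rel D y z" unfolding rel_def us(2) using us(1) agree_equiv(1) by (intro bexI[of _ us]) simp_all
  ultimately show "u \<in> below y D" unfolding below_def mem_Collect_eq using OY[OF z(1)] by (intro exI conjI ballI)
 next
  fix u assume "u \<in> below y D"
  then obtain z \<sigma> where z: "u = vx z ` \<sigma>" "z \<in> Y" "rel D y z" "nested \<sigma>" "\<And>E. E \<in> \<sigma> ==> E \<subset> D" unfolding below_def by blast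
  obtain us where us: "us \<in> lists D" "agree cell p (\<Union>D) (fold \<Phi> us y) z" using z(3) by (auto simp: rel_def)
  define w where "w = fold \<Phi> us y"
  have w: "w \<in> Orb" "w \<in> Y" using us(1) OY unfolding w_def Orb_def by blast+
  have e: "vx w E = vx z E" if "E \<in> \<sigma>" for E
  proof -
   have "E \<subseteq> D" using z(5)[OF that] by blast
   then have "agree cell p (\<Union>E) w z" using agree_equiv(4)[OF us(2)] Union_mono unfolding w_def by blast
   then show ?thesis using vx_eq[OF w(2) z(2) sub[OF \<open>E \<subseteq> D\<close>]] agree_rel by blast
  qed
  define T where "T E = {x \<in> F w. fst x \<notin> E}" for E
  have fT: "fst ` T E = D - E" for E unfolding T_def F_def by force
  have "\<theta> (T E) = vx z E" if "E \<in> \<sigma>" for E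
  proof -
   have "D - (D - E) = E" using z(5)[OF that] by blast
   then show ?thesis using \<theta>[OF w(1), of "T E"] e[OF that] unfolding fT by (simp add: T_def)
  qed
  then have "u = \<theta> ` T ` \<sigma>" unfolding z(1) image_image by simp
  moreover have "T ` \<sigma> \<in> sd (cross D)"
  proof -
   have "T E \<in> cross D" for E by (rule cF[of _ w]) (simp add: T_def)
   moreover have "T E \<noteq> {}" if "E \<in> \<sigma>" for E using fT[of E] z(5)[OF that] by auto
   moreover have "nested (T ` \<sigma>)" by (rule nested_image_antimono[OF z(4)]) (auto simp: T_def)
   ultimately show ?thesis unfolding sd_def by blast
  qed
  ultimately show "u \<in> (`) \<theta> ` sd (cross D)" by blast
 qed
 ultimately show ?thesis using sph_iso[OF sph_sd[OF sph_cross[OF typesD(7)[OF D]]]] by metis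
qed

text \<open>
 This complex is the link in \<open>K\<close> of a simplex, given by a maximal chain
 \<open>\<rho>\<close> from \<open>{}\<close> to \<open>D\<close>. As the simplex contains
 the centre of a cell, it is also the link of a simplex in the sphere around this centre.
\<close>

lemma sph_above:
 assumes y: "y \<in> Y" and D: "D \<in> types"
 shows "card D \<le> n \<and> sph (n - card D) (above y D)"
proof -
 have fD: "finite D" by (rule typesD(7)[OF D])
 obtain ds where ds: "distinct ds" "set ds = D" using finite_distinct_list[OF fD] by blast
 define \<rho> where "\<rho> = {set (take i ds) | i. i \<le> length ds}"
 have lD: "length ds = card D" using ds distinct_card by metis
 have \<rho>: "E \<subseteq> D" "E \<in> types" if "E \<in> \<rho>" for E
 proof -
  show "E \<subseteq> D" using that set_take_subset[of _ ds] ds(2) by (auto simp: \<rho>_def)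
  then show "E \<in> types" by (rule typesD(4)[OF D])
 qed
 have "set (take 0 ds) \<in> \<rho>" "set (take (length ds) ds) \<in> \<rho>" unfolding \<rho>_def by blast+
 then have \<rho>0: "{} \<in> \<rho>" "D \<in> \<rho>" using ds(2) by simp_all
 have n\<rho>: "nested \<rho>" unfolding nested_def \<rho>_def by (auto; metis nat_le_linear set_take_subset_set_take subsetD)
 have cards: "\<exists>R\<in>\<rho>. card R = card E" if "E \<subseteq> D" for E
  using card_mono[OF fD that] ds(1) lD unfolding \<rho>_def by (intro bexI[of _ "set (take (card E) ds)"]) (auto simp: distinct_card)
 have card\<rho>: "card (\<rho> - {{}}) = card D"
 proof -
  have "\<rho> = (\<lambda>i. set (take i ds)) ` {..card D}" unfolding \<rho>_def lD by auto
  moreover have "inj_on (\<lambda>i. set (take i ds)) {..card D}"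
   using ds(1) lD by (intro inj_on_inverseI[of _ card]) (auto simp: distinct_card)
  ultimately have "card \<rho> = Suc (card D)" by (simp add: card_image)
  then show ?thesis using \<rho>0 by simp
 qed
 have eq: "lks K (vx y ` \<rho>) = above y D"
 proof (intro equalityI subsetI)
  fix t assume "t \<in> lks K (vx y ` \<rho>)"
  then have t: "t \<inter> vx y ` \<rho> = {}" "t \<union> vx y ` \<rho> \<in> K" by (auto simp: lks_def)
  obtain z \<sigma> where z: "t \<union> vx y ` \<rho> = vx z ` \<sigma>" "z \<in> Y" "\<sigma> \<subseteq> types" "nested \<sigma>" using t(2) unfolding K_def by blast
  have "vx y E \<in> vx z ` \<sigma>" if "E \<in> \<rho>" for E using that z(1) by blast
  then have e: "vx y E = vx z E" "E \<in> \<sigma>" if "E \<in> \<rho>" for E using that by (simp_all add: vx_in_image)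
  have "t = vx z ` \<sigma> - vx y ` \<rho>" using t(1) z(1) by blast
  also have "vx y ` \<rho> = vx z ` \<rho>" by (rule image_cong[OF refl e(1)])
  finally have "t = vx z ` (\<sigma> - \<rho>)" using vx_inj[of z UNIV] by (simp add: image_set_diff)
  moreover have "rel D y z" using e(1)[OF \<rho>0(2)] vx_eq[OF y z(2) D] by simp
  moreover have "D \<subset> E" if E: "E \<in> \<sigma> - \<rho>" for E
  proof -
   have "\<not> E \<subseteq> D"
   proof
    assume ED: "E \<subseteq> D"
    obtain R where R: "R \<in> \<rho>" "card R = card E" using cards[OF ED] by blast
    have "R \<subseteq> E \<or> E \<subseteq> R" using z(4) e(2)[OF R(1)] E by (auto simp: nested_def)
    then have "R = E" using R card_subset_eq[of R E] card_subset_eq[of E R] finite_subset[OF ED fD] finite_subset[OF \<rho>(1)[OF R(1)] fD] by auto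
    then show False using R(1) E by simp
   qed
   then show ?thesis using z(4) e(2)[OF \<rho>0(2)] E unfolding nested_def by blast
  qed
  ultimately show "t \<in> above y D" unfolding above_def using z nested_subset[OF z(4), of "\<sigma> - \<rho>"] by blast
 next
  fix t assume "t \<in> above y D"
  then obtain z \<sigma> where z: "t = vx z ` \<sigma>" "z \<in> Y" "rel D y z" "\<sigma> \<subseteq> types" "nested \<sigma>" "\<And>E. E \<in> \<sigma> ==> D \<subset> E" unfolding above_def by blast
  obtain w where w: "w \<in> Y" "\<And>E. E \<subseteq> D ==> rel E w y" "\<And>E. D \<subseteq> E ==> rel E z w"
   using rel_split[OF D z(2) y rel_sym[OF D y z(2,3)]] by metis
  have "vx w E = vx y E" if "E \<in> \<rho>" for E using vx_eq[OF w(1) y] w(2) \<rho>[OF that] by blast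
  then have e1: "vx w ` \<rho> = vx y ` \<rho>" by simp
  have "vx z E = vx w E" if "E \<in> \<sigma>" for E
  proof -
   have "E \<in> types" "D \<subseteq> E" using z(4) z(6)[OF that] that by auto
   then show ?thesis using vx_eq[OF z(2) w(1), of E] w(3)[of E] by simp
  qed
  then have e2: "vx w ` \<sigma> = vx z ` \<sigma>" by simp
  have "R \<subseteq> E" if "R \<in> \<rho>" "E \<in> \<sigma>" for R E using \<rho>(1)[OF that(1)] z(6)[OF that(2)] by blast
  then have "nested (\<rho> \<union> \<sigma>)" by (rule nested_Un[OF n\<rho> z(5)])
  then have "nested (\<sigma> \<union> \<rho>)" by (simp add: Un_commute)
  then have "vx w ` (\<sigma> \<union> \<rho>) \<in> K" using z(4) \<rho>(2) by (intro in_K[OF w(1)]) auto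
  then have "t \<union> vx y ` \<rho> \<in> K" unfolding image_Un e1 e2 z(1) .
  moreover have "t \<inter> vx y ` \<rho> = {}" unfolding z(1) vx_def using \<rho>(1) z(6) by blast
  ultimately show "t \<in> lks K (vx y ` \<rho>)" by (simp add: lks_def)
 qed
 have nin: "vx y {} \<notin> vx y ` (\<rho> - {{}})" by (auto simp: vx_def)
 have ins: "vx y ` \<rho> = insert (vx y {}) (vx y ` (\<rho> - {{}}))" using \<rho>0(1) by blast
 have "vx y ` \<rho> \<in> K" using \<rho>(2) n\<rho> by (intro in_K[OF y]) auto
 then have "vx y ` (\<rho> - {{}}) \<in> lk K (vx y {})" unfolding lk_def using nin ins by simp
 from sph_lks[OF sph_oiso[OF oiso_cell[OF y] cpxs(3)[OF y]] this]
 show ?thesis unfolding card_vx card\<rho> lks_insert'[OF nin, symmetric] ins[symmetric] eq .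
qed

lemma lk_join:
 assumes y: "y \<in> Y" and D: "D \<in> types"
 shows "lk K (vx y D) = join (below y D) (above y D)"
proof (intro equalityI subsetI)
 fix t assume "t \<in> lk K (vx y D)"
 then obtain z \<sigma> where z: "t = vx z ` \<sigma>" "z \<in> Y" "rel D y z" "\<sigma> \<subseteq> types" "D \<notin> \<sigma>" "nested (insert D \<sigma>)"
  unfolding lk_K[OF y D] by blast
 have n: "nested {E \<in> \<sigma>. E \<subset> D}" "nested {E \<in> \<sigma>. D \<subset> E}" by (rule nested_subset[OF z(6)]; blast)+
 have "E \<subset> D \<or> D \<subset> E" if "E \<in> \<sigma>" for E using z(5,6) that unfolding nested_def by blast
 then have "t = vx z ` {E \<in> \<sigma>. E \<subset> D} \<union> vx z ` {E \<in> \<sigma>. D \<subset> E}" unfolding z(1) by blast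
 moreover have "vx z ` {E \<in> \<sigma>. E \<subset> D} \<in> below y D" unfolding below_def using z n(1) by blast
 moreover have "vx z ` {E \<in> \<sigma>. D \<subset> E} \<in> above y D" unfolding above_def using z n(2) by blast
 ultimately show "t \<in> join (below y D) (above y D)" unfolding join_def by blast
next
 fix t assume "t \<in> join (below y D) (above y D)"
 then obtain s u where t: "t = s \<union> u" "s \<in> below y D" "u \<in> above y D" unfolding join_def by blast
 obtain z \<sigma> where z: "s = vx z ` \<sigma>" "z \<in> Y" "rel D y z" "nested \<sigma>" "\<And>E. E \<in> \<sigma> ==> E \<subset> D" using t(2) unfolding below_def by blast
 obtain w \<rho> where w: "u = vx w ` \<rho>" "w \<in> Y" "rel D y w" "\<rho> \<subseteq> types" "nested \<rho>" "\<And>E. E \<in> \<rho> ==> D \<subset> E" using t(3) unfolding above_def by blast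
 have "rel D w z" using rel_trans[OF D w(2) y rel_sym[OF D y w(2,3)] z(3)] .
 then obtain x where x: "x \<in> Y" "\<And>E. E \<subseteq> D ==> rel E x z" "\<And>E. D \<subseteq> E ==> rel E w x" "rel D w x"
  using rel_split[OF D w(2) z(2)] by metis
 have \<sigma>T: "E \<in> types" if "E \<in> \<sigma>" for E using typesD(4)[OF D] z(5)[OF that] by blast
 have "vx x E = vx z E" if "E \<in> \<sigma>" for E using vx_eq[OF x(1) z(2) \<sigma>T[OF that]] x(2) z(5)[OF that] by blast
 then have e1: "vx x ` \<sigma> = vx z ` \<sigma>" by simp
 have "vx x E = vx w E" if "E \<in> \<rho>" for E
 proof -
  have "E \<in> types" "D \<subseteq> E" using w(4) w(6)[OF that] that by auto
  then show ?thesis using vx_eq[OF w(2) x(1), of E] x(3)[of E] by simp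
 qed
 then have e2: "vx x ` \<rho> = vx w ` \<rho>" by simp
 have "E \<subseteq> E'" if "E \<in> \<sigma>" "E' \<in> \<rho>" for E E' using z(5)[OF that(1)] w(6)[OF that(2)] by blast
 then have "nested (\<sigma> \<union> \<rho>)" by (rule nested_Un[OF z(4) w(5)])
 then have "nested (insert D (\<sigma> \<union> \<rho>))" using z(5) w(6) unfolding nested_def by blast
 moreover have "t = vx x ` (\<sigma> \<union> \<rho>)" unfolding t(1) z(1) w(1) image_Un e1 e2 ..
 moreover have "rel D y x" using rel_trans[OF D y w(2,3) x(4)] .
 moreover have "D \<notin> \<sigma> \<union> \<rho>" using z(5) w(6) by blast
 moreover have "\<sigma> \<union> \<rho> \<subseteq> types" using \<sigma>T w(4) by blast
 ultimately show "t \<in> lk K (vx y D)" unfolding lk_K[OF y D] using x(1) by blast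
qed

lemma sph_lk_K:
 assumes y: "y \<in> Y" and D: "D \<in> types"
 shows "sph n (lk K (vx y D))"
proof -
 have "\<Union>(below y D) \<inter> \<Union>(above y D) = {}"
 proof -
  have "fst v \<subset> D" if v: "v \<in> \<Union>(below y D)" for v
  proof -
   obtain z \<sigma> where "v \<in> vx z ` \<sigma>" "\<forall>E\<in>\<sigma>. E \<subset> D" using v unfolding below_def by blast
   then show ?thesis by (metis fst_vx imageE)
  qed
  moreover have "D \<subset> fst v" if v: "v \<in> \<Union>(above y D)" for v
  proof -
   obtain z \<sigma> where "v \<in> vx z ` \<sigma>" "\<forall>E\<in>\<sigma>. D \<subset> E" using v unfolding above_def by blast
   then show ?thesis by (metis fst_vx imageE)
  qed
  ultimately show ?thesis by blast
 qed
 from sph_join[OF sph_below[OF y D] conjunct2[OF sph_above[OF y D]] this] show ?thesis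
  using sph_above[OF y D] unfolding lk_join[OF y D] by simp
qed

lemma omfd_K: "Y \<noteq> {} ==> omfd n K \<Omega>"
 unfolding omfd_def vertices_K using cpx_K \<Omega>(1) sph_lk_K by blast

text \<open>
 For \<open>C \<in> D\<close>, the passage \<open>\<Phi> C\<close> acts on the chambers
 around the vertex, because it commutes with the passages of types in \<open>D\<close>. It
 fixes all classes for chains that contain \<open>C\<close>, in particular the vertex, and
 reverses the orientation.
\<close>

lemma lk_symmetric:
 assumes y: "y \<in> Y" and D: "D \<in> types" "D \<noteq> {}"
 shows "\<exists>\<tau>. oiso (- 1) \<tau> (lk K (vx y D)) (ind (vx y D) \<Omega>) (lk K (vx y D)) (ind (vx y D) \<Omega>)"
proof -
 obtain C where C: "C \<in> D" using D(2) by blast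
 note CT = typesD(1)[OF D(1) C]
 have ne: "Y \<noteq> {}" using y by blast
 define P where "P z E v \<longleftrightarrow> E \<subseteq> D \<and> z \<in> Y \<and> rel D y z \<and> v = vx z E" for z E v
 define \<tau> where "\<tau> v = (if \<exists>z E. P z E v then (SOME v'. \<exists>z E. P z E v \<and> v' = vx (\<Phi> C z) E) else v)" for v
 have wd: "rel E (\<Phi> C z) (\<Phi> C w)" if z: "z \<in> Y" "rel D y z" and w: "w \<in> Y" "rel D y w" and E: "E \<subseteq> D" and r: "rel E z w" for z w E
 proof -
  have ET: "E \<in> types" by (rule typesD(4)[OF D(1) E])
  have "rel D z w" using rel_trans[OF D(1) z(1) y rel_sym[OF D(1) y z(1,2)] w(2)] .
  then obtain ws where ws: "ws \<in> lists D" "agree cell p (\<Union>D) (fold \<Phi> ws z) w" by (auto simp: rel_def)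
  obtain us where us: "us \<in> lists E" "agree cell p (\<Union>E) (fold \<Phi> us z) w" using r by (auto simp: rel_def)
  have uD: "us \<in> lists D" using us(1) E by auto
  note Yf = fold_in[OF D(1) ws(1) z(1)] fold_in[OF D(1) uD z(1)]
  have "fold \<Phi> ws z = fold \<Phi> us z"
   using g_cell[OF Yf(1) w(1)] g_cell[OF Yf(2) w(1)] ws(2) us(2) by (intro fold_unique[OF D(1) ws(1) uD z(1)]) (simp add: agree_def)
  then have "agree cell p (\<Union>D) (\<Phi> C (fold \<Phi> us z)) (\<Phi> C w)"
   using ws(2) Yf(2) w(1) C typesD(2)[OF D(1)] by (intro \<Phi>_agree[OF CT]) auto
  then have "agree cell p (\<Union>E) (fold \<Phi> us (\<Phi> C z)) (\<Phi> C w)"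
   unfolding fold_comm[OF D(1) uD C z(1)] using agree_equiv(4) Union_mono[OF E] by blast
  then show ?thesis unfolding rel_def using us(1) by blast
 qed
 have step: "\<Phi> C z \<in> Y" "rel D y (\<Phi> C z)" "\<And>E. C \<in> E ==> E \<in> types ==> vx (\<Phi> C z) E = vx z E" if z: "z \<in> Y" "rel D y z" for z
 proof -
  show \<Phi>z: "\<Phi> C z \<in> Y" by (rule \<Phi>_in[OF CT z(1)])
  have r: "rel E z (\<Phi> C z)" if "C \<in> E" for E
   unfolding rel_def using that agree_equiv(1) by (intro bexI[of _ "[C]"]) auto
  show "rel D y (\<Phi> C z)" by (rule rel_trans[OF D(1) y z r[OF C]])
  show "vx (\<Phi> C z) E = vx z E" if "C \<in> E" "E \<in> types" for E using vx_eq[OF z(1) \<Phi>z that(2)] r[OF that(1)] by simp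
 qed
 have \<tau>: "\<tau> (vx z E) = vx (\<Phi> C z) E" if z: "z \<in> Y" "rel D y z" "E \<subseteq> D" for z E
 proof -
  have P: "P z E (vx z E)" using z by (simp add: P_def)
  have "(SOME v'. \<exists>w F. P w F (vx z E) \<and> v' = vx (\<Phi> C w) F) = vx (\<Phi> C z) E"
  proof (rule some_equality)
   show "\<exists>w F. P w F (vx z E) \<and> vx (\<Phi> C z) E = vx (\<Phi> C w) F" using P by blast
   fix v assume "\<exists>w F. P w F (vx z E) \<and> v = vx (\<Phi> C w) F"
   then obtain w F where w: "w \<in> Y" "rel D y w" "vx z E = vx w F" "v = vx (\<Phi> C w) F" unfolding P_def by blast
   have FE: "F = E" using w(3) by (metis fst_vx)
   have ET: "E \<in> types" by (rule typesD(4)[OF D(1) z(3)])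
   have "rel E z w" using w(3) vx_eq[OF z(1) w(1) ET] FE by simp
   from wd[OF z(1,2) w(1,2) z(3) this] show "v = vx (\<Phi> C z) E"
    unfolding w(4) FE using vx_eq[OF step(1)[OF z(1,2)] step(1)[OF w(1,2)] ET] by simp
  qed
  then show ?thesis unfolding \<tau>_def using P by auto
 qed
 have fix_above: "\<tau> (vx z E) = vx (\<Phi> C z) E" if z: "z \<in> Y" "rel D y z" and E: "D \<subseteq> E" "E \<in> types" for z E
 proof (cases "E = D")
  case False
  then have "\<not> (\<exists>w F. P w F (vx z E))" using E(1) by (auto simp: P_def vx_def)
  then show ?thesis using step(3)[OF z, of E] C E by (auto simp: \<tau>_def)
 qed (use \<tau>[OF z] in simp)
 have "oiso (- 1) \<tau> (lk K (vx y D)) (ind (vx y D) \<Omega>) (lk K (vx y D)) (ind (vx y D) \<Omega>)"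
 proof (rule lk_reflection[OF cpx_K[OF ne] \<Omega>(1)[OF ne] _ sph_lk_K[OF y D(1)]])
  show "vx y D \<in> \<Union>K" unfolding vertices_K using y D by blast
  show "\<tau> (vx y D) = vx y D" using \<tau>[OF y rel_refl order_refl] step(3)[OF y rel_refl C D(1)] by simp
  show "\<tau> (\<tau> v) = v" for v
  proof (cases "\<exists>z E. P z E v")
   case True
   then obtain z E where z: "E \<subseteq> D" "z \<in> Y" "rel D y z" "v = vx z E" unfolding P_def by blast
   then show ?thesis using \<tau>[OF z(2,3,1)] \<tau>[OF step(1,2)[OF z(2,3)] z(1)] \<Phi>_inv[OF CT z(2)] by simp
  qed (auto simp: \<tau>_def)
  fix u assume u: "u \<in> K" "vx y D \<in> u" "card u = Suc n"
  obtain z \<sigma> where z: "u = vx z ` \<sigma>" "z \<in> Y" "\<sigma> \<subseteq> types" "nested \<sigma>" using u(1) unfolding K_def by blast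
  obtain E where E: "E \<in> \<sigma>" "vx y D = vx z E" using u(2) z(1) by blast
  then have ED: "E = D" by (metis fst_vx)
  then have r: "rel D y z" using E vx_eq[OF y z(2) D(1)] by simp
  have \<tau>\<sigma>: "\<tau> (vx z B) = vx (\<Phi> C z) B" if "B \<in> \<sigma>" for B
  proof -
   have "B \<subseteq> D \<or> D \<subseteq> B" using z(4) E(1) that unfolding ED nested_def by blast
   then show ?thesis
   proof
    show ?thesis if "B \<subseteq> D" by (rule \<tau>[OF z(2) r that])
    show ?thesis if "D \<subseteq> B" using fix_above[OF z(2) r that] z(3) \<open>B \<in> \<sigma>\<close> by blast
   qed
  qed
  obtain l where l: "oface n (sd types) l" "\<sigma> = insert {} (set l)" "{} \<notin> set l"
   using facet_of_K[OF z(2-4)] u(3) unfolding z(1) card_vx by metis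
  have "distinct (vx z {} # map (vx z) l)"
   using l(1,3) vx_inj by (auto simp: oface_def distinct_map vx_def)
  moreover have "\<tau> ` u \<in> K"
  proof -
   have "\<tau> ` u = vx (\<Phi> C z) ` \<sigma>" unfolding z(1) image_image using \<tau>\<sigma> by simp
   then show ?thesis using in_K[OF step(1)[OF z(2) r] z(3,4)] by simp
  qed
  moreover have m: "map \<tau> (vx z {} # map (vx z) l) = vx (\<Phi> C z) {} # map (vx (\<Phi> C z)) l"
   using \<tau>\<sigma> l(2) by simp
  have "\<Omega> (map \<tau> (vx z {} # map (vx z) l)) = - \<Omega> (vx z {} # map (vx z) l)"
   unfolding m \<Omega>(3)[OF z(2) l(1)] \<Omega>(3)[OF step(1)[OF z(2) r] l(1)] sign_def \<Phi>_sign[OF CT z(2)] by simp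
  moreover have "set (vx z {} # map (vx z) l) = u" unfolding z(1) l(2) by simp
  ultimately show "\<exists>r. distinct r \<and> set r = u \<and> \<tau> ` u \<in> K \<and> \<Omega> (map \<tau> r) = - \<Omega> r" by blast
 qed
 then show ?thesis by blast
qed

text \<open>
 The links of all vertices but the centres of the cells have a symmetry, so only the centres
 contribute to the sum over the vertices of \<open>K\<close>.
\<close>

lemma sum_cells:
 fixes f :: "oriented_cpx set => rat"
 assumes f: "f \<in> sphere_cochains (int n)" "kills_manifolds n f"
 shows "(\<Sum>i\<in>cell ` Y. at_cpx f n (S i) (\<epsilon> i)) = 0"
proof (cases "Y = {}")
 case False
 let ?v = "\<lambda>i. ({}, {z \<in> Y. i = cell z}) :: nat set set \<times> 'y set"
 let ?h = "\<lambda>v. at_cpx f n (lk K v) (ind v \<Omega>)"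
 have v: "vx y {} = ?v (cell y)" for y by (simp add: vx_def rel_empty)
 have ori: "ori n (lk K v) (ind v \<Omega>)" for v by (rule ori_lk[OF \<Omega>(1)[OF False]])
 have "(\<Sum>v\<in>\<Union>K. ?h v) = 0" by (rule kills_manifolds_generic[OF f(2) omfd_K[OF False]])
 also have "(\<Sum>v\<in>\<Union>K. ?h v) = (\<Sum>v\<in>?v ` cell ` Y. ?h v)"
 proof (rule sum.mono_neutral_right)
  show "finite (\<Union>K)" using cpxD(5)[OF cpx_K[OF False]] .
  show "?v ` cell ` Y \<subseteq> \<Union>K" unfolding vertices_K using typesD(5) by (force simp flip: v)
  show "\<forall>v\<in>\<Union>K - ?v ` cell ` Y. ?h v = 0"
  proof
   fix w assume "w \<in> \<Union>K - ?v ` cell ` Y"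
   then obtain y D where y: "w = vx y D" "y \<in> Y" "D \<in> types" "D \<noteq> {}" unfolding vertices_K using v by blast
   show "?h w = 0" unfolding y(1) using lk_symmetric[OF y(2-4)] at_cpx_reflection[OF f(1) _ sph_lk_K[OF y(2,3)] ori] by blast
  qed
 qed
 also have "\<dots> = (\<Sum>i\<in>cell ` Y. ?h (?v i))"
  by (rule sum.reindex[unfolded o_def]) (auto simp: inj_on_def)
 also have "\<dots> = (\<Sum>i\<in>cell ` Y. at_cpx f n (S i) (\<epsilon> i))"
 proof (rule sum.cong[OF refl])
  fix i assume "i \<in> cell ` Y"
  then obtain y where y: "y \<in> Y" "i = cell y" by blast
  show "?h (?v i) = at_cpx f n (S i) (\<epsilon> i)"
   using at_cpx_oiso[OF oiso_cell[OF y(1)] sph_cpx[OF cpxs(3)[OF y(1)]] cpxs(4)[OF y(1)] sph_cpx[OF sph_lk_K[OF y(1) typesD(5)]] ori, of f]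
   by (simp add: v y(2))
 qed
 finally show ?thesis .
qed simp

end

section \<open>Mirrors in barycentric subdivisions\<close>

abbreviation "sd3 X \<equiv> sd (sd (sd X))"
abbreviation "sdo3 k X \<omega> \<equiv> sdo k (sd (sd X)) (sdo k (sd X) (sdo k X \<omega>))"

text \<open>
 The flags of the spheres \<open>B j\<close> are the facets of their barycentric
 subdivisions, whose vertices are coloured by dimension. For each colour \<open>c\<close> an
 involution \<open>h c\<close> of the set of all flags reverses the orientation; by
 \<open>h_local\<close>, it depends on the member of colour \<open>c\<close> only and renames
 the vertices.
\<close>

locale mirrors =
 fixes n :: nat and J :: "'j set" and B :: "'j => 'v set set" and \<omega> :: "'j => 'v list => int"
  and h :: "nat => 'j \<times> 'v list => 'j \<times> 'v list"
 assumes n: "n > 0" and J: "finite J" and B: "\<And>j. j \<in> J ==> sph n (B j)" "\<And>j. j \<in> J ==> ori n (B j) (\<omega> j)"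
  and h_in: "\<And>c j vs. c < n ==> j \<in> J ==> oface n (B j) vs ==>
   fst (h c (j, vs)) \<in> J \<and> oface n (B (fst (h c (j, vs)))) (snd (h c (j, vs)))"
  and h_inv: "\<And>c j vs. c < n ==> j \<in> J ==> oface n (B j) vs ==> h c (h c (j, vs)) = (j, vs)"
  and h_sign: "\<And>c j vs. c < n ==> j \<in> J ==> oface n (B j) vs ==>
   \<omega> (fst (h c (j, vs))) (snd (h c (j, vs))) = - \<omega> j vs"
  and h_local: "\<And>c j vs ws. c < n ==> j \<in> J ==> oface n (B j) vs ==> oface n (B j) ws ==>
   flag vs ! c = flag ws ! c ==> \<exists>i \<phi>. h c (j, vs) = (i, map \<phi> vs) \<and> h c (j, ws) = (i, map \<phi> ws)"
begin

definition U :: "('j \<times> 'v list) set" where "U = {(j, vs). j \<in> J \<and> oface n (B j) vs}"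

abbreviation T :: "nat set set" where "T \<equiv> Pow {..<n} - {{}}"

abbreviation "alike \<equiv> agree fst (\<lambda>u c. flag (snd u) ! c)"

text \<open>
 The involutions that could serve as passages through the mirrors of type \<open>C\<close>,
 were it not that passages for nested types have to commute.
\<close>

definition crossings :: "nat set => ('j \<times> 'v list => 'j \<times> 'v list) set" where
 "crossings C = {\<Lambda>. \<Lambda> permutes U \<and> (\<forall>u. \<Lambda> (\<Lambda> u) = u) \<and> (\<forall>u\<in>U. \<omega> (fst (\<Lambda> u)) (snd (\<Lambda> u)) = - \<omega> (fst u) (snd u)) \<and>
   (\<forall>D u w. C \<subseteq> D --> D \<subseteq> {..<n} --> u \<in> U --> w \<in> U --> alike D u w --> alike D (\<Lambda> u) (\<Lambda> w))}"

lemma crossingsD: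
 assumes "\<Lambda> \<in> crossings C"
 shows "u \<in> U ==> \<Lambda> u \<in> U" "\<Lambda> (\<Lambda> u) = u" "u \<in> U ==> \<omega> (fst (\<Lambda> u)) (snd (\<Lambda> u)) = - \<omega> (fst u) (snd u)"
  "C \<subseteq> D ==> D \<subseteq> {..<n} ==> u \<in> U ==> w \<in> U ==> alike D u w ==> alike D (\<Lambda> u) (\<Lambda> w)" "\<Lambda> permutes U"
proof -
 note a = assms[unfolded crossings_def mem_Collect_eq]
 show p: "\<Lambda> permutes U" using a by (rule conjunct1)
 show "u \<in> U ==> \<Lambda> u \<in> U" using permutes_in_image[OF p] by simp
 show "\<Lambda> (\<Lambda> u) = u" "u \<in> U ==> \<omega> (fst (\<Lambda> u)) (snd (\<Lambda> u)) = - \<omega> (fst u) (snd u)"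
  "C \<subseteq> D ==> D \<subseteq> {..<n} ==> u \<in> U ==> w \<in> U ==> alike D u w ==> alike D (\<Lambda> u) (\<Lambda> w)" using a by blast+
qed

lemma finite_U: "finite U"
proof -
 have "U \<subseteq> J \<times> {vs. set vs \<subseteq> (\<Union>j\<in>J. \<Union>(B j)) \<and> length vs = n}" by (auto simp: U_def oface_def)
 moreover have "finite (\<Union>j\<in>J. \<Union>(B j))" using J cpxD(5)[OF sph_cpx[OF B(1)]] by (intro finite_UN_I)
 ultimately show ?thesis by (rule finite_subset[OF _ finite_cartesian_product[OF J finite_lists_length_eq]])
qed

lemma finite_crossings: "finite (crossings C)"
 by (rule finite_subset[OF _ finite_permutations[OF finite_U]]) (auto simp: crossings_def)

lemma crossings_ne:
 assumes C: "C \<in> T"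
 shows "crossings C \<noteq> {}"
proof -
 obtain c where c: "c \<in> C" "c < n" using C by blast
 define \<Lambda> where "\<Lambda> u = (if u \<in> U then h c u else u)" for u
 have hU: "h c u \<in> U" "h c (h c u) = u" "\<omega> (fst (h c u)) (snd (h c u)) = - \<omega> (fst u) (snd u)" if u: "u \<in> U" for u
 proof -
  obtain j vs where "u = (j, vs)" "j \<in> J" "oface n (B j) vs" using u by (auto simp: U_def)
  then show "h c u \<in> U" "h c (h c u) = u" "\<omega> (fst (h c u)) (snd (h c u)) = - \<omega> (fst u) (snd u)"
   using h_in[OF c(2), of j vs] h_inv[OF c(2), of j vs] h_sign[OF c(2), of j vs] by (simp_all add: U_def split_beta)
 qed
 have inv: "\<Lambda> (\<Lambda> u) = u" for u using hU by (simp add: \<Lambda>_def)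
 have "\<Lambda> permutes U" unfolding permutes_def
 proof (intro conjI allI impI)
  show "\<exists>!u. \<Lambda> u = w" for w
  proof (rule ex1I)
   show "u = \<Lambda> w" if "\<Lambda> u = w" for u using inv[of u] that by simp
  qed (rule inv)
 qed (simp add: \<Lambda>_def)
 moreover have "alike D (\<Lambda> u) (\<Lambda> w)" if D: "C \<subseteq> D" "D \<subseteq> {..<n}" and u: "u \<in> U" "w \<in> U" and a: "alike D u w" for D u w
 proof -
  obtain j vs ws where uw: "u = (j, vs)" "w = (j, ws)" "j \<in> J" "oface n (B j) vs" "oface n (B j) ws"
   using u a by (auto simp: U_def agree_def)
  have e: "flag vs ! d = flag ws ! d" if "d \<in> D" for d using a that uw by (simp add: agree_def)
  obtain i \<phi> where i: "h c (j, vs) = (i, map \<phi> vs)" "h c (j, ws) = (i, map \<phi> ws)"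
   using h_local[OF c(2) uw(3-5) e] c(1) D(1) by blast
  have "length vs = n" "length ws = n" using uw by (auto simp: oface_def)
  then show ?thesis using e D(2) u unfolding uw(1,2) \<Lambda>_def by (auto simp: agree_def i flag_map)
 qed
 ultimately have "\<Lambda> \<in> crossings C" using inv hU(3) by (simp add: crossings_def \<Lambda>_def)
 then show ?thesis by blast
qed

lemma crossings_conj:
 assumes C: "\<Lambda> \<in> crossings C" and D: "M \<in> crossings D" and CD: "C \<subseteq> D"
 shows "\<Lambda> \<circ> M \<circ> \<Lambda> \<in> crossings D"
proof -
 note c = crossingsD[OF C] and d = crossingsD[OF D]
 have "\<Lambda> \<circ> M \<circ> \<Lambda> permutes U" by (intro permutes_compose c(5) d(5))
 moreover have "alike E (\<Lambda> (M (\<Lambda> u))) (\<Lambda> (M (\<Lambda> w)))"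
  if E: "D \<subseteq> E" "E \<subseteq> {..<n}" and u: "u \<in> U" "w \<in> U" and a: "alike E u w" for E u w
  using E CD u a by (intro c(4) d(4) c(1) d(1)) auto
 ultimately show ?thesis using c(1-3) d(1-3) by (simp add: crossings_def)
qed

abbreviation P :: "(nat set => 'j \<times> 'v list => 'j \<times> 'v list) set" where "P \<equiv> PiE T crossings"

text \<open>
 A chamber consists of a flag \<open>u\<close>, a choice \<open>\<Lambda>\<close> of
 crossings for all types, and parities \<open>G\<close>. A passage of type \<open>C\<close>
 applies \<open>\<Lambda> C\<close> to the flag and conjugates the crossings of all larger
 types by \<open>\<Lambda> C\<close>. This makes passages of nested types \<open>C \<subset>
 D\<close> commute: in either order the flag becomes \<open>\<Lambda> C (\<Lambda> D
 u)\<close>.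
\<close>

definition act :: "nat set => ('j \<times> 'v list) \<times> (nat set => 'j \<times> 'v list => 'j \<times> 'v list) \<times> nat set set =>
  ('j \<times> 'v list) \<times> (nat set => 'j \<times> 'v list => 'j \<times> 'v list) \<times> nat set set" where
 "act C = (\<lambda>(u, \<Lambda>, G). (\<Lambda> C u, (\<lambda>D. if C \<subset> D \<and> D \<in> T then \<Lambda> C \<circ> \<Lambda> D \<circ> \<Lambda> C else \<Lambda> D), {D. (D \<in> G) \<noteq> (D = C)}))"

text \<open>
 The cells are indexed by all triples of \<open>j\<close>, a choice of crossings and parities,
 so every \<open>B j\<close> occurs the same number of times. The chambers being flags, the
 spheres glued are the \<open>sd (B j)\<close>, which the gluing subdivides twice more.
\<close>

lemma sum_zero:
 fixes f :: "oriented_cpx set => rat"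
 assumes f: "f \<in> sphere_cochains (int n)" "kills_manifolds n f"
 shows "(\<Sum>j\<in>J. at_cpx f n (sd3 (B j)) (sdo3 n (B j) (\<omega> j))) = 0"
proof -
 let ?Y = "U \<times> P \<times> Pow T"
 let ?cell = "\<lambda>(u :: 'j \<times> 'v list, \<Lambda> :: nat set => 'j \<times> 'v list => 'j \<times> 'v list, G :: nat set set). (fst u, \<Lambda>, G)"
 let ?p = "\<lambda>(u :: 'j \<times> 'v list, \<Lambda> :: nat set => 'j \<times> 'v list => 'j \<times> 'v list, G :: nat set set) c. flag (snd u) ! c"
 let ?X = "\<lambda>(j, \<Lambda> :: nat set => 'j \<times> 'v list => 'j \<times> 'v list, G :: nat set set). sd (B j)"
 let ?\<eta> = "\<lambda>(j, \<Lambda> :: nat set => 'j \<times> 'v list => 'j \<times> 'v list, G :: nat set set). sdo n (B j) (\<omega> j)"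
 let ?g = "\<lambda>(u :: 'j \<times> 'v list, \<Lambda> :: nat set => 'j \<times> 'v list => 'j \<times> 'v list, G :: nat set set). G"
 have P: "\<Lambda> C \<in> crossings C" if "\<Lambda> \<in> P" "C \<in> T" for \<Lambda> C using that by (rule PiE_mem)
 have nth: "map (\<lambda>c. flag vs ! c) [0..<n] = flag vs" if "oface n (B j) vs" for vs j
  using that map_nth[of "flag vs"] by (simp add: oface_def)
 have c: "cpx (B j)" "small_dim n (B j)" if "j \<in> J" for j
  using sph_cpx[OF B(1)[OF that]] sph_small_dim[OF B(1)[OF that]] by auto
 have agree: "agree ?cell ?p D (u, \<Lambda>, G) (w, \<Lambda>', G') \<longleftrightarrow> alike D u w \<and> \<Lambda> = \<Lambda>' \<and> G = G'" for D u \<Lambda> G w \<Lambda>' G'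
  by (auto simp: agree_def)
 interpret gl: gluing n ?Y ?cell ?p ?X ?\<eta> act ?g
 proof
  show "finite ?Y" using finite_U finite_crossings by (intro finite_cartesian_product finite_PiE) auto
  show "n > 0" by (rule n)
  show "sph n (?X (?cell y))" "ori n (?X (?cell y)) (?\<eta> (?cell y))" if "y \<in> ?Y" for y
   using that sph_sd[OF B(1)] sdo_sph[OF B n] by (auto simp: U_def)
  show "oface n (?X (?cell y)) (map (?p y) [0..<n])" if "y \<in> ?Y" for y
   using that nth oface_flag[OF c(1)] by (auto simp: U_def)
  show "\<exists>z\<in>?Y. ?cell z = ?cell y \<and> s \<subseteq> ?p z ` {..<n}" if y: "y \<in> ?Y" and s: "s \<in> ?X (?cell y)" for y s
  proof -
   obtain j vs \<Lambda> G where j: "y = ((j, vs), \<Lambda>, G)" "j \<in> J" using y by (auto simp: U_def)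
   have s': "s \<in> sd (B j)" using s j by simp
   obtain t where t: "t \<in> sd (B j)" "s \<subseteq> t" "card t = n" using sph_facet[OF sph_sd[OF B(1)[OF j(2)]] s'] by blast
   obtain ws where ws: "oface n (B j) ws" "set (flag ws) = t" using sd_facet_flag[OF c[OF j(2)] t(1,3) n] by blast
   have "(\<lambda>c. flag ws ! c) ` {..<n} = set (flag ws)" using arg_cong[OF nth[OF ws(1)], of set] by (simp add: atLeast0LessThan)
   then show ?thesis using y j ws t by (intro bexI[of _ "((j, ws), \<Lambda>, G)"]) (auto simp: U_def)
  qed
  show "c = d" if "y \<in> ?Y" "z \<in> ?Y" "c < n" "d < n" "?p y c = ?p z d" for y z c d
   using that card_nth_flag[of "snd (fst y)" c] card_nth_flag[of "snd (fst z)" d] by (auto simp: U_def oface_def)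
  show "y = z" if "y \<in> ?Y" "z \<in> ?Y" and a: "agree ?cell ?p {..<n} y z" for y z
  proof -
   obtain j vs \<Lambda> G i ws \<Lambda>' G' where "y = ((j, vs), \<Lambda>, G)" "z = ((i, ws), \<Lambda>', G')" by (metis surj_pair)
   then have y: "y = ((j, vs), \<Lambda>, G)" "z = ((j, ws), \<Lambda>, G)" "oface n (B j) vs" "oface n (B j) ws"
    using that by (auto simp: U_def agree_def)
   then have "map (\<lambda>c. flag vs ! c) [0..<n] = map (\<lambda>c. flag ws ! c) [0..<n]" using a by (auto simp: agree_def)
   then have "flag vs = flag ws" unfolding nth[OF y(3)] nth[OF y(4)] .
   then show ?thesis using flag_inj[of vs ws] y by (simp add: oface_def)
  qed
  fix C assume C: "C \<in> T"
  fix y assume "y \<in> ?Y"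
  then obtain u \<Lambda> G where y: "y = (u, \<Lambda>, G)" "u \<in> U" "\<Lambda> \<in> P" "G \<in> Pow T" by auto
  note L = crossingsD[OF P[OF y(3) C]]
  have \<Lambda>': "(\<lambda>D. if C \<subset> D \<and> D \<in> T then \<Lambda> C \<circ> \<Lambda> D \<circ> \<Lambda> C else \<Lambda> D) \<in> P"
   using y(3) crossings_conj[OF P[OF y(3) C] P[OF y(3)]] by (intro PiE_I) (auto simp: PiE_iff extensional_def)
  have "{D. (D \<in> G) \<noteq> (D = C)} \<in> Pow T" using y(4) C by auto
  with L(1)[OF y(2)] \<Lambda>' show "act C y \<in> ?Y" unfolding act_def y(1) prod.case by (intro SigmaI)
  show "act C (act C y) = y" unfolding act_def y(1) prod.case prod.inject
  proof (intro conjI ext)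
   show "(if C \<subset> C \<and> C \<in> T then \<Lambda> C \<circ> \<Lambda> C \<circ> \<Lambda> C else \<Lambda> C) (\<Lambda> C u) = u" using L(2) by simp
  qed (use L(2) in auto)
  show "?\<eta> (?cell (act C y)) (map (?p (act C y)) [0..<n]) = - ?\<eta> (?cell y) (map (?p y) [0..<n])"
  proof -
   obtain j vs where u: "u = (j, vs)" "j \<in> J" "oface n (B j) vs" using y(2) by (auto simp: U_def)
   obtain i ws where w: "\<Lambda> C u = (i, ws)" "i \<in> J" "oface n (B i) ws" using L(1)[OF y(2)] by (auto simp: U_def)
   have "sdo n (B i) (\<omega> i) (flag ws) = \<omega> i ws" "sdo n (B j) (\<omega> j) (flag vs) = \<omega> j vs"
    using sdo(2)[OF c[OF w(2)] B(2)[OF w(2)] n w(3)] sdo(2)[OF c[OF u(2)] B(2)[OF u(2)] n u(3)] by simp_all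
   then show ?thesis using L(3)[OF y(2)] nth[OF u(3)] nth[OF w(3)] by (simp add: act_def y(1) w(1)) (simp add: u(1))
  qed
  show "B \<in> ?g (act C y) \<longleftrightarrow> (B \<in> ?g y) \<noteq> (B = C)" for B by (simp add: act_def y(1))
  show "agree ?cell ?p D (act C y) (act C z)"
   if D: "C \<subseteq> D" "D \<subseteq> {..<n}" and z: "z \<in> ?Y" and a: "agree ?cell ?p D y z" for D z
  proof -
   obtain w \<Lambda>' G' where zz: "z = (w, \<Lambda>', G')" by (metis surj_pair)
   then have w: "z = (w, \<Lambda>, G)" "w \<in> U" "alike D u w" using z a unfolding y(1) zz agree by simp_all
   show ?thesis unfolding act_def y(1) w(1) prod.case agree using L(4)[OF D y(2) w(2,3)] by simp
  qed
  show "act D (act C y) = act C (act D y)" if D: "D \<in> T" "C \<subseteq> D" for D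
  proof (cases "C = D")
   case False
   then have CD: "C \<subset> D" "\<not> D \<subset> C" "D \<noteq> C" using D by auto
   note M = crossingsD(2)[OF P[OF y(3) D(1)]]
   have "C \<subset> E" if "D \<subset> E" for E using CD that by blast
   then show ?thesis using CD D(1) L(2) M by (auto simp: act_def y(1) fun_eq_iff)
  qed simp
 next
  show "?g y = ?g z" if "?cell y = ?cell z" for y z using that by auto
 qed
 have cells: "?cell ` ?Y = J \<times> P \<times> Pow T"
 proof (intro equalityI subsetI)
  fix i assume "i \<in> J \<times> P \<times> Pow T"
  then obtain j \<Lambda> G where j: "i = (j, \<Lambda>, G)" "j \<in> J" "\<Lambda> \<in> P" "G \<in> Pow T" by auto
  obtain t where t: "t \<in> B j" "card t = n" using sph_facet[OF B(1)[OF j(2)] cpxD(2)[OF c(1)[OF j(2)]]] by blast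
  obtain vs where vs: "distinct vs" "set vs = t" using finite_distinct_list[OF cpxD(3)[OF c(1)[OF j(2)] t(1)]] by blast
  then have "oface n (B j) vs" using t distinct_card[OF vs(1)] by (simp add: oface_def)
  then have "((j, vs), \<Lambda>, G) \<in> ?Y" using j by (simp add: U_def)
  then show "i \<in> ?cell ` ?Y" using j(1) by (intro image_eqI[of _ _ "((j, vs), \<Lambda>, G)"]) simp_all
 qed (auto simp: U_def)
 have fin: "finite (P \<times> Pow T)" using finite_crossings by (intro finite_cartesian_product finite_PiE) auto
 have "P \<noteq> {}" using crossings_ne by (simp add: PiE_eq_empty_iff)
 then have pos: "card (P \<times> Pow T) \<noteq> 0" using fin by (auto simp: card_eq_0_iff)
 let ?h = "\<lambda>j. at_cpx f n (sd3 (B j)) (sdo3 n (B j) (\<omega> j))"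
 have "(\<Sum>i\<in>J \<times> (P \<times> Pow T). ?h (fst i)) = 0"
  using gl.sum_cells[OF f] unfolding cells by (simp add: split_beta)
 moreover have "(\<Sum>i\<in>J \<times> (P \<times> Pow T). ?h (fst i)) = (\<Sum>j\<in>J. \<Sum>x\<in>P \<times> Pow T. ?h j)"
  using sum.cartesian_product[of "\<lambda>j x. ?h j" "P \<times> Pow T" J] by (simp add: split_beta)
 ultimately show ?thesis using pos by (simp flip: sum_distrib_left)
qed

end

section \<open>Pairing vertices with opposite links\<close>

lemma map_across:
 assumes i: "oiso (- 1) \<theta> (lk X v) (ind v \<omega>) (lk Y w) (ind w \<eta>)" and vs: "oface (Suc k) X (v # vs)"
 shows "oface (Suc k) Y (w # map \<theta> vs)" "\<eta> (w # map \<theta> vs) = - \<omega> (v # vs)"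
 using oiso_ordered[OF i vs[folded oface_lk]] by (simp_all add: oface_lk ind_def)

text \<open>
 The mirrors of colour \<open>0\<close> come from the pairing \<open>\<beta>\<close>: a flag
 starting at the vertex \<open>v\<close> is carried to the partner of \<open>v\<close> by an
 isomorphism of the links. As \<open>\<beta>\<close> need not be an involution, the family is
 doubled, and \<open>\<beta>\<close> leads from the first copy to the second, its inverse
 back. For higher colours two vertices of the simplex in question, chosen once and for all,
 are exchanged.
\<close>

lemma paired_sum_zero:
 fixes f :: "oriented_cpx set => rat" and B :: "'j => 'v set set"
 assumes f: "f \<in> sphere_cochains (int n)" "kills_manifolds n f" and n: "n > 0" and J: "finite J"
  and B: "\<And>j. j \<in> J ==> sph n (B j)" "\<And>j. j \<in> J ==> ori n (B j) (\<omega> j)"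
 defines "V \<equiv> Sigma J (\<lambda>j. \<Union>(B j))"
 assumes \<beta>: "bij_betw \<beta> V V"
  and links: "\<And>j v. j \<in> J ==> v \<in> \<Union>(B j) ==> \<exists>\<theta>. oiso (- 1) \<theta> (lk (B j) v) (ind v (\<omega> j))
   (lk (B (fst (\<beta> (j, v)))) (snd (\<beta> (j, v)))) (ind (snd (\<beta> (j, v))) (\<omega> (fst (\<beta> (j, v)))))"
 shows "(\<Sum>j\<in>J. at_cpx f n (sd3 (B j)) (sdo3 n (B j) (\<omega> j))) = 0"
proof -
 obtain k where k: "n = Suc k" using n by (cases n) auto
 define \<Theta> where "\<Theta> j v = (SOME \<theta>. oiso (- 1) \<theta> (lk (B j) v) (ind v (\<omega> j))
   (lk (B (fst (\<beta> (j, v)))) (snd (\<beta> (j, v)))) (ind (snd (\<beta> (j, v))) (\<omega> (fst (\<beta> (j, v))))))" for j v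
 have \<Theta>: "oiso (- 1) (\<Theta> j v) (lk (B j) v) (ind v (\<omega> j))
   (lk (B (fst (\<beta> (j, v)))) (snd (\<beta> (j, v)))) (ind (snd (\<beta> (j, v))) (\<omega> (fst (\<beta> (j, v)))))"
  if "j \<in> J" "v \<in> \<Union>(B j)" for j v
  unfolding \<Theta>_def by (rule someI_ex[OF links[OF that]])
 define \<gamma> where "\<gamma> = inv_into V \<beta>"
 have \<beta>V: "\<beta> x \<in> V" "\<gamma> (\<beta> x) = x" "\<gamma> x \<in> V" "\<beta> (\<gamma> x) = x" if "x \<in> V" for x
  using \<beta> that bij_betw_inv_into_left[OF \<beta>] bij_betw_inv_into_right[OF \<beta>] bij_betw_apply[OF \<beta>]
   bij_betw_apply[OF bij_betw_inv_into[OF \<beta>]] by (auto simp: \<gamma>_def)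
 \<comment> \<open>the partner of a vertex, and the isomorphism of the links\<close>
 define T where "T b j v = (if b then \<gamma> (j, v) else \<beta> (j, v))" for b j v
 define \<theta> where "\<theta> b j v = (if b then inv_into (\<Union>(lk (B (fst (\<gamma> (j, v)))) (snd (\<gamma> (j, v))))) (\<Theta> (fst (\<gamma> (j, v))) (snd (\<gamma> (j, v)))) else \<Theta> j v)" for b j v
 have \<theta>: "oiso (- 1) (\<theta> b j v) (lk (B j) v) (ind v (\<omega> j)) (lk (B (fst (T b j v))) (snd (T b j v))) (ind (snd (T b j v)) (\<omega> (fst (T b j v))))"
  if "(j, v) \<in> V" for b j v
 proof (cases b)
  case True
  have "\<gamma> (j, v) \<in> V" by (rule \<beta>V(3)[OF that])
  then have "fst (\<gamma> (j, v)) \<in> J" "snd (\<gamma> (j, v)) \<in> \<Union>(B (fst (\<gamma> (j, v))))" unfolding V_def by auto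
  from oiso_sym[OF \<Theta>[OF this]] show ?thesis using True \<beta>V(4)[OF that] by (simp add: T_def \<theta>_def)
 next
  case False
  then show ?thesis using \<Theta>[of j v] that by (simp add: T_def \<theta>_def V_def)
 qed
 have T: "T b j v \<in> V" "T (\<not> b) (fst (T b j v)) (snd (T b j v)) = (j, v)" if "(j, v) \<in> V" for b j v
  using \<beta>V[OF that] by (simp_all add: T_def)
 have \<theta>\<theta>: "\<theta> (\<not> b) (fst (T b j v)) (snd (T b j v)) (\<theta> b j v x) = x" if v: "(j, v) \<in> V" and x: "x \<in> \<Union>(lk (B j) v)" for b j v x
 proof (cases b)
  case True
  have "\<gamma> (j, v) \<in> V" by (rule \<beta>V(3)[OF v])
  then have g: "fst (\<gamma> (j, v)) \<in> J" "snd (\<gamma> (j, v)) \<in> \<Union>(B (fst (\<gamma> (j, v))))" unfolding V_def by auto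
  have "\<Union>(lk (B j) v) = \<Theta> (fst (\<gamma> (j, v))) (snd (\<gamma> (j, v))) ` \<Union>(lk (B (fst (\<gamma> (j, v)))) (snd (\<gamma> (j, v))))"
   using oiso_image[OF \<Theta>[OF g]] \<beta>V(4)[OF v] by (simp add: Union_image_image[symmetric])
  then show ?thesis using True x by (simp add: T_def \<theta>_def f_inv_into_f)
 next
  case False
  have "j \<in> J" "v \<in> \<Union>(B j)" using v by (auto simp: V_def)
  then show ?thesis using False x inv_into_f_f[OF oiso_inj[OF \<Theta>]] \<beta>V(2)[OF v] by (simp add: T_def \<theta>_def)
 qed
 define \<phi> where "\<phi> b j v x = (if x = v then snd (T b j v) else \<theta> b j v x)" for b j v x
 define pair where "pair s = (SOME (a, b). a \<in> s \<and> b \<in> s \<and> a \<noteq> b)" for s :: "'v set"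
 define h where "h c = (\<lambda>((j, b), vs). if c = 0 then ((fst (T b j (the_elem (flag vs ! c))), \<not> b), map (\<phi> b j (the_elem (flag vs ! c))) vs)
   else ((j, b), map (exchange (fst (pair (flag vs ! c))) (snd (pair (flag vs ! c)))) vs))" for c :: nat
 have h0: "h 0 ((j, b), v # vs) = ((fst (T b j v), \<not> b), snd (T b j v) # map (\<theta> b j v) vs)"
   "(j, v) \<in> V" "oface n (B (fst (T b j v))) (snd (T b j v) # map (\<theta> b j v) vs)"
   "\<omega> (fst (T b j v)) (snd (T b j v) # map (\<theta> b j v) vs) = - \<omega> j (v # vs)"
   "fst (T b j v) \<in> J" "set vs \<subseteq> \<Union>(lk (B j) v)"
  if j: "j \<in> J" and vs: "oface n (B j) (v # vs)" for j b v vs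
 proof -
  show vV: "(j, v) \<in> V" using j vs by (auto simp: V_def oface_def)
  have "flag (v # vs) ! 0 = {v}" by (simp add: nth_flag)
  then show "h 0 ((j, b), v # vs) = ((fst (T b j v), \<not> b), snd (T b j v) # map (\<theta> b j v) vs)"
   using vs by (auto simp: h_def \<phi>_def oface_def)
  show "oface n (B (fst (T b j v))) (snd (T b j v) # map (\<theta> b j v) vs)"
   "\<omega> (fst (T b j v)) (snd (T b j v) # map (\<theta> b j v) vs) = - \<omega> j (v # vs)"
   using map_across[OF \<theta>[OF vV, of b] vs[unfolded k]] by (simp_all add: k)
  show "fst (T b j v) \<in> J" using T(1)[OF vV, of b] by (auto simp: V_def)
  have "set vs \<in> lk (B j) v" using vs unfolding k oface_lk[symmetric] by (simp add: oface_def)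
  then show "set vs \<subseteq> \<Union>(lk (B j) v)" by blast
 qed
 have hc: "\<exists>x y. h c ((j, b), vs) = ((j, b), map (exchange x y) vs) \<and> x \<in> set (take (Suc c) vs) \<and> y \<in> set (take (Suc c) vs) \<and> x \<noteq> y \<and>
   pair (set (take (Suc c) vs)) = (x, y)"
  if c: "0 < c" "c < n" and vs: "oface n (B j) vs" for c j b vs
 proof -
  let ?s = "set (take (Suc c) vs)"
  have l: "length vs = n" "distinct vs" using vs by (auto simp: oface_def)
  then have "vs ! 0 \<in> ?s" "vs ! 1 \<in> ?s" "vs ! 0 \<noteq> vs ! 1" using c by (auto simp: in_set_conv_nth nth_eq_iff_index_eq)
  then have "\<exists>p. case p of (a, b) => a \<in> ?s \<and> b \<in> ?s \<and> a \<noteq> b" by auto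
  from someI_ex[OF this] have "case pair ?s of (a, b) => a \<in> ?s \<and> b \<in> ?s \<and> a \<noteq> b" by (simp add: pair_def)
  moreover obtain x y where "pair ?s = (x, y)" by (metis surj_pair)
  ultimately show ?thesis using c l by (intro exI[of _ x] exI[of _ y]) (simp add: h_def nth_flag)
 qed
 interpret m: mirrors n "J \<times> (UNIV :: bool set)" "\<lambda>(j, b). B j" "\<lambda>(j, b). \<omega> j" h
 proof
  show "n > 0" "finite (J \<times> (UNIV :: bool set))" using n J by auto
  show "sph n (case jb of (j, b) => B j)" "ori n (case jb of (j, b) => B j) (case jb of (j, b) => \<omega> j)"
   if "jb \<in> J \<times> UNIV" for jb using that B by auto
  fix c jb vs assume c: "c < n" and jb: "jb \<in> J \<times> (UNIV :: bool set)" and vs: "oface n (case jb of (j, b) => B j) vs"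
  obtain j b where j: "jb = (j, b)" "j \<in> J" using jb by auto
  have o: "oface n (B j) vs" using vs j by simp
  have "(fst (h c (jb, vs)) \<in> J \<times> UNIV \<and> oface n (case fst (h c (jb, vs)) of (j, b) => B j) (snd (h c (jb, vs)))) \<and>
    h c (h c (jb, vs)) = (jb, vs) \<and> (case fst (h c (jb, vs)) of (j, b) => \<omega> j) (snd (h c (jb, vs))) = - (case jb of (j, b) => \<omega> j) vs"
  proof (cases "c = 0")
   case True
   obtain v ws where v: "vs = v # ws" using o n by (cases vs) (auto simp: oface_def)
   note h1 = h0(1,3-5)[OF j(2) o[unfolded v], of b] and v' = h0(2,6)[OF j(2) o[unfolded v]]
   note h2 = h0(1)[OF h1(4,2), of "\<not> b"]
   have "map (\<theta> (\<not> b) (fst (T b j v)) (snd (T b j v))) (map (\<theta> b j v) ws) = ws"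
    unfolding map_map by (rule map_idI) (simp only: o_apply \<theta>\<theta>[OF v'(1) subsetD[OF v'(2)]])
   then show ?thesis unfolding True v j(1) h1(1) h2 using T(2)[OF v'(1)] h1(2-4) by simp
  next
   case False
   then have c0: "0 < c" by simp
   obtain x y where x: "h c (jb, vs) = (jb, map (exchange x y) vs)" "x \<in> set (take (Suc c) vs)" "y \<in> set (take (Suc c) vs)" "x \<noteq> y"
    "pair (set (take (Suc c) vs)) = (x, y)" using hc[OF c0 c o, of b] unfolding j(1) by blast
   have xy: "x \<in> set vs" "y \<in> set vs" using x(2,3) set_take_subset[of "Suc c" vs] by auto
   have e: "exchange x y ` set (take (Suc c) vs) = set (take (Suc c) vs)" "exchange x y ` set vs = set vs"
    using x(2,3) xy by (simp_all add: exchange_image)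
   have "inj_on (exchange x y) (set vs)" by (metis exchange_simps(3) inj_onI)
   then have o': "oface n (B j) (map (exchange x y) vs)"
    using o e(2) by (auto simp: oface_def distinct_map)
   obtain x' y' where x': "h c (jb, map (exchange x y) vs) = (jb, map (exchange x' y') (map (exchange x y) vs))"
    "pair (set (take (Suc c) (map (exchange x y) vs))) = (x', y')" using hc[OF c0 c o', of b] unfolding j(1) by blast
   then have "x' = x" "y' = y" using x(5) e(1) by (simp_all add: take_map)
   moreover have "map (exchange x y) (map (exchange x y) vs) = vs" by (simp add: map_idI)
   moreover have "\<omega> j (map (exchange x y) vs) = - \<omega> j vs"
    using o xy x(4) by (intro alternating_exchange[OF oriD(3)[OF B(2)[OF j(2)]]]) (auto simp: oface_def)
   ultimately show ?thesis using x(1) x'(1) o' jb j by simp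
  qed
  then show "fst (h c (jb, vs)) \<in> J \<times> UNIV \<and> oface n (case fst (h c (jb, vs)) of (j, b) => B j) (snd (h c (jb, vs)))"
   "h c (h c (jb, vs)) = (jb, vs)" "(case fst (h c (jb, vs)) of (j, b) => \<omega> j) (snd (h c (jb, vs))) = - (case jb of (j, b) => \<omega> j) vs"
   by simp_all
  show "\<exists>i \<phi>. h c (jb, vs) = (i, map \<phi> vs) \<and> h c (jb, ws) = (i, map \<phi> ws)" if "flag vs ! c = flag ws ! c" for ws
   using that by (cases "c = 0") (auto simp: h_def j(1))
 qed
 let ?h = "\<lambda>j. at_cpx f n (sd3 (B j)) (sdo3 n (B j) (\<omega> j))"
 have "(\<Sum>x\<in>J \<times> (UNIV :: bool set). ?h (fst x)) = 0" using m.sum_zero[OF f] by (simp add: split_beta)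
 moreover have "(\<Sum>x\<in>J \<times> (UNIV :: bool set). ?h (fst x)) = (\<Sum>j\<in>J. \<Sum>b\<in>(UNIV :: bool set). ?h j)"
  using sum.cartesian_product[of "\<lambda>j (b :: bool). ?h j" UNIV J] by (simp add: split_beta)
 ultimately have "(\<Sum>j\<in>J. 2 * ?h j) = 0" by simp
 then show ?thesis unfolding sum_distrib_left[symmetric] by simp
qed

section \<open>From balanced families to coboundaries\<close>

text \<open>
 Extend linearly from a basis of the span of the vectors; the relation between a further vector
 and the basis forces the prescribed value.
\<close>

lemma linear_functional_exists:
 fixes x :: "'i => 'c => rat" and y :: "'i => rat"
 assumes dep: "\<And>S a. finite S ==> S \<subseteq> I ==> (\<And>c. (\<Sum>i\<in>S. a i * x i c) = 0) ==> (\<Sum>i\<in>S. a i * y i) = 0"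
 shows "\<exists>G. (\<forall>u w. G (\<lambda>c. u c + w c) = G u + G w) \<and> (\<forall>r u. G (\<lambda>c. r * u c) = r * G u) \<and> (\<forall>i\<in>I. G (x i) = y i)"
proof -
 let ?s = "\<lambda>r u (c :: 'c). r * u c :: rat"
 interpret vector_space_pair ?s "(*) :: rat => rat => rat"
  by unfold_locales (auto simp: algebra_simps fun_eq_iff)
 obtain B where B: "B \<subseteq> x ` I" "vs1.independent B" "x ` I \<subseteq> vs1.span B"
  using vs1.maximal_independent_subset by blast
 define \<iota> where "\<iota> = inv_into I x"
 have \<iota>: "\<iota> b \<in> I" "x (\<iota> b) = b" if "b \<in> B" for b
  using that B(1) unfolding \<iota>_def by (auto intro: inv_into_into f_inv_into_f)
 obtain G where G: "Vector_Spaces.linear ?s (*) G" "\<forall>b\<in>B. G b = y (\<iota> b)"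
  using linear_independent_extend[OF B(2), of "\<lambda>b. y (\<iota> b)"] by blast
 interpret G: Vector_Spaces.linear ?s "(*)" G by (rule G(1))
 have "G (x i) = y i" if i: "i \<in> I" for i
 proof -
  have "x i \<in> vs1.span B" using B(3) i by blast
  then obtain t r where t: "finite t" "t \<subseteq> B" "x i = (\<Sum>b\<in>t. ?s (r b) b)" unfolding vs1.span_explicit by auto
  have inj: "inj_on \<iota> t" using \<iota>(2) t(2) by (metis inj_onI subsetD)
  let ?S = "insert i (\<iota> ` t)"
  let ?a = "\<lambda>k. (if k = i then 1 else 0) - (if k \<in> \<iota> ` t then r (x k) else 0)"
  have sum: "(\<Sum>k\<in>?S. ?a k * v k) = v i - (\<Sum>b\<in>t. r b * v (\<iota> b))" for v :: "'i => rat"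
  proof -
   have "(\<Sum>k\<in>?S. ?a k * v k) = (\<Sum>k\<in>?S. (if k = i then v k else 0)) - (\<Sum>k\<in>?S. if k \<in> \<iota> ` t then r (x k) * v k else 0)"
    unfolding sum_subtractf[symmetric] by (intro sum.cong) (auto simp: algebra_simps)
   also have "(\<Sum>k\<in>?S. (if k = i then v k else 0)) = v i" using t(1) by (simp add: sum.delta)
   also have "(\<Sum>k\<in>?S. if k \<in> \<iota> ` t then r (x k) * v k else 0) = (\<Sum>k\<in>\<iota> ` t. r (x k) * v k)"
    using t(1) by (subst sum.inter_restrict[symmetric]) (auto intro: sum.cong)
   also have "\<dots> = (\<Sum>b\<in>t. r b * v (\<iota> b))"
    using \<iota>(2) t(2) by (subst sum.reindex[OF inj]) (auto intro!: sum.cong)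
   finally show ?thesis .
  qed
  have ft: "(\<Sum>b\<in>A. ?s (r b) b) c = (\<Sum>b\<in>A. r b * b c)" for A c by (induction A rule: infinite_finite_induct) auto
  have "(\<Sum>k\<in>?S. ?a k * x k c) = 0" for c
   using sum[of "\<lambda>k. x k c"] \<iota>(2) t(2) arg_cong[OF t(3), of "\<lambda>u. u c"] unfolding ft by (simp add: subset_iff)
  then have "(\<Sum>k\<in>?S. ?a k * y k) = 0" using t(1,2) i \<iota>(1) by (intro dep) auto
  then have "y i = (\<Sum>b\<in>t. r b * y (\<iota> b))" using sum[of y] by simp
  also have "\<dots> = G (x i)" using t(2) G(2) unfolding t(3) G.sum G.scale by (intro sum.cong) auto
  finally show ?thesis by simp
 qed
 moreover have "G (\<lambda>c. u c + w c) = G u + G w" for u w using G.add[of u w] by (simp add: plus_fun_def)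
 ultimately show ?thesis using G.scale by blast
qed

lemma common_denominator:
 fixes a :: "'i => rat"
 assumes "finite S"
 shows "\<exists>N m. N \<noteq> 0 \<and> (\<forall>i\<in>S. N * a i = of_int (m i))"
 using assms
proof (induction S rule: finite_induct)
 case (insert i S)
 then obtain N m where N: "N \<noteq> 0" "\<forall>j\<in>S. N * a j = of_int (m j)" by blast
 obtain p q where pq: "quotient_of (N * a i) = (p, q)" by (metis surj_pair)
 have q: "q > 0" "N * a i = of_int p / of_int q" using pq quotient_of_denom_pos quotient_of_div by blast+
 show ?case
 proof (intro exI conjI ballI)
  show "of_int q * N \<noteq> 0" using N q by simp
  show "of_int q * N * a j = of_int (if j = i then p else q * m j)" if "j \<in> insert i S" for j
   using that N(2) q by (auto simp: mult.assoc)
 qed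
qed (auto intro: exI[of _ 1])

abbreviation "cls k X \<eta> \<equiv> iso_class (int k - 1) (X, \<eta>)"

text \<open>
 The cycle \<open>\<Sum>v. [Lk v]\<close> in the vector space spanned by classes of oriented
 spheres, where \<open>[S]\<close> stands for the class of \<open>S\<close> minus that of
 \<open>- S\<close>.
\<close>

definition link_cycle :: "nat => nat set set => (nat list => int) => oriented_cpx set => rat" where
 "link_cycle k L \<omega> C = (\<Sum>v\<in>\<Union>L. of_bool (cls k (lk L v) (ind v \<omega>) = C) - of_bool (cls k (lk L v) (opp (ind v \<omega>)) = C))"

lemma opp_simps [simp]: "opp (opp \<omega>) = \<omega>" "ind v (opp \<omega>) = opp (ind v \<omega>)"
 by (auto simp: opp_def ind_def)

lemma link_cycle_opp: "link_cycle k L (opp \<omega>) C = - link_cycle k L \<omega> C"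
 by (simp add: link_cycle_def flip: sum_negf)

text \<open>
 A family is balanced if its link cycles add up to zero. The second component of an index
 allows for repetitions.
\<close>

definition vanishes_on_balanced :: "nat => (oriented_cpx set => rat) => bool" where
 "vanishes_on_balanced k F \<longleftrightarrow> (\<forall>(J :: (oriented_cpx \<times> nat) set) B \<omega>. finite J -->
   (\<forall>j\<in>J. sph (Suc k) (B j) \<and> ori (Suc k) (B j) (\<omega> j)) -->
   (\<forall>C. (\<Sum>j\<in>J. link_cycle k (B j) (\<omega> j) C) = 0) --> (\<Sum>j\<in>J. at_cpx F (Suc k) (B j) (\<omega> j)) = 0)"

text \<open>
 A rational relation between link cycles becomes a balanced family: clear denominators,
 repeat each sphere as often as its coefficient says, and reverse its orientation if the
 coefficient is negative.
\<close>

lemma integral_cycles: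
 assumes F: "F \<in> sphere_cochains (int (Suc k))" and van: "vanishes_on_balanced k F"
  and S: "finite S" "S \<subseteq> {(L, \<omega>). sph (Suc k) L \<and> ori (Suc k) L \<omega>}"
  and dep: "\<And>C. (\<Sum>i\<in>S. a i * link_cycle k (fst i) (snd i) C) = 0"
 shows "(\<Sum>i\<in>S. a i * at_cpx F (Suc k) (fst i) (snd i)) = 0"
proof -
 obtain N m where N: "N \<noteq> 0" "\<forall>i\<in>S. N * a i = of_int (m i)" using common_denominator[OF S(1)] by blast
 define J where "J = Sigma S (\<lambda>i. {..<nat \<bar>m i\<bar>})"
 define \<omega> where "\<omega> j = (if m (fst j) \<ge> 0 then snd (fst j) else opp (snd (fst j)))" for j :: "oriented_cpx \<times> nat"
 have sum: "(\<Sum>j\<in>J. h (fst (fst j)) (\<omega> j)) = N * (\<Sum>i\<in>S. a i * h (fst i) (snd i))"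
  if h: "\<And>L \<eta>. sph (Suc k) L ==> ori (Suc k) L \<eta> ==> h L (opp \<eta>) = - h L \<eta>" for h :: "nat set set => (nat list => int) => rat"
 proof -
  have "(\<Sum>j\<in>J. h (fst (fst j)) (\<omega> j)) = (\<Sum>i\<in>S. \<Sum>t<nat \<bar>m i\<bar>. h (fst i) (if m i \<ge> 0 then snd i else opp (snd i)))"
   unfolding J_def \<omega>_def using S(1) by (subst sum.Sigma) (auto simp: split_beta)
  also have "\<dots> = (\<Sum>i\<in>S. N * (a i * h (fst i) (snd i)))"
  proof (rule sum.cong[OF refl])
   fix i assume i: "i \<in> S"
   have "h (fst i) (opp (snd i)) = - h (fst i) (snd i)" using S(2) i by (intro h) auto
   then show "(\<Sum>t<nat \<bar>m i\<bar>. h (fst i) (if m i \<ge> 0 then snd i else opp (snd i))) = N * (a i * h (fst i) (snd i))"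
    using N(2) i by (simp add: mult.assoc[symmetric])
  qed
  finally show ?thesis by (simp add: sum_distrib_left)
 qed
 have "(\<Sum>j\<in>J. at_cpx F (Suc k) (fst (fst j)) (\<omega> j)) = 0"
 proof (rule van[unfolded vanishes_on_balanced_def, rule_format])
  show "finite J" unfolding J_def using S(1) by auto
  show "sph (Suc k) (fst (fst j)) \<and> ori (Suc k) (fst (fst j)) (\<omega> j)" if "j \<in> J" for j
   using that subsetD[OF S(2), of "fst j"] by (cases j) (auto simp: J_def \<omega>_def intro: ori_opp)
  show "(\<Sum>j\<in>J. link_cycle k (fst (fst j)) (\<omega> j) C) = 0" for C
   using sum[of "\<lambda>L \<eta>. link_cycle k L \<eta> C"] link_cycle_opp dep[of C] by simp
 qed
 then show ?thesis using sum[of "at_cpx F (Suc k)", OF at_cpx_opp[OF F]] N(1) by simp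
qed

definition cobounds :: "nat => (oriented_cpx set => rat) => bool" where
 "cobounds k F \<longleftrightarrow> (\<exists>g\<in>sphere_cochains (int k). \<forall>L \<omega>. sph (Suc k) (L :: nat set set) \<and> ori (Suc k) L \<omega> -->
   at_cpx F (Suc k) L \<omega> = (\<Sum>v\<in>\<Union>L. at_cpx g k (lk L v) (ind v \<omega>)))"

lemma oiso_opp_both: "oiso 1 \<phi> X \<omega> Y \<eta> ==> oiso 1 \<phi> X (opp \<omega>) Y (opp \<eta>)"
 by (auto simp: oiso_def opp_def)

text \<open>
 By the assumption, the value of \<open>F\<close> depends linearly on the link cycle, through
 a functional \<open>G\<close>. The cochain is \<open>g S = G [S]\<close>, with
 \<open>[S]\<close> as in \<open>link_cycle\<close>.
\<close>

lemma cobounds_if_vanishes_on_balanced: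
 assumes F: "F \<in> sphere_cochains (int (Suc k))" and van: "vanishes_on_balanced k F"
 shows "cobounds k F"
proof -
 let ?I = "{(L :: nat set set, \<omega>). sph (Suc k) L \<and> ori (Suc k) L \<omega>}"
 obtain G where G': "(\<forall>u w. G (\<lambda>c. u c + w c) = G u + G w) \<and> (\<forall>r u. G (\<lambda>c. r * u c) = r * G u) \<and>
   (\<forall>i\<in>?I. G (link_cycle k (fst i) (snd i)) = at_cpx F (Suc k) (fst i) (snd i))"
  using linear_functional_exists[of ?I "\<lambda>i. link_cycle k (fst i) (snd i)" "\<lambda>i. at_cpx F (Suc k) (fst i) (snd i)", OF integral_cycles[OF F van]]
  by (rule exE)
 have G: "G (\<lambda>c. u c + w c) = G u + G w" "G (\<lambda>c. r * u c) = r * G u" for u w r using G' by simp_all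
 have G0: "G (\<lambda>c. 0) = 0" using G(2)[of 0] by simp
 have Gminus: "G (\<lambda>c. u c - w c) = G u - G w" for u w using G(1)[of u "\<lambda>c. - 1 * w c"] G(2)[of "- 1" w] by simp
 have Gsum: "G (\<lambda>c. \<Sum>v\<in>A. u v c) = (\<Sum>v\<in>A. G (u v))" if "finite A" for A and u :: "nat => oriented_cpx set => rat"
  using that by (induction A rule: finite_induct) (simp_all add: G0 G(1))
 define H where "H S \<eta> = G (\<lambda>C. of_bool (cls k S \<eta> = C)) - G (\<lambda>C. of_bool (cls k S (opp \<eta>) = C))" for S \<eta>
 have pres: "H Y \<eta> = H X \<omega>"
  if "oiso 1 \<phi> X \<omega> Y \<eta>" and X: "sph k X" "ori k X \<omega>" and Y: "sph k Y" "ori k Y \<eta>" for \<phi> X \<omega> Y \<eta>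
  unfolding H_def
  using iso_class_eq_of_oiso[OF that(1) sph_cpx[OF X(1)] X(2) sph_cpx[OF Y(1)] Y(2)]
   iso_class_eq_of_oiso[OF oiso_opp_both[OF that(1)] sph_cpx[OF X(1)] ori_opp[OF X(2)] sph_cpx[OF Y(1)] ori_opp[OF Y(2)]]
  by simp
 have inv: "H Y \<eta> = of_int c * H X \<omega>"
  if "oiso c \<phi> X \<omega> Y \<eta>" and X: "sph k X" "ori k X \<omega>" and Y: "sph k Y" "ori k Y \<eta>" and c: "c = 1 \<or> c = -1" for \<phi> X \<omega> Y \<eta> c
  using c that(1) pres[OF _ X Y] pres[OF oiso_opp X(1) ori_opp[OF X(2)] Y] by (auto simp: H_def)
 define g where "g = class_fun k H"
 have "at_cpx F (Suc k) L \<omega> = (\<Sum>v\<in>\<Union>L. at_cpx g k (lk L v) (ind v \<omega>))" if L: "sph (Suc k) L" "ori (Suc k) L \<omega>" for L :: "nat set set" and \<omega>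
 proof -
  have "at_cpx F (Suc k) L \<omega> = G (link_cycle k L \<omega>)" using G' L by simp
  also have "\<dots> = (\<Sum>v\<in>\<Union>L. H (lk L v) (ind v \<omega>))"
   unfolding link_cycle_def[abs_def] H_def Gsum[OF cpxD(5)[OF sph_cpx[OF L(1)]]] Gminus ..
  also have "\<dots> = (\<Sum>v\<in>\<Union>L. at_cpx g k (lk L v) (ind v \<omega>))"
  proof (rule sum.cong[OF refl])
   fix v assume "v \<in> \<Union>L"
   then have s: "sph k (lk L v)" "ori k (lk L v) (ind v \<omega>)" using sph_lk[OF L(1)] ori_lk[OF L(2)] by auto
   show "H (lk L v) (ind v \<omega>) = at_cpx g k (lk L v) (ind v \<omega>)"
    unfolding at_cpx_nat[OF sph_cpx[OF s(1)] s(2)] g_def using class_fun(2)[OF inv s] by simp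
  qed
  finally show ?thesis .
 qed
 moreover have "g \<in> sphere_cochains (int k)" unfolding g_def by (rule class_fun(1)[OF inv])
 ultimately show ?thesis unfolding cobounds_def by blast
qed

text \<open>
 Balanced means that the classes of the vertex links and of the opposite vertex links are the
 same with multiplicities, whence a pairing \<open>\<beta>\<close> of the vertices.
\<close>

lemma vanishes_on_balanced_Sd3:
 assumes f: "f \<in> sphere_cochains (int (Suc k))" "kills_manifolds (Suc k) f"
 shows "vanishes_on_balanced k (Sd (Suc k) (Sd (Suc k) (Sd (Suc k) f)))"
 unfolding vanishes_on_balanced_def
proof (intro allI impI)
 fix J :: "(oriented_cpx \<times> nat) set" and B \<omega>
 assume J: "finite J" and "\<forall>j\<in>J. sph (Suc k) (B j) \<and> ori (Suc k) (B j) (\<omega> j)"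
  and bal: "\<forall>C. (\<Sum>j\<in>J. link_cycle k (B j) (\<omega> j) C) = 0"
 then have B: "sph (Suc k) (B j)" "ori (Suc k) (B j) (\<omega> j)" if "j \<in> J" for j using that by blast+
 let ?V = "Sigma J (\<lambda>j. \<Union>(B j))"
 let ?a = "\<lambda>(j, v). cls k (lk (B j) v) (ind v (\<omega> j))" and ?b = "\<lambda>(j, v). cls k (lk (B j) v) (opp (ind v (\<omega> j)))"
 have fV: "finite ?V" using J cpxD(5)[OF sph_cpx[OF B(1)]] by (intro finite_SigmaI)
 have "image_mset ?a (mset_set ?V) = image_mset ?b (mset_set ?V)"
 proof (rule multiset_eqI)
  fix C :: "oriented_cpx set"
  have card: "(\<Sum>x\<in>?V. of_bool (h x = C)) = rat_of_nat (count (image_mset h (mset_set ?V)) C)" for h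
  proof -
   have "?V \<inter> {x. h x = C} = {x \<in> ?V. h x = C}" by blast
   then show ?thesis using fV by (simp add: count_image_mset_eq_card_vimage)
  qed
  have "0 = (\<Sum>j\<in>J. link_cycle k (B j) (\<omega> j) C)" using bal by simp
  also have "\<dots> = (\<Sum>x\<in>?V. of_bool (?a x = C) - of_bool (?b x = C))"
   unfolding link_cycle_def using J cpxD(5)[OF sph_cpx[OF B(1)]] by (subst sum.Sigma) (auto simp: split_beta)
  finally have "(\<Sum>x\<in>?V. of_bool (?a x = C)) = (\<Sum>x\<in>?V. of_bool (?b x = C) :: rat)" by (simp add: sum_subtractf)
  then show "count (image_mset ?a (mset_set ?V)) C = count (image_mset ?b (mset_set ?V)) C"
   unfolding card by simp
 qed
 from image_mset_eq_implies_permutes[OF fV this] obtain \<beta> where \<beta>: "\<beta> permutes ?V" "\<forall>x\<in>?V. ?a x = ?b (\<beta> x)" .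
 let ?f1 = "Sd (Suc k) f" and ?f2 = "Sd (Suc k) (Sd (Suc k) f)"
 note f1 = Sd(1)[OF f(1) zero_less_Suc]
 note f2 = Sd(1)[OF f1 zero_less_Suc]
 have "at_cpx (Sd (Suc k) ?f2) (Suc k) (B j) (\<omega> j) = at_cpx f (Suc k) (sd3 (B j)) (sdo3 (Suc k) (B j) (\<omega> j))" if j: "j \<in> J" for j
  using Sd(2)[OF f2 _ B[OF j]] Sd(2)[OF f1 _ sph_sd[OF B(1)[OF j]] sdo_sph[OF B[OF j]]]
   Sd(2)[OF f(1) _ sph_sd[OF sph_sd[OF B(1)[OF j]]] sdo_sph[OF sph_sd[OF B(1)[OF j]] sdo_sph[OF B[OF j]]]] by simp
 then have "(\<Sum>j\<in>J. at_cpx (Sd (Suc k) ?f2) (Suc k) (B j) (\<omega> j)) = (\<Sum>j\<in>J. at_cpx f (Suc k) (sd3 (B j)) (sdo3 (Suc k) (B j) (\<omega> j)))"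
  by (rule sum.cong[OF refl])
 also have "\<dots> = 0"
 proof (rule paired_sum_zero[OF f _ J B permutes_imp_bij[OF \<beta>(1)]])
  fix j v assume j: "j \<in> J" "v \<in> \<Union>(B j)"
  obtain i w where i: "\<beta> (j, v) = (i, w)" by (metis surj_pair)
  then have iV: "i \<in> J" "w \<in> \<Union>(B i)" using permutes_in_image[OF \<beta>(1), of "(j, v)"] j by auto
  have s: "sph k (lk (B j) v)" "sph k (lk (B i) w)" using sph_lk[OF B(1)[OF j(1)] j(2)] sph_lk[OF B(1)[OF iV(1)] iV(2)] by auto
  have "?a (j, v) = ?b (i, w)" using \<beta>(2) j i by force
  then obtain \<theta> where "oiso 1 \<theta> (lk (B j) v) (ind v (\<omega> j)) (lk (B i) w) (opp (ind w (\<omega> i)))"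
   using oiso_of_iso_class_eq[OF s(1) ori_lk[OF B(2)[OF j(1)]] s(2) ori_opp[OF ori_lk[OF B(2)[OF iV(1)]]]] by auto
  then have "oiso (- 1) \<theta> (lk (B j) v) (ind v (\<omega> j)) (lk (B i) w) (ind w (\<omega> i))" by (auto simp: oiso_def opp_def)
  then show "\<exists>\<theta>. oiso (- 1) \<theta> (lk (B j) v) (ind v (\<omega> j))
   (lk (B (fst (\<beta> (j, v)))) (snd (\<beta> (j, v)))) (ind (snd (\<beta> (j, v))) (\<omega> (fst (\<beta> (j, v)))))" unfolding i by auto
 qed simp
 finally show "(\<Sum>j\<in>J. at_cpx (Sd (Suc k) ?f2) (Suc k) (B j) (\<omega> j)) = 0" .
qed

lemma cobounds_step:
 assumes f: "f \<in> sphere_cochains (int (Suc k))" "kills_manifolds (Suc k) f" and Sd: "cobounds k (Sd (Suc k) f)"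
 shows "cobounds k f"
proof -
 obtain g where g: "g \<in> sphere_cochains (int k)" "\<And>L \<omega>. sph (Suc k) (L :: nat set set) \<and> ori (Suc k) L \<omega> ==>
   at_cpx f (Suc k) L \<omega> = at_cpx (Sd (Suc k) f) (Suc k) L \<omega> + (\<Sum>v\<in>\<Union>L. at_cpx g k (lk L v) (ind v \<omega>))"
  using Sd_step[OF f] by blast
 obtain h where h: "h \<in> sphere_cochains (int k)" "\<And>L \<omega>. sph (Suc k) (L :: nat set set) \<and> ori (Suc k) L \<omega> ==>
   at_cpx (Sd (Suc k) f) (Suc k) L \<omega> = (\<Sum>v\<in>\<Union>L. at_cpx h k (lk L v) (ind v \<omega>))"
  using Sd unfolding cobounds_def by blast
 have "(\<lambda>C. g C + h C) \<in> sphere_cochains (int k)" using g(1) h(1) by (simp add: sphere_cochains_def)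
 moreover have "at_cpx (\<lambda>C. g C + h C) k X \<eta> = at_cpx g k X \<eta> + at_cpx h k X \<eta>" for X :: "nat set set" and \<eta>
  by (simp add: at_cpx_def)
 ultimately show ?thesis unfolding cobounds_def using g(2) h(2) by (intro bexI[of _ "\<lambda>C. g C + h C"]) (simp_all add: sum.distrib)
qed

lemma cobounds_if_kills_manifolds:
 assumes f: "f \<in> sphere_cochains (int (Suc k))" "kills_manifolds (Suc k) f"
 shows "cobounds k f"
proof -
 note f1 = Sd(1)[OF f(1) zero_less_Suc] Sd_kills[OF f]
 note f2 = Sd(1)[OF f1(1) zero_less_Suc] Sd_kills[OF f1]
 show ?thesis
  by (rule cobounds_step[OF f cobounds_step[OF f1 cobounds_step[OF f2 cobounds_if_vanishes_on_balanced[OF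
      Sd(1)[OF f2(1) zero_less_Suc] vanishes_on_balanced_Sd3[OF f]]]]])
qed

lemma verts_Union: "cpx X ==> verts X = \<Union>X"
 using cpxD(4,6)[of X] by (auto simp: verts_def)

text \<open>
 In degree \<open>n = m\<close>, the hypothesis expresses \<open>f (Lk v)\<close> as a sum of
 coefficients of the edges at \<open>v\<close>, and these cancel in pairs.
\<close>

lemma kills_manifolds_of_boundaries:
 fixes f :: "oriented_cpx set => rat"
 assumes bd: "\<And>K. combinatorial_manifold (int (Suc k)) K ==>
   sharp (int (Suc k)) f (int (Suc k)) K \<in> cooriented_boundary (int (Suc k)) K 1 ` cooriented_chains (int (Suc k)) K 1"
 shows "kills_manifolds (Suc k) f"
 unfolding kills_manifolds_def
proof (intro allI impI)
 fix K :: "nat set set" and \<omega>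
 let ?n = "int (Suc k)"
 assume K: "omfd (Suc k) K \<omega>"
 then have c: "cpx K" and o: "ori (Suc (Suc k)) K \<omega>" and l: "\<And>v. v \<in> \<Union>K ==> sph (Suc k) (lk K v)"
  by (auto simp: omfd_def)
 obtain ch where ch: "ch \<in> cooriented_chains ?n K 1" "sharp ?n f ?n K = cooriented_boundary ?n K 1 ch"
  using bd[OF combinatorial_manifold_of_links[OF c l]] by blast
 have "at_cpx f (Suc k) (lk K v) (ind v \<omega>) = (\<Sum>w\<in>\<Union>(lk K v). ch {v, w} (ind w (ind v \<omega>)))" if v: "v \<in> \<Union>K" for v
 proof -
  have co: "cooriented_simplex ?n K 0 {v} (ind v \<omega>)"
   using cpxD(6)[OF c v] ori_lk[OF o, of v] is_orientation_iff_ori[of "Suc k" "lk K v" "ind v \<omega>"]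
   by (simp add: cooriented_simplex_def coorientation_def sdim_def link_lk[OF c])
  have "at_cpx f (Suc k) (lk K v) (ind v \<omega>) = sharp ?n f ?n K {v} (ind v \<omega>)"
   using co at_cpx_nat[OF sph_cpx[OF l[OF v]] ori_lk[OF o]] by (simp add: sharp_def link_lk[OF c])
  also have "\<dots> = (\<Sum>w\<in>\<Union>(lk K v). ch {v, w} (ind w (ind v \<omega>)))"
   using co unfolding ch(2) by (simp add: cooriented_boundary_def link_lk[OF c] verts_Union[OF sph_cpx[OF l[OF v]]] ind_induced insert_commute)
  finally show ?thesis .
 qed
 then have "(\<Sum>v\<in>\<Union>K. at_cpx f (Suc k) (lk K v) (ind v \<omega>)) = (\<Sum>v\<in>\<Union>K. \<Sum>w\<in>\<Union>(lk K v). ch {v, w} (ind w (ind v \<omega>)))"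
  by simp
 also have "\<dots> = 0"
 proof (rule double_link_sum_zero[OF c o])
  fix v w assume vw: "v \<noteq> w" "{v, w} \<in> K"
  have lk2: "link K {v, w} = lk (lk K v) w"
   using vw cpxD(4)[OF c] by (auto simp: link_def lk_def insert_commute)
  have "ori k (lk (lk K v) w) (ind w (ind v \<omega>))" by (intro ori_lk o)
  then have co: "cooriented_simplex ?n K 1 {v, w} (ind w (ind v \<omega>))"
   using vw is_orientation_iff_ori[of k "lk (lk K v) w"] by (simp add: cooriented_simplex_def coorientation_def sdim_def lk2)
  have op: "opposite (ind w (ind v \<omega>)) = ind w (ind v (opp \<omega>))" by (rule ext) (simp add: opposite_def opp_def)
  have "\<forall>s \<omega>. cooriented_simplex ?n K 1 s \<omega> --> ch s (opposite \<omega>) = - ch s \<omega>"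
   using ch(1) by (simp add: cooriented_chains_def)
  from this[rule_format, OF co] show "ch {v, w} (ind w (ind v (opp \<omega>))) = - ch {v, w} (ind w (ind v \<omega>))"
   unfolding op .
 qed simp
 finally show "(\<Sum>v\<in>\<Union>K. at_cpx f (Suc k) (lk K v) (ind v \<omega>)) = 0" .
qed

text \<open>
 The two points of an oriented sphere of dimension \<open>0\<close> have opposite signs, in accordance
 with the differential being zero in degree \<open>0\<close>.
\<close>

lemma sum_over_two_points:
 fixes g :: "oriented_cpx set => rat"
 assumes g: "g \<in> sphere_cochains (int 0)" and L: "sph 1 (L :: nat set set)" "ori 1 L \<omega>"
 shows "(\<Sum>v\<in>\<Union>L. at_cpx g 0 (lk L v) (ind v \<omega>)) = 0"
proof -
 obtain a b where ab: "a \<noteq> b" "L = {{}, {a}, {b}}" using sph_1_points[OF L(1)] by blast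
 have l: "lk L a = {{}}" "lk L b = {{}}" using ab by (auto simp: lk_def)
 have "ind b \<omega> vs = opp (ind a \<omega>) vs" for vs
 proof (cases vs)
  case Nil
  have "oface 1 L [a]" "oface 1 L [b]" using ab by (auto simp: oface_def)
  then show ?thesis using oriD(4)[OF L(2) ab(1)] Nil by (simp add: ind_def opp_def)
 next
  case (Cons x xs)
  then have "\<not> oface 1 L (c # vs)" for c by (simp add: oface_def)
  then show ?thesis using oriD(2)[OF L(2)] by (simp add: ind_def opp_def)
 qed
 then have i: "ind b \<omega> = opp (ind a \<omega>)" by (rule ext)
 have "sph 0 (lk L a)" using sph_lk[OF L(1), of a] ab by auto
 moreover have "ori 0 (lk L a) (ind a \<omega>)" using ori_lk[of 0 L \<omega> a] L(2) by simp
 ultimately have "at_cpx g 0 {{}} (opp (ind a \<omega>)) = - at_cpx g 0 {{}} (ind a \<omega>)" using at_cpx_opp[OF g] unfolding l by blast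
 moreover have "\<Union>L = {a, b}" using ab by auto
 ultimately show ?thesis using ab(1) l i by simp
qed

lemma sphere_classes_cases:
 assumes "C \<in> sphere_classes n"
 obtains k L \<omega> where "n = int k" "sph k L" "ori k L \<omega>" "C = iso_class (int k - 1) (L, \<omega>)"
proof -
 obtain L \<omega> where L: "C = iso_class (n - 1) (L, \<omega>)" "(L, \<omega>) \<in> oriented_spheres (n - 1)"
  using assms by (auto simp: sphere_classes_def)
 then have "n \<ge> 0" by (auto simp: oriented_spheres_def pl_sphere_def)
 then obtain k where "n = int k" using nonneg_int_cases by blast
 then show thesis using that[of k L \<omega>] L by (simp add: sphere_iff)
qed

text \<open>
 The single point is a \<open>0\<close>-dimensional manifold without
 \<open>1\<close>-simplices, so boundaries vanish at it.
\<close>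

lemma degree_zero:
 fixes f :: "oriented_cpx set => rat"
 assumes bd: "\<And>K. combinatorial_manifold 0 K ==> sharp 0 f 0 K \<in> cooriented_boundary 0 K 1 ` cooriented_chains 0 K 1"
  and L: "sph 0 L" "ori 0 L \<omega>"
 shows "f (iso_class (int 0 - 1) (L, \<omega>)) = 0"
proof -
 let ?K = "{{}, {0 :: nat}}"
 have L0: "L = {{}}" using sph_empty_iff[OF L(1)] by simp
 have c: "cpx ?K" by (auto simp: cpx_def)
 have l: "lk ?K 0 = L" by (auto simp: L0 lk_def)
 then have "sph 0 (lk ?K v)" if "v \<in> \<Union>?K" for v using L(1) that by auto
 from combinatorial_manifold_of_links[OF c this] bd[of ?K] obtain ch where ch: "sharp 0 f 0 ?K = cooriented_boundary 0 ?K 1 ch" by auto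
 have co: "cooriented_simplex 0 ?K 0 {0} \<omega>"
  using L(2) is_orientation_iff_ori[of 0 L \<omega>] by (simp add: cooriented_simplex_def coorientation_def sdim_def link_lk[OF c] l)
 have "f (iso_class (int 0 - 1) (L, \<omega>)) = sharp 0 f 0 ?K {0} \<omega>" using co by (simp add: sharp_def link_lk[OF c] l)
 also have "\<dots> = 0" unfolding ch using co by (simp add: cooriented_boundary_def link_lk[OF c] l) (simp add: L0 verts_def)
 finally show ?thesis .
qed

theorem corollary2p2:
  fixes n :: int and f :: "oriented_cpx set \<Rightarrow> rat"
  assumes "f \<in> sphere_cochains n"
    and "\<And>m K. combinatorial_manifold m K \<Longrightarrow>
           sharp n f m K \<in> cooriented_boundary m K (m - n + 1) ` cooriented_chains m K (m - n + 1)"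
  shows "\<exists>g \<in> sphere_cochains (n - 1). f = coboundary (n - 1) g"
proof (cases "n \<ge> 1")
 case False
 have "f C = 0" for C
 proof (cases "C \<in> sphere_classes n")
  case True
  then obtain k L \<omega> where L: "n = int k" "sph k L" "ori k L \<omega>" "C = iso_class (int k - 1) (L, \<omega>)" by (rule sphere_classes_cases)
  then have "n = 0" "k = 0" using False by auto
  then show ?thesis using degree_zero[of f L \<omega>] assms(2)[of 0] L by simp
 qed (use assms(1) in \<open>simp add: sphere_cochains_def\<close>)
 then show ?thesis using False by (intro bexI[of _ "\<lambda>C. 0"]) (auto simp: sphere_cochains_def coboundary_def fun_eq_iff)
next
 case True
 then obtain k where n: "n = int (Suc k)" using nonneg_int_cases[of "n - 1"] by (metis add.commute diff_add_cancel diff_ge_0_iff_ge of_nat_Suc)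
 have f: "f \<in> sphere_cochains (int (Suc k))" using assms(1) n by simp
 have "kills_manifolds (Suc k) f" using assms(2)[of "int (Suc k)"] unfolding n by (intro kills_manifolds_of_boundaries) simp
 from cobounds_if_kills_manifolds[OF f this] obtain g where g: "g \<in> sphere_cochains (int k)"
  "\<forall>L \<omega>. sph (Suc k) (L :: nat set set) \<and> ori (Suc k) L \<omega> --> at_cpx f (Suc k) L \<omega> = (\<Sum>v\<in>\<Union>L. at_cpx g k (lk L v) (ind v \<omega>))"
  unfolding cobounds_def by blast
 have "f C = coboundary (int k) g C" for C
 proof (cases "C \<in> sphere_classes n")
  case True
  then obtain k' L \<omega> where L': "n = int k'" "sph k' L" "ori k' L \<omega>" "C = iso_class (int k' - 1) (L, \<omega>)" by (rule sphere_classes_cases)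
  moreover from this have "k' = Suc k" using n by simp
  ultimately have L: "sph (Suc k) L" "ori (Suc k) L \<omega>" "C = iso_class (int (Suc k) - 1) (L, \<omega>)" by simp_all
  note c = sph_cpx[OF L(1)]
  have fC: "f C = (\<Sum>v\<in>\<Union>L. at_cpx g k (lk L v) (ind v \<omega>))"
   using g(2) L(1,2) at_cpx_nat[OF c L(2), of f] L(3) by simp
  show ?thesis
  proof (cases "k = 0")
   case True
   then show ?thesis using sum_over_two_points[of g L \<omega>] g(1) L fC by (simp add: coboundary_def)
  next
   case False
   have "(L, \<omega>) \<in> oriented_spheres (int k)" using sphere_iff[of L \<omega> "Suc k"] L by simp
   from coboundary_iso_class[OF _ this, of g] have "coboundary (int k) g C = (\<Sum>v\<in>\<Union>L. g (iso_class (int k - 1) (lk L v, ind v \<omega>)))"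
    using False L(3) by (simp add: link_lk[OF c] verts_Union[OF c] ind_induced)
   also have "\<dots> = (\<Sum>v\<in>\<Union>L. at_cpx g k (lk L v) (ind v \<omega>))"
    by (intro sum.cong refl at_cpx_nat[symmetric] cpx_lk[OF c] ori_lk[OF L(2)])
   finally show ?thesis using fC by simp
  qed
 next
  case False
  then show ?thesis using assms(1) n by (simp add: sphere_cochains_def coboundary_def add.commute)
 qed
 then have "f = coboundary (n - 1) g" using n by auto
 then show ?thesis using g(1) n by auto
qed

end
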